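(* Let $d \geq 5$ and $\frac{d}{d-2} < p \leq \infty$. Then the discrete spherical maximal operator $A_\star$ is bounded from $\ell^p(\mathbb{Z}^d)$ to itself; that is, there is a constant $C = C(d,p) < \infty$ such that $\|A_\star(f)\|_{\ell^p(\mathbb{Z}^d)} \leq C\,\|f\|_{\ell^p(\mathbb{Z}^d)}$ for all $f \in \ell^p(\mathbb{Z}^d)$.
   Context: For $\lambda>0$ with $\lambda^2$ an integer, let $N(\lambda)$ be the number of $m \in \mathbb{Z}^d$ with $|m| = \lambda$, where $|\cdot|$ is the Euclidean norm (for $d\ge 5$ one has $N(\lambda)>0$ for every such $\lambda$). For $f : \mathbb{Z}^d \to \mathbb{C}$ define the spherical averages $$A_\lambda(f)(n) = \frac{1}{N(\lambda)} \sum_{m \in \mathbb{Z}^d,\ |m| = \lambda} f(n-m), \qquad n \in \mathbb{Z}^d,$$ and the maximal function $A_\star(f)(n) = \sup_{\lambda} |A_\lambda(f)(n)|$, the supremum being over all $\lambda > 0$ such that $\lambda^2$ is an integer. *)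

theory Defs
  imports "HOL-Analysis.Analysis"
begin

text \<open>
  The lattice \<open>\<int>\<^sup>d\<close> is the type \<open>int ^ 'd\<close> with \<open>d = CARD('d)\<close>; since \<open>int\<close> is not a normed
  space, the Euclidean norm of a lattice point is that of its image in \<open>real ^ 'd\<close>.
\<close>

definition lattice_norm :: "int ^ 'd \<Rightarrow> real" where
  "lattice_norm m = norm ((\<chi> i. real_of_int (m $ i)) :: real ^ 'd)"

definition lattice_sphere :: "real \<Rightarrow> (int ^ 'd) set" where
  "lattice_sphere r = {m. lattice_norm m = r}"

definition radii :: "real set" where
  "radii = {r. r > 0 \<and> r\<^sup>2 \<in> \<int>}"

definition spherical_avg :: "real \<Rightarrow> (int ^ 'd \<Rightarrow> complex) \<Rightarrow> int ^ 'd \<Rightarrow> complex" where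
  "spherical_avg r f n =
     (1 / of_nat (card (lattice_sphere r :: (int ^ 'd) set))) * (\<Sum>m\<in>lattice_sphere r. f (n - m))"

text \<open>
  The supremum is taken in \<open>real\<close>, so it is the intended one only where the set of averages is
  bounded above.
\<close>

definition spherical_max :: "(int ^ 'd \<Rightarrow> complex) \<Rightarrow> int ^ 'd \<Rightarrow> real" where
  "spherical_max f n = (SUP r\<in>radii. cmod (spherical_avg r f n))"

text \<open>
  The spaces \<open>\<ell>\<^sup>p\<close> over an arbitrary index type and their norms, meaningful for \<open>0 < p \<le> \<infinity>\<close>.
  The norm is a real number and is intended only for members of the space.
\<close>

definition ell :: "ereal \<Rightarrow> ('a \<Rightarrow> 'b::real_normed_vector) set" where
  "ell p = (if p = \<infinity> then {f. bounded (range f)}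
            else {f. (\<lambda>n. norm (f n) powr real_of_ereal p) summable_on UNIV})"

definition ell_norm :: "ereal \<Rightarrow> ('a \<Rightarrow> 'b::real_normed_vector) \<Rightarrow> real" where
  "ell_norm p f = (if p = \<infinity> then (SUP n. norm (f n))
     else (\<Sum>\<^sub>\<infinity>n. norm (f n) powr real_of_ereal p) powr (1 / real_of_ereal p))"

end

theory Submission
  imports Defs
begin

text \<open>
  Let \<open>e(x) = exp(2\<pi>ix)\<close>. For \<open>n \<le> L\<^sup>2 < 4n\<close>, \<open>L\<close> a power of two, the indicator of \<open>|m|\<^sup>2 = n\<close> on the
  cube of half-side \<open>L\<close> is an average of \<open>e(t(|m|\<^sup>2 - n))\<close> over a grid of about \<open>L\<^sup>2\<close> frequencies \<open>t\<close>, and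
  by the four-square theorem the sphere has at least \<open>c L\<^sup>d\<^sup>-\<^sup>2\<close> points. Dirichlet's theorem gives each
  frequency \<open>t = a/q + \<tau>\<close> a size \<open>\<Theta> = q(1 + L\<^sup>2|\<tau>|)\<close>; the multiplier of \<open>e(t|m|\<^sup>2)\<close> on the cube is
  \<open>O(L\<^sup>d \<Theta>\<^sup>-\<^sup>d\<^sup>/\<^sup>2)\<close> and about \<open>R\<^sup>2\<close> frequencies have \<open>\<Theta> \<le> R\<close> (all up to arbitrarily small powers).
  Hence the frequencies with \<open>\<Theta> \<le> R\<close> contribute at most \<open>R\<^sup>2\<close> times the maximal function of cube
  averages, and those with \<open>\<Theta> > R\<close> contribute at most \<open>R\<^sup>2\<^sup>-\<^sup>d\<^sup>/\<^sup>2\<close> on \<open>\<ell>\<^sup>2\<close> at each dyadic scale.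

  To sum over the scales, one uses that near a fraction with small denominator the kernel is, up to a summable
  error, the convolution of a kernel depending on residues modulo \<open>q\<close>, which is the same at all scales, with a
  smooth kernel on \<open>q\<int>\<^sup>d\<close>. The smooth kernel differs from a multiple of the cube average on \<open>q\<int>\<^sup>d\<close> by
  a kernel of mean zero, whose contributions at different scales are almost orthogonal.

  Choosing \<open>R\<close> according to the level gives restricted weak type bounds for all exponents above \<open>d/(d-2)\<close>,
  and interpolation with \<open>\<ell>\<^sup>\<infinity>\<close> finishes the proof.
\<close>

section \<open>Sums of squares\<close>

text \<open>Taking absolute values in the sum over the frequencies \<open>t\<close> discards the
  phase \<open>ee (- (t * n))\<close>, the only place where the radius enters that sum within one
  dyadic scale. The supremum over the radii of a scale thus costs nothing, and a supremum over
  powers of two remains. The price is the number of frequencies, about \<open>R\<^sup>2\<close> of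
  size \<open>R\<close>, against a decay \<open>R powr (- d / 2)\<close>; hence
  \<open>d > 4\<close>. For a level set at height \<open>\<alpha>\<close> the low part gives
  \<open>R\<^sup>2 / \<alpha>\<close> and the high part
  \<open>R powr (4 - d) / \<alpha>\<^sup>2\<close>; they agree for
  \<open>R = \<alpha> powr (- 1 / (d - 2))\<close>, which yields the exponent
  \<open>d / (d - 2)\<close>. Since the range of exponents is open, small powers may be lost
  everywhere, and Weyl differencing can replace the evaluation of Gauss sums: \<open>\<eta>\<close>
  measures the loss and \<open>s = d / 2 - 2 - (d + 1) * \<eta>\<close> is the gain that survives.
  Minor arcs and factorisation errors gain a power of the scale and are summed trivially; the main
  parts of the major arcs gain none and need cancellation between scales. Suprema are linearised on
  finite sets of points.\<close>

definition windmill :: "int \<Rightarrow> (int \<times> int \<times> int) set" where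
  "windmill N = {(x, a, b). x\<^sup>2 + 4 * a * b = N \<and> a > 0 \<and> b > 0}"

lemma int_abs_le_square: "\<bar>x\<bar> \<le> (x::int)\<^sup>2"
proof (cases "x = 0")
  case False
  hence "\<bar>x\<bar> * 1 \<le> \<bar>x\<bar> * \<bar>x\<bar>" by (intro mult_left_mono) auto
  thus ?thesis by (simp add: power2_eq_square)
qed simp

lemma finite_windmill: "finite (windmill N)"
proof (rule finite_subset)
  show "windmill N \<subseteq> {-N..N} \<times> {1..N} \<times> {1..N}"
  proof clarsimp
    fix x a b assume "(x, a, b) \<in> windmill N"
    hence h: "x\<^sup>2 + 4 * a * b = N" "a > 0" "b > 0" by (auto simp: windmill_def)
    have "a \<le> a * b" "b \<le> a * b" using h by auto
    moreover have "\<bar>x\<bar> \<le> x\<^sup>2" by (rule int_abs_le_square)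
    moreover have "0 \<le> a * b" using h by simp
    ultimately show "- N \<le> x \<and> x \<le> N \<and> 1 \<le> a \<and> a \<le> N \<and> 1 \<le> b \<and> b \<le> N"
      using h(2,3) h(1)[unfolded mult.assoc] unfolding abs_le_iff by linarith
  qed
qed auto

lemma odd_square_mod_8: "odd (x::int) \<Longrightarrow> x\<^sup>2 mod 8 = 1"
proof -
  assume "odd x"
  then obtain y where y: "x = 2 * y + 1" by (elim oddE)
  have "even (y * (y + 1))" by simp
  then obtain z where "y * (y + 1) = 2 * z" by (elim evenE)
  hence "x\<^sup>2 = 8 * z + 1" unfolding y by (simp add: power2_eq_square algebra_simps)
  thus ?thesis by simp
qed

lemma not_square_5_mod_8: "(N::int) mod 8 = 5 \<Longrightarrow> x\<^sup>2 \<noteq> N"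
proof
  assume h: "N mod 8 = 5" "x\<^sup>2 = N"
  hence "odd (x\<^sup>2)" by presburger
  hence "x\<^sup>2 mod 8 = 1" by (simp add: odd_square_mod_8)
  thus False using h by simp
qed

text \<open>
  The half \<open>b > x + a\<close> of the windmill set carries the involution
  \<open>(x, a, b) \<mapsto> (-x - 2a, a, b - x - a)\<close>, and \<open>(x, a, b) \<mapsto> (-x, b, a)\<close> exchanges the two halves.
  Modulo functions that are odd under the first map, \<open>(a + b)(ab - x\<^sup>2)\<close> equals
  \<open>x(a\<^sup>2 - b\<^sup>2)\<close>, which is the contribution of \<open>xa\<^sup>2\<close> and so sums to zero by \<open>x \<mapsto> -x\<close>.
\<close>

lemma windmill_sum_zero:
  assumes "N mod 8 = 5"
  shows "(\<Sum>(x, a, b)\<in>windmill N. a * (a * b - x\<^sup>2)) = 0"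
proof -
  define W where "W = windmill N"
  define P where "P = {(x, a, b). (x, a, b) \<in> W \<and> b > x + a}"
  define M where "M = {(x, a, b). (x, a, b) \<in> W \<and> b < x + a}"
  have fin: "finite W" "finite P" "finite M" unfolding W_def P_def M_def
    by (auto intro: finite_subset[OF _ finite_windmill[of N]])
  \<comment> \<open>\<open>b = x + a\<close> would turn \<open>N\<close> into the square
    \<open>(x + 2 * a)\<^sup>2\<close>, impossible for 5 modulo 8; so no point lies between the two
    halves.\<close>
  have "b \<noteq> x + a" if "(x, a, b) \<in> W" for x a b
  proof
    assume "b = x + a"
    hence "(x + 2 * a)\<^sup>2 = N" using that by (auto simp: W_def windmill_def power2_eq_square algebra_simps)
    thus False using not_square_5_mod_8[OF assms] by blast
  qed
  hence W: "W = P \<union> M" "P \<inter> M = {}" by (force simp: P_def M_def)+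
  have half: "(\<Sum>(x, a, b)\<in>W. g x a b) = (\<Sum>(x, a, b)\<in>P. g x a b + g (-x) b a)" for g :: "int \<Rightarrow> int \<Rightarrow> int \<Rightarrow> int"
  proof -
    have "(\<Sum>(x, a, b)\<in>M. g x a b) = (\<Sum>(x, a, b)\<in>P. g (-x) b a)"
      by (rule sum.reindex_bij_witness[where i = "\<lambda>(x, a, b). (-x, b, a)" and j = "\<lambda>(x, a, b). (-x, b, a)"])
         (auto simp: P_def M_def W_def windmill_def algebra_simps)
    thus ?thesis unfolding W(1) by (subst sum.union_disjoint) (use fin W in \<open>auto simp: sum.distrib case_prod_unfold\<close>)
  qed
  have flip: "(\<Sum>(x, a, b)\<in>P. g x a b) = (\<Sum>(x, a, b)\<in>P. g (-x-2*a) a (b-x-a))" for g :: "int \<Rightarrow> int \<Rightarrow> int \<Rightarrow> int"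
    by (rule sum.reindex_bij_witness[where i = "\<lambda>(x, a, b). (-x-2*a, a, b-x-a)" and j = "\<lambda>(x, a, b). (-x-2*a, a, b-x-a)"])
       (auto simp: P_def W_def windmill_def power2_eq_square algebra_simps)
  have "(\<Sum>(x, a, b)\<in>W. x * a\<^sup>2) = (\<Sum>(x, a, b)\<in>W. (-x) * a\<^sup>2)"
    by (rule sum.reindex_bij_witness[where i = "\<lambda>(x, a, b). (-x, a, b)" and j = "\<lambda>(x, a, b). (-x, a, b)"])
       (auto simp: W_def windmill_def)
  hence "(\<Sum>(x, a, b)\<in>W. x * a\<^sup>2) = 0" by (simp add: case_prod_unfold sum_negf)
  hence z: "(\<Sum>(x, a, b)\<in>P. x * a\<^sup>2 - x * b\<^sup>2) = 0" by (subst (asm) half) simp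
  have "(\<Sum>(x, a, b)\<in>P. (a + b) * (a * b - x\<^sup>2) - (x * a\<^sup>2 - x * b\<^sup>2)) =
    (\<Sum>(x, a, b)\<in>P. - ((a + b) * (a * b - x\<^sup>2) - (x * a\<^sup>2 - x * b\<^sup>2)))"
    by (subst flip, rule sum.cong) (auto simp: power2_eq_square algebra_simps)
  moreover have "(\<Sum>(x, a, b)\<in>P. - ((a + b) * (a * b - x\<^sup>2) - (x * a\<^sup>2 - x * b\<^sup>2))) =
    - (\<Sum>(x, a, b)\<in>P. (a + b) * (a * b - x\<^sup>2) - (x * a\<^sup>2 - x * b\<^sup>2))"
    unfolding sum_negf[symmetric] by (rule sum.cong) auto
  ultimately have "(\<Sum>(x, a, b)\<in>P. (a + b) * (a * b - x\<^sup>2) - (x * a\<^sup>2 - x * b\<^sup>2)) = 0"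
    by linarith
  with z have "(\<Sum>(x, a, b)\<in>P. (a + b) * (a * b - x\<^sup>2)) = 0"
    by (simp add: case_prod_unfold sum_subtractf)
  hence "(\<Sum>(x, a, b)\<in>W. a * (a * b - x\<^sup>2)) = 0"
    by (subst half) (simp add: case_prod_unfold algebra_simps)
  thus ?thesis by (simp add: W_def)
qed

definition divisor_sum :: "int \<Rightarrow> int" where
  "divisor_sum m = (\<Sum>a | a \<in> {1..m} \<and> a dvd m. a)"

text \<open>For fixed \<open>x\<close>, necessarily odd, the pairs \<open>(a, b)\<close> of
  \<open>windmill N\<close> are the factorisations of \<open>(N - x\<^sup>2) / 4\<close>. There
  \<open>4 * (a * b - x\<^sup>2)\<close> equals \<open>N - 5 * x\<^sup>2\<close>, constant along the
  fibre, and the remaining factor \<open>a\<close> runs through the divisors: this is four times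
  \<open>windmill_sum_zero\<close>, regrouped.\<close>

lemma divisor_sum_recursion:
  assumes "N mod 8 = 5" "N > 0"
  shows "(\<Sum>x | x \<in> {-N..N} \<and> odd x. (N - 5 * x\<^sup>2) * divisor_sum ((N - x\<^sup>2) div 4)) = 0"
proof -
  let ?X = "{x. x \<in> {-N..N} \<and> odd x}"
  define m where "m x = (N - x\<^sup>2) div 4" for x
  have m4: "4 * m x = N - x\<^sup>2" if "odd x" for x
  proof -
    have "(N - x\<^sup>2) mod 4 = 0" using odd_square_mod_8[OF that] assms(1) by presburger
    thus ?thesis unfolding m_def by presburger
  qed
  have W: "windmill N = (\<lambda>(x, a). (x, a, m x div a)) ` (SIGMA x:?X. {a. a \<in> {1..m x} \<and> a dvd m x})" (is "_ = ?f ` ?S")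
  proof (intro set_eqI iffI)
    fix w assume "w \<in> windmill N"
    moreover obtain x a b where w: "w = (x, a, b)" by (cases w)
    ultimately have h: "x\<^sup>2 + 4 * (a * b) = N" "a > 0" "b > 0" by (auto simp: windmill_def)
    have "odd y" if "y + 4 * z = N" for y z using that assms by presburger
    hence "odd (x\<^sup>2)" using h(1) by blast
    hence o: "odd x" by simp
    have ab: "m x = a * b" using m4[OF o] h by simp
    have "\<bar>x\<bar> \<le> x\<^sup>2" by (rule int_abs_le_square)
    moreover have "a * b > 0" using h by simp
    ultimately have "x \<in> ?X" using h(1) o by (simp add: abs_le_iff)
    moreover have "a * 1 \<le> a * b" using h by (intro mult_left_mono) auto
    ultimately have "(x, a) \<in> ?S" using ab h by auto
    moreover have "w = ?f (x, a)" using ab h w by simp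
    ultimately show "w \<in> ?f ` ?S" by (rule rev_image_eqI)
  next
    fix w assume "w \<in> ?f ` ?S"
    then obtain x a where h: "w = (x, a, m x div a)" "odd x" "1 \<le> a" "a \<le> m x" "a dvd m x" by auto
    have "m x div a > 0" using h by (simp add: pos_imp_zdiv_pos_iff)
    moreover have "a * (m x div a) = m x" using h by simp
    ultimately show "w \<in> windmill N" using h m4[OF h(2)] by (auto simp: windmill_def mult.assoc)
  qed
  have "0 = 4 * (\<Sum>(x, a, b)\<in>windmill N. a * (a * b - x\<^sup>2))" using windmill_sum_zero[OF assms(1)] by simp
  also have "\<dots> = 4 * (\<Sum>(x, a)\<in>?S. a * (m x - x\<^sup>2))"
    unfolding W by (subst sum.reindex) (auto simp: inj_on_def intro!: sum.cong)
  also have "\<dots> = 4 * (\<Sum>x\<in>?X. \<Sum>a | a \<in> {1..m x} \<and> a dvd m x. a * (m x - x\<^sup>2))"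
    by (subst sum.Sigma) (auto intro: finite_subset[of _ "{-N..N}"] finite_subset[of _ "{1..k}" for k])
  also have "\<dots> = (\<Sum>x\<in>?X. (N - 5 * x\<^sup>2) * divisor_sum (m x))"
    unfolding sum_distrib_left divisor_sum_def
  proof (intro sum.cong refl)
    fix x a assume "x \<in> ?X"
    hence "4 * m x = N - x\<^sup>2" using m4 by blast
    hence "N - 5 * x\<^sup>2 = 4 * (m x - x\<^sup>2)" by simp
    thus "4 * (a * (m x - x\<^sup>2)) = (N - 5 * x\<^sup>2) * a" by simp
  qed
  finally show ?thesis by (simp add: m_def)
qed


definition odd_quads :: "int \<Rightarrow> (int \<times> int \<times> int \<times> int) set" where
  "odd_quads m = {(x, y, z, w). odd x \<and> odd y \<and> odd z \<and> odd w \<and> x\<^sup>2 + y\<^sup>2 + z\<^sup>2 + w\<^sup>2 = m}"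

definition odd_quints :: "int \<Rightarrow> (int \<times> int \<times> int \<times> int \<times> int) set" where
  "odd_quints m = {(v, x, y, z, w). odd v \<and> odd x \<and> odd y \<and> odd z \<and> odd w \<and>
     v\<^sup>2 + x\<^sup>2 + y\<^sup>2 + z\<^sup>2 + w\<^sup>2 = m}"

lemma square_le_imp_mem: "(x::int)\<^sup>2 \<le> m \<Longrightarrow> x \<in> {-m..m}"
  using int_abs_le_square[of x] by auto

lemma finite_odd_quads: "finite (odd_quads m)"
proof (rule finite_subset)
  show "odd_quads m \<subseteq> {-m..m} \<times> {-m..m} \<times> {-m..m} \<times> {-m..m}"
  proof
    fix t assume "t \<in> odd_quads m"
    moreover obtain x y z w where t: "t = (x, y, z, w)" by (cases t)
    ultimately have "x\<^sup>2 + y\<^sup>2 + z\<^sup>2 + w\<^sup>2 = m" by (auto simp: odd_quads_def)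
    hence "x\<^sup>2 \<le> m" "y\<^sup>2 \<le> m" "z\<^sup>2 \<le> m" "w\<^sup>2 \<le> m"
      using zero_le_power2[of x] zero_le_power2[of y] zero_le_power2[of z] zero_le_power2[of w] by linarith+
    thus "t \<in> {-m..m} \<times> {-m..m} \<times> {-m..m} \<times> {-m..m}"
      unfolding t by (auto dest!: square_le_imp_mem)
  qed
qed auto

text \<open>
  The sum of \<open>N - 5v\<^sup>2\<close> over all representations of \<open>N\<close> by five odd squares vanishes by symmetry;
  together with the same recursion for the divisor sum this determines the number of representations by four.
\<close>

lemma odd_quads_recursion:
  "(\<Sum>x | x \<in> {-N..N} \<and> odd x. (N - 5 * x\<^sup>2) * int (card (odd_quads (N - x\<^sup>2)))) = 0"
proof -
  let ?X = "{x. x \<in> {-N..N} \<and> odd x}"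
  define Q where "Q = odd_quints N"
  have Q: "Q = (SIGMA v:?X. odd_quads (N - v\<^sup>2))"
  proof (intro set_eqI iffI)
    fix t assume "t \<in> Q"
    moreover obtain v x y z w where t: "t = (v, x, y, z, w)" by (cases t)
    ultimately have h: "v\<^sup>2 + x\<^sup>2 + y\<^sup>2 + z\<^sup>2 + w\<^sup>2 = N" "odd v" "odd x" "odd y" "odd z" "odd w"
      by (auto simp: odd_quints_def Q_def)
    hence "v\<^sup>2 \<le> N"
      using zero_le_power2[of x] zero_le_power2[of y] zero_le_power2[of z] zero_le_power2[of w] by linarith
    with h show "t \<in> (SIGMA v:?X. odd_quads (N - v\<^sup>2))"
      unfolding t by (auto simp: odd_quads_def dest!: square_le_imp_mem)
  qed (auto simp: Q_def odd_quads_def odd_quints_def)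
  have "finite ?X" by (rule finite_subset[of _ "{-N..N}"]) auto
  have 1: "(\<Sum>(v, x, y, z, w)\<in>Q. x\<^sup>2) = (\<Sum>(v, x, y, z, w)\<in>Q. v\<^sup>2)"
    by (rule sum.reindex_bij_witness[where i = "\<lambda>(v, x, y, z, w). (x, v, y, z, w)" and j = "\<lambda>(v, x, y, z, w). (x, v, y, z, w)"])
       (auto simp: Q_def odd_quints_def)
  have 2: "(\<Sum>(v, x, y, z, w)\<in>Q. y\<^sup>2) = (\<Sum>(v, x, y, z, w)\<in>Q. v\<^sup>2)"
    by (rule sum.reindex_bij_witness[where i = "\<lambda>(v, x, y, z, w). (y, x, v, z, w)" and j = "\<lambda>(v, x, y, z, w). (y, x, v, z, w)"])
       (auto simp: Q_def odd_quints_def)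
  have 3: "(\<Sum>(v, x, y, z, w)\<in>Q. z\<^sup>2) = (\<Sum>(v, x, y, z, w)\<in>Q. v\<^sup>2)"
    by (rule sum.reindex_bij_witness[where i = "\<lambda>(v, x, y, z, w). (z, x, y, v, w)" and j = "\<lambda>(v, x, y, z, w). (z, x, y, v, w)"])
       (auto simp: Q_def odd_quints_def)
  have 4: "(\<Sum>(v, x, y, z, w)\<in>Q. w\<^sup>2) = (\<Sum>(v, x, y, z, w)\<in>Q. v\<^sup>2)"
    by (rule sum.reindex_bij_witness[where i = "\<lambda>(v, x, y, z, w). (w, x, y, z, v)" and j = "\<lambda>(v, x, y, z, w). (w, x, y, z, v)"])
       (auto simp: Q_def odd_quints_def)
  have "(\<Sum>(v, x, y, z, w)\<in>Q. N - 5 * v\<^sup>2) = (\<Sum>(v, x, y, z, w)\<in>Q. v\<^sup>2 + x\<^sup>2 + y\<^sup>2 + z\<^sup>2 + w\<^sup>2 - 5 * v\<^sup>2)"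
    by (rule sum.cong) (auto simp: Q_def odd_quints_def)
  also have "\<dots> = (\<Sum>(v, x, y, z, w)\<in>Q. x\<^sup>2) + (\<Sum>(v, x, y, z, w)\<in>Q. y\<^sup>2) + (\<Sum>(v, x, y, z, w)\<in>Q. z\<^sup>2)
      + (\<Sum>(v, x, y, z, w)\<in>Q. w\<^sup>2) - 4 * (\<Sum>(v, x, y, z, w)\<in>Q. v\<^sup>2)"
    by (simp add: case_prod_unfold sum.distrib sum_subtractf sum_distrib_left algebra_simps)
  also have "\<dots> = 0" unfolding 1 2 3 4 by simp
  finally have "(\<Sum>(v, u)\<in>Q. N - 5 * v\<^sup>2) = 0" by (simp add: case_prod_unfold)
  hence "(\<Sum>v\<in>?X. \<Sum>u\<in>odd_quads (N - v\<^sup>2). N - 5 * v\<^sup>2) = 0"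
    unfolding Q using \<open>finite ?X\<close> by (subst sum.Sigma) (auto simp: finite_odd_quads)
  thus ?thesis by (simp add: mult.commute)
qed

lemma card_odd_quads_4: "card (odd_quads 4) = 16"
proof -
  have "odd_quads 4 = {-1,1} \<times> {-1,1} \<times> {-1,1} \<times> {-1,1}" (is "_ = ?R")
  proof (intro set_eqI iffI)
    fix t assume "t \<in> odd_quads 4"
    moreover obtain x y z w where t: "t = (x, y, z, w)" by (cases t)
    ultimately have h: "x\<^sup>2 + y\<^sup>2 + z\<^sup>2 + w\<^sup>2 = 4" "odd x" "odd y" "odd z" "odd w"
      by (auto simp: odd_quads_def)
    have ge: "u\<^sup>2 \<ge> 1" if "odd u" for u :: int using that int_abs_le_square[of u] by (cases "u = 0") auto
    have "u \<in> {-1, 1}" if "u\<^sup>2 \<le> 1" "odd u" for u :: int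
    proof -
      have "\<bar>u\<bar> \<le> 1" using int_abs_le_square[of u] that by linarith
      moreover have "u \<noteq> 0" using that by auto
      ultimately show ?thesis by auto
    qed
    moreover have "x\<^sup>2 \<le> 1" "y\<^sup>2 \<le> 1" "z\<^sup>2 \<le> 1" "w\<^sup>2 \<le> 1" using ge[of x] ge[of y] ge[of z] ge[of w] h by linarith+
    ultimately show "t \<in> ?R" unfolding t using h by blast
  qed (auto simp: odd_quads_def)
  thus ?thesis by (simp add: card_cartesian_product)
qed

lemma divisor_sum_nonpos: "m \<le> 0 \<Longrightarrow> divisor_sum m = 0"
  by (simp add: divisor_sum_def)

lemma odd_quads_nonpos: "m \<le> 0 \<Longrightarrow> odd_quads m = {}"
proof -
  assume m: "m \<le> 0"
  have ge: "u\<^sup>2 > 0" if "odd u" for u :: int using that by (cases "u = 0") auto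
  have False if "odd x" "odd y" "odd z" "odd w" "x\<^sup>2 + y\<^sup>2 + z\<^sup>2 + w\<^sup>2 = m" for x y z w
    using ge[of x] ge[of y] ge[of z] ge[of w] that m by linarith
  thus ?thesis by (auto simp: odd_quads_def)
qed

text \<open>Jacobi's formula for four odd squares, without theta functions:
  \<open>odd_quads_recursion\<close> and \<open>divisor_sum_recursion\<close> are the same linear
  recursion, and the two sides agree at \<open>k = 1\<close>.\<close>

theorem card_odd_quads:
  assumes "odd k"
  shows "int (card (odd_quads (4 * int k))) = 16 * divisor_sum (int k)"
  using assms
proof (induction k rule: less_induct)
  case (less k)
  show ?case
  proof (cases "k = 1")
    case True
    have "{a::int. a = 1 \<and> a dvd 1} = {1}" by auto
    thus ?thesis using True by (simp add: card_odd_quads_4 divisor_sum_def)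
  next
    case False
    with less.prems have k: "k \<ge> 3" by (cases k; presburger)
    \<comment> \<open>With this \<open>N\<close> the wanted value occurs at \<open>x = 1\<close> and
      \<open>x = -1\<close>, with coefficient \<open>N - 5\<close>, nonzero for
      \<open>k \<ge> 3\<close>. All other odd \<open>x\<close> lead to a smaller odd argument, or to
      a nonpositive one where both counts vanish.\<close>
    define N where "N = 4 * int k + 1"
    have N: "N mod 8 = 5" "N > 0" using less.prems unfolding N_def by presburger+
    let ?X = "{x. x \<in> {-N..N} \<and> odd x}"
    define D where "D x = (N - 5 * x\<^sup>2) * (int (card (odd_quads (N - x\<^sup>2))) - 16 * divisor_sum ((N - x\<^sup>2) div 4))" for x
    have "finite ?X" by (rule finite_subset[of _ "{-N..N}"]) auto
    have "(\<Sum>x\<in>?X. D x) = (\<Sum>x\<in>?X. (N - 5 * x\<^sup>2) * int (card (odd_quads (N - x\<^sup>2))))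
          - 16 * (\<Sum>x\<in>?X. (N - 5 * x\<^sup>2) * divisor_sum ((N - x\<^sup>2) div 4))"
      unfolding D_def sum_distrib_left sum_subtractf[symmetric] by (intro sum.cong refl) (simp add: algebra_simps)
    also have "\<dots> = 0" using odd_quads_recursion[of N] divisor_sum_recursion[OF N] by simp
    finally have z: "(\<Sum>x\<in>?X. D x) = 0" .
    have "D x = 0" if x: "x \<in> ?X" "x \<noteq> 1" "x \<noteq> -1" for x
    proof (cases "N - x\<^sup>2 \<le> 0")
      case True
      thus ?thesis by (simp add: D_def odd_quads_nonpos divisor_sum_nonpos)
    next
      case False
      have ox: "x\<^sup>2 mod 8 = 1" using x by (simp add: odd_square_mod_8)
      have "\<bar>x\<bar> \<ge> 2" using x by (cases "x = 0") auto
      hence "\<bar>x\<bar> * \<bar>x\<bar> \<ge> 2 * 2" by (intro mult_mono) auto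
      hence x4: "x\<^sup>2 \<ge> 4" by (simp add: power2_eq_square)
      define l where "l = nat ((N - x\<^sup>2) div 4)"
      have "(N - y) div 4 > 0 \<and> odd ((N - y) div 4) \<and> N - y = 4 * ((N - y) div 4) \<and> (N - y) div 4 < int k"
        if "y mod 8 = 1" "N - y > 0" "y \<ge> 4" for y
      proof -
        define e where "e = 2 * (N div 8 - y div 8) + 1"
        have e: "N - y = 4 * e" "odd e"
          using that(1) N(1) mult_div_mod_eq[of 8 N] mult_div_mod_eq[of 8 y] unfolding e_def by simp_all
        hence "(N - y) div 4 = e" by simp
        thus ?thesis using e that(2,3) by (simp add: N_def)
      qed
      from this[of "x\<^sup>2"] ox False x4
      have "(N - x\<^sup>2) div 4 > 0" "odd ((N - x\<^sup>2) div 4)" "N - x\<^sup>2 = 4 * ((N - x\<^sup>2) div 4)" "(N - x\<^sup>2) div 4 < int k" by auto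
      hence l: "N - x\<^sup>2 = 4 * int l" "(N - x\<^sup>2) div 4 = int l" "odd l" "l < k" 
        unfolding l_def by (auto simp: even_nat_iff)
      from less.IH[OF l(4,3)] show ?thesis unfolding D_def l(2) unfolding l(1) by simp
    qed
    hence "(\<Sum>x\<in>?X. D x) = (\<Sum>x\<in>{1,-1}. D x)"
      by (intro sum.mono_neutral_right) (use \<open>finite ?X\<close> N in auto)
    also have "\<dots> = 2 * D 1" by (simp add: D_def)
    finally have "D 1 = 0" using z by simp
    moreover have "N - 5 \<noteq> 0" using k by (simp add: N_def)
    ultimately have "int (card (odd_quads (N - 1))) = 16 * divisor_sum ((N - 1) div 4)"
      by (simp add: D_def)
    thus ?thesis by (simp add: N_def)
  qed
qed

definition quads :: "int \<Rightarrow> (int \<times> int \<times> int \<times> int) set" where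
  "quads m = {(x, y, z, w). x\<^sup>2 + y\<^sup>2 + z\<^sup>2 + w\<^sup>2 = m}"

lemma finite_quads: "finite (quads m)"
proof (rule finite_subset)
  show "quads m \<subseteq> {-m..m} \<times> {-m..m} \<times> {-m..m} \<times> {-m..m}"
  proof
    fix t assume "t \<in> quads m"
    moreover obtain x y z w where t: "t = (x, y, z, w)" by (cases t)
    ultimately have "x\<^sup>2 + y\<^sup>2 + z\<^sup>2 + w\<^sup>2 = m" by (auto simp: quads_def)
    hence "x\<^sup>2 \<le> m" "y\<^sup>2 \<le> m" "z\<^sup>2 \<le> m" "w\<^sup>2 \<le> m"
      using zero_le_power2[of x] zero_le_power2[of y] zero_le_power2[of z] zero_le_power2[of w] by linarith+
    thus "t \<in> {-m..m} \<times> {-m..m} \<times> {-m..m} \<times> {-m..m}"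
      unfolding t by (auto dest!: square_le_imp_mem)
  qed
qed auto

text \<open>
  A quadruple of odd numbers with sum of squares \<open>4k\<close> and sum divisible by 4 is mapped by
  the Hadamard matrix, divided by 4, to a quadruple with sum of squares \<open>k\<close>; changing one sign shows that
  half of the odd quadruples have sum divisible by 4.
\<close>

lemma card_quads_ge:
  assumes "odd k"
  shows "8 * k \<le> card (quads (int k))"
proof -
  define A where "A = {(x, y, z, w). (x, y, z, w) \<in> odd_quads (4 * int k) \<and> (x + y + z + w) mod 4 = 0}"
  define B where "B = {(x, y, z, w). (x, y, z, w) \<in> odd_quads (4 * int k) \<and> (x + y + z + w) mod 4 = 2}"
  have split: "odd_quads (4 * int k) = A \<union> B" "A \<inter> B = {}"
  proof -
    have "(x + y + z + w) mod 4 = 0 \<or> (x + y + z + w) mod 4 = 2" if "odd x" "odd y" "odd z" "odd w" for x y z w :: int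
      using that by presburger
    thus "odd_quads (4 * int k) = A \<union> B" by (auto simp: A_def B_def odd_quads_def)
  qed (auto simp: A_def B_def)
  have fin: "finite A" "finite B" using finite_odd_quads[of "4 * int k"] unfolding split by auto
  have "(x + y + z - w) mod 4 = 2" if "odd x" "odd y" "odd z" "odd w" "4 dvd x + y + z + w" for x y z w :: int
    using that by presburger
  moreover have "4 dvd x + y + z - w" if "odd x" "odd y" "odd z" "odd w" "(x + y + z + w) mod 4 = 2" for x y z w :: int
    using that by presburger
  ultimately have "bij_betw (\<lambda>(x, y, z, w). (x, y, z, -w)) A B"
    by (intro bij_betw_byWitness[where f' = "\<lambda>(x, y, z, w). (x, y, z, -w)"])
       (auto simp: A_def B_def odd_quads_def)
  hence AB: "card A = card B" by (rule bij_betw_same_card)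
  have "int (2 * card A) = 16 * divisor_sum (int k)"
    using card_odd_quads[OF assms] card_Un_disjoint[OF fin split(2)] split(1) AB by simp
  moreover have "divisor_sum (int k) \<ge> int k"
  proof -
    have "k > 0" using assms by (cases k) auto
    have "(\<Sum>a\<in>{int k}. a) \<le> divisor_sum (int k)" unfolding divisor_sum_def
      by (rule sum_mono2) (use \<open>k > 0\<close> in \<open>auto intro: finite_subset[of _ "{1..int k}"]\<close>)
    thus ?thesis by simp
  qed
  ultimately have "card A \<ge> 8 * k" by linarith
  also have "card A \<le> card (quads (int k))"
  proof (rule card_inj_on_le)
    let ?h = "\<lambda>(x, y, z, w). ((x + y + z + w) div 4, (x + y - z - w) div 4, (x - y + z - w) div 4, (x - y - z + w) div (4::int))"
    have ex: "4 * ((x + y + z + w) div 4) = x + y + z + w" "4 * ((x + y - z - w) div 4) = x + y - z - w"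
       "4 * ((x - y + z - w) div 4) = x - y + z - w" "4 * ((x - y - z + w) div 4) = x - y - z + w"
      if "(x, y, z, w) \<in> A" for x y z w
    proof -
      have "odd x" "odd y" "odd z" "odd w" "(x + y + z + w) mod 4 = 0" using that by (auto simp: A_def odd_quads_def)
      thus "4 * ((x + y + z + w) div 4) = x + y + z + w" "4 * ((x + y - z - w) div 4) = x + y - z - w"
       "4 * ((x - y + z - w) div 4) = x - y + z - w" "4 * ((x - y - z + w) div 4) = x - y - z + w" by presburger+
    qed
    show "inj_on ?h A"
    proof (rule inj_onI)
      fix t t' assume h: "t \<in> A" "t' \<in> A" "?h t = ?h t'"
      obtain x y z w x' y' z' w' where t: "t = (x, y, z, w)" "t' = (x', y', z', w')" by (cases t, cases t') blast
      have e: "(x + y + z + w) div 4 = (x' + y' + z' + w') div 4" "(x + y - z - w) div 4 = (x' + y' - z' - w') div 4"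
        "(x - y + z - w) div 4 = (x' - y' + z' - w') div 4" "(x - y - z + w) div 4 = (x' - y' - z' + w') div 4"
        using h(3) unfolding t by auto
      show "t = t'"
        using ex[OF h(1)[unfolded t]] ex[OF h(2)[unfolded t]] unfolding e t by simp
    qed
    show "?h ` A \<subseteq> quads (int k)"
    proof clarify
      fix x y z w assume h: "(x, y, z, w) \<in> A"
      have "16 * (((x + y + z + w) div 4)\<^sup>2 + ((x + y - z - w) div 4)\<^sup>2 + ((x - y + z - w) div 4)\<^sup>2 + ((x - y - z + w) div 4)\<^sup>2)
         = (4 * ((x + y + z + w) div 4))\<^sup>2 + (4 * ((x + y - z - w) div 4))\<^sup>2 + (4 * ((x - y + z - w) div 4))\<^sup>2 + (4 * ((x - y - z + w) div 4))\<^sup>2"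
        by (simp add: power_mult_distrib)
      also have "\<dots> = 4 * (x\<^sup>2 + y\<^sup>2 + z\<^sup>2 + w\<^sup>2)"
        unfolding ex[OF h] by (simp add: power2_eq_square algebra_simps)
      also have "\<dots> = 16 * int k" using h by (auto simp: A_def odd_quads_def)
      finally show "((x + y + z + w) div 4, (x + y - z - w) div 4, (x - y + z - w) div 4, (x - y - z + w) div 4) \<in> quads (int k)"
        by (simp add: quads_def)
    qed
  qed (rule finite_quads)
  finally show ?thesis .
qed


section \<open>Lattice points on a sphere\<close>

lemma finite_lattice_level: "finite {m :: int ^ 'd::finite. (\<Sum>i\<in>UNIV. (m $ i)\<^sup>2) = n}"
proof (rule finite_subset)
  show "{m :: int ^ 'd. (\<Sum>i\<in>UNIV. (m $ i)\<^sup>2) = n} \<subseteq> vec_lambda ` (PiE UNIV (\<lambda>_. {-n..n}))"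
  proof
    fix m :: "int ^ 'd" assume "m \<in> {m. (\<Sum>i\<in>UNIV. (m $ i)\<^sup>2) = n}"
    hence n: "(\<Sum>i\<in>UNIV. (m $ i)\<^sup>2) = n" by simp
    have "m $ i \<in> {-n..n}" for i
      by (rule square_le_imp_mem, subst n[symmetric], rule member_le_sum) auto
    hence "(\<lambda>i. m $ i) \<in> PiE UNIV (\<lambda>_. {-n..n})" by auto
    thus "m \<in> vec_lambda ` (PiE UNIV (\<lambda>_. {-n..n}))" by (rule rev_image_eqI) simp
  qed
qed (intro finite_imageI finite_PiE; simp)

text \<open>
  All coordinates but four are chosen freely in a range of length about \<open>\<surd>n\<close>, one of them with the parity
  that makes the remainder odd; the last four are then counted by the four-square theorem.
\<close>

lemma card_lattice_level_ge:
  fixes n :: nat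
  assumes d: "CARD('d::finite) \<ge> 5" and n: "n > 0"
  shows "real n * sqrt (real n / (16 * real CARD('d))) ^ (CARD('d) - 4)
         \<le> real (card {m :: int ^ 'd. (\<Sum>i\<in>UNIV. (m $ i)\<^sup>2) = int n})"
proof -
  let ?d = "CARD('d)"
  \<comment> \<open>The constant 16 is chosen so that the \<open>d - 4\<close> free coordinates,
    each about \<open>2 * V\<close> at most, use no more than a quarter of \<open>n\<close> up to
    the parity bit. What is left for the last four squares is then at least
    \<open>n / 4\<close>.\<close>
  define V where "V = nat \<lfloor>sqrt (real n / (16 * real ?d))\<rfloor>"
  have V1: "real V + 1 \<ge> sqrt (real n / (16 * real ?d))" unfolding V_def by linarith
  have "real V \<le> sqrt (real n / (16 * real ?d))" unfolding V_def by simp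
  hence "real V ^ 2 \<le> real n / (16 * real ?d)" by (metis of_nat_0_le_iff power_mono real_sqrt_pow2 divide_nonneg_nonneg mult_nonneg_nonneg zero_le_numeral)
  hence "16 * real ?d * real V ^ 2 \<le> real n" using d by (simp add: field_simps)
  hence "real (16 * ?d * V\<^sup>2) \<le> real n" by simp
  hence V2: "16 * ?d * V\<^sup>2 \<le> n" by (simp only: of_nat_le_iff)
  obtain I where I: "card I = 4" "I \<subseteq> (UNIV :: 'd set)" using obtain_subset_with_card_n[of 4 "UNIV :: 'd set"] d by auto
  then obtain i1 i2 i3 i4 where i: "I = {i1, i2, i3, i4}" "distinct [i1, i2, i3, i4]"
    by (auto simp: card_Suc_eq numeral_eq_Suc)
  hence ne: "i1 \<noteq> i2" "i1 \<noteq> i3" "i1 \<noteq> i4" "i2 \<noteq> i3" "i2 \<noteq> i4" "i3 \<noteq> i4" by auto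
  note ne = ne ne[symmetric]
  define J where "J = UNIV - I"
  have cJ: "card J = ?d - 4" unfolding J_def using I by (subst card_Diff_subset) (auto simp: i(1))
  hence "J \<noteq> {}" using d by auto
  then obtain i0 where i0: "i0 \<in> J" by auto
  define b :: int where "b = (if even n then 1 else 0)"
  define P where "P = PiE J (\<lambda>_. {0..int V})"
  define mv where "mv v i = (if i = i0 then 2 * v i + b else 2 * v i)" for v :: "'d \<Rightarrow> int" and i
  define k where "k v = nat (int n - (\<Sum>i\<in>J. (mv v i)\<^sup>2))" for v
  have finP: "finite P" unfolding P_def by (intro finite_PiE) auto
  have k: "int (k v) = int n - (\<Sum>i\<in>J. (mv v i)\<^sup>2)" "odd (k v)" "n \<le> 8 * k v" if v: "v \<in> P" for v
  proof -
    have vi: "0 \<le> v i" "v i \<le> int V" if "i \<in> J" for i using v that by (auto simp: P_def)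
    have S: "(\<Sum>i\<in>J. (mv v i)\<^sup>2) = 4 * (\<Sum>i\<in>J. (v i)\<^sup>2) + (4 * (v i0 * b) + b)"
    proof -
      have "(\<Sum>i\<in>J. (mv v i)\<^sup>2) = (\<Sum>i\<in>J. 4 * (v i)\<^sup>2 + (if i = i0 then 4 * (v i * b) + b else 0))"
        by (intro sum.cong refl) (auto simp: mv_def b_def power2_eq_square algebra_simps)
      thus ?thesis using i0 by (simp add: sum.distrib sum_distrib_left)
    qed
    have "(\<Sum>i\<in>J. (v i)\<^sup>2) \<le> (\<Sum>i\<in>J. (int V)\<^sup>2)" by (intro sum_mono power_mono vi)
    also have "\<dots> = (int ?d - 4) * (int V)\<^sup>2" using cJ d by (simp add: of_nat_diff)
    finally have 1: "(\<Sum>i\<in>J. (v i)\<^sup>2) \<le> int ?d * (int V)\<^sup>2 - 4 * (int V)\<^sup>2" by (simp add: algebra_simps)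
    have "int V \<le> (int V)\<^sup>2" using int_abs_le_square[of "int V"] unfolding abs_of_nat .
    hence 2: "v i0 * b \<le> (int V)\<^sup>2" using order.trans[OF vi(2)[OF i0]] by (simp add: b_def)
    have 3: "16 * (int ?d * (int V)\<^sup>2) \<le> int n"
      using V2 by (metis (mono_tags, lifting) mult.assoc of_nat_le_iff of_nat_mult of_nat_numeral of_nat_power)
    have 0: "0 \<le> (int V)\<^sup>2" by simp
    \<comment> \<open>The bit is set only for even \<open>n\<close>, so \<open>n \<ge> 2\<close>
      absorbs it below.\<close>
    have b: "b \<le> 1" "b = 1 \<longrightarrow> int n \<ge> 2" using n unfolding b_def by (auto elim!: evenE)
    have le: "4 * (\<Sum>i\<in>J. (mv v i)\<^sup>2) \<le> int n + 4 * b" unfolding S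
    proof -
      have "4 * (4 * p + (4 * r + b)) \<le> int n + 4 * b" if "p \<le> D - 4 * w" "r \<le> w" "16 * D \<le> int n" "0 \<le> w" for p r D w
      proof -
        have "16 * p \<le> 16 * (D - 4 * w)" "16 * r \<le> 16 * w" using that by (intro mult_left_mono; simp)+
        moreover have "16 * (D - 4 * w) = 16 * D - 64 * w" by simp
        ultimately have "16 * p + 16 * r \<le> 16 * D - 64 * w + 16 * w" by (simp only: add_mono)
        also have "\<dots> \<le> 16 * D" using that(4) by simp
        finally have "16 * p + 16 * r \<le> int n" using that(3) by (rule order.trans)
        thus ?thesis by (simp add: algebra_simps)
      qed
      from this[OF 1 2 3 0] show "4 * (4 * (\<Sum>i\<in>J. (v i)\<^sup>2) + (4 * (v i0 * b) + b)) \<le> int n + 4 * b" .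
    qed
    have "b = 0 \<or> b = 1" by (simp add: b_def)
    hence ge: "4 * (int n - (\<Sum>i\<in>J. (mv v i)\<^sup>2)) \<ge> int n" using le b by auto
    thus kk: "int (k v) = int n - (\<Sum>i\<in>J. (mv v i)\<^sup>2)" unfolding k_def by simp
    show "n \<le> 8 * k v" using ge unfolding kk[symmetric] by linarith
    have "odd (int n - b)" by (auto simp: b_def)
    hence "odd (int (k v))" unfolding kk S by simp
    thus "odd (k v)" by simp
  qed
  define h where "h = (\<lambda>(v, x, y, z, w). (\<chi> i. if i = i1 then x else if i = i2 then y else if i = i3 then z
      else if i = i4 then w else mv v i) :: int ^ 'd)"
  let ?S = "SIGMA v:P. quads (int (k v))"
  have "real n * sqrt (real n / (16 * real ?d)) ^ (?d - 4) \<le> real n * (real V + 1) ^ (?d - 4)"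
    by (intro mult_left_mono power_mono V1) auto
  also have "\<dots> = (\<Sum>v\<in>P. real n)"
    unfolding P_def by (simp add: card_PiE i(1) J_def cJ[unfolded J_def i(1)])
  also have "\<dots> \<le> (\<Sum>v\<in>P. real (card (quads (int (k v)))))"
  proof (rule sum_mono)
    fix v assume v: "v \<in> P"
    show "real n \<le> real (card (quads (int (k v))))"
      using k(3)[OF v] card_quads_ge[OF k(2)[OF v]] by linarith
  qed
  also have "\<dots> = real (card ?S)" using finP by (simp add: card_SigmaI finite_quads)
  also have "card ?S \<le> card {m :: int ^ 'd. (\<Sum>i\<in>UNIV. (m $ i)\<^sup>2) = int n}"
  proof (rule card_inj_on_le[of h])
    show "h ` ?S \<subseteq> {m :: int ^ 'd. (\<Sum>i\<in>UNIV. (m $ i)\<^sup>2) = int n}"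
    proof clarify
      fix v x y z w assume v: "v \<in> P" and q: "(x, y, z, w) \<in> quads (int (k v))"
      have "(\<Sum>i\<in>UNIV. (h (v, x, y, z, w) $ i)\<^sup>2) = (\<Sum>i\<in>I. (h (v, x, y, z, w) $ i)\<^sup>2) + (\<Sum>i\<in>J. (h (v, x, y, z, w) $ i)\<^sup>2)"
        unfolding J_def by (subst sum.subset_diff[of I]) (auto simp: add.commute)
      also have "(\<Sum>i\<in>J. (h (v, x, y, z, w) $ i)\<^sup>2) = (\<Sum>i\<in>J. (mv v i)\<^sup>2)"
        by (intro sum.cong refl) (auto simp: h_def J_def i(1))
      also have "(\<Sum>i\<in>I. (h (v, x, y, z, w) $ i)\<^sup>2) = x\<^sup>2 + y\<^sup>2 + z\<^sup>2 + w\<^sup>2"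
        by (simp add: i(1) h_def ne)
      finally show "(\<Sum>i\<in>UNIV. (h (v, x, y, z, w) $ i)\<^sup>2) = int n" using q k(1)[OF v] by (simp add: quads_def)
    qed
    show "inj_on h ?S"
    proof (rule inj_onI)
      fix t t' assume t: "t \<in> ?S" "t' \<in> ?S" and eq: "h t = h t'"
      obtain v x y z w v' x' y' z' w' where tt: "t = (v, x, y, z, w)" "t' = (v', x', y', z', w')" by (cases t, cases t') blast
      have v: "v \<in> P" "v' \<in> P" using t unfolding tt by auto
      have e: "h (v, x, y, z, w) $ j = h (v', x', y', z', w') $ j" for j using eq unfolding tt by simp
      have "x = x'" "y = y'" "z = z'" "w = w'" using e[of i1] e[of i2] e[of i3] e[of i4] unfolding h_def by (simp_all add: ne)
      moreover have "v j = v' j" for j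
      proof (cases "j \<in> J")
        case True
        hence "mv v j = mv v' j" using e[of j] by (simp add: h_def J_def i(1))
        thus ?thesis by (simp add: mv_def split: if_splits)
      next
        case False
        thus ?thesis using v by (simp add: P_def PiE_def extensional_def)
      qed
      ultimately show "t = t'" unfolding tt by auto
    qed
  qed (rule finite_lattice_level)
  finally show ?thesis by simp
qed

section \<open>Weyl sums\<close>

definition ee :: "real \<Rightarrow> complex" where "ee x = cis (2 * pi * x)"

lemma norm_ee [simp]: "norm (ee x) = 1"
  by (simp add: ee_def)

lemma ee_0 [simp]: "ee 0 = 1"
  by (simp add: ee_def)

lemma ee_add: "ee (x + y) = ee x * ee y"
  by (simp add: ee_def cis_mult distrib_left)

lemma ee_uminus: "ee (- x) = cnj (ee x)"
  by (simp add: ee_def cis_cnj)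

lemma ee_diff: "ee (x - y) = ee x * cnj (ee y)"
  using ee_add[of x "- y"] by (simp add: ee_uminus)

lemma ee_of_int [simp]: "ee (of_int k) = 1"
  by (simp add: ee_def cis.ctr complex_eq_iff)

lemma ee_add_of_int: "ee (x + of_int k) = ee x"
  by (simp add: ee_add)

lemma ee_sum: "finite A \<Longrightarrow> ee (\<Sum>i\<in>A. f i) = (\<Prod>i\<in>A. ee (f i))"
  by (induction A rule: finite_induct) (auto simp: ee_add)

lemma norm_one_minus_ee: "norm (1 - ee x) = 2 * \<bar>sin (pi * x)\<bar>"
proof -
  have "(norm (1 - ee x))\<^sup>2 = (1 - cos (2 * (pi * x)))\<^sup>2 + (sin (2 * (pi * x)))\<^sup>2"
    by (simp add: ee_def cmod_power2 mult.assoc)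
  also have "\<dots> = 2 - 2 * cos (2 * (pi * x))"
    using sin_cos_squared_add[of "2 * (pi * x)"] by (simp add: power2_eq_square algebra_simps)
  also have "\<dots> = (2 * \<bar>sin (pi * x)\<bar>)\<^sup>2"
    by (simp add: cos_double_sin power_mult_distrib)
  finally show ?thesis by (rule power2_eq_imp_eq) auto
qed

lemma norm_ee_diff_le: "norm (ee x - ee y) \<le> 2 * pi * \<bar>x - y\<bar>"
proof -
  have "ee x - ee y = ee x * (1 - ee (y - x))"
    using ee_add[of x "y - x"] by (simp add: algebra_simps)
  hence "norm (ee x - ee y) = 2 * \<bar>sin (pi * (y - x))\<bar>"
    by (simp add: norm_mult norm_one_minus_ee)
  also have "\<dots> \<le> 2 * \<bar>pi * (y - x)\<bar>" by (intro mult_left_mono abs_sin_x_le_abs_x) auto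
  finally show ?thesis by (simp add: abs_mult abs_minus_commute)
qed

definition ndist :: "real \<Rightarrow> real" where "ndist x = \<bar>x - of_int (round x)\<bar>"

lemma ndist_nonneg [simp]: "ndist x \<ge> 0"
  by (simp add: ndist_def)

lemma ndist_le: "ndist x \<le> \<bar>x - of_int k\<bar>"
  unfolding ndist_def by (rule round_diff_minimal)

lemma ndist_le_half: "ndist x \<le> 1 / 2"
  unfolding ndist_def using of_int_round_abs_le[of x] by (simp add: abs_minus_commute)

lemma ndist_add_of_int: "ndist (x + of_int k) = ndist x"
proof (rule antisym)
  show "ndist (x + of_int k) \<le> ndist x"
    using ndist_le[of "x + of_int k" "round x + k"] by (simp add: ndist_def)
  show "ndist x \<le> ndist (x + of_int k)"
    using ndist_le[of x "round (x + of_int k) - k"] by (simp add: ndist_def algebra_simps)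
qed

lemma ndist_triangle: "ndist x \<le> ndist (x + y) + \<bar>y\<bar>"
  using ndist_le[of x "round (x + y)"] by (simp add: ndist_def)

lemma ndist_small: "\<bar>x\<bar> \<le> 1 / 2 \<Longrightarrow> ndist x = \<bar>x\<bar>"
proof (rule antisym)
  assume x: "\<bar>x\<bar> \<le> 1 / 2"
  show "ndist x \<le> \<bar>x\<bar>" using ndist_le[of x 0] by simp
  show "\<bar>x\<bar> \<le> ndist x"
  proof (cases "round x = 0")
    case False
    hence "\<bar>of_int (round x) :: real\<bar> \<ge> 1" by linarith
    thus ?thesis using x unfolding ndist_def by linarith
  qed (simp add: ndist_def)
qed

lemma sin_ge_linear:
  fixes x :: real
  assumes "0 \<le> x" "x \<le> pi / 2"
  shows "2 / pi * x \<le> sin x"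
proof -
  have "concave_on {0..pi/2} sin"
    by (rule f''_le0_imp_concave[where f' = cos and f'' = "\<lambda>x. - sin x"])
       (auto intro!: derivative_eq_intros sin_ge_zero)
  from concave_onD[OF this, of "2 / pi * x" 0 "pi / 2"] assms show ?thesis
    by (simp add: field_simps)
qed

lemma norm_one_minus_ee_ge: "norm (1 - ee x) \<ge> 4 * ndist x"
proof -
  define y where "y = x - of_int (round x)"
  have y: "\<bar>y\<bar> \<le> 1 / 2" "ndist x = \<bar>y\<bar>" using ndist_le_half[of x] by (auto simp: y_def ndist_def)
  have "ee x = ee y" using ee_add_of_int[of y "round x"] by (simp add: y_def)
  hence "norm (1 - ee x) = 2 * \<bar>sin (pi * y)\<bar>" by (simp add: norm_one_minus_ee)
  also have "\<bar>sin (pi * y)\<bar> = \<bar>sin (pi * \<bar>y\<bar>)\<bar>" by (cases "y \<ge> 0") auto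
  finally have 1: "norm (1 - ee x) = 2 * \<bar>sin (pi * \<bar>y\<bar>)\<bar>" .
  have "2 / pi * (pi * \<bar>y\<bar>) \<le> sin (pi * \<bar>y\<bar>)" using y pi_gt_zero by (intro sin_ge_linear) auto
  hence "2 * \<bar>y\<bar> \<le> \<bar>sin (pi * \<bar>y\<bar>)\<bar>" by simp
  thus ?thesis using y 1 by simp
qed

text \<open>Summation by parts: multiplication by \<open>1 - ee x\<close> leaves only the boundary
  values and the variation of \<open>g\<close>, and \<open>4 * ndist x\<close> is a lower bound for
  \<open>norm (1 - ee x)\<close>. With \<open>g\<close> constant this is the geometric sum; with
  \<open>g\<close> a slowly varying quadratic phase it gives decay away from frequency zero.\<close>

lemma abel_sum_bound:
  fixes g :: "int \<Rightarrow> complex"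
  assumes "A \<le> B"
  shows "4 * ndist x * norm (\<Sum>u\<in>{A..B}. g u * ee (of_int u * x))
           \<le> norm (g A) + norm (g B) + (\<Sum>u\<in>{A+1..B}. norm (g u - g (u - 1)))"
proof -
  have "(1 - ee x) * (\<Sum>u\<in>{A..B}. g u * ee (of_int u * x)) =
     g A * ee (of_int A * x) - g B * ee (of_int (B + 1) * x) + (\<Sum>u\<in>{A+1..B}. (g u - g (u - 1)) * ee (of_int u * x))"
    using assms
  proof (induction B rule: int_ge_induct)
    case base
    show ?case by (simp add: algebra_simps ee_add)
  next
    case (step B)
    have "{A..B + 1} = insert (B + 1) {A..B}" "{A+1..B + 1} = insert (B + 1) {A+1..B}" using step.hyps by auto
    moreover have "ee (of_int (B + 1) * x) = ee (of_int B * x) * ee x" "ee (of_int (B + 1 + 1) * x) = ee (of_int B * x) * ee x * ee x"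
      by (simp_all add: ee_add[symmetric] algebra_simps)
    ultimately show ?case using step.IH by (simp add: algebra_simps)
  qed
  also have "norm \<dots> \<le> norm (g A * ee (of_int A * x)) + norm (g B * ee (of_int (B + 1) * x))
      + (\<Sum>u\<in>{A+1..B}. norm ((g u - g (u - 1)) * ee (of_int u * x)))"
    by (intro order.trans[OF norm_triangle_ineq] add_mono norm_triangle_ineq4 norm_sum)
  also have "\<dots> = norm (g A) + norm (g B) + (\<Sum>u\<in>{A+1..B}. norm (g u - g (u - 1)))"
    by (simp add: norm_mult)
  finally show ?thesis
    using mult_right_mono[OF norm_one_minus_ee_ge[of x] norm_ge_zero[of "\<Sum>u\<in>{A..B}. g u * ee (of_int u * x)"]]
    by (simp add: norm_mult)
qed

definition qsum :: "int set \<Rightarrow> real \<Rightarrow> real \<Rightarrow> complex" where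
  "qsum S t x = (\<Sum>m\<in>S. ee (t * of_int (m\<^sup>2) + of_int m * x))"

text \<open>The classical \<open>min (N + 1) (1 / (2 * ndist x))\<close>; the case
  \<open>ndist x = 0\<close> is separated because \<open>1 / 0 = 0\<close> would make the minimum
  vanish.\<close>

definition geom_bound :: "nat \<Rightarrow> real \<Rightarrow> real" where
  "geom_bound N x = (if ndist x = 0 then real N + 1 else min (real N + 1) (1 / (2 * ndist x)))"

lemma geom_bound_nonneg: "geom_bound N x \<ge> 0"
  by (simp add: geom_bound_def)

lemma geom_bound_le: "geom_bound N x \<le> real N + 1"
  by (simp add: geom_bound_def)

lemma norm_geom_sum_le:
  assumes "B - A \<le> int N"
  shows "norm (\<Sum>u\<in>{A..B}. ee (of_int u * x)) \<le> geom_bound N x"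
proof (cases "A \<le> B")
  case True
  have "norm (\<Sum>u\<in>{A..B}. ee (of_int u * x)) \<le> (\<Sum>u\<in>{A..B}. norm (ee (of_int u * x)))" by (rule norm_sum)
  also have "\<dots> = of_int (B - A + 1)" using True by simp
  also have "\<dots> \<le> real N + 1" using assms by linarith
  finally have 1: "norm (\<Sum>u\<in>{A..B}. ee (of_int u * x)) \<le> real N + 1" .
  have "4 * ndist x * norm (\<Sum>u\<in>{A..B}. ee (of_int u * x)) \<le> 2"
    using abel_sum_bound[OF True, of x "\<lambda>_. 1"] by simp
  hence "norm (\<Sum>u\<in>{A..B}. ee (of_int u * x)) \<le> 1 / (2 * ndist x)" if "ndist x \<noteq> 0"
    using that ndist_nonneg[of x] by (simp add: field_simps less_le)
  with 1 show ?thesis by (auto simp: geom_bound_def)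
qed (auto simp: geom_bound_nonneg)

text \<open>Weyl differencing: in the expanded square the phase at \<open>m + h\<close> minus the
  phase at \<open>m\<close> is linear in \<open>m\<close>, so the inner sums are geometric with
  frequency \<open>2 * t * h\<close>. The frequency \<open>x\<close> survives only in a unimodular
  factor, which makes the bound uniform in \<open>x\<close>.\<close>

lemma norm_qsum_sq_le:
  assumes "B - A \<le> int N"
  shows "(norm (qsum {A..B} t x))\<^sup>2 \<le> (\<Sum>h\<in>{- int N..int N}. geom_bound N (2 * t * of_int h))"
proof -
  define a where "a m = ee (t * of_int (m\<^sup>2) + of_int m * x)" for m :: int
  define I where "I h = {max A (A - h)..min B (B - h)}" for h
  have "of_real ((norm (qsum {A..B} t x))\<^sup>2) = qsum {A..B} t x * cnj (qsum {A..B} t x)"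
    unfolding complex_norm_square ..
  also have "\<dots> = (\<Sum>(m, m')\<in>{A..B} \<times> {A..B}. a m * cnj (a m'))"
    by (simp add: qsum_def a_def sum_product sum.cartesian_product)
  also have "\<dots> = (\<Sum>(h, m)\<in>Sigma {- int N..int N} I. a (m + h) * cnj (a m))"
    by (rule sum.reindex_bij_witness[where i = "\<lambda>(h, m). (m + h, m)" and j = "\<lambda>(m, m'). (m - m', m')"])
       (use assms in \<open>auto simp: I_def\<close>)
  also have "\<dots> = (\<Sum>h\<in>{- int N..int N}. \<Sum>m\<in>I h. a (m + h) * cnj (a m))"
    by (subst sum.Sigma) (auto simp: I_def)
  also have "\<dots> = (\<Sum>h\<in>{- int N..int N}. ee (t * of_int (h\<^sup>2) + of_int h * x) * (\<Sum>m\<in>I h. ee (of_int m * (2 * t * of_int h))))"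
    unfolding sum_distrib_left a_def ee_uminus[symmetric] ee_add[symmetric]
    by (intro sum.cong refl arg_cong[where f = ee]) (simp add: power2_eq_square algebra_simps)
  finally have "(norm (qsum {A..B} t x))\<^sup>2 = norm \<dots>" by (metis abs_of_nonneg norm_of_real zero_le_power2)
  also have "\<dots> \<le> (\<Sum>h\<in>{- int N..int N}. norm (ee (t * of_int (h\<^sup>2) + of_int h * x) * (\<Sum>m\<in>I h. ee (of_int m * (2 * t * of_int h)))))"
    by (rule norm_sum)
  also have "\<dots> = (\<Sum>h\<in>{- int N..int N}. norm (\<Sum>m\<in>I h. ee (of_int m * (2 * t * of_int h))))"
    by (simp add: norm_mult)
  also have "\<dots> \<le> (\<Sum>h\<in>{- int N..int N}. geom_bound N (2 * t * of_int h))"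
    unfolding I_def by (intro sum_mono norm_geom_sum_le) (use assms in auto)
  finally show ?thesis .
qed

text \<open>Passing from the even multiples to all \<open>h\<close> in the doubled range allows a
  rational approximation of \<open>t\<close> itself to be used, whatever the parity of its
  denominator.\<close>

lemma norm_qsum_sq_le':
  assumes "B - A \<le> int N"
  shows "(norm (qsum {A..B} t x))\<^sup>2 \<le> (\<Sum>h\<in>{- 2 * int N..2 * int N}. geom_bound N (t * of_int h))"
proof -
  have "(\<Sum>h\<in>{- int N..int N}. geom_bound N (2 * t * of_int h)) = (\<Sum>h\<in>(*) 2 ` {- int N..int N}. geom_bound N (t * of_int h))"
    by (subst sum.reindex) (auto simp: inj_on_def algebra_simps)
  also have "\<dots> \<le> (\<Sum>h\<in>{- 2 * int N..2 * int N}. geom_bound N (t * of_int h))"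
    by (rule sum_mono2) (auto simp: geom_bound_nonneg)
  finally show ?thesis using norm_qsum_sq_le[OF assms, of t x] by linarith
qed

lemma card_congruent_le:
  assumes "finite T" "T \<subseteq> {A..B}" "A \<le> B" "(q::int) > 0" and "\<And>h h'. h \<in> T \<Longrightarrow> h' \<in> T \<Longrightarrow> q dvd h - h'"
  shows "real (card T) \<le> of_int (B - A) / of_int q + 2"
proof -
  have "inj_on (\<lambda>h. h div q) T"
  proof (rule inj_onI)
    fix h h' assume h: "h \<in> T" "h' \<in> T" "h div q = h' div q"
    hence "h mod q = h' mod q" using assms(5) by (simp add: mod_eq_dvd_iff)
    thus "h = h'" using h(3) by (metis mult_div_mod_eq)
  qed
  hence "card T \<le> card {A div q..B div q}"
    by (rule card_inj_on_le) (use assms in \<open>auto intro!: zdiv_mono1\<close>)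
  also have "\<dots> = nat (B div q - A div q + 1)" by simp
  finally have "real (card T) \<le> real (nat (B div q - A div q + 1))" by (simp only: of_nat_le_iff)
  also have "\<dots> = of_int (B div q) - of_int (A div q) + 1"
    using zdiv_mono1[OF assms(3,4)] by simp
  also have "\<dots> \<le> of_int B / of_int q - (of_int A / of_int q - 1) + 1"
  proof -
    have "of_int (B div q) \<le> (of_int B / of_int q :: real)"
      unfolding floor_divide_of_int_eq[symmetric, where 'a = real] by (rule of_int_floor_le)
    moreover have "of_int (A div q) \<ge> (of_int A / of_int q - 1 :: real)"
      unfolding floor_divide_of_int_eq[symmetric, where 'a = real] by linarith
    ultimately show ?thesis by linarith
  qed
  finally show ?thesis by (simp add: diff_divide_distrib)
qed

lemma one_plus_ln_le_powr:
  assumes "0 < \<eta>" "\<eta> \<le> 1" "x \<ge> (1::real)"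
  shows "1 + ln x \<le> x powr \<eta> / \<eta>"
proof -
  have "\<eta> * (1 + ln x) \<le> 1 + \<eta> * ln x" using assms by (simp add: algebra_simps)
  also have "\<dots> \<le> exp (\<eta> * ln x)" by (rule exp_ge_add_one_self)
  also have "\<dots> = x powr \<eta>" using assms by (simp add: powr_def)
  finally show ?thesis using assms by (simp add: field_simps)
qed

lemma sum_inverse_le_ln: "q \<ge> 1 \<Longrightarrow> (\<Sum>r\<in>{1..<q}. 1 / real r) \<le> 1 + ln (real q)"
proof -
  assume q: "q \<ge> 1"
  have "(\<Sum>r\<in>{1..<q}. 1 / real r) \<le> (\<Sum>r\<in>{1..q}. 1 / real r)" by (rule sum_mono2) auto
  also have "\<dots> = harm q" by (simp add: harm_def field_simps)
  also have "harm q \<le> 1 + ln (real q)"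
    using decseqD[OF decseq_harm_diff_ln, of 0 "q - 1"] q by (simp add: harm_Suc harm_expand)
  finally show ?thesis .
qed

lemma sum_powr_le:
  assumes "0 < \<eta>" "\<eta> \<le> (1::real)"
  shows "(\<Sum>w\<in>{1..W}. real w powr (\<eta> - 1)) \<le> real W powr \<eta> / \<eta>"
proof (induction W)
  case (Suc W)
  have "\<eta> * real (Suc W) powr (\<eta> - 1) \<le> real (Suc W) powr \<eta> - real W powr \<eta>"
  proof (cases "W = 0")
    case False
    have "\<exists>z. real W < z \<and> z < real (Suc W) \<and> real (Suc W) powr \<eta> - real W powr \<eta> = (real (Suc W) - real W) * (\<eta> * z powr (\<eta> - 1))"
      by (rule MVT2) (use False in \<open>auto intro!: derivative_eq_intros simp: powr_diff\<close>)
    then obtain z where z: "real W < z" "z < real (Suc W)" "real (Suc W) powr \<eta> - real W powr \<eta> = \<eta> * z powr (\<eta> - 1)" by auto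
    have "real (Suc W) powr (\<eta> - 1) \<le> z powr (\<eta> - 1)" using z False assms by (intro powr_mono2') auto
    thus ?thesis using z assms by simp
  qed (use assms in simp)
  hence "real (Suc W) powr (\<eta> - 1) \<le> (real (Suc W) powr \<eta> - real W powr \<eta>) / \<eta>" using assms by (simp add: field_simps)
  thus ?case using Suc.IH by (simp add: diff_divide_distrib)
qed simp


lemma ndist_fraction_ge:
  assumes "0 < r" "r < (q::int)"
  shows "min (of_int r / of_int q) (of_int (q - r) / of_int q) \<le> ndist (of_int r / of_int q)"
proof -
  define k where "k = round (of_int r / of_int q :: real)"
  have q: "q > 0" using assms by simp
  have "min r (q - r) \<le> \<bar>r - k * q\<bar>"
  proof (cases "k \<le> 0")
    case True
    hence "k * q \<le> 0" using q by (simp add: mult_nonpos_nonneg)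
    thus ?thesis by simp
  next
    case False
    hence "1 * q \<le> k * q" using q by (intro mult_right_mono) auto
    thus ?thesis by simp
  qed
  hence "real_of_int (min r (q - r)) \<le> of_int \<bar>r - k * q\<bar>" by (simp only: of_int_le_iff)
  hence "real_of_int (min r (q - r)) / of_int q \<le> \<bar>of_int r - of_int k * of_int q\<bar> / of_int q" using q
    by (intro divide_right_mono) auto
  also have "\<dots> = \<bar>of_int r / of_int q - of_int k\<bar>" using q by (simp add: field_simps abs_divide)
  finally show ?thesis using q by (simp add: ndist_def k_def min_def divide_le_cancel split: if_splits)
qed

lemma sum_inverse_ndist_le:
  assumes "q \<ge> (1::nat)"
  shows "(\<Sum>r\<in>{1..<int q}. 1 / ndist (of_int r / real q)) \<le> 2 * real q * (1 + ln (real q))"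
proof -
  have "(\<Sum>r\<in>{1..<int q}. 1 / ndist (of_int r / real q)) \<le> (\<Sum>r\<in>{1..<int q}. real q / of_int r + real q / of_int (int q - r))"
  proof (rule sum_mono)
    fix r assume r: "r \<in> {1..<int q}"
    let ?a = "of_int r / real q" and ?b = "of_int (int q - r) / real q"
    have ab: "?a > 0" "?b > 0" using r by auto
    have "min ?a ?b \<le> ndist ?a" using ndist_fraction_ge[of r "int q"] r by simp
    hence "1 / ndist ?a \<le> 1 / min ?a ?b" using ab by (intro divide_left_mono) auto
    also have "\<dots> \<le> 1 / ?a + 1 / ?b"
      using divide_pos_pos[OF zero_less_one ab(1)] divide_pos_pos[OF zero_less_one ab(2)] unfolding min_def by (cases "?a \<le> ?b") (simp_all del: divide_divide_eq_right)
    finally show "1 / ndist ?a \<le> real q / of_int r + real q / of_int (int q - r)" by simp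
  qed
  also have "\<dots> = (\<Sum>r\<in>{1..<int q}. real q / of_int r) + (\<Sum>r\<in>{1..<int q}. real q / of_int (int q - r))"
    by (rule sum.distrib)
  also have "(\<Sum>r\<in>{1..<int q}. real q / of_int (int q - r)) = (\<Sum>r\<in>{1..<int q}. real q / of_int r)"
    by (rule sum.reindex_bij_witness[where i = "\<lambda>r. int q - r" and j = "\<lambda>r. int q - r"]) auto
  also have "(\<Sum>r\<in>{1..<int q}. real q / of_int r) = (\<Sum>r\<in>{1..<q}. real q / real r)"
    by (rule sum.reindex_bij_witness[where i = int and j = nat]) auto
  also have "\<dots> = real q * (\<Sum>r\<in>{1..<q}. 1 / real r)" by (simp add: sum_distrib_left)
  also have "\<dots> + \<dots> \<le> 2 * (real q * (1 + ln (real q)))"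
    using sum_inverse_le_ln[OF assms] by (simp add: mult_left_mono)
  finally show ?thesis by simp
qed

text \<open>For \<open>h\<close> not divisible by \<open>q\<close> the point
  \<open>a * h / q\<close> stays at distance at least \<open>1 / q\<close> from the integers, and
  the perturbation \<open>\<tau> * h\<close> moves it by at most half of its distance. Each residue
  class is met at most \<open>4 * N / q + 2\<close> times, and the inverse distances of the nonzero
  residues sum to \<open>q\<close> times a logarithm.\<close>

lemma sum_geom_bound_nondivisible:
  assumes q: "q \<ge> (1::nat)" and cop: "coprime a (int q)" and N: "N \<ge> 1" and \<tau>: "4 * real N * real q * \<bar>\<tau>\<bar> \<le> 1"
  shows "(\<Sum>h | h \<in> {- 2 * int N..2 * int N} \<and> \<not> int q dvd h. geom_bound N ((of_int a / real q + \<tau>) * of_int h))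
         \<le> (8 * real N + 4 * real q) * (1 + ln (real q))"
proof -
  define H where "H = {h. h \<in> {- 2 * int N..2 * int N} \<and> \<not> int q dvd h}"
  have finH: "finite H" unfolding H_def by (rule finite_subset[of _ "{- 2 * int N..2 * int N}"]) auto
  define \<rho> where "\<rho> h = (a * h) mod int q" for h
  have \<rho>: "\<rho> h \<in> {1..<int q}" if "h \<in> H" for h
  proof -
    have "\<not> int q dvd a * h" using that cop by (simp add: H_def coprime_commute coprime_dvd_mult_right_iff)
    hence "\<rho> h \<noteq> 0" by (simp add: \<rho>_def dvd_eq_mod_eq_0)
    moreover have "0 \<le> \<rho> h" "\<rho> h < int q" using q by (auto simp: \<rho>_def)
    ultimately show ?thesis by auto
  qed
  have G: "geom_bound N ((of_int a / real q + \<tau>) * of_int h) \<le> 1 / ndist (of_int (\<rho> h) / real q)" if h: "h \<in> H" for h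
  proof -
    let ?n = "ndist (of_int (\<rho> h) / real q)"
    have "real_of_int (a * h) = of_int (int q * ((a * h) div int q) + \<rho> h)" unfolding \<rho>_def by simp
    hence "real_of_int (a * h) / real q = of_int (\<rho> h) / real q + of_int ((a * h) div int q)"
      using q by (simp add: field_simps)
    hence n: "ndist (of_int (a * h) / real q) = ?n" by (simp only: ndist_add_of_int)
    have "1 / real q \<le> min (of_int (\<rho> h) / real q) (of_int (int q - \<rho> h) / real q)"
      using \<rho>[OF h] q by (auto simp: divide_right_mono)
    also have "\<dots> \<le> ?n" using ndist_fraction_ge[of "\<rho> h" "int q"] \<rho>[OF h] by simp
    finally have n1: "1 / real q \<le> ?n" .
    hence n0: "?n > 0" using q by (smt (verit) divide_pos_pos of_nat_0_less_iff zero_less_one less_le_trans One_nat_def Suc_le_lessD)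
    have "\<bar>\<tau> * of_int h\<bar> \<le> \<bar>\<tau>\<bar> * (2 * real N)"
      using h by (auto simp: abs_mult H_def intro!: mult_left_mono)
    also have "\<dots> \<le> 1 / (2 * real q)" using \<tau> q by (simp add: field_simps)
    finally have th: "\<bar>\<tau> * of_int h\<bar> \<le> ?n / 2" using n1 by simp
    have "?n \<le> ndist ((of_int a / real q + \<tau>) * of_int h) + \<bar>\<tau> * of_int h\<bar>"
      using ndist_triangle[of "of_int (a * h) / real q" "\<tau> * of_int h"] unfolding n by (simp add: algebra_simps)
    hence d: "?n / 2 \<le> ndist ((of_int a / real q + \<tau>) * of_int h)" using th by linarith
    hence "geom_bound N ((of_int a / real q + \<tau>) * of_int h) \<le> 1 / (2 * ndist ((of_int a / real q + \<tau>) * of_int h))"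
      using n0 by (auto simp: geom_bound_def)
    also have "\<dots> \<le> 1 / (2 * (?n / 2))" using d n0 by (intro divide_left_mono mult_left_mono mult_pos_pos) auto
    finally show ?thesis by simp
  qed
  have "(\<Sum>h\<in>H. geom_bound N ((of_int a / real q + \<tau>) * of_int h)) \<le> (\<Sum>h\<in>H. 1 / ndist (of_int (\<rho> h) / real q))"
    by (intro sum_mono G)
  also have "\<dots> = (\<Sum>r\<in>{1..<int q}. \<Sum>h | h \<in> H \<and> \<rho> h = r. 1 / ndist (of_int (\<rho> h) / real q))"
    by (rule sum.group[symmetric]) (use finH \<rho> in auto)
  also have "\<dots> = (\<Sum>r\<in>{1..<int q}. real (card {h. h \<in> H \<and> \<rho> h = r}) * (1 / ndist (of_int r / real q)))"
    by (intro sum.cong refl) simp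
  also have "\<dots> \<le> (\<Sum>r\<in>{1..<int q}. (4 * real N / real q + 2) * (1 / ndist (of_int r / real q)))"
  proof (intro sum_mono mult_right_mono)
    fix r
    have "real (card {h. h \<in> H \<and> \<rho> h = r}) \<le> of_int (2 * int N - (- 2 * int N)) / of_int (int q) + 2"
    proof (rule card_congruent_le)
      fix h h' assume "h \<in> {h. h \<in> H \<and> \<rho> h = r}" "h' \<in> {h. h \<in> H \<and> \<rho> h = r}"
      hence "int q dvd a * h - a * h'" by (simp add: \<rho>_def mod_eq_dvd_iff[symmetric])
      hence "int q dvd a * (h - h')" by (simp add: algebra_simps)
      thus "int q dvd h - h'" using cop by (simp add: coprime_commute coprime_dvd_mult_right_iff)
    next
      show "finite {h. h \<in> H \<and> \<rho> h = r}" using finH by simp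
    qed (use q in \<open>auto simp: H_def\<close>)
    thus "real (card {h. h \<in> H \<and> \<rho> h = r}) \<le> 4 * real N / real q + 2" by simp
  qed auto
  also have "\<dots> = (4 * real N / real q + 2) * (\<Sum>r\<in>{1..<int q}. 1 / ndist (of_int r / real q))"
    by (simp add: sum_distrib_left)
  also have "\<dots> \<le> (4 * real N / real q + 2) * (2 * real q * (1 + ln (real q)))"
    by (intro mult_left_mono sum_inverse_ndist_le q) auto
  also have "\<dots> = (8 * real N + 4 * real q) * (1 + ln (real q))"
    using q by (simp add: field_simps)
  finally show ?thesis by (simp add: H_def)
qed

lemma sum_symmetric_int:
  fixes f :: "int \<Rightarrow> real"
  assumes "\<And>w. f (- w) = f w"
  shows "(\<Sum>w\<in>{- int W..int W}. f w) = f 0 + 2 * (\<Sum>w\<in>{1..W}. f (int w))"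
proof (induction W)
  case (Suc W)
  have "{- int (Suc W)..int (Suc W)} = insert (- int (Suc W)) (insert (int (Suc W)) {- int W..int W})" by auto
  thus ?case using Suc.IH assms[of "int (Suc W)"] by simp
qed simp

text \<open>For \<open>h = q * w\<close> the fraction disappears modulo 1 and only
  \<open>\<tau> * q * w\<close> remains, which the hypothesis on \<open>\<tau>\<close> keeps at most
  one half in modulus. These terms carry the main contribution \<open>N\<^sup>2 / q\<close>, with
  the decay in \<open>\<tau>\<close> of a squared Fresnel integral, up to
  \<open>\<eta>\<close>.\<close>

lemma sum_geom_bound_divisible:
  assumes \<eta>: "0 < \<eta>" "\<eta> \<le> 1" and q: "q \<ge> (1::nat)" and N: "N \<ge> 1" and \<tau>: "4 * real N * real q * \<bar>\<tau>\<bar> \<le> 1"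
  shows "(\<Sum>h | h \<in> {- 2 * int N..2 * int N} \<and> int q dvd h. geom_bound N ((of_int a / real q + \<tau>) * of_int h))
         \<le> 2 * real N + 16 / \<eta> * ((real N)\<^sup>2 / real q) * (1 + (real N)\<^sup>2 * \<bar>\<tau>\<bar>) powr (\<eta> - 1)"
proof -
  define W where "W = (2 * N) div q"
  have Wq: "real W \<le> 2 * real N / real q" unfolding W_def using of_nat_div_le_of_nat[of "2 * N" q, where 'a = real] by simp
  define b where "b = \<bar>\<tau>\<bar>"
  define M where "M = 1 + (real N)\<^sup>2 * b"
  have b0: "b \<ge> 0" by (simp add: b_def)
  define g where "g w = geom_bound N (\<tau> * real q * of_int w)" for w :: int
  have "(\<Sum>h | h \<in> {- 2 * int N..2 * int N} \<and> int q dvd h. geom_bound N ((of_int a / real q + \<tau>) * of_int h)) =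
     (\<Sum>w\<in>{- int W..int W}. g w)"
  proof (rule sum.reindex_bij_witness[where i = "\<lambda>w. int q * w" and j = "\<lambda>h. h div int q"])
    fix h assume h: "h \<in> {h. h \<in> {- 2 * int N..2 * int N} \<and> int q dvd h}"
    then obtain w where w: "h = int q * w" by (auto elim: dvdE)
    have hw: "h div int q = w" using w q by simp
    show "int q * (h div int q) = h" using w hw by simp
    have "\<bar>w\<bar> * int q \<le> int (2 * N)" using h w q by (auto simp: abs_le_iff mult.commute abs_if)
    hence "\<bar>w\<bar> \<le> int (2 * N) div int q" using zdiv_mono1[of "\<bar>w\<bar> * int q" "int (2 * N)" "int q"] q by simp
    thus "h div int q \<in> {- int W..int W}" unfolding hw W_def by (simp add: zdiv_int abs_le_iff)
    have "(of_int a / real q + \<tau>) * of_int h = \<tau> * real q * of_int w + of_int (a * w)"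
      using q w by (simp add: field_simps)
    thus "g (h div int q) = geom_bound N ((of_int a / real q + \<tau>) * of_int h)"
      unfolding hw g_def geom_bound_def by (simp only: ndist_add_of_int)
  next
    fix w assume "w \<in> {- int W..int W}"
    hence "\<bar>w\<bar> \<le> int W" by auto
    hence "int q * \<bar>w\<bar> \<le> int q * int W" by (intro mult_left_mono) auto
    also have "\<dots> \<le> 2 * int N" unfolding W_def using times_div_less_eq_dividend[of q "2 * N"] by (metis of_nat_le_iff of_nat_mult of_nat_numeral)
    finally have "\<bar>int q * w\<bar> \<le> 2 * int N" by (simp add: abs_mult)
    thus "int q * w \<in> {h. h \<in> {- 2 * int N..2 * int N} \<and> int q dvd h}" by auto
  qed (use q in auto)
  also have "\<dots> \<le> 2 * real N + 16 / \<eta> * ((real N)\<^sup>2 / real q) * M powr (\<eta> - 1)"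
  \<comment> \<open>If \<open>N\<^sup>2 * b \<le> 1\<close>, then \<open>M\<close> lies between 1
    and 2 and the number of terms times the trivial bound is enough.\<close>
  proof (cases "(real N)\<^sup>2 * b \<le> 1")
    case True
    have "(\<Sum>w\<in>{- int W..int W}. g w) \<le> (\<Sum>w\<in>{- int W..int W}. 2 * real N)"
      unfolding g_def by (intro sum_mono order.trans[OF geom_bound_le]) (use N in auto)
    also have "\<dots> = (2 * real W + 1) * (2 * real N)" by (simp add: algebra_simps)
    also have "\<dots> \<le> (2 * (2 * real N / real q) + 1) * (2 * real N)" using Wq by (intro mult_right_mono) auto
    also have "\<dots> = 2 * real N + 16 * ((real N)\<^sup>2 / real q) * (1 / 2)" by (simp add: power2_eq_square algebra_simps)
    also have "\<dots> \<le> 2 * real N + 16 / \<eta> * ((real N)\<^sup>2 / real q) * M powr (\<eta> - 1)"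
    proof (intro add_left_mono mult_mono)
      show "16 \<le> 16 / \<eta>" using \<eta> by (simp add: field_simps)
      have "2 powr (- 1) \<le> 2 powr (\<eta> - 1)" using \<eta> by (intro powr_mono) auto
      also have "\<dots> \<le> M powr (\<eta> - 1)" using True \<eta> b0 by (intro powr_mono2') (auto simp: M_def add_pos_nonneg)
      finally show "1 / 2 \<le> M powr (\<eta> - 1)" by (simp add: powr_minus)
    qed (use \<eta> in auto)
    finally show ?thesis .
  next
    case False
    hence b1: "b > 0" "(real N)\<^sup>2 * b > 1" using b0 by (auto simp: less_le)
    have g: "g (int w) \<le> (2 * real N) powr \<eta> * (b * real q) powr (\<eta> - 1) * real w powr (\<eta> - 1)" if w: "w \<in> {1..W}" for w
    proof -
      have "b * real q * real w \<le> b * real q * (2 * real N / real q)"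
        using w Wq b0 by (intro mult_left_mono order.trans[OF _ Wq]) auto
      also have "\<dots> = 2 * real N * b" using q by simp
      also have "4 * real N * b * 1 \<le> 4 * real N * b * real q" using q b0 by (intro mult_left_mono) auto
      hence "2 * real N * b \<le> 1 / 2" using \<tau> by (simp add: b_def mult.commute mult.left_commute)
      finally have le: "b * real q * real w \<le> 1 / 2" .
      have n: "ndist (\<tau> * real q * of_int (int w)) = b * real q * real w"
        using ndist_small[of "\<tau> * real q * of_int (int w)"] le by (simp add: abs_mult b_def)
      have p: "b * real q * real w > 0" using b1 q w by simp
      let ?y = "1 / (2 * (b * real q * real w))"
      have y: "?y > 0" using p by simp
      have "g (int w) = min (real N + 1) ?y" using p b1 q w unfolding g_def geom_bound_def n by auto
      also have "\<dots> \<le> min (2 * real N) ?y" using N by (auto simp: min_def)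
      \<comment> \<open>A geometric mean of the two bounds, with weights \<open>\<eta>\<close> and
        \<open>1 - \<eta>\<close>, avoids a logarithm of \<open>N\<close>: the sum over
        \<open>w\<close> of \<open>w powr (\<eta> - 1)\<close> is at most
        \<open>W powr \<eta> / \<eta>\<close>, and the powers of \<open>N\<close> and
        \<open>q\<close> recombine to \<open>N\<^sup>2 / q\<close>.\<close>
      also have "\<dots> = min (2 * real N) ?y powr \<eta> * min (2 * real N) ?y powr (1 - \<eta>)"
        using y N by (simp flip: powr_add)
      also have "\<dots> \<le> (2 * real N) powr \<eta> * ?y powr (1 - \<eta>)"
        using y N \<eta> by (intro mult_mono powr_mono2) auto
      also have "?y powr (1 - \<eta>) = (2 * (b * real q * real w)) powr (\<eta> - 1)"
        using p b1 q w by (auto simp: powr_divide powr_diff)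
      also have "\<dots> \<le> (b * real q * real w) powr (\<eta> - 1)" using p \<eta> by (intro powr_mono2') auto
      also have "\<dots> = (b * real q) powr (\<eta> - 1) * real w powr (\<eta> - 1)" using b0 by (subst powr_mult) auto
      finally show ?thesis by (simp add: mult_left_mono mult.assoc)
    qed
    have sym: "g (- w) = g w" for w
    proof -
      have "ndist (- x) \<le> ndist x" for x using ndist_le[of "- x" "- round x"] by (simp add: ndist_def abs_minus_commute)
      from this[of "\<tau> * real q * of_int w"] this[of "- (\<tau> * real q * of_int w)"]
      show ?thesis by (simp add: g_def geom_bound_def)
    qed
    have "(\<Sum>w\<in>{- int W..int W}. g w) = g 0 + 2 * (\<Sum>w\<in>{1..W}. g (int w))"
      by (rule sum_symmetric_int) (rule sym)
    also have "\<dots> \<le> 2 * real N + 2 * (\<Sum>w\<in>{1..W}. (2 * real N) powr \<eta> * (b * real q) powr (\<eta> - 1) * real w powr (\<eta> - 1))"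
      using geom_bound_le[of N 0] N by (intro add_mono mult_left_mono sum_mono g) (auto simp: g_def)
    also have "\<dots> = 2 * real N + 2 * ((2 * real N) powr \<eta> * (b * real q) powr (\<eta> - 1) * (\<Sum>w\<in>{1..W}. real w powr (\<eta> - 1)))"
      by (simp add: sum_distrib_left)
    also have "\<dots> \<le> 2 * real N + 2 * ((2 * real N) powr \<eta> * (b * real q) powr (\<eta> - 1) * ((2 * real N / real q) powr \<eta> / \<eta>))"
    proof (intro add_left_mono mult_left_mono order.trans[OF sum_powr_le[OF \<eta>]] divide_right_mono powr_mono2)
    qed (use \<eta> Wq in auto)
    also have "(2 * real N) powr \<eta> * (b * real q) powr (\<eta> - 1) * ((2 * real N / real q) powr \<eta> / \<eta>)
        = 4 powr \<eta> / \<eta> * ((real N)\<^sup>2 / real q) * ((real N)\<^sup>2 * b) powr (\<eta> - 1)"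
    proof -
      have N2: "(real N)\<^sup>2 = real N powr 2" using N by (simp add: powr_numeral)
      have "(2 * real N) powr \<eta> * (b * real q) powr (\<eta> - 1) * ((2 * real N / real q) powr \<eta>)
        = (2 powr \<eta> * 2 powr \<eta>) * (real N powr \<eta> * real N powr \<eta>) * b powr (\<eta> - 1) * (real q powr (\<eta> - 1) / real q powr \<eta>)"
        using b0 by (simp add: powr_mult powr_divide)
      also have "2 powr \<eta> * 2 powr \<eta> = (4 :: real) powr \<eta>" by (simp flip: powr_mult)
      also have "real q powr (\<eta> - 1) / real q powr \<eta> = 1 / real q" using q by (simp add: powr_diff)
      also have "real N powr \<eta> * real N powr \<eta> = (real N)\<^sup>2 * ((real N)\<^sup>2) powr (\<eta> - 1)"
        unfolding N2 powr_powr powr_add[symmetric] by (simp add: algebra_simps)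
      finally show ?thesis using b0 by (simp add: powr_mult field_simps)
    qed
    also have "2 * real N + 2 * (4 powr \<eta> / \<eta> * ((real N)\<^sup>2 / real q) * ((real N)\<^sup>2 * b) powr (\<eta> - 1))
        \<le> 2 * real N + 2 * (4 / \<eta> * ((real N)\<^sup>2 / real q) * (2 * M powr (\<eta> - 1)))"
    proof (intro add_left_mono mult_left_mono mult_mono divide_right_mono)
      have "4 powr \<eta> \<le> (4::real) powr 1" using \<eta> by (intro powr_mono) auto
      thus "4 powr \<eta> \<le> (4::real)" by simp
      have "((real N)\<^sup>2 * b) powr (\<eta> - 1) \<le> (M / 2) powr (\<eta> - 1)" using b1 \<eta> by (intro powr_mono2') (auto simp: M_def mult.commute)
      also have "\<dots> = M powr (\<eta> - 1) / 2 powr (\<eta> - 1)" using b1 by (subst powr_divide) (auto simp: M_def)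
      also have "\<dots> = M powr (\<eta> - 1) * 2 powr (1 - \<eta>)" by (simp add: powr_diff)
      also have "\<dots> \<le> M powr (\<eta> - 1) * 2 powr 1" using \<eta> by (intro mult_left_mono powr_mono) auto
      finally show "((real N)\<^sup>2 * b) powr (\<eta> - 1) \<le> 2 * M powr (\<eta> - 1)" by simp
    qed (use \<eta> in auto)
    also have "\<dots> = 2 * real N + 16 / \<eta> * ((real N)\<^sup>2 / real q) * M powr (\<eta> - 1)" by simp
    finally show ?thesis .
  qed
  finally show ?thesis by (simp add: M_def b_def)
qed

text \<open>The second summand is, up to \<open>\<eta>\<close>, the square of what a Gauss sum times
  a Fresnel integral would give. The first is an error that the later choices of \<open>q\<close>
  and \<open>N\<close> absorb; its factor \<open>q powr \<eta> / \<eta>\<close> replaces a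
  logarithm.\<close>

lemma weyl_bound:
  assumes \<eta>: "0 < \<eta>" "\<eta> \<le> 1" and q: "q \<ge> (1::nat)" and cop: "coprime a (int q)" and N: "N \<ge> 1"
    and \<tau>: "4 * real N * real q * \<bar>\<tau>\<bar> \<le> 1" and AB: "B - A \<le> int N"
  shows "(norm (qsum {A..B} (of_int a / real q + \<tau>) x))\<^sup>2
    \<le> 16 / \<eta> * ((real N + real q) * real q powr \<eta> + (real N)\<^sup>2 / real q * (1 + (real N)\<^sup>2 * \<bar>\<tau>\<bar>) powr (\<eta> - 1))"
proof -
  let ?I = "{- 2 * int N..2 * int N}" and ?g = "\<lambda>h. geom_bound N ((of_int a / real q + \<tau>) * of_int h)"
  have "(norm (qsum {A..B} (of_int a / real q + \<tau>) x))\<^sup>2 \<le> (\<Sum>h\<in>?I. ?g h)"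
    by (rule norm_qsum_sq_le'[OF AB])
  also have "\<dots> = (\<Sum>h | h \<in> ?I \<and> \<not> int q dvd h. ?g h) + (\<Sum>h | h \<in> ?I \<and> int q dvd h. ?g h)"
    by (subst sum.union_disjoint[symmetric]) (auto intro!: sum.cong intro: finite_subset[of _ ?I])
  also have "\<dots> \<le> (8 * real N + 4 * real q) * (1 + ln (real q)) +
      (2 * real N + 16 / \<eta> * ((real N)\<^sup>2 / real q) * (1 + (real N)\<^sup>2 * \<bar>\<tau>\<bar>) powr (\<eta> - 1))"
    by (intro add_mono sum_geom_bound_nondivisible sum_geom_bound_divisible assms)
  finally have 1: "(norm (qsum {A..B} (of_int a / real q + \<tau>) x))\<^sup>2 \<le> \<dots>" .
  have "(8 * real N + 4 * real q) * (1 + ln (real q)) + 2 * real N \<le> (10 * real N + 4 * real q) * (1 + ln (real q))"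
    using q by (simp add: algebra_simps)
  also have "\<dots> \<le> (16 * (real N + real q)) * (real q powr \<eta> / \<eta>)"
    using q by (intro mult_mono one_plus_ln_le_powr \<eta>) auto
  finally show ?thesis using 1 by (simp add: algebra_simps)
qed

section \<open>Finitely supported functions and Parseval's identity\<close>

definition fsupp :: "(int ^ 'd \<Rightarrow> complex) \<Rightarrow> bool" where
  "fsupp f \<longleftrightarrow> finite {n. f n \<noteq> 0}"

definition l2sq :: "(int ^ 'd \<Rightarrow> complex) \<Rightarrow> real" where
  "l2sq f = (\<Sum>n | f n \<noteq> 0. (cmod (f n))\<^sup>2)"

definition dotp :: "real ^ 'd \<Rightarrow> int ^ 'd \<Rightarrow> real" where
  "dotp \<xi> m = (\<Sum>i\<in>UNIV. \<xi> $ i * of_int (m $ i))"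

definition ft :: "(int ^ 'd \<Rightarrow> complex) \<Rightarrow> real ^ 'd \<Rightarrow> complex" where
  "ft f \<xi> = (\<Sum>n | f n \<noteq> 0. f n * ee (dotp \<xi> n))"

text \<open>The sum runs over the support of \<open>K\<close>, so that a finitely supported kernel
  can act on an arbitrary \<open>f\<close>.\<close>

definition cv :: "(int ^ 'd \<Rightarrow> complex) \<Rightarrow> (int ^ 'd \<Rightarrow> complex) \<Rightarrow> int ^ 'd \<Rightarrow> complex" where
  "cv K f n = (\<Sum>m | K m \<noteq> 0. K m * f (n - m))"

lemma fsuppI: "finite A \<Longrightarrow> (\<And>n. n \<notin> A \<Longrightarrow> f n = 0) \<Longrightarrow> fsupp f"
  unfolding fsupp_def by (rule finite_subset[of _ A]) auto

lemma l2sq_eq: "finite A \<Longrightarrow> (\<And>n. n \<notin> A \<Longrightarrow> f n = 0) \<Longrightarrow> l2sq f = (\<Sum>n\<in>A. (cmod (f n))\<^sup>2)"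
  unfolding l2sq_def by (rule sum.mono_neutral_left) auto

lemma ft_eq: "finite A \<Longrightarrow> (\<And>n. n \<notin> A \<Longrightarrow> f n = 0) \<Longrightarrow> ft f \<xi> = (\<Sum>n\<in>A. f n * ee (dotp \<xi> n))"
  unfolding ft_def by (rule sum.mono_neutral_left) auto

lemma cv_eq: "finite A \<Longrightarrow> (\<And>n. n \<notin> A \<Longrightarrow> K n = 0) \<Longrightarrow> cv K f n = (\<Sum>m\<in>A. K m * f (n - m))"
  unfolding cv_def by (rule sum.mono_neutral_left) auto

lemma l2sq_nonneg: "l2sq f \<ge> 0"
  unfolding l2sq_def by (simp add: sum_nonneg)

lemma sum_le_l2sq:
  assumes "fsupp f" "finite X"
  shows "(\<Sum>n\<in>X. (cmod (f n))\<^sup>2) \<le> l2sq f"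
proof -
  have "l2sq f = (\<Sum>n\<in>{n. f n \<noteq> 0} \<union> X. (cmod (f n))\<^sup>2)"
    by (rule l2sq_eq) (use assms in \<open>auto simp: fsupp_def\<close>)
  also have "\<dots> \<ge> (\<Sum>n\<in>X. (cmod (f n))\<^sup>2)"
    by (rule sum_mono2) (use assms in \<open>auto simp: fsupp_def\<close>)
  finally show ?thesis .
qed

lemma dotp_add: "dotp \<xi> (m + n) = dotp \<xi> m + dotp \<xi> n"
  by (simp add: dotp_def sum.distrib algebra_simps)

lemma dotp_diff: "dotp \<xi> (m - n) = dotp \<xi> m - dotp \<xi> n"
  by (simp add: dotp_def sum_subtractf algebra_simps)

lemma cv_support:
  assumes "cv K f n \<noteq> 0"
  shows "n \<in> (\<lambda>(m, k). m + k) ` ({m. K m \<noteq> 0} \<times> {k. f k \<noteq> 0})"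
proof -
  obtain m where "K m \<noteq> 0" "f (n - m) \<noteq> 0"
    using assms unfolding cv_def by (metis (mono_tags, lifting) mem_Collect_eq mult_not_zero sum.not_neutral_contains_not_neutral)
  thus ?thesis by (intro image_eqI[where x = "(m, n - m)"]) auto
qed

lemma fsupp_cv: "fsupp K \<Longrightarrow> fsupp f \<Longrightarrow> fsupp (cv K f)"
  unfolding fsupp_def
  by (rule finite_subset[of _ "(\<lambda>(m, k). m + k) ` ({m. K m \<noteq> 0} \<times> {k. f k \<noteq> 0})"]) (use cv_support in auto)

lemma ft_cv:
  assumes "fsupp K" "fsupp f"
  shows "ft (cv K f) \<xi> = ft K \<xi> * ft f \<xi>"
proof -
  define S where "S = {m. K m \<noteq> 0}"
  define T where "T = {k. f k \<noteq> 0}"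
  define U where "U = (\<lambda>(m, k). m + k) ` (S \<times> T)"
  have fin: "finite S" "finite T" "finite U" using assms by (auto simp: S_def T_def U_def fsupp_def)
  have "ft (cv K f) \<xi> = (\<Sum>n\<in>U. cv K f n * ee (dotp \<xi> n))"
    by (rule ft_eq) (use fin cv_support[of K f] in \<open>auto simp: U_def S_def T_def\<close>)
  also have "\<dots> = (\<Sum>n\<in>U. \<Sum>m\<in>S. K m * f (n - m) * ee (dotp \<xi> n))"
    by (simp add: cv_def S_def sum_distrib_right)
  also have "\<dots> = (\<Sum>m\<in>S. \<Sum>n\<in>U. K m * f (n - m) * ee (dotp \<xi> n))" by (rule sum.swap)
  also have "\<dots> = (\<Sum>m\<in>S. \<Sum>k\<in>T. K m * f k * ee (dotp \<xi> (m + k)))"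
  proof (rule sum.cong[OF refl])
    fix m assume m: "m \<in> S"
    have "(\<Sum>n\<in>U. K m * f (n - m) * ee (dotp \<xi> n)) = (\<Sum>n\<in>(+) m ` T. K m * f (n - m) * ee (dotp \<xi> n))"
    proof (rule sum.mono_neutral_right)
      show "\<forall>n\<in>U - (+) m ` T. K m * f (n - m) * ee (dotp \<xi> n) = 0"
      proof
        fix n assume n: "n \<in> U - (+) m ` T"
        have "n - m \<notin> T" using n image_eqI[of n "(+) m" "n - m" T] by auto
        thus "K m * f (n - m) * ee (dotp \<xi> n) = 0" by (simp add: T_def)
      qed
    qed (use fin m in \<open>auto simp: U_def\<close>)
    thus "(\<Sum>n\<in>U. K m * f (n - m) * ee (dotp \<xi> n)) = (\<Sum>k\<in>T. K m * f k * ee (dotp \<xi> (m + k)))"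
      by (simp add: sum.reindex)
  qed
  also have "\<dots> = ft K \<xi> * ft f \<xi>"
    unfolding ft_def S_def[symmetric] T_def[symmetric] sum_product
    by (intro sum.cong refl) (simp add: dotp_add ee_add)
  finally show ?thesis .
qed

lemma fsupp_lincomb: "fsupp f \<Longrightarrow> fsupp g \<Longrightarrow> fsupp (\<lambda>n. f n - c * g n)"
  unfolding fsupp_def by (rule finite_subset[of _ "{n. f n \<noteq> 0} \<union> {n. g n \<noteq> 0}"]) auto

lemma ft_lincomb:
  assumes "fsupp f" "fsupp g"
  shows "ft (\<lambda>n. f n - c * g n) \<xi> = ft f \<xi> - c * ft g \<xi>"
proof -
  define A where "A = {n. f n \<noteq> 0} \<union> {n. g n \<noteq> 0}"
  have A: "finite A" using assms by (auto simp: A_def fsupp_def)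
  show ?thesis
    by (subst (1 2 3) ft_eq[OF A]) (auto simp: A_def sum_subtractf sum_distrib_left algebra_simps)
qed

lemma sum_ee_fraction:
  assumes "L \<ge> (1::nat)"
  shows "(\<Sum>x\<in>{..<L}. ee (real x / real L * of_int k)) = (if int L dvd k then of_nat L else 0)"
proof (cases "int L dvd k")
  case True
  then obtain j where "k = int L * j" by (elim dvdE)
  hence "real x / real L * of_int k = of_int (int x * j)" for x using assms by simp
  hence "ee (real x / real L * of_int k) = 1" for x by (simp only: ee_of_int)
  thus ?thesis using True by simp
next
  case False
  define z where "z = ee (of_int k / real L)"
  have pow: "z ^ x = ee (real x / real L * of_int k)" for x
  proof (induction x)
    case (Suc x)
    have "z ^ Suc x = ee (of_int k / real L + real x / real L * of_int k)" using Suc.IH by (simp add: z_def ee_add)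
    thus ?case by (simp add: algebra_simps add_divide_distrib)
  qed simp
  have "ndist (of_int k / real L) \<noteq> 0"
  proof
    assume "ndist (of_int k / real L) = 0"
    hence "real_of_int k = of_int (int L * round (of_int k / real L))" using assms by (simp add: ndist_def field_simps)
    hence "k = int L * round (of_int k / real L)" by (simp only: of_int_eq_iff)
    thus False using False by (metis dvd_triv_left)
  qed
  hence "norm (1 - z) > 0" using norm_one_minus_ee_ge[of "of_int k / real L"] ndist_nonneg[of "of_int k / real L"]
    unfolding z_def by linarith
  hence z1: "z \<noteq> 1" by auto
  have "z ^ L = ee (of_int k)" unfolding pow using assms by simp
  hence "(\<Sum>x\<in>{..<L}. z ^ x) = 0" using z1 by (simp add: sum_gp_strict)
  thus ?thesis using False by (simp add: pow)
qed

definition gridpt :: "nat \<Rightarrow> ('d \<Rightarrow> nat) \<Rightarrow> real ^ 'd" where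
  "gridpt L g = (\<chi> i. real (g i) / real L)"

text \<open>Discrete replacement for the integral over the torus: as soon as \<open>L\<close>
  exceeds twice every coordinate in the support, distinct points of the support stay distinct modulo
  \<open>L\<close>, and the orthogonality of the \<open>L\<close>-th roots of unity is
  exact.\<close>

lemma parseval_grid:
  fixes f :: "int ^ 'd::finite \<Rightarrow> complex"
  assumes "fsupp f"
  shows "\<exists>L0\<ge>1. \<forall>L\<ge>L0. real L ^ CARD('d) * l2sq f = (\<Sum>g\<in>PiE UNIV (\<lambda>_. {..<L}). (cmod (ft f (gridpt L g)))\<^sup>2)"
proof -
  define S where "S = {n. f n \<noteq> 0}"
  have S: "finite S" using assms by (simp add: S_def fsupp_def)
  define b where "b = (\<Sum>m\<in>S. \<Sum>i\<in>UNIV. \<bar>m $ i\<bar>)"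
  have b: "\<bar>m $ i\<bar> \<le> b" if "m \<in> S" for m and i
  proof -
    have "\<bar>m $ i\<bar> \<le> (\<Sum>i\<in>UNIV. \<bar>m $ i\<bar>)" by (rule member_le_sum) auto
    also have "\<dots> \<le> b" unfolding b_def by (rule member_le_sum[OF that]) (use S in \<open>auto intro: sum_nonneg\<close>)
    finally show ?thesis .
  qed
  define L0 where "L0 = nat (2 * b + 1)"
  have b0: "b \<ge> 0" unfolding b_def by (intro sum_nonneg) auto
  show ?thesis
  proof (intro exI[of _ L0] conjI allI impI)
    show "1 \<le> L0" using b0 by (simp add: L0_def)
    fix L assume "L \<ge> L0"
    hence L: "L \<ge> 1" "int L > 2 * b" using b0 by (auto simp: L0_def)
    let ?P = "PiE (UNIV :: 'd set) (\<lambda>_. {..<L})"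
    have orth: "(\<Sum>g\<in>?P. ee (dotp (gridpt L g) (m - n))) = (if m = n then of_nat L ^ CARD('d) else 0)"
      if "m \<in> S" "n \<in> S" for m n
    proof -
      have "(\<Sum>g\<in>?P. ee (dotp (gridpt L g) (m - n))) = (\<Sum>g\<in>?P. \<Prod>i\<in>UNIV. ee (real (g i) / real L * of_int ((m - n) $ i)))"
        by (simp add: dotp_def gridpt_def ee_sum)
      also have "\<dots> = (\<Prod>i\<in>UNIV. \<Sum>x\<in>{..<L}. ee (real x / real L * of_int ((m - n) $ i)))"
        by (subst prod_sum_PiE) auto
      also have "\<dots> = (\<Prod>i\<in>UNIV. if int L dvd (m - n) $ i then of_nat L else 0)"
        by (simp only: sum_ee_fraction[OF L(1)])
      also have "\<dots> = (if m = n then of_nat L ^ CARD('d) else 0)"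
      proof (cases "m = n")
        case False
        then obtain i where i: "m $ i \<noteq> n $ i" by (auto simp: vec_eq_iff)
        have "\<not> int L dvd (m - n) $ i"
        proof
          assume "int L dvd (m - n) $ i"
          hence "int L \<le> \<bar>(m - n) $ i\<bar>" using i dvd_imp_le_int[of "(m - n) $ i" "int L"] by simp
          thus False using b[OF that(1), of i] b[OF that(2), of i] L(2) by (simp add: abs_le_iff) linarith
        qed
        thus ?thesis using False by (auto simp: prod_zero_iff)
      qed simp
      finally show ?thesis .
    qed
    have "of_real (\<Sum>g\<in>?P. (cmod (ft f (gridpt L g)))\<^sup>2) = (\<Sum>g\<in>?P. ft f (gridpt L g) * cnj (ft f (gridpt L g)))"
      unfolding of_real_sum by (simp only: complex_norm_square)
    also have "\<dots> = (\<Sum>g\<in>?P. \<Sum>m\<in>S. \<Sum>n\<in>S. f m * cnj (f n) * ee (dotp (gridpt L g) (m - n)))"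
      unfolding ft_def S_def[symmetric] cnj_sum sum_product
      by (intro sum.cong refl) (simp add: dotp_diff ee_diff)
    also have "\<dots> = (\<Sum>m\<in>S. \<Sum>n\<in>S. \<Sum>g\<in>?P. f m * cnj (f n) * ee (dotp (gridpt L g) (m - n)))"
      by (subst sum.swap, rule sum.cong[OF refl], rule sum.swap)
    also have "\<dots> = (\<Sum>m\<in>S. \<Sum>n\<in>S. if m = n then f m * cnj (f n) * of_nat L ^ CARD('d) else 0)"
      unfolding sum_distrib_left[symmetric] by (intro sum.cong refl) (simp add: orth)
    also have "\<dots> = of_nat L ^ CARD('d) * (\<Sum>m\<in>S. f m * cnj (f m))"
      using S by (simp add: sum_distrib_left mult.commute mult.left_commute)
    also have "\<dots> = of_real (real L ^ CARD('d) * l2sq f)"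
      unfolding l2sq_def S_def[symmetric] of_real_mult of_real_sum complex_norm_square by simp
    finally show "real L ^ CARD('d) * l2sq f = (\<Sum>g\<in>?P. (cmod (ft f (gridpt L g)))\<^sup>2)" by (simp only: of_real_eq_iff)
  qed
qed

text \<open>A single grid, fine enough for \<open>f\<close> and for every \<open>g j\<close>,
  transfers the pointwise inequality between multipliers to the norms. Treating a weighted family at
  once is what gives access to square functions over the scales.\<close>

lemma parseval_dominated:
  fixes f :: "int ^ 'd::finite \<Rightarrow> complex"
  assumes "finite J" "fsupp f" "\<And>j. j \<in> J \<Longrightarrow> fsupp (g j)"
    and le: "\<And>\<xi>. (\<Sum>j\<in>J. w j * (cmod (ft (g j) \<xi>))\<^sup>2) \<le> B * (cmod (ft f \<xi>))\<^sup>2"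
  shows "(\<Sum>j\<in>J. w j * l2sq (g j)) \<le> B * l2sq f"
proof -
  obtain L0 where L0: "L0 \<ge> 1" "\<And>L. L \<ge> L0 \<Longrightarrow> real L ^ CARD('d) * l2sq f = (\<Sum>g\<in>PiE UNIV (\<lambda>_. {..<L}). (cmod (ft f (gridpt L g)))\<^sup>2)"
    using parseval_grid[OF assms(2)] by blast
  have "\<forall>j\<in>J. \<exists>L0. \<forall>L\<ge>L0. real L ^ CARD('d) * l2sq (g j) = (\<Sum>h\<in>PiE UNIV (\<lambda>_. {..<L}). (cmod (ft (g j) (gridpt L h)))\<^sup>2)"
    using parseval_grid assms(3) by blast
  then obtain Lj where Lj: "\<And>j L. j \<in> J \<Longrightarrow> L \<ge> Lj j \<Longrightarrow>
      real L ^ CARD('d) * l2sq (g j) = (\<Sum>h\<in>PiE UNIV (\<lambda>_. {..<L}). (cmod (ft (g j) (gridpt L h)))\<^sup>2)"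
    by metis
  define L where "L = L0 + (\<Sum>j\<in>J. Lj j)"
  have LL: "L \<ge> 1" "L \<ge> L0" "\<And>j. j \<in> J \<Longrightarrow> L \<ge> Lj j"
    using L0(1) member_le_sum[of _ J Lj] assms(1) by (auto simp: L_def intro: le_add2 trans_le_add2)
  let ?P = "PiE (UNIV :: 'd set) (\<lambda>_. {..<L})"
  have "real L ^ CARD('d) * (\<Sum>j\<in>J. w j * l2sq (g j)) = (\<Sum>j\<in>J. w j * (\<Sum>h\<in>?P. (cmod (ft (g j) (gridpt L h)))\<^sup>2))"
    unfolding sum_distrib_left by (intro sum.cong refl) (use Lj LL in \<open>simp add: mult.left_commute flip: sum_distrib_left\<close>)
  also have "\<dots> = (\<Sum>h\<in>?P. \<Sum>j\<in>J. w j * (cmod (ft (g j) (gridpt L h)))\<^sup>2)"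
    unfolding sum_distrib_left by (rule sum.swap)
  also have "\<dots> \<le> (\<Sum>h\<in>?P. B * (cmod (ft f (gridpt L h)))\<^sup>2)" by (intro sum_mono le)
  also have "\<dots> = real L ^ CARD('d) * (B * l2sq f)" using L0(2)[OF LL(2)] by (simp add: sum_distrib_left mult.left_commute flip: sum_distrib_left)
  finally show ?thesis using LL(1) by simp
qed

lemma l2sq_le_of_ft_le:
  fixes f :: "int ^ 'd::finite \<Rightarrow> complex"
  assumes "fsupp f" "fsupp g" "\<And>\<xi>. cmod (ft g \<xi>) \<le> B * cmod (ft f \<xi>)"
  shows "l2sq g \<le> B\<^sup>2 * l2sq f"
proof -
  have "(\<Sum>j\<in>{()}. 1 * l2sq g) \<le> B\<^sup>2 * l2sq f"
    by (rule parseval_dominated) (use assms in \<open>auto simp: power_mult_distrib[symmetric] intro!: power_mono\<close>)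
  thus ?thesis by simp
qed

definition prod_kernel :: "int set \<Rightarrow> (int \<Rightarrow> complex) \<Rightarrow> int ^ 'd \<Rightarrow> complex" where
  "prod_kernel S \<phi> m = (if \<forall>i. m $ i \<in> S then \<Prod>i\<in>UNIV. \<phi> (m $ i) else 0)"

lemma bij_betw_vec_box: "bij_betw vec_lambda (PiE (UNIV :: 'd::finite set) (\<lambda>_. S)) {m. \<forall>i. m $ i \<in> S}"
  by (rule bij_betw_byWitness[where f' = vec_nth]) auto

lemma finite_vec_box: "finite S \<Longrightarrow> finite {m :: 'a ^ 'd::finite. \<forall>i. m $ i \<in> S}"
  using bij_betw_finite[OF bij_betw_vec_box[where 'd = 'd], of S] by (simp add: finite_PiE)

lemma card_vec_box: "finite S \<Longrightarrow> card {m :: 'a ^ 'd::finite. \<forall>i. m $ i \<in> S} = card S ^ CARD('d)"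
  using bij_betw_same_card[OF bij_betw_vec_box[where 'd = 'd], of S] by (simp add: card_PiE)

lemma fsupp_prod_kernel: "finite S \<Longrightarrow> fsupp (prod_kernel S \<phi>)"
  by (rule fsuppI[OF finite_vec_box[of S]]) (auto simp: prod_kernel_def)

lemma ft_prod_kernel:
  assumes "finite S"
  shows "ft (prod_kernel S \<phi>) (\<xi> :: real ^ 'd::finite) = (\<Prod>i\<in>UNIV. \<Sum>s\<in>S. \<phi> s * ee (of_int s * \<xi> $ i))"
proof -
  have "ft (prod_kernel S \<phi>) \<xi> = (\<Sum>m | \<forall>i. m $ i \<in> S. prod_kernel S \<phi> m * ee (dotp \<xi> m))"
    by (rule ft_eq[OF finite_vec_box[OF assms]]) (auto simp: prod_kernel_def)
  also have "\<dots> = (\<Sum>h\<in>PiE UNIV (\<lambda>_. S). prod_kernel S \<phi> (vec_lambda h) * ee (dotp \<xi> (vec_lambda h)))"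
    using sum.reindex_bij_betw[OF bij_betw_vec_box, of "\<lambda>m. prod_kernel S \<phi> m * ee (dotp \<xi> m)" S] by simp
  also have "\<dots> = (\<Sum>h\<in>PiE UNIV (\<lambda>_. S). \<Prod>i\<in>UNIV. \<phi> (h i) * ee (of_int (h i) * \<xi> $ i))"
    by (intro sum.cong refl) (auto simp: prod_kernel_def dotp_def ee_sum prod.distrib mult.commute)
  also have "\<dots> = (\<Prod>i\<in>UNIV. \<Sum>s\<in>S. \<phi> s * ee (of_int s * \<xi> $ i))"
    by (subst prod_sum_PiE) (use assms in auto)
  finally show ?thesis .
qed

section \<open>Cube averages and interpolation\<close>

definition cube :: "nat \<Rightarrow> (int ^ 'd) set" where
  "cube r = {u. \<forall>i. u $ i \<in> {- int r..int r}}"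

lemma finite_cube [simp]: "finite (cube r :: (int ^ 'd::finite) set)"
  unfolding cube_def by (rule finite_vec_box) simp

lemma card_cube: "card (cube r :: (int ^ 'd::finite) set) = (2 * r + 1) ^ CARD('d)"
  unfolding cube_def by (subst card_vec_box) (auto simp: nat_add_distrib nat_mult_distrib)

lemma cube_mono: "r \<le> s \<Longrightarrow> cube r \<subseteq> cube s"
  unfolding cube_def by auto (metis le_minus_iff minus_le_iff neg_le_iff_le of_nat_le_iff order.trans)+

lemma cube_diff: "u \<in> cube r \<Longrightarrow> v \<in> cube s \<Longrightarrow> u - v \<in> cube (r + s)"
proof -
  assume u: "u \<in> cube r" and v: "v \<in> cube s"
  have "(u - v) $ i \<in> {- int (r + s)..int (r + s)}" for i
  proof -
    have "u $ i \<in> {- int r..int r}" "v $ i \<in> {- int s..int s}" using u v unfolding cube_def by auto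
    thus ?thesis by auto
  qed
  thus ?thesis unfolding cube_def by auto
qed

text \<open>
  Vitali covering by induction: a point with the largest radius accounts for all points in the doubled cube around
  it, and the cubes of the remaining points are disjoint from its own.
\<close>

lemma vitali_weak_type:
  fixes F :: "int ^ 'd::finite \<Rightarrow> real" and r :: "int ^ 'd \<Rightarrow> nat" and \<alpha> :: real
  assumes "finite X" and F: "\<And>y. F y \<ge> 0" and "\<alpha> > 0" and q: "q \<noteq> 0"
    and "\<And>x. x \<in> X \<Longrightarrow> \<alpha> * card (cube (r x) :: (int ^ 'd) set) \<le> (\<Sum>u\<in>cube (r x). F (x - q *s u))"
  shows "\<alpha> * card X \<le> 2 ^ CARD('d) * (\<Sum>y\<in>(\<Union>x\<in>X. (\<lambda>u. x - q *s u) ` cube (r x)). F y)"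
  using assms(1,5)
proof (induction X rule: finite_psubset_induct)
  case (psubset X)
  define Q where "Q x = (\<lambda>u. x - q *s u) ` cube (r x)" for x
  have finQ: "finite (Q x)" for x by (simp add: Q_def)
  show ?case
  proof (cases "X = {}")
    case False
    then obtain y where y: "y \<in> X" "\<And>x. x \<in> X \<Longrightarrow> r x \<le> r y"
      using ex_has_greatest_nat[of "\<lambda>x. x \<in> X" _ r "Max (r ` X) + 1"] psubset.hyps
      by (metis Max_ge finite_imageI image_eqI less_Suc_eq_le Suc_eq_plus1 ex_in_conv)
    define X1 where "X1 = X \<inter> (\<lambda>u. y - q *s u) ` cube (2 * r y)"
    define X2 where "X2 = X - X1"
    have "y \<in> X1" using y by (auto simp: X1_def cube_def vec_eq_iff intro!: image_eqI[where x = 0])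
    hence sub: "X2 \<subset> X" using y by (auto simp: X2_def)
    have "card X1 \<le> card (cube (2 * r y) :: (int ^ 'd) set)"
      unfolding X1_def by (rule order.trans[OF card_mono card_image_le]) auto
    also have "\<dots> \<le> (2 * (2 * r y + 1)) ^ CARD('d)" unfolding card_cube by (intro power_mono) auto
    also have "\<dots> = 2 ^ CARD('d) * card (cube (r y) :: (int ^ 'd) set)" by (simp only: card_cube power_mult_distrib)
    finally have "real (card X1) \<le> 2 ^ CARD('d) * real (card (cube (r y) :: (int ^ 'd) set))"
      by (metis of_nat_le_iff of_nat_mult of_nat_numeral of_nat_power)
    hence "\<alpha> * real (card X1) \<le> \<alpha> * (2 ^ CARD('d) * real (card (cube (r y) :: (int ^ 'd) set)))"
      using \<open>\<alpha> > 0\<close> by (intro mult_left_mono) auto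
    also have "\<dots> = 2 ^ CARD('d) * (\<alpha> * card (cube (r y) :: (int ^ 'd) set))" by (rule mult.left_commute)
    also have "\<dots> \<le> 2 ^ CARD('d) * (\<Sum>u\<in>cube (r y). F (y - q *s u))"
      by (intro mult_left_mono psubset.prems y) auto
    also have "(\<Sum>u\<in>cube (r y). F (y - q *s u)) = (\<Sum>z\<in>Q y. F z)"
      unfolding Q_def by (subst sum.reindex) (use q in \<open>auto simp: inj_on_def vec_eq_iff\<close>)
    finally have 1: "\<alpha> * card X1 \<le> 2 ^ CARD('d) * (\<Sum>z\<in>Q y. F z)" .
    have 2: "\<alpha> * card X2 \<le> 2 ^ CARD('d) * (\<Sum>z\<in>(\<Union>x\<in>X2. Q x). F z)"
      unfolding Q_def by (rule psubset.IH[OF sub]) (use psubset.prems sub in auto)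
    \<comment> \<open>Cubes based in different classes modulo \<open>q\<close> never meet, and
      within one class the usual argument applies to the coordinate \<open>u\<close>; hence the
      constant is free of \<open>q\<close>.\<close>
    have disj: "Q y \<inter> (\<Union>x\<in>X2. Q x) = {}"
    proof (rule ccontr)
      assume "Q y \<inter> (\<Union>x\<in>X2. Q x) \<noteq> {}"
      then obtain z x where z: "x \<in> X2" "z \<in> Q x" "z \<in> Q y" by blast
      then obtain u v where "u \<in> cube (r x)" "z = x - q *s u" "v \<in> cube (r y)" "z = y - q *s v"
        unfolding Q_def by blast
      with z have h: "x \<in> X2" "u \<in> cube (r x)" "v \<in> cube (r y)" "x - q *s u = y - q *s v" by auto
      have "r x \<le> r y" using h(1) y by (auto simp: X2_def)
      hence "v - u \<in> cube (2 * r y)" using cube_diff[OF h(3,2)] cube_mono[of "r y + r x" "2 * r y"] by auto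
      moreover have "x = y - q *s (v - u)" using h(4) by (simp add: vec_eq_iff algebra_simps)
      ultimately have "x \<in> (\<lambda>u. y - q *s u) ` cube (2 * r y)" by (rule rev_image_eqI)
      hence "x \<in> X1" using h(1) unfolding X1_def X2_def by blast
      thus False using h(1) by (simp add: X2_def)
    qed
    have "card X = card X1 + card X2"
      unfolding X2_def using psubset.hyps by (subst card_Diff_subset) (auto simp: X1_def card_mono)
    hence "\<alpha> * card X \<le> 2 ^ CARD('d) * ((\<Sum>z\<in>Q y. F z) + (\<Sum>z\<in>(\<Union>x\<in>X2. Q x). F z))"
      using 1 2 by (simp add: algebra_simps)
    also have "(\<Sum>z\<in>Q y. F z) + (\<Sum>z\<in>(\<Union>x\<in>X2. Q x). F z) = (\<Sum>z\<in>Q y \<union> (\<Union>x\<in>X2. Q x). F z)"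
      by (rule sum.union_disjoint[symmetric]) (use disj finQ finite_subset[OF _ psubset.hyps(1), of X2] in \<open>auto simp: X2_def\<close>)
    also have "\<dots> \<le> (\<Sum>z\<in>(\<Union>x\<in>X. Q x). F z)"
      by (rule sum_mono2) (use F psubset.hyps finQ y in \<open>auto simp: X2_def\<close>)
    finally show ?thesis by (simp add: Q_def)
  qed simp
qed

section \<open>Interpolation from restricted weak type\<close>

lemma sum_geometric_levels_le:
  fixes z B \<theta> :: real and \<Lambda> :: "int set"
  assumes "finite \<Lambda>" "z > 0" "\<theta> > 0" "\<And>l. l \<in> \<Lambda> \<Longrightarrow> z * 2 powr (- of_int l) \<le> B"
  shows "(\<Sum>l\<in>\<Lambda>. (z * 2 powr (- of_int l)) powr \<theta>) \<le> B powr \<theta> / (1 - 2 powr (- \<theta>))"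
proof (cases "\<Lambda> = {}")
  case False
  define m where "m = Min \<Lambda>"
  have m: "m \<in> \<Lambda>" "\<And>l. l \<in> \<Lambda> \<Longrightarrow> m \<le> l" using False assms(1) by (auto simp: m_def)
  define x where "x = 2 powr (- \<theta>)"
  have x: "0 < x" "x < 1" using assms(3) by (auto simp: x_def powr_less_one)
  have "(\<Sum>l\<in>\<Lambda>. (z * 2 powr (- of_int l)) powr \<theta>) \<le> (\<Sum>l\<in>\<Lambda>. B powr \<theta> * x ^ nat (l - m))"
  proof (rule sum_mono)
    fix l assume l: "l \<in> \<Lambda>"
    have "x ^ nat (l - m) = x powr (real (nat (l - m)))" using x by (simp add: powr_realpow)
    also have "\<dots> = (2 powr (of_int m - of_int l)) powr \<theta>" using m(2)[OF l] by (simp add: x_def powr_powr algebra_simps)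
    finally have "(z * 2 powr (- of_int m)) powr \<theta> * x ^ nat (l - m) = (z * 2 powr (- of_int m) * 2 powr (of_int m - of_int l)) powr \<theta>"
      using assms(2) by (simp add: powr_mult)
    also have "z * 2 powr (- of_int m) * 2 powr (of_int m - of_int l) = z * 2 powr (- of_int l)"
      by (simp add: mult.assoc flip: powr_add)
    finally have "(z * 2 powr (- of_int l)) powr \<theta> = (z * 2 powr (- of_int m)) powr \<theta> * x ^ nat (l - m)" by simp
    also have "\<dots> \<le> B powr \<theta> * x ^ nat (l - m)"
      using assms(2,3) assms(4)[OF m(1)] x by (intro mult_right_mono powr_mono2) auto
    finally show "(z * 2 powr (- of_int l)) powr \<theta> \<le> B powr \<theta> * x ^ nat (l - m)" .
  qed
  also have "\<dots> = B powr \<theta> * (\<Sum>i\<in>(\<lambda>l. nat (l - m)) ` \<Lambda>. x ^ i)"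
    unfolding sum_distrib_left[symmetric] 
    by (subst sum.reindex) (use m in \<open>auto simp: inj_on_def eq_nat_nat_iff\<close>)
  also have "\<dots> \<le> B powr \<theta> * (\<Sum>i. x ^ i)"
    using x assms(1) by (intro mult_left_mono sum_le_suminf) (auto simp: summable_geometric)
  also have "(\<Sum>i. x ^ i) = 1 / (1 - x)" using x by (simp add: suminf_geometric)
  finally show ?thesis by (simp add: x_def)
next
  case True
  have "2 powr (- \<theta>) < 1" using assms(3) by (auto simp: powr_less_one)
  thus ?thesis using True by simp
qed

text \<open>At height about \<open>2 powr (- l)\<close> there are at most
  \<open>A * 2 powr ((l + 1) * p1)\<close> points, each contributing at most
  \<open>2 powr (- l * p2)\<close>; as \<open>t x \<le> 1\<close> only \<open>l \<ge> 0\<close>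
  occurs, and \<open>p1 < p2\<close> makes the series geometric.\<close>

lemma sum_powr_weak_type_le:
  fixes t :: "'x \<Rightarrow> real" and p1 p2 A :: real
  assumes "finite X" "0 < p1" "p1 < p2" and t: "\<And>x. x \<in> X \<Longrightarrow> 0 \<le> t x" "\<And>x. x \<in> X \<Longrightarrow> t x \<le> 1" and "A \<ge> 0"
    and weak: "\<And>\<alpha>. 0 < \<alpha> \<Longrightarrow> \<alpha> \<le> 1 \<Longrightarrow> real (card {x \<in> X. t x > \<alpha>}) \<le> A * \<alpha> powr (- p1)"
  shows "(\<Sum>x\<in>X. t x powr p2) \<le> A * (2 powr p1 / (1 - 2 powr (- (p2 - p1))))"
proof -
  define lev where "lev x = \<lfloor>- log 2 (t x)\<rfloor>" for x
  define X' where "X' = {x \<in> X. t x > 0}"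
  define \<Lambda> where "\<Lambda> = lev ` X'"
  have fin: "finite X'" "finite \<Lambda>" using assms(1) by (auto simp: X'_def \<Lambda>_def)
  have lev: "t x \<le> 2 powr (- of_int (lev x))" "t x > 2 powr (- of_int (lev x) - 1)" "lev x \<ge> 0" if "x \<in> X'" for x
  proof -
    have tx: "t x > 0" "t x \<le> 1" using that t by (auto simp: X'_def)
    have le: "of_int (lev x) \<le> - log 2 (t x)" "- log 2 (t x) < of_int (lev x) + 1" by (auto simp: lev_def)
    have "2 powr (log 2 (t x)) \<le> 2 powr (- of_int (lev x))" using le by (intro powr_mono) auto
    thus "t x \<le> 2 powr (- of_int (lev x))" using tx by simp
    have "2 powr (- of_int (lev x) - 1) < 2 powr (log 2 (t x))" using le by (intro powr_less_mono) auto
    thus "t x > 2 powr (- of_int (lev x) - 1)" using tx by simp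
    have "log 2 (t x) \<le> 0" using tx by simp
    thus "lev x \<ge> 0" by (simp add: lev_def)
  qed
  have "(\<Sum>x\<in>X. t x powr p2) = (\<Sum>x\<in>X'. t x powr p2)"
    by (rule sum.mono_neutral_right) (use assms(1) t in \<open>auto simp: X'_def less_le\<close>)
  also have "\<dots> = (\<Sum>l\<in>\<Lambda>. \<Sum>x | x \<in> X' \<and> lev x = l. t x powr p2)"
    by (rule sum.group[symmetric]) (use fin in \<open>auto simp: \<Lambda>_def\<close>)
  also have "\<dots> \<le> (\<Sum>l\<in>\<Lambda>. A * 2 powr p1 * (1 * 2 powr (- of_int l)) powr (p2 - p1))"
  proof (rule sum_mono)
    fix l assume "l \<in> \<Lambda>"
    hence l: "l \<ge> 0" using lev by (auto simp: \<Lambda>_def)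
    let ?S = "{x. x \<in> X' \<and> lev x = l}"
    have "(\<Sum>x\<in>?S. t x powr p2) \<le> (\<Sum>x\<in>?S. (2 powr (- of_int l)) powr p2)"
      by (intro sum_mono powr_mono2) (use lev assms(2,3) in \<open>auto simp: X'_def\<close>)
    also have "\<dots> = real (card ?S) * (2 powr (- of_int l)) powr p2" by simp
    also have "real (card ?S) \<le> real (card {x \<in> X. t x > 2 powr (- of_int l - 1)})"
      by (intro of_nat_mono card_mono) (use lev assms(1) in \<open>auto simp: X'_def\<close>)
    also have "\<dots> \<le> A * (2 powr (- of_int l - 1)) powr (- p1)"
      using l by (intro weak) (auto simp: powr_le_one_le intro: order.trans[OF powr_mono[of _ 0 2]])
    finally have "(\<Sum>x\<in>?S. t x powr p2) \<le> A * (2 powr (- of_int l - 1)) powr (- p1) * (2 powr (- of_int l)) powr p2"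
      by (simp add: mult_right_mono)
    also have "\<dots> = A * (2 powr p1 * (2 powr (- of_int l)) powr (p2 - p1))"
      by (simp add: powr_powr mult.assoc algebra_simps flip: powr_add)
    finally show "(\<Sum>x\<in>?S. t x powr p2) \<le> A * 2 powr p1 * (1 * 2 powr (- of_int l)) powr (p2 - p1)" by simp
  qed
  also have "\<dots> = A * 2 powr p1 * (\<Sum>l\<in>\<Lambda>. (1 * 2 powr (- of_int l)) powr (p2 - p1))" by (simp add: sum_distrib_left)
  also have "\<dots> \<le> A * 2 powr p1 * (1 powr (p2 - p1) / (1 - 2 powr (- (p2 - p1))))"
  proof (intro mult_left_mono sum_geometric_levels_le)
    fix l assume "l \<in> \<Lambda>"
    hence "l \<ge> 0" using lev by (auto simp: \<Lambda>_def)
    thus "1 * 2 powr - real_of_int l \<le> 1" using powr_mono[of "- of_int l" 0 2] by simp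
  qed (use assms fin in auto)
  finally show ?thesis by simp
qed

text \<open>
  If \<open>v\<close> is the value at \<open>x\<close>, the part of \<open>f\<close> below \<open>v/2\<close> contributes at most
  \<open>v/2\<close>, so one of the higher dyadic level sets, at height \<open>2\<^sup>l\<close>, has average
  at least \<open>K (v/2\<^sup>l)\<^sup>1\<^sup>+\<^sup>\<theta>\<close>.
\<close>

lemma level_set_pointwise:
  fixes f w :: "'y \<Rightarrow> real" and p p2 :: real
  assumes "finite Y" "finite Z" and p: "0 < p2" "p2 < p"
    and f: "\<And>y. f y \<ge> 0" "\<And>y. y \<notin> Z \<Longrightarrow> f y = 0"
    and w: "\<And>y. y \<in> Y \<Longrightarrow> w y \<ge> 0" "(\<Sum>y\<in>Y. w y) \<le> 1"
  defines "lev \<equiv> \<lambda>y. \<lfloor>log 2 (f y)\<rfloor>"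
  defines "Z' \<equiv> {y \<in> Z. f y > 0}"
  defines "\<theta> \<equiv> p / p2 - 1"
  defines "K \<equiv> (1 - 2 powr (- \<theta>)) / (8 * 4 powr \<theta>)"
  shows "(\<Sum>y\<in>Y. w y * f y) powr p \<le> K powr (- p2) *
    (\<Sum>l\<in>lev ` Z'. 2 powr (of_int l * p) * (\<Sum>y\<in>Y. w y * of_bool (y \<in> Z' \<and> lev y = l)) powr p2)"
proof -
  define \<Lambda> where "\<Lambda> = lev ` Z'"
  have fin: "finite Z'" "finite \<Lambda>" using assms(2) by (auto simp: Z'_def \<Lambda>_def)
  define v where "v = (\<Sum>y\<in>Y. w y * f y)"
  define t where "t l = (\<Sum>y\<in>Y. w y * of_bool (y \<in> Z' \<and> lev y = l))" for l
  have v0: "v \<ge> 0" unfolding v_def by (intro sum_nonneg mult_nonneg_nonneg w f)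
  have t0: "t l \<ge> 0" for l unfolding t_def by (intro sum_nonneg mult_nonneg_nonneg w) auto
  have \<theta>: "\<theta> > 0" using p by (simp add: \<theta>_def)
  hence x: "2 powr (- \<theta>) < 1" by (auto simp: powr_less_one)
  hence K: "K > 0" by (simp add: K_def)
  have lev: "2 powr (of_int (lev y)) \<le> f y" "f y < 2 * 2 powr (of_int (lev y))" if "y \<in> Z'" for y
  proof -
    have fy: "f y > 0" using that by (simp add: Z'_def)
    have le: "of_int (lev y) \<le> log 2 (f y)" "log 2 (f y) < of_int (lev y) + 1" by (auto simp: lev_def)
    have "2 powr (of_int (lev y)) \<le> 2 powr (log 2 (f y))" using le by (intro powr_mono) auto
    thus "2 powr (of_int (lev y)) \<le> f y" using fy by simp
    have "2 powr (log 2 (f y)) < 2 powr (of_int (lev y) + 1)" using le by (intro powr_less_mono) auto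
    thus "f y < 2 * 2 powr (of_int (lev y))" using fy by (simp add: powr_add)
  qed
  show ?thesis unfolding \<Lambda>_def[symmetric] t_def[symmetric] v_def[symmetric]
  proof (cases "v = 0")
    case False
    hence v: "v > 0" using v0 by simp
    \<comment> \<open>If every level were small, the low values of \<open>f\<close> would account
      for at most \<open>v / 2\<close> and all higher levels together for at most
      \<open>v / 4\<close>, by the choice of \<open>K\<close>.\<close>
    have "\<exists>l\<in>\<Lambda>. t l > K * (v * 2 powr (- of_int l)) powr (1 + \<theta>)"
    proof (rule ccontr)
      assume "\<not> ?thesis"
      hence tl: "t l \<le> K * (v * 2 powr (- of_int l)) powr (1 + \<theta>)" if "l \<in> \<Lambda>" for l using that by force
      \<comment> \<open>Levels outside \<open>\<Lambda>'\<close> have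
        \<open>4 * 2 powr l < v\<close>, so \<open>f\<close> is below \<open>v / 2\<close> there and
        the constant \<open>v / 2\<close> covers them.\<close>
      define \<Lambda>' where "\<Lambda>' = {l \<in> \<Lambda>. v * 2 powr (- of_int l) \<le> 4}"
      have "f y \<le> v / 2 + (\<Sum>l\<in>\<Lambda>'. 2 * 2 powr (of_int l) * of_bool (y \<in> Z' \<and> lev y = l))" for y
      proof (cases "y \<in> Z'")
        case True
        have *: "(\<Sum>l\<in>\<Lambda>'. 2 * 2 powr (of_int l) * of_bool (y \<in> Z' \<and> lev y = l)) = (if lev y \<in> \<Lambda>' then 2 * 2 powr (of_int (lev y)) else 0)"
          using True fin by (simp add: \<Lambda>'_def of_bool_def if_distrib sum.delta cong: if_cong)
        show ?thesis
        proof (cases "lev y \<in> \<Lambda>'")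
          case True
          thus ?thesis unfolding * using lev(2)[OF \<open>y \<in> Z'\<close>] v by simp
        next
          case False
          hence "v * 2 powr (- of_int (lev y)) > 4" using True by (auto simp: \<Lambda>'_def \<Lambda>_def)
          hence "4 * 2 powr (of_int (lev y)) < v" by (simp add: powr_minus field_simps)
          thus ?thesis unfolding * using lev(2)[OF \<open>y \<in> Z'\<close>] False by simp
        qed
      next
        case False
        hence "f y = 0" using f by (force simp: Z'_def less_le)
        thus ?thesis using v False by simp
      qed
      hence "v \<le> (\<Sum>y\<in>Y. w y * (v / 2 + (\<Sum>l\<in>\<Lambda>'. 2 * 2 powr (of_int l) * of_bool (y \<in> Z' \<and> lev y = l))))"
        unfolding v_def by (intro sum_mono mult_left_mono w) auto
      also have "\<dots> = v / 2 * (\<Sum>y\<in>Y. w y) + (\<Sum>y\<in>Y. \<Sum>l\<in>\<Lambda>'. w y * (2 * 2 powr (of_int l) * of_bool (y \<in> Z' \<and> lev y = l)))"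
        by (simp add: distrib_left sum.distrib sum_distrib_left mult.commute)
      also have "(\<Sum>y\<in>Y. \<Sum>l\<in>\<Lambda>'. w y * (2 * 2 powr (of_int l) * of_bool (y \<in> Z' \<and> lev y = l))) = (\<Sum>l\<in>\<Lambda>'. 2 * 2 powr (of_int l) * t l)"
        unfolding t_def sum_distrib_left by (subst sum.swap) (simp add: mult_ac)
      also have "v / 2 * (\<Sum>y\<in>Y. w y) + (\<Sum>l\<in>\<Lambda>'. 2 * 2 powr (of_int l) * t l) \<le> v / 2 * 1 + (\<Sum>l\<in>\<Lambda>'. 2 * K * v * (v * 2 powr (- of_int l)) powr \<theta>)"
      proof (intro add_mono mult_left_mono sum_mono w)
        fix l assume "l \<in> \<Lambda>'"
        hence "2 * 2 powr (of_int l) * t l \<le> 2 * 2 powr (of_int l) * (K * (v * 2 powr (- of_int l)) powr (1 + \<theta>))"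
          by (intro mult_left_mono tl) (auto simp: \<Lambda>'_def)
        also have "(v * 2 powr (- of_int l)) powr (1 + \<theta>) = v * 2 powr (- of_int l) * (v * 2 powr (- of_int l)) powr \<theta>"
          using v by (simp add: powr_add)
        finally show "2 * 2 powr (of_int l) * t l \<le> 2 * K * v * (v * 2 powr (- of_int l)) powr \<theta>"
          by (simp add: powr_minus field_simps)
      qed (use v in auto)
      also have "(\<Sum>l\<in>\<Lambda>'. 2 * K * v * (v * 2 powr (- of_int l)) powr \<theta>) = 2 * K * v * (\<Sum>l\<in>\<Lambda>'. (v * 2 powr (- of_int l)) powr \<theta>)"
        by (simp add: sum_distrib_left)
      also have "\<dots> \<le> 2 * K * v * (4 powr \<theta> / (1 - 2 powr (- \<theta>)))"
        using K v \<theta> fin by (intro mult_left_mono sum_geometric_levels_le) (auto simp: \<Lambda>'_def)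
      also have "\<dots> = v / 4"
      proof -
        have "4 powr \<theta> > (0::real)" "1 - 2 powr (- \<theta>) > 0" using x by auto
        thus ?thesis unfolding K_def using \<theta> by (simp add: divide_simps)
      qed
      finally show False using v by simp
    qed
    then obtain l where l: "l \<in> \<Lambda>" "t l > K * (v * 2 powr (- of_int l)) powr (1 + \<theta>)" by blast
    have th: "(1 + \<theta>) * p2 = p" using p by (simp add: \<theta>_def)
    have "K powr p2 * (v powr p * 2 powr (- of_int l * p)) = (K * (v * 2 powr (- of_int l)) powr (1 + \<theta>)) powr p2"
      using K v by (simp add: powr_mult powr_powr th mult.assoc)
    also have "\<dots> \<le> t l powr p2" using l(2) K p by (intro powr_mono2) auto
    finally have "v powr p \<le> K powr (- p2) * (2 powr (of_int l * p) * t l powr p2)"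
      using K by (simp add: powr_minus field_simps)
    also have "\<dots> \<le> K powr (- p2) * (\<Sum>l\<in>\<Lambda>. 2 powr (of_int l * p) * t l powr p2)"
      using fin l(1) by (intro mult_left_mono member_le_sum) auto
    finally show "v powr p \<le> K powr (- p2) * (\<Sum>l\<in>\<Lambda>. 2 powr (of_int l * p) * t l powr p2)" .
  qed (auto intro!: mult_nonneg_nonneg sum_nonneg)
qed

text \<open>Interpolation between a restricted weak type estimate and the trivial bound by the
  supremum, the latter being the condition that the weights sum to at most 1. The weights
  \<open>w x\<close> express a maximal operator after a choice has been made at every
  \<open>x\<close>, so the operator is linear and positive; \<open>C\<close> depends on the
  exponents only.\<close>

lemma restricted_weak_type_interpolation:
  fixes p1 p :: real
  assumes "0 < p1" "p1 < p"
  shows "\<exists>C\<ge>0. \<forall>(X :: 'x set) (Y :: 'x \<Rightarrow> 'y set) w A f Z. finite X \<longrightarrow> finite Z \<longrightarrow> A \<ge> 0 \<longrightarrow>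
    (\<forall>x\<in>X. finite (Y x) \<and> (\<forall>y\<in>Y x. 0 \<le> w x y) \<and> (\<Sum>y\<in>Y x. w x y) \<le> 1) \<longrightarrow>
    (\<forall>F X' \<alpha>. finite F \<longrightarrow> X' \<subseteq> X \<longrightarrow> 0 < \<alpha> \<longrightarrow> \<alpha> \<le> 1 \<longrightarrow> (\<forall>x\<in>X'. \<alpha> < (\<Sum>y\<in>Y x. w x y * of_bool (y \<in> F))) \<longrightarrow>
       real (card X') \<le> A * \<alpha> powr (- p1) * real (card F)) \<longrightarrow>
    (\<forall>y. f y \<ge> 0) \<longrightarrow> (\<forall>y. y \<notin> Z \<longrightarrow> f y = 0) \<longrightarrow>
    (\<Sum>x\<in>X. (\<Sum>y\<in>Y x. w x y * f y) powr p) \<le> C * A * (\<Sum>y\<in>Z. f y powr p)"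
proof -
  \<comment> \<open>The gap \<open>p1 < p2\<close> serves to sum the heights of the averages of one
    level set, the gap \<open>p2 < p\<close> to sum over the level sets of \<open>f\<close>.\<close>
  define p2 where "p2 = (p1 + p) / 2"
  have p: "0 < p2" "p1 < p2" "p2 < p" using assms by (auto simp: p2_def)
  define \<theta> where "\<theta> = p / p2 - 1"
  define K where "K = (1 - 2 powr (- \<theta>)) / (8 * 4 powr \<theta>)"
  define D where "D = 2 powr p1 / (1 - 2 powr (- (p2 - p1)))"
  have "2 powr (- (p2 - p1)) < (1::real)" using p by (intro powr_less_one) auto
  hence D: "D \<ge> 0" by (simp add: D_def)
  show ?thesis
  proof (intro exI[of _ "K powr (- p2) * D"] conjI allI impI)
    show "0 \<le> K powr (- p2) * D" using D by simp
    fix X :: "'x set" and Y :: "'x \<Rightarrow> 'y set" and w A and f :: "'y \<Rightarrow> real" and Z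
    assume fin: "finite X" "finite Z" and A: "A \<ge> 0"
      and Y: "\<forall>x\<in>X. finite (Y x) \<and> (\<forall>y\<in>Y x. 0 \<le> w x y) \<and> (\<Sum>y\<in>Y x. w x y) \<le> (1::real)"
      and weak: "\<forall>F X' \<alpha>. finite F \<longrightarrow> X' \<subseteq> X \<longrightarrow> 0 < \<alpha> \<longrightarrow> \<alpha> \<le> 1 \<longrightarrow> (\<forall>x\<in>X'. \<alpha> < (\<Sum>y\<in>Y x. w x y * of_bool (y \<in> F))) \<longrightarrow>
       real (card X') \<le> A * \<alpha> powr (- p1) * real (card F)"
      and f: "\<forall>y. f y \<ge> (0::real)" "\<forall>y. y \<notin> Z \<longrightarrow> f y = 0"
    define lev where "lev y = \<lfloor>log 2 (f y)\<rfloor>" for y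
    define Z' where "Z' = {y \<in> Z. f y > 0}"
    define F where "F l = {y. y \<in> Z' \<and> lev y = l}" for l
    have finZ: "finite Z'" "finite (F l)" for l using fin by (auto simp: Z'_def F_def)
    define t where "t l x = (\<Sum>y\<in>Y x. w x y * of_bool (y \<in> F l))" for l x
    have t: "(\<Sum>x\<in>X. t l x powr p2) \<le> (A * real (card (F l))) * D" for l
      unfolding D_def
    proof (rule sum_powr_weak_type_le)
      fix x assume x: "x \<in> X"
      show "0 \<le> t l x" unfolding t_def using Y x by (auto intro!: sum_nonneg)
      have "t l x \<le> (\<Sum>y\<in>Y x. w x y)" unfolding t_def using Y x by (intro sum_mono) auto
      thus "t l x \<le> 1" using Y x order.trans by blast
    next
      fix \<alpha> :: real assume \<alpha>: "0 < \<alpha>" "\<alpha> \<le> 1"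
      show "real (card {x \<in> X. \<alpha> < t l x}) \<le> A * real (card (F l)) * \<alpha> powr (- p1)"
      proof -
        have "real (card {x \<in> X. \<alpha> < t l x}) \<le> A * \<alpha> powr (- p1) * real (card (F l))"
          using weak[rule_format, OF finZ(2)[of l] _ \<alpha>, of "{x \<in> X. \<alpha> < t l x}"] unfolding t_def by blast
        thus ?thesis by (simp add: mult_ac)
      qed
    qed (use fin p assms A in auto)
    have "(\<Sum>x\<in>X. (\<Sum>y\<in>Y x. w x y * f y) powr p) \<le> (\<Sum>x\<in>X. K powr (- p2) * (\<Sum>l\<in>lev ` Z'. 2 powr (of_int l * p) * t l x powr p2))"
      unfolding K_def \<theta>_def lev_def Z'_def t_def F_def
      by (intro sum_mono order.trans[OF level_set_pointwise[of _ Z p2 p f]]) (use fin p f Y in \<open>auto simp: lev_def Z'_def\<close>)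
    also have "\<dots> = K powr (- p2) * (\<Sum>l\<in>lev ` Z'. 2 powr (of_int l * p) * (\<Sum>x\<in>X. t l x powr p2))"
      unfolding sum_distrib_left by (rule sum.swap)
    also have "\<dots> \<le> K powr (- p2) * (\<Sum>l\<in>lev ` Z'. 2 powr (of_int l * p) * ((A * real (card (F l))) * D))"
      by (intro mult_left_mono sum_mono t) auto
    also have "\<dots> = K powr (- p2) * D * A * (\<Sum>l\<in>lev ` Z'. \<Sum>y\<in>F l. 2 powr (of_int l * p))"
      by (simp add: sum_distrib_left mult_ac)
    also have "(\<Sum>l\<in>lev ` Z'. \<Sum>y\<in>F l. 2 powr (of_int l * p)) \<le> (\<Sum>l\<in>lev ` Z'. \<Sum>y\<in>F l. f y powr p)"
    proof (intro sum_mono)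
      fix l y assume "y \<in> F l"
      hence y: "f y > 0" "lev y = l" by (auto simp: F_def Z'_def)
      have "2 powr (of_int l) \<le> 2 powr (log 2 (f y))" using y by (intro powr_mono) (auto simp: lev_def)
      hence "2 powr (of_int l) \<le> f y" using y by simp
      hence "(2 powr (of_int l)) powr p \<le> f y powr p" using p by (intro powr_mono2) auto
      thus "2 powr (of_int l * p) \<le> f y powr p" by (simp add: powr_powr)
    qed
    also have "(\<Sum>l\<in>lev ` Z'. \<Sum>y\<in>F l. f y powr p) = (\<Sum>y\<in>Z'. f y powr p)"
      unfolding F_def by (rule sum.group) (use finZ in auto)
    also have "\<dots> \<le> (\<Sum>y\<in>Z. f y powr p)" by (rule sum_mono2) (use fin in \<open>auto simp: Z'_def\<close>)
    finally show "(\<Sum>x\<in>X. (\<Sum>y\<in>Y x. w x y * f y) powr p) \<le> K powr (- p2) * D * A * (\<Sum>y\<in>Z. f y powr p)"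
      using D A by (simp add: mult_left_mono)
  qed
qed

definition lattice_avg :: "int \<Rightarrow> nat \<Rightarrow> (int ^ 'd \<Rightarrow> real) \<Rightarrow> int ^ 'd \<Rightarrow> real" where
  "lattice_avg q r F x = (\<Sum>u\<in>cube r. F (x - q *s u)) / real (card (cube r :: (int ^ 'd) set))"

lemma lattice_avg_reindex:
  fixes F :: "int ^ 'd::finite \<Rightarrow> real"
  assumes "q \<noteq> 0"
  shows "lattice_avg q r F x = (\<Sum>y\<in>(\<lambda>u. x - q *s u) ` cube r. 1 / real (card (cube r :: (int ^ 'd) set)) * F y)"
  unfolding lattice_avg_def
  by (subst sum.reindex) (use assms in \<open>auto simp: inj_on_def vec_eq_iff sum_divide_distrib\<close>)

lemma lattice_avg_weak_type:
  fixes F :: "(int ^ 'd::finite) set" and r :: "int ^ 'd \<Rightarrow> nat"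
  assumes "finite X" "finite F" "\<alpha> > 0" "q \<noteq> 0" "\<And>x. x \<in> X \<Longrightarrow> \<alpha> < lattice_avg q (r x) (\<lambda>y. of_bool (y \<in> F)) x"
  shows "real (card X) \<le> 2 ^ CARD('d) / \<alpha> * real (card F)"
proof -
  have "\<alpha> * card X \<le> 2 ^ CARD('d) * (\<Sum>y\<in>(\<Union>x\<in>X. (\<lambda>u. x - q *s u) ` cube (r x)). of_bool (y \<in> F))"
  proof (rule vitali_weak_type[of X "\<lambda>y. of_bool (y \<in> F)" \<alpha> q r])
    fix x assume "x \<in> X"
    from assms(5)[OF this] show "\<alpha> * real (card (cube (r x) :: (int ^ 'd) set)) \<le> (\<Sum>u\<in>cube (r x). of_bool (x - q *s u \<in> F))"
      by (simp add: lattice_avg_def card_cube field_simps)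
  qed (use assms in auto)
  also have "(\<Sum>y\<in>(\<Union>x\<in>X. (\<lambda>u. x - q *s u) ` cube (r x)). of_bool (y \<in> F) :: real) \<le> real (card F)"
    using assms(1,2) by (subst sum_of_bool_eq) (auto intro!: card_mono)
  finally show ?thesis using assms(3) by (simp add: field_simps)
qed

text \<open>The choice of a radius at every point linearises the maximal function. The weak type 1
  estimate from the covering lemma is interpolated with the supremum bound; the constant inherits
  its independence of \<open>q\<close> from the covering argument.\<close>

lemma lattice_maximal_l2:
  "\<exists>C\<ge>0. \<forall>q F X (r :: int ^ 'd::finite \<Rightarrow> nat). q \<noteq> 0 \<longrightarrow> fsupp F \<longrightarrow> finite X \<longrightarrow>
     (\<Sum>x\<in>X. (lattice_avg q (r x) (\<lambda>y. cmod (F y)) x)\<^sup>2) \<le> C * l2sq F"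
proof -
  obtain C where C: "C \<ge> 0" and main: "\<And>(X :: (int ^ 'd) set) (Y :: int ^ 'd \<Rightarrow> (int ^ 'd) set) w A f Z. finite X \<Longrightarrow> finite Z \<Longrightarrow> A \<ge> 0 \<Longrightarrow>
    (\<forall>x\<in>X. finite (Y x) \<and> (\<forall>y\<in>Y x. 0 \<le> w x y) \<and> (\<Sum>y\<in>Y x. w x y) \<le> 1) \<Longrightarrow>
    (\<forall>F X' \<alpha>. finite F \<longrightarrow> X' \<subseteq> X \<longrightarrow> 0 < \<alpha> \<longrightarrow> \<alpha> \<le> 1 \<longrightarrow> (\<forall>x\<in>X'. \<alpha> < (\<Sum>y\<in>Y x. w x y * of_bool (y \<in> F))) \<longrightarrow>
       real (card X') \<le> A * \<alpha> powr (- 1) * real (card F)) \<Longrightarrow>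
    (\<forall>y. f y \<ge> 0) \<Longrightarrow> (\<forall>y. y \<notin> Z \<longrightarrow> f y = 0) \<Longrightarrow>
    (\<Sum>x\<in>X. (\<Sum>y\<in>Y x. w x y * f y) powr 2) \<le> C * A * (\<Sum>y\<in>Z. f y powr 2)"
    using restricted_weak_type_interpolation[of 1 2, where 'x = "int ^ 'd" and 'y = "int ^ 'd"] by auto
  show ?thesis
  proof (intro exI[of _ "C * 2 ^ CARD('d)"] conjI allI impI)
    show "0 \<le> C * 2 ^ CARD('d)" using C by simp
    fix q :: int and F :: "int ^ 'd \<Rightarrow> complex" and X :: "(int ^ 'd) set" and r :: "int ^ 'd \<Rightarrow> nat"
    assume q: "q \<noteq> 0" and F: "fsupp F" and X: "finite X"
    let ?Y = "\<lambda>x. (\<lambda>u. x - q *s u) ` cube (r x)"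
    let ?w = "\<lambda>x (y :: int ^ 'd). 1 / real (card (cube (r x) :: (int ^ 'd) set))"
    have "(\<Sum>x\<in>X. (\<Sum>y\<in>?Y x. ?w x y * cmod (F y)) powr 2) \<le> C * 2 ^ CARD('d) * (\<Sum>y | F y \<noteq> 0. cmod (F y) powr 2)"
    proof (rule main)
      show "\<forall>x\<in>X. finite (?Y x) \<and> (\<forall>y\<in>?Y x. 0 \<le> ?w x y) \<and> (\<Sum>y\<in>?Y x. ?w x y) \<le> 1"
      proof (intro ballI conjI)
        fix x
        have "card (?Y x) = card (cube (r x) :: (int ^ 'd) set)"
          by (rule card_image) (use q in \<open>auto simp: inj_on_def vec_eq_iff\<close>)
        thus "(\<Sum>y\<in>?Y x. ?w x y) \<le> 1" by simp
      qed auto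
      show "\<forall>F X' \<alpha>. finite F \<longrightarrow> X' \<subseteq> X \<longrightarrow> 0 < \<alpha> \<longrightarrow> \<alpha> \<le> 1 \<longrightarrow> (\<forall>x\<in>X'. \<alpha> < (\<Sum>y\<in>?Y x. ?w x y * of_bool (y \<in> F))) \<longrightarrow>
         real (card X') \<le> 2 ^ CARD('d) * \<alpha> powr (- 1) * real (card F)"
      proof (intro allI impI)
        fix F :: "(int ^ 'd) set" and X' and \<alpha> :: real
        assume h: "finite F" "X' \<subseteq> X" "0 < \<alpha>" "\<forall>x\<in>X'. \<alpha> < (\<Sum>y\<in>?Y x. ?w x y * of_bool (y \<in> F))"
        have "real (card X') \<le> 2 ^ CARD('d) / \<alpha> * real (card F)"
          by (rule lattice_avg_weak_type[where q = q and r = r]) (use h X q finite_subset in \<open>auto simp: lattice_avg_reindex\<close>)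
        thus "real (card X') \<le> 2 ^ CARD('d) * \<alpha> powr (- 1) * real (card F)"
          using h(3) by (simp add: powr_minus field_simps)
      qed
    qed (use X F in \<open>auto simp: fsupp_def\<close>)
    thus "(\<Sum>x\<in>X. (lattice_avg q (r x) (\<lambda>y. cmod (F y)) x)\<^sup>2) \<le> C * 2 ^ CARD('d) * l2sq F"
      by (simp add: l2sq_def lattice_avg_reindex[OF q] sum_nonneg powr_numeral)
  qed
qed

section \<open>Quadratic exponential sums on an arc\<close>

lemma norm_qsum_le: "finite S \<Longrightarrow> norm (qsum S t x) \<le> real (card S)"
  unfolding qsum_def by (rule order.trans[OF norm_sum]) simp

lemma powr_minus_quarter_le:
  fixes x y s :: real
  assumes "x > 0" "x / 4 \<le> y" "0 \<le> s"
  shows "y powr (- s) \<le> 4 powr s * x powr (- s)"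
proof -
  have "y powr (- s) \<le> (x / 4) powr (- s)" using assms by (intro powr_mono2') auto
  also have "\<dots> = 4 powr s * x powr (- s)" using assms by (simp add: powr_divide powr_minus field_simps)
  finally show ?thesis .
qed

text \<open>\<open>weyl_bound\<close> on an interval of length \<open>2 * L\<close>, at a frequency
  given in Dirichlet's form. The error term is absorbed because the size
  \<open>q * (1 + L\<^sup>2 * \<bar>\<tau>\<bar>)\<close> is at most \<open>9 * L\<close>, so that
  \<open>L\<close> is at most \<open>9 * L\<^sup>2\<close> divided by this size.\<close>

lemma qsum_sphere_bound:
  assumes \<eta>: "0 < \<eta>" "\<eta> \<le> 1" and L: "L \<ge> (1::nat)" and q: "1 \<le> q" "q \<le> 8 * L" and cop: "coprime a (int q)"
    and \<tau>: "8 * real L * real q * \<bar>\<tau>\<bar> \<le> 1"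
  shows "(norm (qsum {- int L..int L} (of_int a / real q + \<tau>) x))\<^sup>2
     \<le> 1600 / \<eta> * (real L)\<^sup>2 * (real q * (1 + (real L)\<^sup>2 * \<bar>\<tau>\<bar>)) powr (\<eta> - 1)"
proof -
  define M where "M = 1 + (real L)\<^sup>2 * \<bar>\<tau>\<bar>"
  define \<Theta> where "\<Theta> = real q * M"
  have M: "M \<ge> 1" by (simp add: M_def)
  have \<Theta>q: "\<Theta> \<ge> real q" "real q \<ge> 1" "\<Theta> \<ge> 1" using M q mult_mono[of 1 "real q" 1 M] by (auto simp: \<Theta>_def)
  have "(real L)\<^sup>2 * (real q * \<bar>\<tau>\<bar>) = real L / 8 * (8 * real L * real q * \<bar>\<tau>\<bar>)" by (simp add: power2_eq_square)
  also have "\<dots> \<le> real L / 8 * 1" by (intro mult_left_mono \<tau>) auto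
  finally have "\<Theta> \<le> real q + real L / 8" by (simp add: \<Theta>_def M_def algebra_simps)
  hence "\<Theta> \<le> 9 * real L" using q by linarith
  hence "real L * \<Theta> \<le> real L * (9 * real L)" by (intro mult_left_mono) auto
  hence L\<Theta>: "real L \<le> 9 * (real L)\<^sup>2 / \<Theta>" using \<Theta>q by (simp add: field_simps power2_eq_square)
  have "(norm (qsum {- int L..int L} (of_int a / real q + \<tau>) x))\<^sup>2
    \<le> 16 / \<eta> * ((real (2 * L) + real q) * real q powr \<eta> + (real (2 * L))\<^sup>2 / real q * (1 + (real (2 * L))\<^sup>2 * \<bar>\<tau>\<bar>) powr (\<eta> - 1))"
    by (rule weyl_bound) (use assms in auto)
  also have "\<dots> \<le> 16 / \<eta> * (90 * (real L)\<^sup>2 * \<Theta> powr (\<eta> - 1) + 4 * (real L)\<^sup>2 * \<Theta> powr (\<eta> - 1))"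
  proof (intro mult_left_mono add_mono)
    have "(real (2 * L) + real q) * real q powr \<eta> \<le> (10 * real L) * \<Theta> powr \<eta>"
      using q \<Theta>q \<eta> by (intro mult_mono powr_mono2) auto
    also have "\<dots> \<le> (10 * (9 * (real L)\<^sup>2 / \<Theta>)) * \<Theta> powr \<eta>" using L\<Theta> by (intro mult_right_mono) auto
    also have "\<dots> = 90 * (real L)\<^sup>2 * \<Theta> powr (\<eta> - 1)" using \<Theta>q by (simp add: powr_diff)
    finally show "(real (2 * L) + real q) * real q powr \<eta> \<le> 90 * (real L)\<^sup>2 * \<Theta> powr (\<eta> - 1)" .
    have "1 / real q * (1 + (real (2 * L))\<^sup>2 * \<bar>\<tau>\<bar>) powr (\<eta> - 1) \<le> real q powr (\<eta> - 1) * M powr (\<eta> - 1)"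
    proof (intro mult_mono powr_mono2')
      have "1 / real q = real q powr (- 1)" using q by (simp add: powr_minus_divide)
      also have "\<dots> \<le> real q powr (\<eta> - 1)" using q \<eta> by (intro powr_mono) auto
      finally show "1 / real q \<le> real q powr (\<eta> - 1)" .
      show "M \<le> 1 + (real (2 * L))\<^sup>2 * \<bar>\<tau>\<bar>" by (auto simp: M_def power_mult_distrib intro!: mult_right_mono)
    qed (use M \<eta> in auto)
    also have "\<dots> = \<Theta> powr (\<eta> - 1)" using M by (simp add: \<Theta>_def powr_mult)
    finally have "(4 * (real L)\<^sup>2) * (1 / real q * (1 + (real (2 * L))\<^sup>2 * \<bar>\<tau>\<bar>) powr (\<eta> - 1)) \<le> (4 * (real L)\<^sup>2) * \<Theta> powr (\<eta> - 1)"
      by (intro mult_left_mono) auto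
    thus "(real (2 * L))\<^sup>2 / real q * (1 + (real (2 * L))\<^sup>2 * \<bar>\<tau>\<bar>) powr (\<eta> - 1) \<le> 4 * (real L)\<^sup>2 * \<Theta> powr (\<eta> - 1)"
      by (simp add: power_mult_distrib)
  qed (use \<eta> in auto)
  also have "\<dots> = 1504 / \<eta> * (real L)\<^sup>2 * \<Theta> powr (\<eta> - 1)" by (simp add: algebra_simps)
  also have "\<dots> \<le> 1600 / \<eta> * (real L)\<^sup>2 * \<Theta> powr (\<eta> - 1)"
    using \<eta> by (intro mult_right_mono divide_right_mono) auto
  finally show ?thesis by (simp add: \<Theta>_def M_def)
qed

text \<open>Square root cancellation in a complete Gauss sum, up to a power \<open>\<eta>\<close>,
  from differencing alone: \<open>N = q\<close> and \<open>\<tau> = 0\<close> in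
  \<open>weyl_bound\<close>.\<close>

lemma qsum_complete_bound:
  assumes \<eta>: "0 < \<eta>" "\<eta> \<le> 1" and q: "1 \<le> q" and cop: "coprime a (int q)"
  shows "(norm (qsum {0..<int q} (of_int a / real q) x))\<^sup>2 \<le> 48 / \<eta> * real q powr (1 + \<eta>)"
proof -
  have "{0..<int q} = {0..int q - 1}" by auto
  hence "(norm (qsum {0..<int q} (of_int a / real q) x))\<^sup>2
    \<le> 16 / \<eta> * ((real q + real q) * real q powr \<eta> + (real q)\<^sup>2 / real q * (1 + (real q)\<^sup>2 * \<bar>0\<bar>) powr (\<eta> - 1))"
    using weyl_bound[OF \<eta> q cop q, of 0 "int q - 1" 0 x] by simp
  also have "\<dots> = 16 / \<eta> * (2 * real q powr (1 + \<eta>) + real q powr 1)" using q by (simp add: power2_eq_square powr_add)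
  also have "\<dots> \<le> 16 / \<eta> * (2 * real q powr (1 + \<eta>) + real q powr (1 + \<eta>))"
    using q \<eta> by (intro mult_left_mono add_left_mono powr_mono) auto
  finally show ?thesis by simp
qed

text \<open>The case of denominator 1. The hypothesis on \<open>t\<close> keeps
  \<open>1 + U\<^sup>2 * \<bar>t\<bar>\<close> at most \<open>2 * U\<close>, which absorbs the
  linear error of \<open>weyl_bound\<close>.\<close>

lemma qsum_smooth_bound:
  assumes \<eta>: "0 < \<eta>" "\<eta> \<le> 1" and U: "U \<ge> (1::nat)" and t: "8 * real U * \<bar>t\<bar> \<le> 1"
  shows "(norm (qsum {- int U..int U} t x))\<^sup>2 \<le> 160 / \<eta> * (real U)\<^sup>2 * (1 + (real U)\<^sup>2 * \<bar>t\<bar>) powr (\<eta> - 1)"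
proof -
  define M where "M = 1 + (real U)\<^sup>2 * \<bar>t\<bar>"
  have M: "M \<ge> 1" by (simp add: M_def)
  have "(real U)\<^sup>2 * \<bar>t\<bar> = real U / 8 * (8 * real U * \<bar>t\<bar>)" by (simp add: power2_eq_square)
  also have "\<dots> \<le> real U / 8 * 1" by (intro mult_left_mono t) auto
  finally have "M \<le> 2 * real U" using U by (simp add: M_def)
  hence "real U * M \<le> real U * (2 * real U)" by (intro mult_left_mono) auto
  hence "real U \<le> 2 * (real U)\<^sup>2 / M" using M by (simp add: field_simps power2_eq_square)
  also have "\<dots> = 2 * (real U)\<^sup>2 * M powr (- 1)" using M by (simp add: powr_minus_divide)
  also have "\<dots> \<le> 2 * (real U)\<^sup>2 * M powr (\<eta> - 1)" using M \<eta> by (intro mult_left_mono powr_mono) auto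
  finally have UM: "real U \<le> 2 * (real U)\<^sup>2 * M powr (\<eta> - 1)" .
  have "(norm (qsum {- int U..int U} t x))\<^sup>2
    \<le> 16 / \<eta> * ((real (2 * U) + 1) * 1 + (real (2 * U))\<^sup>2 * (1 + (real (2 * U))\<^sup>2 * \<bar>t\<bar>) powr (\<eta> - 1))"
    using weyl_bound[OF \<eta>, of 1 0 "2 * U" t "int U" "- int U" x] U t by simp
  also have "\<dots> \<le> 16 / \<eta> * (6 * (real U)\<^sup>2 * M powr (\<eta> - 1) + (4 * (real U)\<^sup>2) * M powr (\<eta> - 1))"
  proof (intro mult_left_mono add_mono)
    show "(real (2 * U) + 1) * 1 \<le> 6 * (real U)\<^sup>2 * M powr (\<eta> - 1)" using UM U by simp
    have "M \<le> 1 + (real (2 * U))\<^sup>2 * \<bar>t\<bar>" by (auto simp: M_def power_mult_distrib intro!: mult_right_mono)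
    hence "(1 + (real (2 * U))\<^sup>2 * \<bar>t\<bar>) powr (\<eta> - 1) \<le> M powr (\<eta> - 1)" using M \<eta> by (intro powr_mono2') auto
    thus "(real (2 * U))\<^sup>2 * (1 + (real (2 * U))\<^sup>2 * \<bar>t\<bar>) powr (\<eta> - 1) \<le> (4 * (real U)\<^sup>2) * M powr (\<eta> - 1)"
      by (simp add: power_mult_distrib mult_left_mono)
  qed (use \<eta> in auto)
  also have "\<dots> = 160 / \<eta> * (real U)\<^sup>2 * M powr (\<eta> - 1)" by (simp add: algebra_simps)
  finally show ?thesis by (simp add: M_def)
qed

lemma norm_ee_diff_le': "norm (ee x - ee y) \<le> 8 * \<bar>x - y\<bar>"
proof -
  have "2 * pi * \<bar>x - y\<bar> \<le> 8 * \<bar>x - y\<bar>" using pi_less_4 by (intro mult_right_mono) auto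
  thus ?thesis using norm_ee_diff_le[of x y] by linarith
qed

text \<open>The quadratic phase has total variation of order
  \<open>U\<^sup>2 * \<bar>t\<bar>\<close> on the interval, so summation by parts costs a factor
  \<open>1 + U\<^sup>2 * \<bar>t\<bar>\<close> compared with a geometric sum.\<close>

lemma qsum_far_bound:
  assumes U: "U \<ge> (1::nat)"
  shows "ndist x * norm (qsum {- int U..int U} t x) \<le> 12 * (1 + (real U)\<^sup>2 * \<bar>t\<bar>)"
proof -
  define g where "g u = ee (t * of_int (u\<^sup>2))" for u :: int
  have "4 * ndist x * norm (\<Sum>u\<in>{- int U..int U}. g u * ee (of_int u * x))
           \<le> norm (g (- int U)) + norm (g (int U)) + (\<Sum>u\<in>{- int U+1..int U}. norm (g u - g (u - 1)))"
    by (rule abel_sum_bound) simp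
  also have "(\<Sum>u\<in>{- int U+1..int U}. norm (g u - g (u - 1))) \<le> (\<Sum>u\<in>{- int U+1..int U}. 24 * real U * \<bar>t\<bar>)"
  proof (rule sum_mono)
    fix u assume u: "u \<in> {- int U+1..int U}"
    have "norm (g u - g (u - 1)) \<le> 8 * \<bar>t * of_int (u\<^sup>2) - t * of_int ((u - 1)\<^sup>2)\<bar>"
      unfolding g_def by (rule norm_ee_diff_le')
    also have "t * of_int (u\<^sup>2) - t * of_int ((u - 1)\<^sup>2) = t * of_int (2 * u - 1)" by (simp add: power2_eq_square algebra_simps)
    also have "\<bar>t * of_int (2 * u - 1)\<bar> = \<bar>real_of_int (2 * u - 1)\<bar> * \<bar>t\<bar>" by (simp add: abs_mult)
    also have "\<bar>real_of_int (2 * u - 1)\<bar> * \<bar>t\<bar> \<le> (3 * real U) * \<bar>t\<bar>"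
      using u U by (intro mult_right_mono) (auto simp: abs_le_iff)
    finally show "norm (g u - g (u - 1)) \<le> 24 * real U * \<bar>t\<bar>" by simp
  qed
  also have "\<dots> = 48 * ((real U)\<^sup>2 * \<bar>t\<bar>)" by (simp add: power2_eq_square)
  finally have "4 * ndist x * norm (qsum {- int U..int U} t x) \<le> 2 + 48 * ((real U)\<^sup>2 * \<bar>t\<bar>)"
    by (simp add: qsum_def g_def ee_add)
  thus ?thesis by (simp add: algebra_simps)
qed

lemma qsum_near_zero:
  assumes U: "U \<ge> (1::nat)"
  shows "norm (qsum {- int U..int U} t x - qsum {- int U..int U} t 0) \<le> 24 * (real U)\<^sup>2 * ndist x"
proof -
  have "norm (qsum {- int U..int U} t x - qsum {- int U..int U} t 0)
     \<le> (\<Sum>m\<in>{- int U..int U}. norm (ee (t * of_int (m\<^sup>2) + of_int m * x) - ee (t * of_int (m\<^sup>2) + of_int m * 0)))"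
    unfolding qsum_def sum_subtractf[symmetric] by (rule norm_sum)
  also have "\<dots> \<le> (\<Sum>m\<in>{- int U..int U}. 8 * real U * ndist x)"
  proof (rule sum_mono)
    fix m assume m: "m \<in> {- int U..int U}"
    have "of_int m * x = of_int m * (x - of_int (round x)) + of_int (m * round x)"
      by (simp add: algebra_simps)
    hence "ee (of_int m * x) = ee (of_int m * (x - of_int (round x)))" by (metis ee_add_of_int)
    moreover define y where "y = of_int m * (x - of_int (round x))"
    ultimately have e: "ee (of_int m * x) = ee y" by simp
    have "ee (t * of_int (m\<^sup>2) + of_int m * x) - ee (t * of_int (m\<^sup>2) + of_int m * 0)
       = ee (t * of_int (m\<^sup>2)) * (ee (of_int m * (x - of_int (round x))) - ee 0)"
      unfolding ee_add e y_def[symmetric] ee_0 by (simp add: algebra_simps)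
    hence "norm (ee (t * of_int (m\<^sup>2) + of_int m * x) - ee (t * of_int (m\<^sup>2) + of_int m * 0))
      \<le> 8 * \<bar>of_int m * (x - of_int (round x)) - 0\<bar>"
      using norm_ee_diff_le'[of "of_int m * (x - of_int (round x))" 0] by (simp add: norm_mult)
    also have "\<dots> = 8 * (\<bar>of_int m\<bar> * ndist x)" by (simp add: abs_mult ndist_def)
    also have "\<bar>real_of_int m\<bar> * ndist x \<le> real U * ndist x" using m by (intro mult_right_mono) (auto simp: abs_le_iff)
    finally show "norm (ee (t * of_int (m\<^sup>2) + of_int m * x) - ee (t * of_int (m\<^sup>2) + of_int m * 0)) \<le> 8 * real U * ndist x" by simp
  qed
  also have "\<dots> = (2 * real U + 1) * (8 * real U * ndist x)" by (simp add: nat_add_distrib nat_mult_distrib algebra_simps)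
  also have "\<dots> \<le> (3 * real U) * (8 * real U * ndist x)" using U by (intro mult_right_mono) auto
  finally show ?thesis by (simp add: power2_eq_square)
qed

text \<open>
  Writing \<open>m = q u + r\<close>, the phase \<open>a m\<^sup>2/q\<close> depends on \<open>r\<close> only, and \<open>\<tau> m\<^sup>2\<close> changes by little when \<open>m\<close> is
  replaced by \<open>q u\<close>.
\<close>

lemma qsum_factorisation:
  assumes q: "1 \<le> q" "q \<le> L" and U: "U = L div q"
  shows "norm (qsum {- int L..int L} (of_int a / real q + \<tau>) x
      - qsum {0..<int q} (of_int a / real q) x * qsum {- int U..int U} (\<tau> * (real q)\<^sup>2) (real q * x))
    \<le> 80 * real q * (1 + (real L)\<^sup>2 * \<bar>\<tau>\<bar>)"
proof -
  define c where "c m = ee (of_int a / real q * of_int (m\<^sup>2) + of_int m * x)" for m :: int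
  define e1 where "e1 m = ee (\<tau> * of_int (m\<^sup>2))" for m :: int
  define e2 where "e2 m = ee (\<tau> * of_int ((int q * (m div int q))\<^sup>2))" for m :: int
  \<comment> \<open>The union of the blocks of \<open>q\<close> consecutive integers that start at
    the multiples \<open>q * u\<close> with \<open>\<bar>u\<bar> \<le> U\<close>; on each block
    \<open>e2\<close> is constant.\<close>
  define I where "I = {- int q * int U..<int q * int U + int q}"
  have qU: "int q * int U \<le> int L" "int L < int q * int U + int q"
  proof -
    have "q * U \<le> L" "L < q * U + q" using q mult_div_mod_eq[of q L] mod_less_divisor[of q L] unfolding U
      by linarith+
    thus "int q * int U \<le> int L" "int L < int q * int U + int q" by (metis of_nat_le_iff of_nat_mult, metis of_nat_add of_nat_less_iff of_nat_mult)
  qed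
  have "qsum {0..<int q} (of_int a / real q) x * qsum {- int U..int U} (\<tau> * (real q)\<^sup>2) (real q * x)
    = (\<Sum>(r, u)\<in>{0..<int q} \<times> {- int U..int U}. ee (of_int a / real q * of_int (r\<^sup>2) + of_int r * x) * ee (\<tau> * (real q)\<^sup>2 * of_int (u\<^sup>2) + of_int u * (real q * x)))"
    by (simp add: qsum_def sum_product sum.cartesian_product)
  also have "\<dots> = (\<Sum>m\<in>I. c m * e2 m)"
  proof (rule sum.reindex_bij_witness[where i = "\<lambda>m. (m mod int q, m div int q)" and j = "\<lambda>(r, u). int q * u + r"])
    fix p assume p: "p \<in> {0..<int q} \<times> {- int U..int U}"
    obtain r u where ru: "p = (r, u)" by (cases p)
    have r: "0 \<le> r" "r < int q" and u: "- int U \<le> u" "u \<le> int U" using p ru by auto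
    have dm: "(int q * u + r) div int q = u" "(int q * u + r) mod int q = r" using r by auto
    show "((case p of (r, u) \<Rightarrow> int q * u + r) mod int q, (case p of (r, u) \<Rightarrow> int q * u + r) div int q) = p"
      using dm ru by simp
    have "int q * (- int U) \<le> int q * u" "int q * u \<le> int q * int U" using u by (intro mult_left_mono; simp)+
    hence "- int q * int U \<le> int q * u + r" "int q * u + r < int q * int U + int q" using r by linarith+
    thus "(case p of (r, u) \<Rightarrow> int q * u + r) \<in> I" by (simp only: I_def ru prod.case atLeastLessThan_iff)
    have "of_int a / real q * of_int ((int q * u + r)\<^sup>2) = of_int a / real q * of_int (r\<^sup>2) + of_int (a * (int q * u\<^sup>2 + 2 * u * r))"
      using q by (simp add: field_simps power2_eq_square)
    hence "c (int q * u + r) * e2 (int q * u + r) = ee ((of_int a / real q * of_int (r\<^sup>2) + of_int (int q * u + r) * x + \<tau> * of_int ((int q * u)\<^sup>2))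
        + of_int (a * (int q * u\<^sup>2 + 2 * u * r)))"
      unfolding c_def e2_def dm ee_add[symmetric] by (simp add: algebra_simps)
    also have "\<dots> = ee (of_int a / real q * of_int (r\<^sup>2) + of_int (int q * u + r) * x + \<tau> * of_int ((int q * u)\<^sup>2))"
      by (rule ee_add_of_int)
    also have "\<dots> = ee (of_int a / real q * of_int (r\<^sup>2) + of_int r * x) * ee (\<tau> * (real q)\<^sup>2 * of_int (u\<^sup>2) + of_int u * (real q * x))"
      unfolding ee_add[symmetric] by (simp add: power_mult_distrib algebra_simps)
    finally show "c (case p of (r, u) \<Rightarrow> int q * u + r) * e2 (case p of (r, u) \<Rightarrow> int q * u + r) =
       (case p of (r, u) \<Rightarrow> ee (of_int a / real q * of_int (r\<^sup>2) + of_int r * x) * ee (\<tau> * (real q)\<^sup>2 * of_int (u\<^sup>2) + of_int u * (real q * x)))"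
      by (simp add: ru)
  next
    fix m assume m: "m \<in> I"
    have "(int q * (- int U)) div int q = - int U" using q by (intro nonzero_mult_div_cancel_left) simp
    hence "m div int q \<ge> - int U" using m q zdiv_mono1[of "int q * (- int U)" m "int q"] unfolding I_def by simp
    moreover have "m div int q < int U + 1"
    proof -
      have 1: "m < int q * (int U + 1)" using m by (simp add: I_def algebra_simps)
      have 2: "int q * (m div int q) \<le> m" using q mult_div_mod_eq[of "int q" m] pos_mod_sign[of "int q" m] by linarith
      show ?thesis
      proof (rule ccontr)
        assume "\<not> ?thesis"
        hence "int q * (int U + 1) \<le> int q * (m div int q)" by (intro mult_left_mono) auto
        thus False using 1 2 by linarith
      qed
    qed
    ultimately show "(m mod int q, m div int q) \<in> {0..<int q} \<times> {- int U..int U}" using q by auto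
  qed (use q in auto)
  finally have H: "qsum {0..<int q} (of_int a / real q) x * qsum {- int U..int U} (\<tau> * (real q)\<^sup>2) (real q * x) = (\<Sum>m\<in>I. c m * e2 m)" .
  have K: "qsum {- int L..int L} (of_int a / real q + \<tau>) x = (\<Sum>m\<in>{- int L..int L}. c m * e1 m)"
    unfolding qsum_def c_def e1_def ee_add[symmetric] by (simp add: algebra_simps)
  have "real_of_int (int q * int U) \<le> real_of_int (int L)" "real_of_int (int L) \<le> real_of_int (int q * int U + int q)"
    using qU by (simp_all only: of_int_le_iff less_imp_le)
  hence qUr: "real q * real U \<le> real L" "real L \<le> real q * real U + real q" by simp_all
  have qU0: "0 \<le> int q * int U" by simp
  \<comment> \<open>\<open>I\<close> and the original interval share \<open>J\<close>; the end
    pieces \<open>J1\<close> and \<open>J2\<close> contain at most \<open>q\<close> points each,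
    which is where the part of the error without \<open>\<tau>\<close> comes from.\<close>
  define J where "J = {- int q * int U..int L}"
  define J1 where "J1 = {- int L..<- int q * int U}"
  define J2 where "J2 = {int L<..<int q * int U + int q}"
  have "(\<Sum>m\<in>{- int L..int L}. c m * e1 m) = (\<Sum>m\<in>J. c m * e1 m) + (\<Sum>m\<in>J1. c m * e1 m)"
  proof -
    have "{- l..l} = {- w..l} \<union> {- l..<- w}" if "0 \<le> w" "w \<le> l" for w l :: int using that by auto
    from this[OF qU0 qU(1)] have "{- int L..int L} = J \<union> J1" by (simp add: J_def J1_def)
    moreover have "J \<inter> J1 = {}" by (auto simp: J_def J1_def)
    ultimately show ?thesis by (simp add: sum.union_disjoint J_def J1_def)
  qed
  moreover have "(\<Sum>m\<in>I. c m * e2 m) = (\<Sum>m\<in>J. c m * e2 m) + (\<Sum>m\<in>J2. c m * e2 m)"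
  proof -
    have "{- w..<w + v} = {- w..l} \<union> {l<..<w + v}" if "0 \<le> w" "w \<le> l" "l < w + v" for w l v :: int using that by auto
    from this[OF qU0 qU] have "I = J \<union> J2" by (simp add: I_def J_def J2_def)
    moreover have "J \<inter> J2 = {}" by (auto simp: J_def J2_def)
    ultimately show ?thesis by (simp add: sum.union_disjoint J_def J2_def)
  qed
  ultimately have "norm ((\<Sum>m\<in>{- int L..int L}. c m * e1 m) - (\<Sum>m\<in>I. c m * e2 m))
     = norm ((\<Sum>m\<in>J. c m * e1 m - c m * e2 m) + (\<Sum>m\<in>J1. c m * e1 m) - (\<Sum>m\<in>J2. c m * e2 m))"
    by (simp add: sum_subtractf algebra_simps)
  also have "\<dots> \<le> norm (\<Sum>m\<in>J. c m * e1 m - c m * e2 m) + norm (\<Sum>m\<in>J1. c m * e1 m) + norm (\<Sum>m\<in>J2. c m * e2 m)"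
    by (intro order.trans[OF norm_triangle_ineq4] add_right_mono norm_triangle_ineq)
  also have "\<dots> \<le> 72 * (real L)\<^sup>2 * real q * \<bar>\<tau>\<bar> + real q + real q"
  proof (intro add_mono)
    have "norm (\<Sum>m\<in>J. c m * e1 m - c m * e2 m) \<le> (\<Sum>m\<in>J. norm (c m * e1 m - c m * e2 m))" by (rule norm_sum)
    also have "\<dots> \<le> (\<Sum>m\<in>J. 24 * real q * real L * \<bar>\<tau>\<bar>)"
    proof (rule sum_mono)
      fix m assume m: "m \<in> J"
      let ?m = "int q * (m div int q)"
      have mm: "?m \<le> m" "m < ?m + int q" using q mult_div_mod_eq[of "int q" m] pos_mod_sign[of "int q" m] pos_mod_bound[of "int q" m] by linarith+
      have "c m * e1 m - c m * e2 m = c m * (e1 m - e2 m)" by (simp add: algebra_simps)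
      hence "norm (c m * e1 m - c m * e2 m) = norm (e1 m - e2 m)" by (simp add: norm_mult c_def)
      also have "\<dots> \<le> 8 * \<bar>\<tau> * of_int (m\<^sup>2) - \<tau> * of_int (?m\<^sup>2)\<bar>" unfolding e1_def e2_def by (rule norm_ee_diff_le')
      also have "\<tau> * of_int (m\<^sup>2) - \<tau> * of_int (?m\<^sup>2) = \<tau> * (of_int (m - ?m) * of_int (m + ?m))"
        by (simp add: power2_eq_square algebra_simps)
      also have "\<bar>\<tau> * (of_int (m - ?m) * of_int (m + ?m))\<bar> = (\<bar>of_int (m - ?m)\<bar> * \<bar>of_int (m + ?m)\<bar>) * \<bar>\<tau>\<bar>" by (simp add: abs_mult mult_ac)
      also have "\<dots> \<le> (real q * (3 * real L)) * \<bar>\<tau>\<bar>"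
      proof (intro mult_right_mono mult_mono)
        show "\<bar>real_of_int (m - ?m)\<bar> \<le> real q" using mm by linarith
        have "m \<ge> - int L" "m \<le> int L" using m qU by (auto simp: J_def)
        thus "\<bar>real_of_int (m + ?m)\<bar> \<le> 3 * real L" using mm q by linarith
      qed auto
      finally show "norm (c m * e1 m - c m * e2 m) \<le> 24 * real q * real L * \<bar>\<tau>\<bar>" by (simp add: mult_ac)
    qed
    also have "\<dots> = real (card J) * (24 * real q * real L * \<bar>\<tau>\<bar>)" by simp
    also have "\<dots> \<le> (3 * real L) * (24 * real q * real L * \<bar>\<tau>\<bar>)"
    proof (intro mult_right_mono)
      show "real (card J) \<le> 3 * real L" using q qUr by (simp add: J_def)
    qed auto
    finally show "norm (\<Sum>m\<in>J. c m * e1 m - c m * e2 m) \<le> 72 * (real L)\<^sup>2 * real q * \<bar>\<tau>\<bar>" by (simp add: power2_eq_square mult_ac)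
    have "norm (\<Sum>m\<in>J1. c m * e1 m) \<le> (\<Sum>m\<in>J1. norm (c m * e1 m))" by (rule norm_sum)
    also have "\<dots> = real (card J1)" by (simp add: norm_mult c_def e1_def)
    also have "\<dots> \<le> real q" using qU qUr by (simp add: J1_def)
    finally show "norm (\<Sum>m\<in>J1. c m * e1 m) \<le> real q" .
    have "norm (\<Sum>m\<in>J2. c m * e2 m) \<le> (\<Sum>m\<in>J2. norm (c m * e2 m))" by (rule norm_sum)
    also have "\<dots> = real (card J2)" by (simp add: norm_mult c_def e2_def)
    also have "\<dots> \<le> real q" using qU qUr by (simp add: J2_def)
    finally show "norm (\<Sum>m\<in>J2. c m * e2 m) \<le> real q" .
  qed
  also have "\<dots> = real q * (2 + 72 * ((real L)\<^sup>2 * \<bar>\<tau>\<bar>))" by (simp add: algebra_simps)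
  also have "\<dots> \<le> real q * (80 + 80 * ((real L)\<^sup>2 * \<bar>\<tau>\<bar>))" by (intro mult_left_mono add_mono mult_right_mono) auto
  finally show ?thesis unfolding K H by (simp add: algebra_simps)
qed

lemma norm_prod_diff_le:
  fixes a b :: "'i \<Rightarrow> complex"
  assumes "finite I" "B \<ge> 0" "\<And>i. i \<in> I \<Longrightarrow> norm (a i) \<le> B" "\<And>i. i \<in> I \<Longrightarrow> norm (b i) \<le> B"
    and "\<And>i. i \<in> I \<Longrightarrow> norm (a i - b i) \<le> \<epsilon>"
  shows "norm ((\<Prod>i\<in>I. a i) - (\<Prod>i\<in>I. b i)) \<le> real (card I) * B ^ (card I - 1) * \<epsilon>"
  using assms(1,3-5)
proof (induction I rule: finite_induct)
  case (insert j I)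
  have "(\<Prod>i\<in>insert j I. a i) - (\<Prod>i\<in>insert j I. b i) = (a j - b j) * (\<Prod>i\<in>I. a i) + b j * ((\<Prod>i\<in>I. a i) - (\<Prod>i\<in>I. b i))"
    using insert.hyps by (simp add: algebra_simps)
  also have "norm \<dots> \<le> norm (a j - b j) * norm (\<Prod>i\<in>I. a i) + norm (b j) * norm ((\<Prod>i\<in>I. a i) - (\<Prod>i\<in>I. b i))"
    by (intro order.trans[OF norm_triangle_ineq]) (simp add: norm_mult)
  also have "\<dots> \<le> \<epsilon> * B ^ card I + B * (real (card I) * B ^ (card I - 1) * \<epsilon>)"
  proof (intro add_mono mult_mono)
    have "norm (\<Prod>i\<in>I. a i) \<le> (\<Prod>i\<in>I. B)" unfolding prod_norm[symmetric] by (intro prod_mono) (use insert in auto)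
    thus "norm (\<Prod>i\<in>I. a i) \<le> B ^ card I" by simp
    show "0 \<le> \<epsilon>" using insert.prems(3)[of j] by (rule order.trans[OF norm_ge_zero]) simp
  qed (use insert assms(2) in auto)
  also have "B * (real (card I) * B ^ (card I - 1) * \<epsilon>) = real (card I) * B ^ card I * \<epsilon>"
    by (cases "card I") auto
  finally show ?case using insert.hyps by (simp add: algebra_simps)
qed auto

section \<open>Rational approximation of the frequencies\<close>

text \<open>Denominators up to \<open>8 * L\<close> give the error bound that
  \<open>weyl_bound\<close> demands for an interval of length \<open>2 * L\<close>. The numerator is
  kept between 0 and the denominator so that the fractions can be counted.\<close>

lemma dirichlet_choice:
  assumes "L \<ge> (1::nat)" "0 \<le> t" "t \<le> 1"
  shows "\<exists>aq. coprime (fst aq) (int (snd aq)) \<and> 1 \<le> snd aq \<and> snd aq \<le> 8 * L \<and>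
     8 * real L * real (snd aq) * \<bar>t - of_int (fst aq) / real (snd aq)\<bar> \<le> 1 \<and> 0 \<le> fst aq \<and> fst aq \<le> int (snd aq)"
proof -
  have "8 * L > 0" using assms by simp
  then obtain h k where hk: "coprime h k" "0 < k" "k \<le> int (8 * L)" "\<bar>of_int k * t - of_int h\<bar> < 1 / real (8 * L)"
    using Dirichlet_approx_coprime[of "8 * L" t] by metis
  define q where "q = nat k"
  have q: "k = int q" "q \<ge> 1" "q \<le> 8 * L" using hk by (auto simp: q_def)
  have "1 / real (8 * L) \<le> 1" using assms by simp
  hence lt: "\<bar>of_int k * t - of_int h\<bar> < 1" using hk(4) by linarith
  have "0 \<le> of_int k * t" "of_int k * t \<le> of_int k" using hk(2) assms by (auto simp: mult_left_le)
  hence "real_of_int h > -1" "real_of_int h < of_int k + 1" using lt by linarith+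
  hence "h \<ge> 0" "h \<le> k" by linarith+
  moreover have "8 * real L * real q * \<bar>t - of_int h / real q\<bar> \<le> 1"
  proof -
    have "real q * \<bar>t - of_int h / real q\<bar> = \<bar>real q * t - of_int h\<bar>"
      using q by (simp add: abs_mult[symmetric, of "real q", simplified] right_diff_distrib)
    also have "\<dots> \<le> 1 / (8 * real L)" using hk(4) q by simp
    finally have "8 * real L * (real q * \<bar>t - of_int h / real q\<bar>) \<le> 8 * real L * (1 / (8 * real L))"
      by (intro mult_left_mono) auto
    thus ?thesis using assms by (simp add: mult.assoc)
  qed
  ultimately show ?thesis using q hk(1) by (intro exI[of _ "(h, q)"]) auto
qed

text \<open>
  A frequency \<open>t = a/q + \<tau>\<close> has size \<open>\<Theta> = q (1 + L\<^sup>2|\<tau>|)\<close>, chosen so that the Weyl sum of length \<open>L\<close> at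
  \<open>t\<close> is about \<open>L \<Theta>\<^sup>-\<^sup>1\<^sup>/\<^sup>2\<close> and about \<open>R\<^sup>2\<close> of the grid frequencies satisfy \<open>\<Theta> \<le> R\<close>.
\<close>

definition arc_center :: "nat \<Rightarrow> real \<Rightarrow> int \<times> nat" where
  "arc_center L t = (SOME aq. coprime (fst aq) (int (snd aq)) \<and> 1 \<le> snd aq \<and> snd aq \<le> 8 * L \<and>
     8 * real L * real (snd aq) * \<bar>t - of_int (fst aq) / real (snd aq)\<bar> \<le> 1 \<and> 0 \<le> fst aq \<and> fst aq \<le> int (snd aq))"

definition arc_err :: "nat \<Rightarrow> real \<Rightarrow> real" where
  "arc_err L t = t - of_int (fst (arc_center L t)) / real (snd (arc_center L t))"

definition arc_width :: "nat \<Rightarrow> real \<Rightarrow> real" where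
  "arc_width L t = 1 + (real L)\<^sup>2 * \<bar>arc_err L t\<bar>"

definition arc_size :: "nat \<Rightarrow> real \<Rightarrow> real" where
  "arc_size L t = real (snd (arc_center L t)) * arc_width L t"

lemma arc_center:
  assumes "L \<ge> 1" "0 \<le> t" "t \<le> 1" "arc_center L t = (a, q)"
  shows "coprime a (int q)" "1 \<le> q" "q \<le> 8 * L" "8 * real L * real q * \<bar>arc_err L t\<bar> \<le> 1" "0 \<le> a" "a \<le> int q"
    "t = of_int a / real q + arc_err L t" "arc_size L t = real q * arc_width L t" "arc_width L t \<ge> 1" "real q \<le> arc_size L t" "1 \<le> arc_size L t"
    "arc_width L t \<le> arc_size L t"
proof -
  from someI_ex[OF dirichlet_choice[OF assms(1-3)], folded arc_center_def] assms(4)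
  show *: "coprime a (int q)" "1 \<le> q" "q \<le> 8 * L" "8 * real L * real q * \<bar>arc_err L t\<bar> \<le> 1" "0 \<le> a" "a \<le> int q"
    by (auto simp: arc_err_def)
  show "t = of_int a / real q + arc_err L t" "arc_size L t = real q * arc_width L t"
    using assms(4) by (auto simp: arc_err_def arc_size_def)
  show w: "arc_width L t \<ge> 1" by (simp add: arc_width_def)
  have q1: "real q \<ge> 1" using * by simp
  have sz: "arc_size L t = real q * arc_width L t" using assms(4) by (simp add: arc_size_def)
  show "real q \<le> arc_size L t" using mult_left_mono[OF w, of "real q"] unfolding sz by simp
  thus "1 \<le> arc_size L t" using q1 by linarith
  show "arc_width L t \<le> arc_size L t" using mult_right_mono[OF q1, of "arc_width L t"] w unfolding sz by simp
qed

text \<open>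
  The grid size exceeds \<open>\<bar>|m|\<^sup>2 - n\<bar>\<close> for \<open>m\<close> in the cube of half-side \<open>L\<close> and \<open>n \<le> L\<^sup>2\<close>, so that averaging
  over the grid detects \<open>|m|\<^sup>2 = n\<close> exactly.
\<close>

definition grid_size :: "nat \<Rightarrow> nat \<Rightarrow> nat" where
  "grid_size d L = d * L\<^sup>2 + 1"

lemma grid_size_pos [simp]: "grid_size d L > 0"
  by (simp add: grid_size_def)

lemma sum_inverse_squares_le: "(\<Sum>i\<in>{..<n::nat}. 1 / (1 + real i)\<^sup>2) \<le> 2"
proof -
  have "n > 0 \<Longrightarrow> (\<Sum>i\<in>{..<n::nat}. 1 / (1 + real i)\<^sup>2) \<le> 2 - 1 / real n"
  proof (induction n rule: nat_induct)
    case (Suc n)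
    show ?case
    proof (cases "n = 0")
      case False
      have "1 / (1 + real n)\<^sup>2 \<le> 1 / (real n * (1 + real n))"
        using False by (intro divide_left_mono) (auto simp: power2_eq_square)
      also have "\<dots> = 1 / real n - 1 / real (Suc n)" using False by (simp add: field_simps)
      finally show ?thesis using Suc.IH False by simp
    qed simp
  qed simp
  thus ?thesis by (cases "n = 0") (auto intro: order.trans)
qed

lemma sum_inverse_dist_le:
  fixes x :: real
  shows "(\<Sum>j\<in>{..<n::nat}. (1 + \<bar>real j - x\<bar>) powr (-2)) \<le> 16"
proof -
  define x0 where "x0 = \<lfloor>x\<rfloor>"
  have le: "(1 + \<bar>real j - x\<bar>) powr (-2) \<le> 4 / (1 + real (nat \<bar>int j - x0\<bar>))\<^sup>2" for j
  proof -
    have "\<bar>real j - of_int x0\<bar> \<le> \<bar>real j - x\<bar> + 1" unfolding x0_def by linarith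
    moreover have "real (nat \<bar>int j - x0\<bar>) = \<bar>real j - of_int x0\<bar>" by simp
    moreover have "1 + N \<le> 2 * (1 + Y)" if "X \<le> Y + 1" "N = X" "0 \<le> Y" for N X Y :: real using that by simp
    ultimately have "1 + real (nat \<bar>int j - x0\<bar>) \<le> 2 * (1 + \<bar>real j - x\<bar>)"
      using abs_ge_zero by blast
    hence "(1 + real (nat \<bar>int j - x0\<bar>))\<^sup>2 \<le> (2 * (1 + \<bar>real j - x\<bar>))\<^sup>2" by (intro power_mono) auto
    moreover have "(2::real)\<^sup>2 = 4" by simp
    ultimately have sq: "(1 + real (nat \<bar>int j - x0\<bar>))\<^sup>2 \<le> 4 * (1 + \<bar>real j - x\<bar>)\<^sup>2" by (simp only: power_mult_distrib)
    have "(1 + \<bar>real j - x\<bar>) powr (-2) = 4 / (4 * (1 + \<bar>real j - x\<bar>)\<^sup>2)"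
      by (simp add: powr_minus_divide powr_numeral)
    also have "\<dots> \<le> 4 / (1 + real (nat \<bar>int j - x0\<bar>))\<^sup>2"
      by (intro divide_left_mono sq mult_pos_pos zero_less_power) (auto simp: add_pos_nonneg)
    finally show ?thesis .
  qed
  have half: "(\<Sum>j\<in>S. 1 / (1 + real (nat \<bar>int j - x0\<bar>))\<^sup>2) \<le> 2"
    if S: "finite S" "inj_on (\<lambda>j. nat \<bar>int j - x0\<bar>) S" for S
  proof -
    define N where "N = Suc (Max ((\<lambda>j. nat \<bar>int j - x0\<bar>) ` S))"
    have "(\<Sum>j\<in>S. 1 / (1 + real (nat \<bar>int j - x0\<bar>))\<^sup>2) = (\<Sum>i\<in>(\<lambda>j. nat \<bar>int j - x0\<bar>) ` S. 1 / (1 + real i)\<^sup>2)"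
      by (subst sum.reindex[OF S(2)]) simp
    also have "\<dots> \<le> (\<Sum>i\<in>{..<N}. 1 / (1 + real i)\<^sup>2)"
      by (rule sum_mono2) (use S in \<open>auto simp: N_def less_Suc_eq_le\<close>)
    also have "\<dots> \<le> 2" by (rule sum_inverse_squares_le)
    finally show ?thesis .
  qed
  let ?S1 = "{j \<in> {..<n}. int j \<ge> x0}" and ?S2 = "{j \<in> {..<n}. int j < x0}"
  have "(\<Sum>j\<in>{..<n}. (1 + \<bar>real j - x\<bar>) powr (-2)) \<le> (\<Sum>j\<in>{..<n}. 4 * (1 / (1 + real (nat \<bar>int j - x0\<bar>))\<^sup>2))"
    using le by (intro sum_mono) simp
  also have "\<dots> = 4 * ((\<Sum>j\<in>?S1. 1 / (1 + real (nat \<bar>int j - x0\<bar>))\<^sup>2) + (\<Sum>j\<in>?S2. 1 / (1 + real (nat \<bar>int j - x0\<bar>))\<^sup>2))"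
    unfolding sum_distrib_left[symmetric] by (subst sum.union_disjoint[symmetric]) (auto intro!: sum.cong arg_cong[where f = "(*) 4"])
  also have "\<dots> \<le> 4 * (2 + 2)"
    by (intro mult_left_mono add_mono half) (auto simp: inj_on_def)
  finally show ?thesis by simp
qed

text \<open>The grid spacing is of order \<open>1 / L\<^sup>2\<close>, so the values of
  \<open>L\<^sup>2 * (t - c)\<close> are separated by a constant, and the sum of inverse squares is
  bounded uniformly in \<open>L\<close> and in the centre \<open>c\<close>.\<close>

lemma sum_arc_widths_le:
  assumes "L \<ge> 1"
  shows "(\<Sum>j\<in>{..<grid_size d L}. (1 + (real L)\<^sup>2 * \<bar>real j / real (grid_size d L) - c\<bar>) powr (-2)) \<le> 16 * (real d + 1)\<^sup>2"
proof -
  let ?Q = "real (grid_size d L)"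
  have Q: "?Q \<le> (real d + 1) * (real L)\<^sup>2" "?Q > 0"
  proof -
    have "1 \<le> (real L)\<^sup>2" using assms by (simp add: one_le_power)
    thus "?Q \<le> (real d + 1) * (real L)\<^sup>2" by (simp add: grid_size_def algebra_simps)
  qed simp
  have "(1 + (real L)\<^sup>2 * \<bar>real j / ?Q - c\<bar>) powr (-2) \<le> (real d + 1)\<^sup>2 * (1 + \<bar>real j - c * ?Q\<bar>) powr (-2)" for j
  proof -
    have "\<bar>real j - c * ?Q\<bar> = ?Q * \<bar>real j / ?Q - c\<bar>"
      using Q by (simp add: abs_mult[symmetric, of ?Q, simplified] right_diff_distrib mult.commute)
    also have "\<dots> \<le> (real d + 1) * (real L)\<^sup>2 * \<bar>real j / ?Q - c\<bar>" using Q by (intro mult_right_mono) auto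
    finally have le: "\<bar>real j - c * ?Q\<bar> \<le> (real d + 1) * ((real L)\<^sup>2 * \<bar>real j / ?Q - c\<bar>)" by (simp only: mult.assoc)
    have "1 + X \<le> (1 + Y) * (real d + 1)" if "X \<le> (real d + 1) * Y" for X Y :: real
      using that by (simp add: algebra_simps)
    from this[OF le] have "(1 + \<bar>real j - c * ?Q\<bar>) / (real d + 1) \<le> 1 + (real L)\<^sup>2 * \<bar>real j / ?Q - c\<bar>"
      by (subst pos_divide_le_eq) (auto simp: add_nonneg_pos)
    hence "(1 + (real L)\<^sup>2 * \<bar>real j / ?Q - c\<bar>) powr (-2) \<le> ((1 + \<bar>real j - c * ?Q\<bar>) / (real d + 1)) powr (-2)"
      by (intro powr_mono2') (auto intro!: divide_pos_pos add_pos_nonneg)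
    also have "\<dots> = (real d + 1)\<^sup>2 * (1 + \<bar>real j - c * ?Q\<bar>) powr (-2)"
      by (simp add: powr_minus_divide powr_numeral power_divide)
    finally show ?thesis .
  qed
  hence "(\<Sum>j\<in>{..<grid_size d L}. (1 + (real L)\<^sup>2 * \<bar>real j / ?Q - c\<bar>) powr (-2)) \<le> (\<Sum>j\<in>{..<grid_size d L}. (real d + 1)\<^sup>2 * (1 + \<bar>real j - c * ?Q\<bar>) powr (-2))"
    by (intro sum_mono)
  also have "\<dots> = (real d + 1)\<^sup>2 * (\<Sum>j\<in>{..<grid_size d L}. (1 + \<bar>real j - c * ?Q\<bar>) powr (-2))" by (simp add: sum_distrib_left)
  also have "\<dots> \<le> (real d + 1)\<^sup>2 * 16" by (intro mult_left_mono sum_inverse_dist_le) auto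
  finally show ?thesis by simp
qed

text \<open>A summed form, uniform in \<open>L\<close>, of the statement that about
  \<open>R\<^sup>2\<close> frequencies have size at most \<open>R\<close>. The sum over the chosen
  centres is enlarged to all fractions: one fraction \<open>a / q\<close> gives about
  \<open>q powr (- (2 + \<eta>))\<close>, there are \<open>q + 1\<close> numerators, and
  \<open>\<eta>\<close> makes the series over \<open>q\<close> converge.\<close>

lemma sum_arc_sizes_le:
  assumes "\<eta> > (0::real)"
  shows "\<exists>C\<ge>0. \<forall>L\<ge>1. (\<Sum>j\<in>{..<grid_size d L}. arc_size L (real j / real (grid_size d L)) powr (- (2 + \<eta>))) \<le> C"
proof -
  have summ: "summable (\<lambda>q. real q powr (- (1 + \<eta>)))" using assms by (subst summable_real_powr_iff) auto
  define S where "S = (\<Sum>q. real q powr (- (1 + \<eta>)))"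
  have S0: "S \<ge> 0" unfolding S_def by (intro suminf_nonneg summ) auto
  show ?thesis
  proof (intro exI[of _ "32 * (real d + 1)\<^sup>2 * S"] conjI allI impI)
    show "0 \<le> 32 * (real d + 1)\<^sup>2 * S" using S0 by simp
    fix L :: nat assume L: "L \<ge> 1"
    let ?Q = "grid_size d L" and ?J = "{..<grid_size d L}"
    define t where "t j = real j / real ?Q" for j
    define g where "g q a j = (real q * (1 + (real L)\<^sup>2 * \<bar>t j - of_int a / real q\<bar>)) powr (- (2 + \<eta>))" for q a j
    define P where "P = (SIGMA q:{1..8*L}. {0..int q})"
    \<comment> \<open>The centre chosen for \<open>t j\<close> is one of the pairs in
      \<open>P\<close>; the terms of all other pairs are nonnegative and are added for free.\<close>
    have "(\<Sum>j\<in>?J. arc_size L (t j) powr (- (2 + \<eta>))) \<le> (\<Sum>j\<in>?J. \<Sum>(q, a)\<in>P. g q a j)"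
    proof (rule sum_mono)
      fix j assume "j \<in> ?J"
      hence t: "0 \<le> t j" "t j \<le> 1" by (auto simp: t_def)
      obtain a q where aq: "arc_center L (t j) = (a, q)" by (cases "arc_center L (t j)")
      note ac = arc_center[OF L t aq]
      have "arc_size L (t j) powr (- (2 + \<eta>)) = (\<lambda>(q, a). g q a j) (q, a)"
        unfolding g_def ac(8) arc_width_def arc_err_def aq by simp
      also have "\<dots> \<le> (\<Sum>(q, a)\<in>P. g q a j)"
        by (rule member_le_sum) (use ac in \<open>auto simp: P_def g_def\<close>)
      finally show "arc_size L (t j) powr (- (2 + \<eta>)) \<le> (\<Sum>(q, a)\<in>P. g q a j)" .
    qed
    also have "\<dots> = (\<Sum>(q, a)\<in>P. \<Sum>j\<in>?J. g q a j)"
      by (subst sum.swap) (simp add: case_prod_unfold)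
    also have "\<dots> \<le> (\<Sum>(q, a)\<in>P. real q powr (- (2 + \<eta>)) * (16 * (real d + 1)\<^sup>2))"
    proof (rule sum_mono, clarify)
      fix q a assume "(q, a) \<in> P"
      hence q: "q \<ge> 1" by (auto simp: P_def)
      have "(\<Sum>j\<in>?J. g q a j) \<le> (\<Sum>j\<in>?J. real q powr (- (2 + \<eta>)) * (1 + (real L)\<^sup>2 * \<bar>real j / real ?Q - of_int a / real q\<bar>) powr (-2))"
      proof (rule sum_mono)
        fix j
        have "g q a j = real q powr (- (2 + \<eta>)) * (1 + (real L)\<^sup>2 * \<bar>real j / real ?Q - of_int a / real q\<bar>) powr (- (2 + \<eta>))"
          unfolding g_def t_def by (subst powr_mult) auto
        also have "\<dots> \<le> real q powr (- (2 + \<eta>)) * (1 + (real L)\<^sup>2 * \<bar>real j / real ?Q - of_int a / real q\<bar>) powr (-2)"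
          using assms by (intro mult_left_mono powr_mono) auto
        finally show "g q a j \<le> real q powr (- (2 + \<eta>)) * (1 + (real L)\<^sup>2 * \<bar>real j / real ?Q - of_int a / real q\<bar>) powr (-2)" .
      qed
      also have "\<dots> = real q powr (- (2 + \<eta>)) * (\<Sum>j\<in>?J. (1 + (real L)\<^sup>2 * \<bar>real j / real ?Q - of_int a / real q\<bar>) powr (-2))"
        by (simp add: sum_distrib_left)
      also have "\<dots> \<le> real q powr (- (2 + \<eta>)) * (16 * (real d + 1)\<^sup>2)"
        by (intro mult_left_mono sum_arc_widths_le L) auto
      finally show "(\<Sum>j\<in>?J. g q a j) \<le> real q powr (- (2 + \<eta>)) * (16 * (real d + 1)\<^sup>2)" .
    qed
    also have "\<dots> = (\<Sum>q\<in>{1..8*L}. \<Sum>a\<in>{0..int q}. real q powr (- (2 + \<eta>)) * (16 * (real d + 1)\<^sup>2))"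
      unfolding P_def by (subst sum.Sigma) auto
    also have "\<dots> \<le> (\<Sum>q\<in>{1..8*L}. 32 * (real d + 1)\<^sup>2 * real q powr (- (1 + \<eta>)))"
    proof (rule sum_mono)
      fix q assume q: "q \<in> {1..8*L}"
      have "real q powr (- (1 + \<eta>)) = real q powr 1 * real q powr (- (2 + \<eta>))"
        unfolding powr_add[symmetric] by simp
      hence e: "real q powr (- (1 + \<eta>)) = real q * real q powr (- (2 + \<eta>))" using q by simp
      have "(\<Sum>a\<in>{0..int q}. real q powr (- (2 + \<eta>)) * (16 * (real d + 1)\<^sup>2)) = (real q + 1) * (real q powr (- (2 + \<eta>)) * (16 * (real d + 1)\<^sup>2))"
        by (simp add: nat_add_distrib)
      also have "\<dots> \<le> (2 * real q) * (real q powr (- (2 + \<eta>)) * (16 * (real d + 1)\<^sup>2))"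
        using q by (intro mult_right_mono) auto
      finally show "(\<Sum>a\<in>{0..int q}. real q powr (- (2 + \<eta>)) * (16 * (real d + 1)\<^sup>2)) \<le> 32 * (real d + 1)\<^sup>2 * real q powr (- (1 + \<eta>))"
        unfolding e by (simp add: mult_ac)
    qed
    also have "\<dots> = 32 * (real d + 1)\<^sup>2 * (\<Sum>q\<in>{1..8*L}. real q powr (- (1 + \<eta>)))" by (simp add: sum_distrib_left)
    also have "\<dots> \<le> 32 * (real d + 1)\<^sup>2 * S"
      unfolding S_def by (intro mult_left_mono sum_le_suminf summ) auto
    finally show "(\<Sum>j\<in>?J. arc_size L (real j / real ?Q) powr (- (2 + \<eta>))) \<le> 32 * (real d + 1)\<^sup>2 * S" by (simp add: t_def)
  qed
qed

section \<open>Quadratic product kernels and the smooth kernel with its mean removed\<close>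

definition quad_kernel :: "int set \<Rightarrow> real \<Rightarrow> int ^ 'd \<Rightarrow> complex" where
  "quad_kernel S t = prod_kernel S (\<lambda>m. ee (t * of_int (m\<^sup>2)))"

lemma fsupp_quad_kernel: "finite S \<Longrightarrow> fsupp (quad_kernel S t)"
  unfolding quad_kernel_def by (rule fsupp_prod_kernel)

lemma ft_quad_kernel:
  assumes "finite S"
  shows "ft (quad_kernel S t) (\<xi> :: real ^ 'd::finite) = (\<Prod>i\<in>UNIV. qsum S t (\<xi> $ i))"
  unfolding quad_kernel_def using assms by (simp add: ft_prod_kernel qsum_def ee_add)

lemma ft_quad_kernel_multiples:
  assumes "finite S" "q \<noteq> 0"
  shows "ft (quad_kernel ((*) q ` S) t) (\<xi> :: real ^ 'd::finite) = (\<Prod>i\<in>UNIV. qsum S (t * (of_int q)\<^sup>2) (of_int q * \<xi> $ i))"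
  unfolding quad_kernel_def using assms
  by (subst ft_prod_kernel) (auto intro!: prod.cong sum.cong simp: sum.reindex inj_on_def qsum_def ee_add[symmetric] power_mult_distrib algebra_simps)

lemma norm_prod_le_power:
  fixes a :: "'i::finite \<Rightarrow> complex"
  assumes "\<And>i. norm (a i) \<le> B"
  shows "norm (\<Prod>i\<in>UNIV. a i) \<le> B ^ CARD('i)"
proof -
  have "(\<Prod>i\<in>UNIV. norm (a i)) \<le> (\<Prod>i\<in>(UNIV :: 'i set). B)" by (intro prod_mono) (use assms in auto)
  thus ?thesis by (simp add: prod_norm)
qed

text \<open>
  Subtracting \<open>mean_ratio\<close> times the multiplier of the cube average makes the multiplier vanish at the zero
  frequency, which is what allows summation over the dyadic scales.
\<close>

definition mean_ratio :: "nat \<Rightarrow> nat \<Rightarrow> real \<Rightarrow> complex" where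
  "mean_ratio d U t = (qsum {- int U..int U} t 0 / of_nat (2 * U + 1)) ^ d"

definition smooth_diff :: "nat \<Rightarrow> real \<Rightarrow> real ^ 'd \<Rightarrow> complex" where
  "smooth_diff U t y = (\<Prod>i\<in>UNIV. qsum {- int U..int U} t (y $ i))
      - mean_ratio CARD('d) U t * (\<Prod>i\<in>UNIV. qsum {- int U..int U} 0 (y $ i))"

lemma norm_qsum_interval_le: "norm (qsum {- int U..int U} t x) \<le> real (2 * U + 1)"
  using norm_qsum_le[of "{- int U..int U}" t x] by (simp add: nat_add_distrib nat_mult_distrib)

lemma norm_mean_ratio_le_1: "norm (mean_ratio d U t) \<le> 1"
  unfolding mean_ratio_def norm_power using norm_qsum_interval_le[of U t 0]
  by (intro power_le_one) (auto simp: norm_divide simp del: of_nat_Suc)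

lemma qsum_0_0: "qsum {- int U..int U} 0 0 = of_nat (2 * U + 1)"
  by (simp add: qsum_def nat_add_distrib nat_mult_distrib)

lemma norm_qsum_smooth_power_le:
  assumes \<eta>: "0 < \<eta>" "\<eta> \<le> 1" and U: "U \<ge> (1::nat)" and t: "8 * real U * \<bar>t\<bar> \<le> 1"
  shows "norm (qsum {- int U..int U} t x) ^ d \<le> sqrt (160 / \<eta>) ^ d * real U ^ d * (1 + (real U)\<^sup>2 * \<bar>t\<bar>) powr (- ((1 - \<eta>) * real d / 2))"
proof -
  define M where "M = 1 + (real U)\<^sup>2 * \<bar>t\<bar>"
  have M: "M \<ge> 1" by (simp add: M_def)
  have "(M powr ((\<eta> - 1) / 2))\<^sup>2 = M powr (\<eta> - 1)" by (simp add: power2_eq_square flip: powr_add)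
  hence "(norm (qsum {- int U..int U} t x))\<^sup>2 \<le> (sqrt (160 / \<eta>) * real U * M powr ((\<eta> - 1) / 2))\<^sup>2"
    using qsum_smooth_bound[OF assms, of x] \<eta> unfolding power_mult_distrib M_def[symmetric] by simp
  hence "norm (qsum {- int U..int U} t x) \<le> sqrt (160 / \<eta>) * real U * M powr ((\<eta> - 1) / 2)"
    by (rule power2_le_imp_le) (use \<eta> in auto)
  hence "norm (qsum {- int U..int U} t x) ^ d \<le> (sqrt (160 / \<eta>) * real U * M powr ((\<eta> - 1) / 2)) ^ d"
    by (intro power_mono) auto
  also have "\<dots> = sqrt (160 / \<eta>) ^ d * real U ^ d * M powr (- ((1 - \<eta>) * real d / 2))"
    using M by (simp add: power_mult_distrib powr_power algebra_simps diff_divide_distrib add_divide_distrib)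
  finally show ?thesis by (simp add: M_def)
qed

lemma norm_mean_ratio_le:
  assumes \<eta>: "0 < \<eta>" "\<eta> \<le> 1" and U: "U \<ge> (1::nat)" and t: "8 * real U * \<bar>t\<bar> \<le> 1"
  shows "norm (mean_ratio d U t) \<le> sqrt (160 / \<eta>) ^ d * (1 + (real U)\<^sup>2 * \<bar>t\<bar>) powr (- ((1 - \<eta>) * real d / 2))"
proof -
  have "norm (mean_ratio d U t) = norm (qsum {- int U..int U} t 0) ^ d / real (2 * U + 1) ^ d"
    by (simp add: mean_ratio_def norm_power norm_divide power_divide del: of_nat_Suc)
  also have "\<dots> \<le> (sqrt (160 / \<eta>) ^ d * real U ^ d * (1 + (real U)\<^sup>2 * \<bar>t\<bar>) powr (- ((1 - \<eta>) * real d / 2))) / real U ^ d"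
    using U \<eta> by (intro frac_le norm_qsum_smooth_power_le assms power_mono) auto
  also have "\<dots> = sqrt (160 / \<eta>) ^ d * (1 + (real U)\<^sup>2 * \<bar>t\<bar>) powr (- ((1 - \<eta>) * real d / 2))" using U by simp
  finally show ?thesis .
qed

text \<open>Here \<open>\<rho>\<close> measures how far \<open>y\<close> is from the integer points.
  The first bound is the decay of both terms in \<open>t\<close>. The second uses that the
  difference vanishes at \<open>y = 0\<close>. The third is summation by parts in the coordinate
  farthest from the integers, the other coordinates being estimated trivially.\<close>

lemma smooth_diff_bounds:
  assumes \<eta>: "0 < \<eta>" "\<eta> \<le> 1"
  shows "\<exists>C\<ge>0. \<forall>U t (y :: real ^ 'd::finite) \<rho>. U \<ge> 1 \<longrightarrow> 8 * real U * \<bar>t\<bar> \<le> 1 \<longrightarrow> \<rho> = Max (range (\<lambda>i. ndist (y $ i))) \<longrightarrow>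
     norm (smooth_diff U t y) \<le> C * real U ^ CARD('d) * (1 + (real U)\<^sup>2 * \<bar>t\<bar>) powr (- ((1 - \<eta>) * real CARD('d) / 2)) \<and>
     norm (smooth_diff U t y) \<le> C * real U ^ CARD('d) * (1 + (real U)\<^sup>2 * \<bar>t\<bar>) * (real U * \<rho>) \<and>
     norm (smooth_diff U t y) * (real U * \<rho>) \<le> C * real U ^ CARD('d) * (1 + (real U)\<^sup>2 * \<bar>t\<bar>)"
proof -
  let ?d = "CARD('d)"
  define A where "A = sqrt (160 / \<eta>) ^ ?d"
  have A: "A \<ge> 0" using \<eta> by (simp add: A_def)
  define C where "C = A * (1 + 3 ^ ?d) + 48 * real ?d * 3 ^ (?d - 1) + 24 * 3 ^ (?d - 1)"
  have C: "A * (1 + 3 ^ ?d) \<le> C" "48 * real ?d * 3 ^ (?d - 1) \<le> C" "24 * 3 ^ (?d - 1) \<le> C" "C \<ge> 0" using A by (auto simp: C_def)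
  show ?thesis
  proof (intro exI[of _ C] conjI allI impI)
    fix U t and y :: "real ^ 'd" and \<rho>
    assume U: "1 \<le> U" and t: "8 * real U * \<bar>t\<bar> \<le> 1" and \<rho>: "\<rho> = Max (range (\<lambda>i. ndist (y $ i)))"
    define M where "M = 1 + (real U)\<^sup>2 * \<bar>t\<bar>"
    define s where "s = (1 - \<eta>) * real ?d / 2"
    have M: "M \<ge> 1" by (simp add: M_def)
    define h where "h i = qsum {- int U..int U} t (y $ i)" for i
    define h0 where "h0 i = qsum {- int U..int U} 0 (y $ i)" for i
    define c where "c = mean_ratio ?d U t"
    have D: "smooth_diff U t y = (\<Prod>i\<in>UNIV. h i) - c * (\<Prod>i\<in>UNIV. h0 i)"
      by (simp add: smooth_diff_def h_def h0_def c_def)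
    have nd: "ndist (y $ i) \<le> \<rho>" for i unfolding \<rho> by (rule Max_ge) auto
    have \<rho>0: "\<rho> \<ge> 0" using nd ndist_nonneg order.trans by blast
    have c1: "norm c \<le> 1" unfolding c_def by (rule norm_mean_ratio_le_1)
    have le3: "norm (qsum {- int U..int U} t' x) \<le> 3 * real U" for t' x
      using norm_qsum_interval_le[of U t' x] U by simp
    have Ud: "real U * real U ^ (?d - 1) = real U ^ ?d" by (simp flip: power_Suc)
    have prod_h: "norm (\<Prod>i\<in>UNIV. h i) \<le> A * real U ^ ?d * M powr (- s)"
    proof -
      have "norm (\<Prod>i\<in>UNIV. h i) = (\<Prod>i\<in>UNIV. norm (h i))" by (simp add: prod_norm)
      define m where "m = Max (range (\<lambda>i. norm (h i)))"
      have "m \<in> range (\<lambda>i. norm (h i))" unfolding m_def by (rule Max_in) auto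
      then obtain i where i: "m = norm (h i)" by auto
      have "norm (\<Prod>i\<in>UNIV. h i) \<le> m ^ ?d" by (rule norm_prod_le_power) (auto simp: m_def)
      also have "\<dots> \<le> A * real U ^ ?d * M powr (- s)"
        unfolding i h_def A_def M_def s_def by (rule norm_qsum_smooth_power_le[OF \<eta> U t])
      finally show ?thesis .
    qed
    have prod_h0: "norm (\<Prod>i\<in>UNIV. h0 i) \<le> 3 ^ ?d * real U ^ ?d"
      using norm_prod_le_power[of h0 "3 * real U"] le3 by (simp add: h0_def power_mult_distrib)
    have "norm (smooth_diff U t y) \<le> norm (\<Prod>i\<in>UNIV. h i) + norm c * norm (\<Prod>i\<in>UNIV. h0 i)"
      unfolding D by (rule order.trans[OF norm_triangle_ineq4]) (simp add: norm_mult)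
    also have "\<dots> \<le> A * real U ^ ?d * M powr (- s) + (A * M powr (- s)) * (3 ^ ?d * real U ^ ?d)"
      using A norm_mean_ratio_le[OF \<eta> U t, of ?d]
      by (intro add_mono prod_h mult_mono prod_h0) (auto simp: c_def A_def M_def s_def)
    also have "\<dots> = (A * (1 + 3 ^ ?d)) * (real U ^ ?d * M powr (- s))" by (simp add: algebra_simps)
    also have "\<dots> \<le> C * (real U ^ ?d * M powr (- s))" by (intro mult_right_mono C) auto
    finally show "norm (smooth_diff U t y) \<le> C * real U ^ ?d * (1 + (real U)\<^sup>2 * \<bar>t\<bar>) powr (- ((1 - \<eta>) * real ?d / 2))"
      by (simp add: M_def s_def mult_ac)

    have near: "norm ((\<Prod>i\<in>UNIV. qsum {- int U..int U} t' (y $ i)) - (\<Prod>i\<in>(UNIV :: 'd set). qsum {- int U..int U} t' 0))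
       \<le> 24 * real ?d * 3 ^ (?d - 1) * real U ^ ?d * (real U * \<rho>)" for t'
    proof -
      have "norm ((\<Prod>i\<in>UNIV. qsum {- int U..int U} t' (y $ i)) - (\<Prod>i\<in>(UNIV :: 'd set). qsum {- int U..int U} t' 0))
        \<le> real ?d * (3 * real U) ^ (?d - 1) * (24 * (real U)\<^sup>2 * \<rho>)"
      proof (rule norm_prod_diff_le)
        fix i
        show "norm (qsum {- int U..int U} t' (y $ i) - qsum {- int U..int U} t' 0) \<le> 24 * (real U)\<^sup>2 * \<rho>"
          using qsum_near_zero[OF U, of t' "y $ i"] mult_left_mono[OF nd[of i], of "24 * (real U)\<^sup>2"] by simp
      qed (use le3 in auto)
      also have "\<dots> = 24 * real ?d * 3 ^ (?d - 1) * (real U * real U ^ (?d - 1)) * (real U * \<rho>)"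
        by (simp add: power_mult_distrib power2_eq_square mult_ac)
      finally show ?thesis unfolding Ud .
    qed
    \<comment> \<open>\<open>mean_ratio\<close> is chosen so that the first product and
      \<open>c\<close> times the second take the same value at frequency zero; this value can be
      subtracted from both.\<close>
    have "smooth_diff U t y = ((\<Prod>i\<in>UNIV. h i) - (\<Prod>i\<in>(UNIV :: 'd set). qsum {- int U..int U} t 0))
       - c * ((\<Prod>i\<in>UNIV. h0 i) - (\<Prod>i\<in>(UNIV :: 'd set). qsum {- int U..int U} 0 0))"
    proof -
      have "(of_nat (2 * U + 1) :: complex) \<noteq> 0" by (simp only: of_nat_eq_0_iff)
      hence "c * (\<Prod>i\<in>(UNIV :: 'd set). qsum {- int U..int U} 0 0) = (\<Prod>i\<in>(UNIV :: 'd set). qsum {- int U..int U} t 0)"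
        unfolding c_def mean_ratio_def qsum_0_0 by (simp add: power_divide del: of_nat_add of_nat_Suc)
      thus ?thesis unfolding D right_diff_distrib by simp
    qed
    also have "norm \<dots> \<le> norm ((\<Prod>i\<in>UNIV. h i) - (\<Prod>i\<in>(UNIV :: 'd set). qsum {- int U..int U} t 0))
       + norm c * norm ((\<Prod>i\<in>UNIV. h0 i) - (\<Prod>i\<in>(UNIV :: 'd set). qsum {- int U..int U} 0 0))"
      by (rule order.trans[OF norm_triangle_ineq4]) (simp add: norm_mult)
    also have "\<dots> \<le> 24 * real ?d * 3 ^ (?d - 1) * real U ^ ?d * (real U * \<rho>) + 1 * (24 * real ?d * 3 ^ (?d - 1) * real U ^ ?d * (real U * \<rho>))"
      unfolding h_def h0_def by (intro add_mono mult_mono near c1) auto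
    also have "\<dots> = (48 * real ?d * 3 ^ (?d - 1)) * (real U ^ ?d * (real U * \<rho>))" by simp
    also have "\<dots> \<le> (C * M) * (real U ^ ?d * (real U * \<rho>))"
    proof (rule mult_right_mono)
      show "48 * real ?d * 3 ^ (?d - 1) \<le> C * M" using C mult_left_mono[OF M C(4)] by linarith
    qed (use \<rho>0 in auto)
    finally show "norm (smooth_diff U t y) \<le> C * real U ^ ?d * (1 + (real U)\<^sup>2 * \<bar>t\<bar>) * (real U * \<rho>)"
      by (simp add: M_def mult_ac)

    have "\<rho> \<in> range (\<lambda>i. ndist (y $ i))" unfolding \<rho> by (rule Max_in) auto
    then obtain i0 where i0: "\<rho> = ndist (y $ i0)" by auto
    have far: "norm (\<Prod>i\<in>UNIV. qsum {- int U..int U} t' (y $ i)) * (real U * \<rho>) \<le> 12 * 3 ^ (?d - 1) * real U ^ ?d * (1 + (real U)\<^sup>2 * \<bar>t'\<bar>)" for t'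
    proof -
      have "(\<Prod>i\<in>UNIV. norm (qsum {- int U..int U} t' (y $ i))) = norm (qsum {- int U..int U} t' (y $ i0)) * (\<Prod>i\<in>UNIV - {i0}. norm (qsum {- int U..int U} t' (y $ i)))"
        by (rule prod.remove) auto
      also have "\<dots> \<le> norm (qsum {- int U..int U} t' (y $ i0)) * (\<Prod>i\<in>UNIV - {i0}. 3 * real U)"
        by (intro mult_left_mono prod_mono) (use le3 in auto)
      also have "(\<Prod>i\<in>UNIV - {i0}. 3 * real U) = (3 * real U) ^ (?d - 1)" by (simp add: card_Diff_singleton)
      finally have "norm (\<Prod>i\<in>UNIV. qsum {- int U..int U} t' (y $ i)) * (real U * \<rho>)
          \<le> norm (qsum {- int U..int U} t' (y $ i0)) * (3 * real U) ^ (?d - 1) * (real U * \<rho>)"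
        using \<rho>0 by (intro mult_right_mono) (auto simp: prod_norm)
      also have "\<dots> = (ndist (y $ i0) * norm (qsum {- int U..int U} t' (y $ i0))) * (3 ^ (?d - 1) * (real U * real U ^ (?d - 1)))"
        by (simp add: i0 power_mult_distrib mult_ac)
      also have "\<dots> \<le> (12 * (1 + (real U)\<^sup>2 * \<bar>t'\<bar>)) * (3 ^ (?d - 1) * (real U * real U ^ (?d - 1)))"
        by (intro mult_right_mono qsum_far_bound U) auto
      finally show ?thesis unfolding Ud by (simp add: algebra_simps)
    qed
    have "norm (smooth_diff U t y) * (real U * \<rho>) \<le> (norm (\<Prod>i\<in>UNIV. h i) + norm c * norm (\<Prod>i\<in>UNIV. h0 i)) * (real U * \<rho>)"
      unfolding D using \<rho>0 by (intro mult_right_mono order.trans[OF norm_triangle_ineq4]) (auto simp: norm_mult)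
    also have "\<dots> = norm (\<Prod>i\<in>UNIV. h i) * (real U * \<rho>) + norm c * (norm (\<Prod>i\<in>UNIV. h0 i) * (real U * \<rho>))"
      by (simp add: algebra_simps)
    also have "\<dots> \<le> 12 * 3 ^ (?d - 1) * real U ^ ?d * M + 1 * (12 * 3 ^ (?d - 1) * real U ^ ?d * M)"
    proof -
      have 1: "norm (\<Prod>i\<in>UNIV. h i) * (real U * \<rho>) \<le> 12 * 3 ^ (?d - 1) * real U ^ ?d * M" using far[of t] by (simp add: h_def M_def)
      have "norm (\<Prod>i\<in>UNIV. h0 i) * (real U * \<rho>) \<le> 12 * 3 ^ (?d - 1) * real U ^ ?d * 1" using far[of 0] by (simp add: h0_def)
      also have "\<dots> \<le> 12 * 3 ^ (?d - 1) * real U ^ ?d * M" by (intro mult_left_mono M) auto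
      finally have 2: "norm (\<Prod>i\<in>UNIV. h0 i) * (real U * \<rho>) \<le> 12 * 3 ^ (?d - 1) * real U ^ ?d * M" .
      show ?thesis by (intro add_mono 1 mult_mono[OF c1 2]) (use \<rho>0 in auto)
    qed
    also have "\<dots> = (24 * 3 ^ (?d - 1)) * (real U ^ ?d * M)" by simp
    also have "\<dots> \<le> C * (real U ^ ?d * M)" using M by (intro mult_right_mono C) auto
    finally show "norm (smooth_diff U t y) * (real U * \<rho>) \<le> C * real U ^ ?d * (1 + (real U)\<^sup>2 * \<bar>t\<bar>)" by (simp add: M_def mult_ac)
  qed (rule C)
qed

section \<open>Minor arcs and factorisation on the major arcs\<close>

lemma L2_set_sum_le: "finite J \<Longrightarrow> L2_set (\<lambda>x. \<Sum>j\<in>J. g j x) X \<le> (\<Sum>j\<in>J. L2_set (g j) X)"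
proof (induction J rule: finite_induct)
  case (insert j J)
  have "L2_set (\<lambda>x. \<Sum>j\<in>insert j J. g j x) X = L2_set (\<lambda>x. g j x + (\<Sum>j\<in>J. g j x)) X" using insert.hyps by simp
  also have "\<dots> \<le> L2_set (g j) X + L2_set (\<lambda>x. \<Sum>j\<in>J. g j x) X" by (rule L2_set_triangle_ineq)
  also have "\<dots> \<le> L2_set (g j) X + (\<Sum>j\<in>J. L2_set (g j) X)" using insert.IH by simp
  finally show ?case using insert.hyps by simp
qed (simp add: L2_set_def)

lemma L2_set_cmult: "c \<ge> 0 \<Longrightarrow> L2_set (\<lambda>x. c * g x) X = c * L2_set g X"
  by (simp add: L2_set_right_distrib)

lemma L2_set_cmod_le: "fsupp g \<Longrightarrow> finite X \<Longrightarrow> L2_set (\<lambda>x. cmod (g x)) X \<le> sqrt (l2sq g)"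
  unfolding L2_set_def by (intro real_sqrt_le_mono sum_le_l2sq)

lemma L2_set_cmod_le_of_ft_le:
  fixes f :: "int ^ 'd::finite \<Rightarrow> complex"
  assumes "fsupp f" "fsupp g" "finite X" "B \<ge> 0" "\<And>\<xi>. cmod (ft g \<xi>) \<le> B * cmod (ft f \<xi>)"
  shows "L2_set (\<lambda>x. cmod (g x)) X \<le> B * sqrt (l2sq f)"
proof -
  have "L2_set (\<lambda>x. cmod (g x)) X \<le> sqrt (l2sq g)" using assms by (intro L2_set_cmod_le) auto
  also have "\<dots> \<le> sqrt (B\<^sup>2 * l2sq f)" using assms by (intro real_sqrt_le_mono l2sq_le_of_ft_le) auto
  also have "\<dots> = B * sqrt (l2sq f)" using assms by (simp add: real_sqrt_mult)
  finally show ?thesis .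
qed

definition gridfrac :: "nat \<Rightarrow> nat \<Rightarrow> nat \<Rightarrow> real" where
  "gridfrac d L j = real j / real (grid_size d L)"

lemma gridfrac_range: "j < grid_size d L \<Longrightarrow> 0 \<le> gridfrac d L j \<and> gridfrac d L j \<le> 1"
  by (simp add: gridfrac_def)

text \<open>The support is a cube: the multiplier then factors over the coordinates, and the cube
  still contains every sphere of radius at most \<open>L\<close>.\<close>

definition ball_kernel :: "nat \<Rightarrow> real \<Rightarrow> int ^ 'd \<Rightarrow> complex" where
  "ball_kernel L t = quad_kernel {- int L..int L} t"

lemma fsupp_ball_kernel: "fsupp (ball_kernel L t)"
  unfolding ball_kernel_def by (rule fsupp_quad_kernel) simp

lemma norm_ft_ball_kernel_le:
  assumes \<eta>: "0 < \<eta>" "\<eta> \<le> 1" and L: "L \<ge> 1" and t: "0 \<le> t" "t \<le> 1"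
  shows "cmod (ft (ball_kernel L t) (\<xi> :: real ^ 'd::finite))
    \<le> sqrt (1600 / \<eta>) ^ CARD('d) * real L ^ CARD('d) * arc_size L t powr (- ((1 - \<eta>) * real CARD('d) / 2))"
proof -
  obtain a q where aq: "arc_center L t = (a, q)" by (cases "arc_center L t")
  note ac = arc_center[OF L t aq]
  have b: "cmod (qsum {- int L..int L} t (\<xi> $ i)) \<le> sqrt (1600 / \<eta>) * real L * arc_size L t powr ((\<eta> - 1) / 2)" for i
  proof (rule power2_le_imp_le)
    have "(cmod (qsum {- int L..int L} t (\<xi> $ i)))\<^sup>2 \<le> 1600 / \<eta> * (real L)\<^sup>2 * (real q * (1 + (real L)\<^sup>2 * \<bar>arc_err L t\<bar>)) powr (\<eta> - 1)"
      by (subst ac(7), rule qsum_sphere_bound) (use \<eta> L ac in auto)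
    also have "real q * (1 + (real L)\<^sup>2 * \<bar>arc_err L t\<bar>) = arc_size L t" using ac(8) by (simp add: arc_width_def)
    also have "arc_size L t powr (\<eta> - 1) = (arc_size L t powr ((\<eta> - 1) / 2))\<^sup>2" by (simp add: power2_eq_square flip: powr_add)
    finally show "(cmod (qsum {- int L..int L} t (\<xi> $ i)))\<^sup>2 \<le> (sqrt (1600 / \<eta>) * real L * arc_size L t powr ((\<eta> - 1) / 2))\<^sup>2"
      using \<eta> unfolding power_mult_distrib by simp
  qed (use \<eta> in auto)
  have "cmod (ft (ball_kernel L t) \<xi>) \<le> (sqrt (1600 / \<eta>) * real L * arc_size L t powr ((\<eta> - 1) / 2)) ^ CARD('d)"
    unfolding ball_kernel_def by (subst ft_quad_kernel) (auto intro: norm_prod_le_power b)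
  also have "\<dots> = sqrt (1600 / \<eta>) ^ CARD('d) * real L ^ CARD('d) * arc_size L t powr (- ((1 - \<eta>) * real CARD('d) / 2))"
    using ac(11) by (simp add: power_mult_distrib powr_power algebra_simps diff_divide_distrib add_divide_distrib)
  finally show ?thesis .
qed

text \<open>Of the decay exponent \<open>(1 - \<eta>) * d / 2\<close> of each multiplier,
  \<open>2 + \<eta>\<close> is spent on the sum over the frequencies and \<open>s + \<eta>\<close>
  on the threshold \<open>Y\<close>. The surplus \<open>\<eta>\<close> beyond \<open>s\<close> later
  pays for the sum over the scales.\<close>

lemma minor_arcs_bound:
  fixes \<eta> s :: real
  assumes \<eta>: "0 < \<eta>" "\<eta> \<le> 1" and s: "s = real CARD('d::finite) / 2 - 2 - (real CARD('d) + 1) * \<eta>" "s > 0"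
  shows "\<exists>C\<ge>0. \<forall>L (f :: int ^ 'd \<Rightarrow> complex) X Y. L \<ge> 1 \<longrightarrow> fsupp f \<longrightarrow> finite X \<longrightarrow> Y \<ge> 1 \<longrightarrow>
     L2_set (\<lambda>x. (\<Sum>j | j < grid_size CARD('d) L \<and> Y < arc_size L (gridfrac CARD('d) L j).
        cmod (cv (ball_kernel L (gridfrac CARD('d) L j)) f x)) / real L ^ CARD('d)) X
       \<le> C * Y powr (- (s + \<eta>)) * sqrt (l2sq f)"
proof -
  let ?d = "CARD('d)"
  define \<sigma> where "\<sigma> = (1 - \<eta>) * real ?d / 2"
  define A where "A = sqrt (1600 / \<eta>) ^ ?d"
  have A: "A \<ge> 0" using \<eta> by (simp add: A_def)
  obtain C where C: "C \<ge> 0" "\<And>L. L \<ge> 1 \<Longrightarrow> (\<Sum>j\<in>{..<grid_size ?d L}. arc_size L (real j / real (grid_size ?d L)) powr (- (2 + \<eta>))) \<le> C"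
    using sum_arc_sizes_le[OF \<eta>(1), of ?d] by blast
  have d1: "real ?d \<ge> 1" by (simp add: Suc_leI)
  have sig: "\<sigma> \<ge> (2 + \<eta>) + (s + \<eta>)"
  proof -
    have "\<eta> * 4 \<le> \<eta> * (real ?d)"
    proof -
      have "real ?d / 2 - 2 > 0" using s \<eta> d1 by (smt (verit) mult_nonneg_nonneg)
      thus ?thesis using \<eta> by (intro mult_left_mono) auto
    qed
    hence "\<eta> * 2 \<le> \<eta> * real ?d" using \<eta> by linarith
    thus ?thesis unfolding \<sigma>_def s(1) by (simp add: field_simps)
  qed
  show ?thesis
  proof (intro exI[of _ "A * C"] conjI allI impI)
    show "0 \<le> A * C" using A C by simp
    fix L :: nat and f :: "int ^ 'd \<Rightarrow> complex" and X :: "(int ^ 'd) set" and Y :: real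
    assume L: "L \<ge> 1" and f: "fsupp f" and X: "finite X" and Y: "Y \<ge> 1"
    let ?Q = "grid_size ?d L" and ?t = "gridfrac ?d L"
    define J where "J = {j. j < ?Q \<and> Y < arc_size L (?t j)}"
    have finJ: "finite J" unfolding J_def by auto
    have "L2_set (\<lambda>x. (\<Sum>j\<in>J. cmod (cv (ball_kernel L (?t j)) f x)) / real L ^ ?d) X
       = (1 / real L ^ ?d) * L2_set (\<lambda>x. \<Sum>j\<in>J. cmod (cv (ball_kernel L (?t j)) f x)) X"
      by (subst L2_set_cmult[symmetric]) auto
    also have "\<dots> \<le> (1 / real L ^ ?d) * (\<Sum>j\<in>J. L2_set (\<lambda>x. cmod (cv (ball_kernel L (?t j)) f x)) X)"
      by (intro mult_left_mono L2_set_sum_le finJ) auto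
    also have "\<dots> \<le> (1 / real L ^ ?d) * (\<Sum>j\<in>J. (A * real L ^ ?d * (Y powr (- (s + \<eta>)) * arc_size L (?t j) powr (- (2 + \<eta>)))) * sqrt (l2sq f))"
    proof (intro mult_left_mono sum_mono)
      fix j assume j: "j \<in> J"
      hence t: "0 \<le> ?t j" "?t j \<le> 1" using gridfrac_range by (auto simp: J_def)
      have sz: "arc_size L (?t j) > Y" "arc_size L (?t j) > 0" using j Y by (auto simp: J_def)
      show "L2_set (\<lambda>x. cmod (cv (ball_kernel L (?t j)) f x)) X \<le> (A * real L ^ ?d * (Y powr (- (s + \<eta>)) * arc_size L (?t j) powr (- (2 + \<eta>)))) * sqrt (l2sq f)"
      proof (rule L2_set_cmod_le_of_ft_le)
        fix \<xi> :: "real ^ 'd"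
        have "cmod (ft (ball_kernel L (?t j)) \<xi>) \<le> A * real L ^ ?d * arc_size L (?t j) powr (- \<sigma>)"
          unfolding A_def \<sigma>_def by (rule norm_ft_ball_kernel_le[OF \<eta> L t])
        also have "arc_size L (?t j) powr (- \<sigma>) \<le> arc_size L (?t j) powr (- (s + \<eta>) + (- (2 + \<eta>)))"
          using sig sz Y by (intro powr_mono) auto
        also have "\<dots> = arc_size L (?t j) powr (- (s + \<eta>)) * arc_size L (?t j) powr (- (2 + \<eta>))" by (rule powr_add)
        also have "\<dots> \<le> Y powr (- (s + \<eta>)) * arc_size L (?t j) powr (- (2 + \<eta>))"
          using sz Y s \<eta> by (intro mult_right_mono powr_mono2') auto
        finally have "cmod (ft (ball_kernel L (?t j)) \<xi>) \<le> A * real L ^ ?d * (Y powr (- (s + \<eta>)) * arc_size L (?t j) powr (- (2 + \<eta>)))"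
          using A by (simp add: mult_left_mono)
        thus "cmod (ft (cv (ball_kernel L (?t j)) f) \<xi>) \<le> A * real L ^ ?d * (Y powr (- (s + \<eta>)) * arc_size L (?t j) powr (- (2 + \<eta>))) * cmod (ft f \<xi>)"
          by (simp add: ft_cv fsupp_ball_kernel f norm_mult mult_right_mono)
      qed (use f X A in \<open>auto intro: fsupp_cv fsupp_ball_kernel\<close>)
    qed auto
    also have "\<dots> = A * Y powr (- (s + \<eta>)) * sqrt (l2sq f) * (\<Sum>j\<in>J. arc_size L (?t j) powr (- (2 + \<eta>)))"
      using L by (simp add: sum_distrib_left mult_ac)
    also have "\<dots> \<le> A * Y powr (- (s + \<eta>)) * sqrt (l2sq f) * C"
    proof (rule mult_left_mono)
      have "(\<Sum>j\<in>J. arc_size L (?t j) powr (- (2 + \<eta>))) \<le> (\<Sum>j\<in>{..<?Q}. arc_size L (?t j) powr (- (2 + \<eta>)))"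
        by (rule sum_mono2) (auto simp: J_def)
      also have "\<dots> \<le> C" using C(2)[OF L] by (simp add: gridfrac_def)
      finally show "(\<Sum>j\<in>J. arc_size L (?t j) powr (- (2 + \<eta>))) \<le> C" .
    qed (use A in \<open>auto simp: l2sq_nonneg\<close>)
    finally show "L2_set (\<lambda>x. (\<Sum>j | j < ?Q \<and> Y < arc_size L (?t j). cmod (cv (ball_kernel L (?t j)) f x)) / real L ^ ?d) X
       \<le> A * C * Y powr (- (s + \<eta>)) * sqrt (l2sq f)"
      by (simp add: J_def mult_ac)
  qed
qed

definition residue_kernel :: "int \<Rightarrow> nat \<Rightarrow> int ^ 'd \<Rightarrow> complex" where
  "residue_kernel a q = quad_kernel {0..<int q} (of_int a / real q)"

text \<open>For \<open>\<tau> = 0\<close> this is the indicator of a cube in the sublattice of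
  multiples of \<open>q\<close>, which is how cube averages enter the major arcs.\<close>

definition smooth_kernel :: "nat \<Rightarrow> nat \<Rightarrow> real \<Rightarrow> int ^ 'd \<Rightarrow> complex" where
  "smooth_kernel q U \<tau> = quad_kernel ((*) (int q) ` {- int U..int U}) \<tau>"

lemma fsupp_residue_kernel: "fsupp (residue_kernel a q)"
  unfolding residue_kernel_def by (rule fsupp_quad_kernel) simp

lemma fsupp_smooth_kernel: "fsupp (smooth_kernel q U \<tau>)"
  unfolding smooth_kernel_def by (rule fsupp_quad_kernel) simp

lemma ft_residue_kernel:
  "ft (residue_kernel a q) (\<xi> :: real ^ 'd::finite) = (\<Prod>i\<in>UNIV. qsum {0..<int q} (of_int a / real q) (\<xi> $ i))"
  unfolding residue_kernel_def by (rule ft_quad_kernel) simp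

lemma ft_smooth_kernel:
  "q \<ge> 1 \<Longrightarrow> ft (smooth_kernel q U \<tau>) (\<xi> :: real ^ 'd::finite) = (\<Prod>i\<in>UNIV. qsum {- int U..int U} (\<tau> * (real q)\<^sup>2) (real q * \<xi> $ i))"
  unfolding smooth_kernel_def by (subst ft_quad_kernel_multiples) auto

text \<open>Each coordinate has size at most \<open>3 * L\<close> and is factorised with error at
  most \<open>80 * arc_size L t\<close>; replacing the coordinates one at a time exchanges one
  factor \<open>L\<close> for the size of the arc.\<close>

lemma factorisation_multiplier_bound:
  assumes L: "L \<ge> 1" and t: "0 \<le> t" "t \<le> 1" and aq: "arc_center L t = (a, q)" and qL: "q \<le> L"
  shows "cmod (ft (ball_kernel L t) (\<xi> :: real ^ 'd::finite) - ft (smooth_kernel q (L div q) (arc_err L t)) \<xi> * ft (residue_kernel a q) \<xi>)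
    \<le> 80 * real CARD('d) * 3 ^ (CARD('d) - 1) * real L ^ (CARD('d) - 1) * arc_size L t"
proof -
  note ac = arc_center[OF L t aq]
  define U where "U = L div q"
  have U: "U \<ge> 1" "q * U \<le> L" using ac qL unfolding U_def by (auto simp: div_greater_zero_iff Suc_le_eq)
  define a1 where "a1 i = qsum {- int L..int L} t (\<xi> $ i)" for i
  define b1 where "b1 i = qsum {0..<int q} (of_int a / real q) (\<xi> $ i) * qsum {- int U..int U} (arc_err L t * (real q)\<^sup>2) (real q * \<xi> $ i)" for i
  have "cmod ((\<Prod>i\<in>UNIV. a1 i) - (\<Prod>i\<in>(UNIV :: 'd set). b1 i)) \<le> real CARD('d) * (3 * real L) ^ (CARD('d) - 1) * (80 * arc_size L t)"
  proof (rule norm_prod_diff_le)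
    fix i
    have "cmod (a1 i) \<le> real (2 * L + 1)" unfolding a1_def by (rule norm_qsum_interval_le)
    thus "cmod (a1 i) \<le> 3 * real L" using L by simp
    have "cmod (b1 i) \<le> real (card {0..<int q}) * real (2 * U + 1)"
      unfolding b1_def norm_mult by (intro mult_mono norm_qsum_le norm_qsum_interval_le) auto
    also have "\<dots> \<le> real q * (3 * real U)" using U by (intro mult_mono) auto
    also have "\<dots> = 3 * real (q * U)" by simp
    also have "\<dots> \<le> 3 * real L" using U(2) by (simp del: of_nat_mult)
    finally show "cmod (b1 i) \<le> 3 * real L" .
    have "cmod (a1 i - b1 i) \<le> 80 * real q * (1 + (real L)\<^sup>2 * \<bar>arc_err L t\<bar>)"
      unfolding a1_def b1_def by (subst ac(7), rule qsum_factorisation) (use ac qL U_def in auto)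
    thus "cmod (a1 i - b1 i) \<le> 80 * arc_size L t" by (simp add: ac(8) arc_width_def)
  qed auto
  moreover have "ft (ball_kernel L t) \<xi> = (\<Prod>i\<in>UNIV. a1 i)"
    unfolding ball_kernel_def a1_def by (rule ft_quad_kernel) simp
  moreover have "ft (smooth_kernel q (L div q) (arc_err L t)) \<xi> * ft (residue_kernel a q) \<xi> = (\<Prod>i\<in>UNIV. b1 i)"
    using ac(2) by (simp add: ft_smooth_kernel ft_residue_kernel b1_def U_def prod.distrib mult.commute)
  ultimately show ?thesis by (simp add: power_mult_distrib mult_ac)
qed

text \<open>The residue kernel acts first: it depends on the fraction alone, so at all scales and
  all frequencies near that fraction the smooth kernels are applied to one and the same
  function.\<close>

definition arc_part :: "nat \<Rightarrow> real \<Rightarrow> (int ^ 'd \<Rightarrow> complex) \<Rightarrow> int ^ 'd \<Rightarrow> complex" where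
  "arc_part L t f = cv (smooth_kernel (snd (arc_center L t)) (L div snd (arc_center L t)) (arc_err L t))
      (cv (residue_kernel (fst (arc_center L t)) (snd (arc_center L t))) f)"

text \<open>Relative to the trivial bound each frequency is off by a multiple of
  \<open>arc_size / L\<close>, and the size is at most \<open>L powr \<delta>\<close>. Splitting off
  \<open>arc_size powr (- (2 + \<eta>))\<close> for the sum over the frequencies, and inserting
  \<open>R powr (- s)\<close>, costs \<open>L powr (\<delta> * (3 + \<eta> + s))\<close>; the choice
  \<open>\<delta> = 1 / (2 * d)\<close> keeps this at most \<open>L powr (1 / 2)\<close>.\<close>

lemma factorisation_error_bound:
  fixes \<eta> s :: real
  assumes \<eta>: "0 < \<eta>" "\<eta> \<le> 1" and s: "0 < s" "s \<le> real CARD('d::finite) / 2 - 2"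
  shows "\<exists>C\<ge>0. \<forall>L (f :: int ^ 'd \<Rightarrow> complex) X R. L \<ge> 1 \<longrightarrow> fsupp f \<longrightarrow> finite X \<longrightarrow> R \<ge> 1 \<longrightarrow>
     L2_set (\<lambda>x. (\<Sum>j | j < grid_size CARD('d) L \<and> R < arc_size L (gridfrac CARD('d) L j) \<and>
           arc_size L (gridfrac CARD('d) L j) \<le> real L powr (1 / (2 * real CARD('d))).
        cmod (cv (ball_kernel L (gridfrac CARD('d) L j)) f x - arc_part L (gridfrac CARD('d) L j) f x)) / real L ^ CARD('d)) X
       \<le> C * R powr (- s) * real L powr (- (1 / 2)) * sqrt (l2sq f)"
proof -
  let ?d = "CARD('d)"
  define \<delta> where "\<delta> = 1 / (2 * real ?d)"
  define A where "A = 80 * real ?d * 3 ^ (?d - 1)"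
  have A: "A \<ge> 0" by (simp add: A_def)
  have d4: "real ?d > 4" using s by linarith
  obtain C where C: "C \<ge> 0" "\<And>L. L \<ge> 1 \<Longrightarrow> (\<Sum>j\<in>{..<grid_size ?d L}. arc_size L (real j / real (grid_size ?d L)) powr (- (2 + \<eta>))) \<le> C"
    using sum_arc_sizes_le[OF \<eta>(1), of ?d] by blast
  have \<delta>: "0 < \<delta>" "\<delta> \<le> 1" "\<delta> * (3 + \<eta>) + \<delta> * s \<le> 1 / 2"
  proof -
    show "0 < \<delta>" "\<delta> \<le> 1" using d4 by (auto simp: \<delta>_def)
    have "\<delta> * (3 + \<eta>) + \<delta> * s \<le> \<delta> * (4 + (real ?d / 2 - 2))"
      unfolding distrib_left[symmetric] using \<eta> s \<open>0 < \<delta>\<close> by (intro mult_left_mono) auto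
    also have "\<dots> \<le> 1 / 2" using d4 by (simp add: \<delta>_def field_simps)
    finally show "\<delta> * (3 + \<eta>) + \<delta> * s \<le> 1 / 2" .
  qed
  show ?thesis
  proof (intro exI[of _ "A * C"] conjI allI impI)
    show "0 \<le> A * C" using A C by simp
    fix L :: nat and f :: "int ^ 'd \<Rightarrow> complex" and X :: "(int ^ 'd) set" and R :: real
    assume L: "L \<ge> 1" and f: "fsupp f" and X: "finite X" and R: "R \<ge> 1"
    let ?Q = "grid_size ?d L" and ?t = "gridfrac ?d L"
    define J where "J = {j. j < ?Q \<and> R < arc_size L (?t j) \<and> arc_size L (?t j) \<le> real L powr \<delta>}"
    have finJ: "finite J" unfolding J_def by auto
    define W where "W = R powr (- s) * real L powr (\<delta> * s) * real L powr (\<delta> * (3 + \<eta>))"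
    have L0: "real L > 0" using L by simp
    have Ld: "real L ^ ?d = real L ^ (?d - 1) * real L" by (metis One_nat_def Suc_diff_1 power_Suc2 zero_less_card_finite)
    have "L2_set (\<lambda>x. (\<Sum>j\<in>J. cmod (cv (ball_kernel L (?t j)) f x - arc_part L (?t j) f x)) / real L ^ ?d) X
       = (1 / real L ^ ?d) * L2_set (\<lambda>x. \<Sum>j\<in>J. cmod (cv (ball_kernel L (?t j)) f x - arc_part L (?t j) f x)) X"
      by (subst L2_set_cmult[symmetric]) auto
    also have "\<dots> \<le> (1 / real L ^ ?d) * (\<Sum>j\<in>J. L2_set (\<lambda>x. cmod (cv (ball_kernel L (?t j)) f x - arc_part L (?t j) f x)) X)"
      by (intro mult_left_mono L2_set_sum_le finJ) auto
    also have "\<dots> \<le> (1 / real L ^ ?d) * (\<Sum>j\<in>J. (A * real L ^ (?d - 1) * (W * arc_size L (?t j) powr (- (2 + \<eta>)))) * sqrt (l2sq f))"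
    proof (intro mult_left_mono sum_mono)
      fix j assume j: "j \<in> J"
      hence t: "0 \<le> ?t j" "?t j \<le> 1" using gridfrac_range by (auto simp: J_def)
      obtain a q where aq: "arc_center L (?t j) = (a, q)" by (cases "arc_center L (?t j)")
      note ac = arc_center[OF L t aq]
      have sz: "R < arc_size L (?t j)" "arc_size L (?t j) \<le> real L powr \<delta>" "arc_size L (?t j) > 0" using j R by (auto simp: J_def)
      have "real L powr \<delta> \<le> real L powr 1" using L \<delta> by (intro powr_mono) auto
      hence qL: "q \<le> L" using ac(10) sz L by simp
      have size: "arc_size L (?t j) \<le> W * arc_size L (?t j) powr (- (2 + \<eta>))"
      proof -
        have "arc_size L (?t j) = arc_size L (?t j) powr (3 + \<eta>) * arc_size L (?t j) powr (- (2 + \<eta>))"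
          using sz by (simp flip: powr_add)
        also have "\<dots> \<le> (real L powr \<delta>) powr (3 + \<eta>) * arc_size L (?t j) powr (- (2 + \<eta>))"
          using sz \<eta> by (intro mult_right_mono powr_mono2) auto
        also have "\<dots> = 1 * real L powr (\<delta> * (3 + \<eta>)) * arc_size L (?t j) powr (- (2 + \<eta>))" by (simp add: powr_powr)
        also have "\<dots> \<le> (R powr (- s) * real L powr (\<delta> * s)) * real L powr (\<delta> * (3 + \<eta>)) * arc_size L (?t j) powr (- (2 + \<eta>))"
        proof (intro mult_right_mono)
          have "R powr s \<le> (real L powr \<delta>) powr s" using sz R s by (intro powr_mono2) auto
          thus "1 \<le> R powr (- s) * real L powr (\<delta> * s)" using R by (simp add: powr_powr powr_minus field_simps)
        qed auto
        finally show ?thesis by (simp add: W_def)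
      qed
      show "L2_set (\<lambda>x. cmod (cv (ball_kernel L (?t j)) f x - arc_part L (?t j) f x)) X
         \<le> (A * real L ^ (?d - 1) * (W * arc_size L (?t j) powr (- (2 + \<eta>)))) * sqrt (l2sq f)"
      proof (rule L2_set_cmod_le_of_ft_le)
        have fs: "fsupp (cv (ball_kernel L (?t j)) f)" "fsupp (arc_part L (?t j) f)"
          unfolding arc_part_def by (intro fsupp_cv fsupp_ball_kernel fsupp_smooth_kernel fsupp_residue_kernel f)+
        show "fsupp (\<lambda>x. cv (ball_kernel L (?t j)) f x - arc_part L (?t j) f x)"
          using fsupp_lincomb[OF fs, of 1] by simp
        fix \<xi> :: "real ^ 'd"
        have "ft (\<lambda>x. cv (ball_kernel L (?t j)) f x - arc_part L (?t j) f x) \<xi>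
          = (ft (ball_kernel L (?t j)) \<xi> - ft (smooth_kernel q (L div q) (arc_err L (?t j))) \<xi> * ft (residue_kernel a q) \<xi>) * ft f \<xi>"
          using ft_lincomb[OF fs, of 1 \<xi>]
          by (simp add: arc_part_def aq ft_cv fsupp_cv fsupp_ball_kernel fsupp_smooth_kernel fsupp_residue_kernel f algebra_simps)
        moreover have "cmod (ft (ball_kernel L (?t j)) \<xi> - ft (smooth_kernel q (L div q) (arc_err L (?t j))) \<xi> * ft (residue_kernel a q) \<xi>)
          \<le> A * real L ^ (?d - 1) * (W * arc_size L (?t j) powr (- (2 + \<eta>)))"
          using order.trans[OF factorisation_multiplier_bound[OF L t aq qL, of \<xi>, folded A_def] mult_left_mono[OF size, of "A * real L ^ (?d - 1)"]] A
          by simp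
        ultimately show "cmod (ft (\<lambda>x. cv (ball_kernel L (?t j)) f x - arc_part L (?t j) f x) \<xi>)
            \<le> A * real L ^ (?d - 1) * (W * arc_size L (?t j) powr (- (2 + \<eta>))) * cmod (ft f \<xi>)"
          by (simp add: norm_mult mult_right_mono)
      qed (use f X A in \<open>auto simp: W_def\<close>)
    qed auto
    also have "\<dots> = A * (W / real L) * sqrt (l2sq f) * (\<Sum>j\<in>J. arc_size L (?t j) powr (- (2 + \<eta>)))"
      using L0 unfolding Ld by (simp add: sum_distrib_left mult_ac)
    also have "\<dots> \<le> A * (R powr (- s) * real L powr (- (1 / 2))) * sqrt (l2sq f) * C"
    proof (intro mult_mono mult_left_mono)
      have "W / real L = R powr (- s) * real L powr (\<delta> * (3 + \<eta>) + \<delta> * s - 1)"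
        using L0 by (simp add: W_def powr_add powr_diff)
      also have "\<dots> \<le> R powr (- s) * real L powr (- (1 / 2))"
        using \<delta>(3) L by (intro mult_left_mono powr_mono) auto
      finally show "W / real L \<le> R powr (- s) * real L powr (- (1 / 2))" .
      have "(\<Sum>j\<in>J. arc_size L (?t j) powr (- (2 + \<eta>))) \<le> (\<Sum>j\<in>{..<?Q}. arc_size L (?t j) powr (- (2 + \<eta>)))"
        by (rule sum_mono2) (auto simp: J_def)
      also have "\<dots> \<le> C" using C(2)[OF L] by (simp add: gridfrac_def)
      finally show "(\<Sum>j\<in>J. arc_size L (?t j) powr (- (2 + \<eta>))) \<le> C" .
    qed (use A in \<open>auto simp: W_def l2sq_nonneg intro!: sum_nonneg\<close>)
    finally show "L2_set (\<lambda>x. (\<Sum>j | j < ?Q \<and> R < arc_size L (?t j) \<and> arc_size L (?t j) \<le> real L powr (1 / (2 * real ?d)).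
        cmod (cv (ball_kernel L (?t j)) f x - arc_part L (?t j) f x)) / real L ^ ?d) X
       \<le> A * C * R powr (- s) * real L powr (- (1 / 2)) * sqrt (l2sq f)"
      by (simp add: J_def \<delta>_def mult_ac)
  qed
qed

section \<open>The major arcs around one fraction\<close>

lemma dyadic_multiple_bounds:
  assumes "1 \<le> q" "q \<le> (L::nat)"
  shows "1 \<le> L div q" "real (L div q) * real q \<le> real L" "real L / 2 \<le> real (L div q) * real q"
proof -
  show U: "1 \<le> L div q" using assms by (simp add: div_greater_zero_iff Suc_le_eq)
  have "(L div q) * q \<le> L" by simp
  hence "real ((L div q) * q) \<le> real L" by (simp only: of_nat_le_iff)
  thus "real (L div q) * real q \<le> real L" by simp
  have "L < (L div q) * q + q" using div_mult_mod_eq[of L q] mod_less_divisor[of q L] assms by linarith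
  also have "\<dots> \<le> 2 * ((L div q) * q)" using U mult_right_mono[OF U, of q] by simp
  finally have "real L < real (2 * ((L div q) * q))" by (simp only: of_nat_less_iff)
  thus "real L / 2 \<le> real (L div q) * real q" by simp
qed

text \<open>Up to a factor 2 from the integer division, \<open>w = (2 ^ k div q) * \<rho>\<close> is
  geometric in \<open>k\<close>, and \<open>min w (1 / w)\<close> decays geometrically on both sides
  of the scale where \<open>w\<close> is about 1. The bound is uniform in \<open>q\<close> and
  \<open>\<rho>\<close>: at each frequency effectively boundedly many scales matter.\<close>

lemma sum_dyadic_oscillation_le:
  assumes \<kappa>: "\<kappa> > (0::real)" and "finite Ks" and q: "1 \<le> q" and Ks: "\<And>k. k \<in> Ks \<Longrightarrow> q \<le> 2 ^ k" and \<rho>: "\<rho> > (0::real)"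
  shows "(\<Sum>k\<in>Ks. min (real (2 ^ k div q) * \<rho>) (1 / (real (2 ^ k div q) * \<rho>)) powr \<kappa>) \<le> 2 * 2 powr \<kappa> / (1 - 2 powr (- \<kappa>))"
proof -
  define w where "w k = 2 ^ k * \<rho> / real q" for k :: nat
  have w0: "w k > 0" for k using \<rho> q by (simp add: w_def)
  define K1 where "K1 = {k \<in> Ks. w k \<le> 1}"
  define K2 where "K2 = {k \<in> Ks. w k > 1}"
  have fin: "finite K1" "finite K2" using assms(2) by (auto simp: K1_def K2_def)
  have le: "min (real (2 ^ k div q) * \<rho>) (1 / (real (2 ^ k div q) * \<rho>)) powr \<kappa> \<le> 2 powr \<kappa> * min (w k) (1 / w k) powr \<kappa>" if k: "k \<in> Ks" for k
  proof -
    define u where "u = real (2 ^ k div q) * \<rho>"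
    note b = dyadic_multiple_bounds[OF q Ks[OF k]]
    have "real (2 ^ k div q) \<le> 2 ^ k / real q" using b(2) q by (simp add: field_simps)
    from mult_right_mono[OF this, of \<rho>] have u1: "u \<le> w k" using \<rho> by (simp add: u_def w_def)
    have "2 ^ k / real q / 2 \<le> real (2 ^ k div q)" using b(3) q by (simp add: field_simps)
    from mult_right_mono[OF this, of \<rho>] have u2: "w k / 2 \<le> u" using \<rho> by (simp add: u_def w_def)
    have u0: "u > 0" using w0[of k] u2 by linarith
    have "1 / u \<le> 1 / (w k / 2)" using u2 w0[of k] u0 by (intro divide_left_mono) auto
    hence "min u (1 / u) \<le> 2 * min (w k) (1 / w k)" using u1 w0[of k] by (auto simp: min_def)
    hence "min u (1 / u) powr \<kappa> \<le> (2 * min (w k) (1 / w k)) powr \<kappa>" using u0 \<kappa> by (intro powr_mono2) auto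
    also have "\<dots> = 2 powr \<kappa> * min (w k) (1 / w k) powr \<kappa>" using w0[of k] by (subst powr_mult) auto
    finally show ?thesis by (simp add: u_def)
  qed
  have s1: "(\<Sum>k\<in>K1. w k powr \<kappa>) \<le> 1 powr \<kappa> / (1 - 2 powr (- \<kappa>))"
  proof -
    have e: "\<rho> / real q * 2 powr (- real_of_int (- int k)) = w k" for k by (simp add: w_def powr_realpow)
    have "(\<Sum>k\<in>K1. w k powr \<kappa>) = (\<Sum>l\<in>(\<lambda>k. - int k) ` K1. (\<rho> / real q * 2 powr (- of_int l)) powr \<kappa>)"
      by (subst sum.reindex) (auto simp: inj_on_def e[simplified])
    also have "\<dots> \<le> 1 powr \<kappa> / (1 - 2 powr (- \<kappa>))"
    proof (rule sum_geometric_levels_le)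
      fix l assume "l \<in> (\<lambda>k. - int k) ` K1"
      then obtain k where k: "l = - int k" "k \<in> K1" by blast
      show "\<rho> / real q * 2 powr - real_of_int l \<le> 1" unfolding k(1) e using k(2) by (simp add: K1_def)
    qed (use fin \<kappa> \<rho> q in auto)
    finally show ?thesis .
  qed
  have s2: "(\<Sum>k\<in>K2. (1 / w k) powr \<kappa>) \<le> 1 powr \<kappa> / (1 - 2 powr (- \<kappa>))"
  proof -
    have e: "real q / \<rho> * 2 powr (- real_of_int (int k)) = 1 / w k" for k by (simp add: w_def powr_minus powr_realpow field_simps)
    have "(\<Sum>k\<in>K2. (1 / w k) powr \<kappa>) = (\<Sum>l\<in>int ` K2. (real q / \<rho> * 2 powr (- of_int l)) powr \<kappa>)"
      by (subst sum.reindex) (auto simp: inj_on_def e[simplified])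
    also have "\<dots> \<le> 1 powr \<kappa> / (1 - 2 powr (- \<kappa>))"
    proof (rule sum_geometric_levels_le)
      fix l assume "l \<in> int ` K2"
      then obtain k where k: "l = int k" "k \<in> K2" by blast
      show "real q / \<rho> * 2 powr - real_of_int l \<le> 1" unfolding k(1) e using k(2) w0[of k] by (simp add: K2_def)
    qed (use fin \<kappa> \<rho> q in auto)
    finally show ?thesis .
  qed
  have "(\<Sum>k\<in>Ks. min (real (2 ^ k div q) * \<rho>) (1 / (real (2 ^ k div q) * \<rho>)) powr \<kappa>) \<le> (\<Sum>k\<in>Ks. 2 powr \<kappa> * min (w k) (1 / w k) powr \<kappa>)"
    by (intro sum_mono le)
  also have "\<dots> = 2 powr \<kappa> * (\<Sum>k\<in>K1 \<union> K2. min (w k) (1 / w k) powr \<kappa>)"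
    unfolding sum_distrib_left by (intro sum.cong) (auto simp: K1_def K2_def)
  also have "(\<Sum>k\<in>K1 \<union> K2. min (w k) (1 / w k) powr \<kappa>) = (\<Sum>k\<in>K1. min (w k) (1 / w k) powr \<kappa>) + (\<Sum>k\<in>K2. min (w k) (1 / w k) powr \<kappa>)"
    by (rule sum.union_disjoint) (use fin in \<open>auto simp: K1_def K2_def\<close>)
  also have "\<dots> \<le> (\<Sum>k\<in>K1. w k powr \<kappa>) + (\<Sum>k\<in>K2. (1 / w k) powr \<kappa>)"
    using w0 \<kappa> by (intro add_mono sum_mono powr_mono2) (auto simp: less_imp_le)
  also have "\<dots> \<le> 2 / (1 - 2 powr (- \<kappa>))" using s1 s2 by simp
  finally show ?thesis by (simp add: mult_left_mono mult.commute)
qed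

lemma interpolate_two_bounds:
  fixes x a b \<kappa> :: real
  assumes "0 \<le> x" "x \<le> a" "x \<le> b" "0 < \<kappa>" "\<kappa> < 1"
  shows "x\<^sup>2 \<le> a powr (2 * (1 - \<kappa>)) * b powr (2 * \<kappa>)"
proof (cases "x = 0")
  case False
  hence "x > 0" using assms by simp
  hence "x\<^sup>2 = x powr (2 * (1 - \<kappa>)) * x powr (2 * \<kappa>)" by (simp add: powr_numeral algebra_simps flip: powr_add)
  also have "\<dots> \<le> a powr (2 * (1 - \<kappa>)) * b powr (2 * \<kappa>)" using assms by (intro mult_mono powr_mono2) auto
  finally show ?thesis .
qed simp

text \<open>
  The exponent \<open>1/(2d)\<close> that delimits the major arcs only has to be small: it makes the factorisation error of
  all major arcs together at most \<open>L\<^sup>-\<^sup>1\<^sup>/\<^sup>2\<close>, up to the factor \<open>R\<^sup>-\<^sup>s\<close>.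
\<close>

definition arc_indices :: "nat \<Rightarrow> real \<Rightarrow> int \<Rightarrow> nat \<Rightarrow> nat \<Rightarrow> nat set" where
  "arc_indices d R a q L = {j. j < grid_size d L \<and> arc_center L (gridfrac d L j) = (a, q) \<and>
     R < arc_size L (gridfrac d L j) \<and> arc_size L (gridfrac d L j) \<le> real L powr (1 / (2 * real d))}"

lemma finite_arc_indices [simp]: "finite (arc_indices d R a q L)"
  unfolding arc_indices_def by auto

text \<open>\<open>M'\<close> is the arc width after rescaling from \<open>L\<close> to the length
  \<open>U\<close> on the multiples of \<open>q\<close>, hence comparable to
  \<open>arc_width\<close>. Since \<open>R < q * arc_width\<close>, a power of the width beyond
  \<open>-2\<close> may be traded for the same power of \<open>R / q\<close>, and the power
  \<open>-2\<close> is kept for the sum over the frequencies around \<open>a / q\<close>.\<close>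

lemma arc_indices_facts:
  assumes "L \<ge> 1" "d \<ge> 1" "R > 0" "j \<in> arc_indices d R a q L"
  defines "t \<equiv> gridfrac d L j" and "U \<equiv> L div q"
  defines "M' \<equiv> 1 + (real U)\<^sup>2 * \<bar>arc_err L t * (real q)\<^sup>2\<bar>"
  shows "1 \<le> q" "q \<le> L" "coprime a (int q)" "0 \<le> a" "a \<le> int q" "1 \<le> U" "8 * real U * \<bar>arc_err L t * (real q)\<^sup>2\<bar> \<le> 1"
    "arc_width L t / 4 \<le> M'" "M' \<ge> 1" "R / real q < arc_width L t" "arc_width L t \<ge> 1"
    "\<And>e. e \<ge> 0 \<Longrightarrow> M' powr (- (2 + e)) \<le> 4 powr (2 + e) * ((R / real q) powr (- e) * arc_width L t powr (-2))"
proof -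
  have j: "j < grid_size d L" "arc_center L t = (a, q)" "R < arc_size L t" "arc_size L t \<le> real L powr (1 / (2 * real d))"
    using assms(4) by (auto simp: arc_indices_def t_def)
  have t: "0 \<le> t" "t \<le> 1" using gridfrac_range[OF j(1)] by (auto simp: t_def)
  note ac = arc_center[OF assms(1) t j(2)]
  have "real L powr (1 / (2 * real d)) \<le> real L powr 1" using assms by (intro powr_mono) auto
  hence qL: "q \<le> L" using ac(10) j assms(1) by simp
  have U: "1 \<le> U" "real U * real q \<le> real L" "real L / 2 \<le> real U * real q"
    using dyadic_multiple_bounds[OF ac(2) qL] by (auto simp: U_def)
  show 1: "1 \<le> q" "q \<le> L" "coprime a (int q)" "0 \<le> a" "a \<le> int q" "1 \<le> U" using ac qL U by auto
  have "8 * real U * \<bar>arc_err L t * (real q)\<^sup>2\<bar> = 8 * (real U * real q) * (real q * \<bar>arc_err L t\<bar>)"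
    by (simp add: abs_mult power2_eq_square)
  also have "\<dots> \<le> 8 * real L * (real q * \<bar>arc_err L t\<bar>)" using U by (intro mult_right_mono) auto
  also have "\<dots> \<le> 1" using ac(4) by (simp add: mult.assoc)
  finally show "8 * real U * \<bar>arc_err L t * (real q)\<^sup>2\<bar> \<le> 1" .
  have "(real L / 2)\<^sup>2 \<le> (real U * real q)\<^sup>2" using U by (intro power_mono) auto
  hence "(real L / 2)\<^sup>2 * \<bar>arc_err L t\<bar> \<le> (real U * real q)\<^sup>2 * \<bar>arc_err L t\<bar>" by (intro mult_right_mono) auto
  thus W4: "arc_width L t / 4 \<le> M'"
    unfolding M'_def arc_width_def by (simp add: abs_mult power_mult_distrib power_divide mult_ac)
  show "M' \<ge> 1" by (simp add: M'_def)
  show Rq: "R / real q < arc_width L t" using j(3) ac(2,8) by (simp add: divide_less_eq mult.commute)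
  show W1: "arc_width L t \<ge> 1" by (rule ac)
  have q0: "real q > 0" using ac(2) by simp
  show "M' powr (- (2 + e)) \<le> 4 powr (2 + e) * ((R / real q) powr (- e) * arc_width L t powr (-2))" if e: "e \<ge> 0" for e
  proof -
    have "M' powr (- (2 + e)) \<le> 4 powr (2 + e) * arc_width L t powr (- (2 + e))"
      using W1 W4 e by (intro powr_minus_quarter_le) auto
    also have "arc_width L t powr (- (2 + e)) = arc_width L t powr (- e) * arc_width L t powr (-2)"
      unfolding powr_add[symmetric] by (rule arg_cong[where f = "(powr) (arc_width L t)"]) simp
    also have "\<dots> \<le> (R / real q) powr (- e) * arc_width L t powr (-2)"
      using Rq q0 assms(3) e by (intro mult_right_mono powr_mono2') auto
    finally show ?thesis by (simp add: mult_left_mono)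
  qed
qed

lemma sum_arc_indices_widths_le:
  assumes "L \<ge> 1"
  shows "(\<Sum>j\<in>arc_indices d R a q L. arc_width L (gridfrac d L j) powr (-2)) \<le> 16 * (real d + 1)\<^sup>2"
proof -
  have "(\<Sum>j\<in>arc_indices d R a q L. arc_width L (gridfrac d L j) powr (-2))
      = (\<Sum>j\<in>arc_indices d R a q L. (1 + (real L)\<^sup>2 * \<bar>real j / real (grid_size d L) - of_int a / real q\<bar>) powr (-2))"
    by (intro sum.cong refl) (auto simp: arc_indices_def arc_width_def arc_err_def gridfrac_def)
  also have "\<dots> \<le> (\<Sum>j\<in>{..<grid_size d L}. (1 + (real L)\<^sup>2 * \<bar>real j / real (grid_size d L) - of_int a / real q\<bar>) powr (-2))"
    by (rule sum_mono2) (auto simp: arc_indices_def)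
  also have "\<dots> \<le> 16 * (real d + 1)\<^sup>2" by (rule sum_arc_widths_le[OF assms])
  finally show ?thesis .
qed

text \<open>A geometric mean, with weights \<open>1 - \<eta>\<close> and \<open>\<eta>\<close>, of
  the decay bound and the oscillation bounds. The negative exponent of the width is at least
  \<open>4 + 2 * s\<close>: 2 to cancel the weight on the left, 2 for the sum over the frequencies,
  \<open>2 * s\<close> for the threshold. This count is the origin of the loss
  \<open>(d + 1) * \<eta>\<close> in \<open>s\<close>.\<close>

lemma smooth_diff_square_bound:
  fixes \<eta> s :: real
  assumes \<eta>: "0 < \<eta>" "\<eta> < 1" and s: "s = real CARD('d::finite) / 2 - 2 - (real CARD('d) + 1) * \<eta>" "s > 0"
  shows "\<exists>C\<ge>0. \<forall>L R a q j (\<xi> :: real ^ 'd) \<rho>. L \<ge> 1 \<longrightarrow> R > 0 \<longrightarrow> j \<in> arc_indices CARD('d) R a q L \<longrightarrow>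
     \<rho> = Max (range (\<lambda>i. ndist (real q * \<xi> $ i))) \<longrightarrow>
     (arc_width L (gridfrac CARD('d) L j))\<^sup>2 * (norm (smooth_diff (L div q) (arc_err L (gridfrac CARD('d) L j) * (real q)\<^sup>2) (\<chi> i. real q * \<xi> $ i)))\<^sup>2
       \<le> C * (real (L div q) ^ CARD('d))\<^sup>2 * ((R / real q) powr (- s))\<^sup>2 * arc_width L (gridfrac CARD('d) L j) powr (-2)
          * min (real (L div q) * \<rho>) (1 / (real (L div q) * \<rho>)) powr (2 * \<eta>)"
proof -
  let ?d = "CARD('d)"
  define \<sigma> where "\<sigma> = (1 - \<eta>) * real ?d / 2"
  obtain C where C: "C \<ge> 0" and bounds: "\<And>U t (y :: real ^ 'd) \<rho>. U \<ge> 1 \<Longrightarrow> 8 * real U * \<bar>t\<bar> \<le> 1 \<Longrightarrow> \<rho> = Max (range (\<lambda>i. ndist (y $ i))) \<Longrightarrow>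
     norm (smooth_diff U t y) \<le> C * real U ^ ?d * (1 + (real U)\<^sup>2 * \<bar>t\<bar>) powr (- \<sigma>) \<and>
     norm (smooth_diff U t y) \<le> C * real U ^ ?d * (1 + (real U)\<^sup>2 * \<bar>t\<bar>) * (real U * \<rho>) \<and>
     norm (smooth_diff U t y) * (real U * \<rho>) \<le> C * real U ^ ?d * (1 + (real U)\<^sup>2 * \<bar>t\<bar>)"
    using smooth_diff_bounds[OF \<eta>(1), where 'd = 'd] \<eta>(2) unfolding \<sigma>_def by (metis less_imp_le)
  show ?thesis
  proof (intro exI[of _ "C\<^sup>2 * 4 powr (4 + 2 * s)"] conjI allI impI)
    show "0 \<le> C\<^sup>2 * 4 powr (4 + 2 * s)" by simp
    fix L and R :: real and a q j and \<xi> :: "real ^ 'd" and \<rho>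
    assume L: "L \<ge> 1" and R: "R > 0" and j: "j \<in> arc_indices ?d R a q L" and \<rho>: "\<rho> = Max (range (\<lambda>i. ndist (real q * \<xi> $ i)))"
    define U where "U = L div q"
    define t where "t = arc_err L (gridfrac ?d L j) * (real q)\<^sup>2"
    define y where "y = (\<chi> i. real q * \<xi> $ i)"
    define M where "M = 1 + (real U)\<^sup>2 * \<bar>t\<bar>"
    define W where "W = arc_width L (gridfrac ?d L j)"
    have d1: "?d \<ge> 1" by (simp add: Suc_leI)
    note af = arc_indices_facts[OF L d1 R j, folded U_def, folded t_def, folded M_def W_def]
    have U: "1 \<le> U" and t: "8 * real U * \<bar>t\<bar> \<le> 1" and M1: "M \<ge> 1" and W1: "W \<ge> 1" using af by auto
    have \<rho>y: "\<rho> = Max (range (\<lambda>i. ndist (y $ i)))" by (simp add: y_def \<rho>)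
    have "ndist (y $ i) \<le> \<rho>" for i unfolding \<rho>y by (rule Max_ge) auto
    hence \<rho>0: "\<rho> \<ge> 0" using ndist_nonneg order.trans by blast
    define z where "z = min (real U * \<rho>) (1 / (real U * \<rho>))"
    note b = bounds[OF U t \<rho>y, folded M_def]
    have b2: "norm (smooth_diff U t y) \<le> C * real U ^ ?d * M * z"
    proof (cases "\<rho> = 0")
      case True
      thus ?thesis using b by (simp add: z_def)
    next
      case False
      hence "real U * \<rho> > 0" using \<rho>0 U by simp
      moreover from this have "norm (smooth_diff U t y) \<le> C * real U ^ ?d * M * (1 / (real U * \<rho>))"
        using b by (simp add: field_simps)
      ultimately show ?thesis using b by (auto simp: z_def min_def)
    qed
    have z0: "z \<ge> 0" using \<rho>0 by (simp add: z_def)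
    define B where "B = C * real U ^ ?d"
    have B0: "B \<ge> 0" using C by (simp add: B_def)
    have "(norm (smooth_diff U t y))\<^sup>2 \<le> (B * M powr (- \<sigma>)) powr (2 * (1 - \<eta>)) * (B * M * z) powr (2 * \<eta>)"
      by (rule interpolate_two_bounds) (use b b2 \<eta> in \<open>auto simp: B_def\<close>)
    also have "\<dots> = (B powr (2 * (1 - \<eta>)) * B powr (2 * \<eta>)) * (M powr (- \<sigma> * (2 * (1 - \<eta>))) * M powr (2 * \<eta>)) * z powr (2 * \<eta>)"
      using B0 M1 z0 by (simp add: powr_mult powr_powr mult_ac)
    also have "B powr (2 * (1 - \<eta>)) * B powr (2 * \<eta>) = B\<^sup>2"
      using B0 by (cases "B = 0") (auto simp: powr_numeral simp flip: powr_add)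
    also have "M powr (- \<sigma> * (2 * (1 - \<eta>))) * M powr (2 * \<eta>) \<le> M powr (- (2 + (2 + 2 * s)))"
    proof -
      have "- \<sigma> * (2 * (1 - \<eta>)) + 2 * \<eta> \<le> - (2 + (2 + 2 * s))"
      proof -
        have "\<sigma> * (2 * (1 - \<eta>)) = real ?d - 2 * \<eta> * real ?d + \<eta>\<^sup>2 * real ?d" by (simp add: \<sigma>_def power2_eq_square field_simps)
        moreover have "\<eta>\<^sup>2 * real ?d \<ge> 0" by simp
        ultimately show ?thesis unfolding s(1) by (simp add: algebra_simps)
      qed
      thus ?thesis using M1 unfolding powr_add[symmetric] by (intro powr_mono) auto
    qed
    also have "M powr (- (2 + (2 + 2 * s))) \<le> 4 powr (2 + (2 + 2 * s)) * W powr (- (2 + (2 + 2 * s)))"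
      using af(8) W1 s by (intro powr_minus_quarter_le) auto
    also have "W powr (- (2 + (2 + 2 * s))) = W powr (-2) * (W powr (-2) * (W powr (- s))\<^sup>2)"
      unfolding power2_eq_square powr_add[symmetric] by (rule arg_cong[where f = "(powr) W"]) simp
    finally have "(norm (smooth_diff U t y))\<^sup>2 \<le> B\<^sup>2 * (4 powr (2 + (2 + 2 * s)) * (W powr (-2) * (W powr (-2) * (W powr (- s))\<^sup>2))) * z powr (2 * \<eta>)"
      using B0 by (simp add: mult_left_mono mult_right_mono)
    hence "W\<^sup>2 * (norm (smooth_diff U t y))\<^sup>2 \<le> W\<^sup>2 * (B\<^sup>2 * (4 powr (2 + (2 + 2 * s)) * (W powr (-2) * (W powr (-2) * (W powr (- s))\<^sup>2))) * z powr (2 * \<eta>))"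
      by (rule mult_left_mono) simp
    also have "\<dots> = (W\<^sup>2 * W powr (-2)) * B\<^sup>2 * 4 powr (4 + 2 * s) * (W powr (- s))\<^sup>2 * W powr (-2) * z powr (2 * \<eta>)"
      by (simp add: mult_ac add.assoc[symmetric])
    also have "W\<^sup>2 * W powr (-2) = 1" using W1 by (simp add: powr_minus powr_numeral)
    also have "1 * B\<^sup>2 * 4 powr (4 + 2 * s) * (W powr (- s))\<^sup>2 * W powr (-2) * z powr (2 * \<eta>)
       \<le> 1 * B\<^sup>2 * 4 powr (4 + 2 * s) * ((R / real q) powr (- s))\<^sup>2 * W powr (-2) * z powr (2 * \<eta>)"
      using af(1,10) R s by (intro mult_right_mono mult_left_mono power_mono powr_mono2') auto
    finally show "W\<^sup>2 * (norm (smooth_diff U t y))\<^sup>2 \<le> C\<^sup>2 * 4 powr (4 + 2 * s) * (real U ^ ?d)\<^sup>2 * ((R / real q) powr (- s))\<^sup>2 * W powr (-2) * z powr (2 * \<eta>)"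
      by (simp add: B_def power_mult_distrib mult_ac)
  qed
qed

lemma norm_cv_smooth_kernel_le:
  fixes F :: "int ^ 'd::finite \<Rightarrow> complex"
  assumes q: "q \<ge> 1"
  shows "cmod (cv (smooth_kernel q U \<tau>) F x) \<le> real (card (cube U :: (int ^ 'd) set)) * lattice_avg (int q) U (\<lambda>y. cmod (F y)) x"
proof -
  let ?A = "(\<lambda>u. int q *s u) ` (cube U :: (int ^ 'd) set)"
  have inj: "inj_on (\<lambda>u. int q *s u) (cube U :: (int ^ 'd) set)" using q by (auto simp: inj_on_def vec_eq_iff)
  have "cv (smooth_kernel q U \<tau>) F x = (\<Sum>m\<in>?A. smooth_kernel q U \<tau> m * F (x - m))"
  proof (rule cv_eq)
    fix m :: "int ^ 'd" assume m: "m \<notin> ?A"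
    show "smooth_kernel q U \<tau> m = 0"
    proof (rule ccontr)
      assume "smooth_kernel q U \<tau> m \<noteq> 0"
      hence "\<forall>i. m $ i \<in> (*) (int q) ` {- int U..int U}" by (auto simp: smooth_kernel_def quad_kernel_def prod_kernel_def split: if_splits)
      hence "\<forall>i. \<exists>v. v \<in> {- int U..int U} \<and> m $ i = int q * v" by blast
      then obtain v where v: "\<And>i. v i \<in> {- int U..int U}" "\<And>i. m $ i = int q * v i" by metis
      have "m = int q *s (\<chi> i. v i)" using v(2) by (simp add: vec_eq_iff)
      moreover have "(\<chi> i. v i) \<in> cube U" unfolding cube_def using v(1) by simp
      ultimately show False using m by blast
    qed
  qed simp
  also have "cmod \<dots> \<le> (\<Sum>m\<in>?A. cmod (smooth_kernel q U \<tau> m * F (x - m)))" by (rule norm_sum)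
  also have "\<dots> \<le> (\<Sum>m\<in>?A. cmod (F (x - m)))"
  proof (rule sum_mono)
    fix m :: "int ^ 'd"
    have "cmod (smooth_kernel q U \<tau> m) \<le> 1"
      by (auto simp: smooth_kernel_def quad_kernel_def prod_kernel_def simp flip: prod_norm)
    thus "cmod (smooth_kernel q U \<tau> m * F (x - m)) \<le> cmod (F (x - m))"
      by (simp add: norm_mult mult_left_le_one_le)
  qed
  also have "\<dots> = (\<Sum>u\<in>cube U. cmod (F (x - int q *s u)))" by (simp add: sum.reindex[OF inj])
  finally show ?thesis by (simp add: lattice_avg_def card_cube)
qed

lemma ball_kernel_eq_smooth: "ball_kernel L t = smooth_kernel 1 L t"
  by (simp add: ball_kernel_def smooth_kernel_def)

lemma lattice_avg_nonneg: "(\<And>y. F y \<ge> 0) \<Longrightarrow> lattice_avg q r F x \<ge> 0"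
  by (simp add: lattice_avg_def sum_nonneg)

text \<open>All scales of \<open>Ks\<close> at one fraction: \<open>Z\<close> majorises the supremum
  over the scales, and \<open>C\<close> is independent of \<open>Ks\<close>. Each smooth kernel is
  split into a multiple of the cube sum on the multiples of \<open>q\<close>, controlled by the
  maximal function, and a part with vanishing mean, controlled by a square function. The factor
  \<open>(1 / q) ^ d\<close> is the density of that sublattice.\<close>

lemma arc_family_bound:
  fixes \<eta> s :: real
  assumes \<eta>: "0 < \<eta>" "\<eta> < 1" and s: "s = real CARD('d::finite) / 2 - 2 - (real CARD('d) + 1) * \<eta>" "s > 0"
  shows "\<exists>C\<ge>0. \<forall>a q R (F :: int ^ 'd \<Rightarrow> complex) Ks. R > 0 \<longrightarrow> q \<ge> 1 \<longrightarrow> fsupp F \<longrightarrow> finite Ks \<longrightarrow>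
    (\<exists>Z. (\<forall>x. Z x \<ge> 0) \<and>
      (\<forall>k\<in>Ks. \<forall>x. (\<Sum>j\<in>arc_indices CARD('d) R a q (2 ^ k).
         cmod (cv (smooth_kernel q (2 ^ k div q) (arc_err (2 ^ k) (gridfrac CARD('d) (2 ^ k) j))) F x)) / real (2 ^ k) ^ CARD('d) \<le> Z x) \<and>
      (\<forall>X. finite X \<longrightarrow> L2_set Z X \<le> C * ((1 / real q) ^ CARD('d) * (R / real q) powr (- s)) * sqrt (l2sq F)))"
proof -
  let ?d = "CARD('d)"
  have d1: "?d \<ge> 1" by (simp add: Suc_leI)
  define \<sigma> where "\<sigma> = (1 - \<eta>) * real ?d / 2"
  have \<sigma>: "\<sigma> \<ge> 2 + s"
  proof -
    have "0 \<le> \<eta> * real ?d" using \<eta> by simp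
    thus ?thesis unfolding \<sigma>_def s(1) using \<eta> by (simp add: field_simps)
  qed
  define A where "A = sqrt (160 / \<eta>) ^ ?d"
  have A: "A \<ge> 0" using \<eta> by (simp add: A_def)
  define C3 where "C3 = 16 * (real ?d + 1)\<^sup>2"
  have C3: "C3 \<ge> 0" by (simp add: C3_def)
  define C4 where "C4 = 2 * 2 powr (2 * \<eta>) / (1 - 2 powr (- (2 * \<eta>)))"
  have "2 powr (- (2 * \<eta>)) < (1::real)" using \<eta> by (intro powr_less_one) auto
  hence C4: "C4 \<ge> 0" by (simp add: C4_def)
  obtain C1 where C1: "C1 \<ge> 0" and diff_bound: "\<And>L R a q j (\<xi> :: real ^ 'd) \<rho>. L \<ge> 1 \<Longrightarrow> R > 0 \<Longrightarrow> j \<in> arc_indices ?d R a q L \<Longrightarrow>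
     \<rho> = Max (range (\<lambda>i. ndist (real q * \<xi> $ i))) \<Longrightarrow>
     (arc_width L (gridfrac ?d L j))\<^sup>2 * (norm (smooth_diff (L div q) (arc_err L (gridfrac ?d L j) * (real q)\<^sup>2) (\<chi> i. real q * \<xi> $ i)))\<^sup>2
       \<le> C1 * (real (L div q) ^ ?d)\<^sup>2 * ((R / real q) powr (- s))\<^sup>2 * arc_width L (gridfrac ?d L j) powr (-2)
          * min (real (L div q) * \<rho>) (1 / (real (L div q) * \<rho>)) powr (2 * \<eta>)"
    using smooth_diff_square_bound[OF \<eta> s] by blast
  obtain C2 where C2: "C2 \<ge> 0" and maximal: "\<And>q F X (r :: int ^ 'd \<Rightarrow> nat). q \<noteq> 0 \<Longrightarrow> fsupp F \<Longrightarrow> finite X \<Longrightarrow>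
     (\<Sum>x\<in>X. (lattice_avg q (r x) (\<lambda>y. cmod (F y)) x)\<^sup>2) \<le> C2 * l2sq F"
    using lattice_maximal_l2[where 'd = 'd] by blast
  define Cs where "Cs = C3 * (C1 * C3 * C4)"
  have Cs: "Cs \<ge> 0" using C1 C3 C4 by (simp add: Cs_def)
  define Ch where "Ch = A * 4 powr (2 + s) * C3 * 3 ^ ?d"
  have Ch: "Ch \<ge> 0" using A C3 by (simp add: Ch_def)
  show ?thesis
  proof (intro exI[of _ "sqrt Cs + Ch * sqrt C2"] conjI allI impI)
    show "0 \<le> sqrt Cs + Ch * sqrt C2" using Cs Ch C2 by simp
    fix a :: int and q :: nat and R :: real and F :: "int ^ 'd \<Rightarrow> complex" and Ks :: "nat set"
    assume R: "R > 0" and q: "q \<ge> 1" and F: "fsupp F" and Ks: "finite Ks"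
    \<comment> \<open>Scales with \<open>2 ^ k < q\<close> carry no frequencies of the family;
      without them every \<open>U k\<close> is at least 1.\<close>
    define Ks' where "Ks' = {k \<in> Ks. q \<le> 2 ^ k}"
    have Ks': "finite Ks'" "\<And>k. k \<in> Ks' \<Longrightarrow> q \<le> 2 ^ k" using Ks by (auto simp: Ks'_def)
    define J where "J k = arc_indices ?d R a q (2 ^ k)" for k
    define U where "U k = (2 ^ k div q :: nat)" for k
    define \<tau> where "\<tau> k j = arc_err (2 ^ k) (gridfrac ?d (2 ^ k) j)" for k j
    define M where "M k j = arc_width (2 ^ k) (gridfrac ?d (2 ^ k) j)" for k j
    define c where "c k j = mean_ratio ?d (U k) (\<tau> k j * (real q)\<^sup>2)" for k j
    define g where "g k j x = cv (smooth_kernel q (U k) (\<tau> k j)) F x - c k j * cv (smooth_kernel q (U k) 0) F x" for k j x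
    define ND where "ND k = real (2 ^ k) ^ ?d" for k :: nat
    define E where "E = (1 / real q) ^ ?d * (R / real q) powr (- s)"
    have E0: "E \<ge> 0" by (simp add: E_def)
    have ND0: "ND k > 0" for k by (simp add: ND_def)
    have L1: "(2::nat) ^ k \<ge> 1" for k by simp
    have finJ: "finite (J k)" for k by (simp add: J_def)
    have M2: "(\<Sum>j\<in>J k. M k j powr (-2)) \<le> C3" for k
      unfolding J_def M_def C3_def by (rule sum_arc_indices_widths_le[OF L1])
    have M1: "M k j \<ge> 1" for k j by (simp add: M_def arc_width_def)
    have fg: "fsupp (g k j)" for k j
      unfolding g_def by (intro fsupp_lincomb fsupp_cv fsupp_smooth_kernel F)
    have UE: "real (U k) ^ ?d \<le> (1 / real q) ^ ?d * ND k" if "k \<in> Ks'" for k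
    proof -
      have "real (U k) \<le> 1 / real q * real (2 ^ k)" using dyadic_multiple_bounds(2)[OF q Ks'(2)[OF that]] q
        by (simp add: U_def field_simps)
      hence "real (U k) ^ ?d \<le> (1 / real q * real (2 ^ k)) ^ ?d" by (intro power_mono) auto
      thus ?thesis by (simp only: power_mult_distrib ND_def)
    qed

    have ftg: "ft (g k j) \<xi> = smooth_diff (U k) (\<tau> k j * (real q)\<^sup>2) (\<chi> i. real q * \<xi> $ i) * ft F \<xi>" for k j \<xi>
      unfolding g_def
      by (subst ft_lincomb) (auto simp: fsupp_cv fsupp_smooth_kernel F ft_cv ft_smooth_kernel[OF q] smooth_diff_def c_def algebra_simps)
    \<comment> \<open>Parseval for the whole family indexed by scale and frequency: at each
      \<open>\<xi>\<close> the inverse square of the width is summed over the frequencies and the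
      oscillation factor \<open>z\<close> over the scales.\<close>
    have square: "(\<Sum>(k, j)\<in>Sigma Ks' J. ((M k j)\<^sup>2 / (ND k)\<^sup>2) * l2sq (g k j)) \<le> (C1 * C3 * C4 * E\<^sup>2) * l2sq F"
    proof -
      have "(\<Sum>p\<in>Sigma Ks' J. (case p of (k, j) \<Rightarrow> (M k j)\<^sup>2 / (ND k)\<^sup>2) * l2sq (case p of (k, j) \<Rightarrow> g k j)) \<le> (C1 * C3 * C4 * E\<^sup>2) * l2sq F"
      proof (rule parseval_dominated)
        fix \<xi> :: "real ^ 'd"
        define \<rho> where "\<rho> = Max (range (\<lambda>i. ndist (real q * \<xi> $ i)))"
        have "ndist (real q * \<xi> $ i) \<le> \<rho>" for i unfolding \<rho>_def by (rule Max_ge) auto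
        hence \<rho>0: "\<rho> \<ge> 0" using ndist_nonneg order.trans by blast
        define z where "z k = min (real (U k) * \<rho>) (1 / (real (U k) * \<rho>)) powr (2 * \<eta>)" for k
        have z0: "z k \<ge> 0" for k by (simp add: z_def)
        have sumz: "(\<Sum>k\<in>Ks'. z k) \<le> C4"
        proof (cases "\<rho> = 0")
          case True
          thus ?thesis using C4 by (simp add: z_def)
        next
          case False
          thus ?thesis unfolding z_def U_def C4_def using \<rho>0 Ks' q \<eta>
            by (intro sum_dyadic_oscillation_le) auto
        qed
        have "(\<Sum>p\<in>Sigma Ks' J. (case p of (k, j) \<Rightarrow> (M k j)\<^sup>2 / (ND k)\<^sup>2) * (cmod (ft (case p of (k, j) \<Rightarrow> g k j) \<xi>))\<^sup>2)
          = (\<Sum>k\<in>Ks'. \<Sum>j\<in>J k. ((M k j)\<^sup>2 / (ND k)\<^sup>2) * (cmod (ft (g k j) \<xi>))\<^sup>2)"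
          by (subst sum.Sigma) (use Ks' finJ in \<open>auto simp: case_prod_unfold\<close>)
        also have "\<dots> \<le> (\<Sum>k\<in>Ks'. \<Sum>j\<in>J k. (C1 * E\<^sup>2 * z k * (cmod (ft F \<xi>))\<^sup>2) * M k j powr (-2))"
        proof (intro sum_mono)
          fix k j assume k: "k \<in> Ks'" and j: "j \<in> J k"
          have "(M k j)\<^sup>2 * (norm (smooth_diff (U k) (\<tau> k j * (real q)\<^sup>2) (\<chi> i. real q * \<xi> $ i)))\<^sup>2
            \<le> C1 * (real (U k) ^ ?d)\<^sup>2 * ((R / real q) powr (- s))\<^sup>2 * M k j powr (-2) * z k"
            using diff_bound[OF L1 R j[unfolded J_def] \<rho>_def] by (simp only: M_def U_def \<tau>_def z_def)
          also have "\<dots> \<le> C1 * ((1 / real q) ^ ?d * ND k)\<^sup>2 * ((R / real q) powr (- s))\<^sup>2 * M k j powr (-2) * z k"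
            using C1 z0 UE[OF k] by (intro mult_right_mono mult_left_mono power_mono) auto
          also have "\<dots> = (ND k)\<^sup>2 * (C1 * E\<^sup>2 * z k * M k j powr (-2))" by (simp add: E_def power_mult_distrib mult_ac)
          finally have "(M k j)\<^sup>2 * (norm (smooth_diff (U k) (\<tau> k j * (real q)\<^sup>2) (\<chi> i. real q * \<xi> $ i)))\<^sup>2 / (ND k)\<^sup>2 \<le> C1 * E\<^sup>2 * z k * M k j powr (-2)"
            using ND0[of k] by (simp add: divide_le_eq mult.commute)
          from mult_right_mono[OF this, of "(cmod (ft F \<xi>))\<^sup>2"]
          show "((M k j)\<^sup>2 / (ND k)\<^sup>2) * (cmod (ft (g k j) \<xi>))\<^sup>2 \<le> (C1 * E\<^sup>2 * z k * (cmod (ft F \<xi>))\<^sup>2) * M k j powr (-2)"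
            unfolding ftg by (simp add: norm_mult power_mult_distrib mult_ac)
        qed
        also have "\<dots> = (\<Sum>k\<in>Ks'. (C1 * E\<^sup>2 * z k * (cmod (ft F \<xi>))\<^sup>2) * (\<Sum>j\<in>J k. M k j powr (-2)))"
          by (simp add: sum_distrib_left)
        also have "\<dots> \<le> (\<Sum>k\<in>Ks'. (C1 * E\<^sup>2 * z k * (cmod (ft F \<xi>))\<^sup>2) * C3)"
          using C1 z0 by (intro sum_mono mult_left_mono M2) auto
        also have "\<dots> = (C1 * E\<^sup>2 * (cmod (ft F \<xi>))\<^sup>2 * C3) * (\<Sum>k\<in>Ks'. z k)"
          unfolding sum_distrib_left by (intro sum.cong refl) (simp add: mult_ac)
        also have "\<dots> \<le> (C1 * E\<^sup>2 * (cmod (ft F \<xi>))\<^sup>2 * C3) * C4" using C1 C3 by (intro mult_left_mono sumz) auto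
        finally show "(\<Sum>p\<in>Sigma Ks' J. (case p of (k, j) \<Rightarrow> (M k j)\<^sup>2 / (ND k)\<^sup>2) * (cmod (ft (case p of (k, j) \<Rightarrow> g k j) \<xi>))\<^sup>2)
           \<le> (C1 * C3 * C4 * E\<^sup>2) * (cmod (ft F \<xi>))\<^sup>2" by (simp add: mult_ac)
      qed (use Ks' finJ fg F in auto)
      thus ?thesis by (simp add: case_prod_unfold)
    qed

    \<comment> \<open>The square function dominates the supremum over the scales; within one scale
      the frequencies are still summed with absolute values.\<close>
    define Zs where "Zs x = sqrt (\<Sum>k\<in>Ks'. (\<Sum>j\<in>J k. cmod (g k j x) / ND k)\<^sup>2)" for x
    have Zs_bound: "L2_set Zs X \<le> sqrt Cs * E * sqrt (l2sq F)" if X: "finite X" for X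
    proof -
      have "(\<Sum>x\<in>X. (Zs x)\<^sup>2) = (\<Sum>x\<in>X. \<Sum>k\<in>Ks'. (\<Sum>j\<in>J k. cmod (g k j x) / ND k)\<^sup>2)"
        unfolding Zs_def by (intro sum.cong refl real_sqrt_pow2 sum_nonneg) auto
      also have "\<dots> \<le> (\<Sum>x\<in>X. \<Sum>k\<in>Ks'. C3 * (\<Sum>j\<in>J k. ((M k j)\<^sup>2 / (ND k)\<^sup>2) * (cmod (g k j x))\<^sup>2))"
      proof (intro sum_mono)
        fix x k
        \<comment> \<open>Cauchy-Schwarz with the weights \<open>M k j powr (-1)\<close>, whose
          squares have a sum over the frequencies bounded uniformly in the scale; the price is the
          factor \<open>(M k j)\<^sup>2\<close> that \<open>square\<close> provides for.\<close>
        have "(\<Sum>j\<in>J k. cmod (g k j x) / ND k) = (\<Sum>j\<in>J k. M k j powr (-1) * (M k j * (cmod (g k j x) / ND k)))"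
        proof (intro sum.cong refl)
          fix j have "M k j > 0" using M1[of k j] by linarith
          thus "cmod (g k j x) / ND k = M k j powr (-1) * (M k j * (cmod (g k j x) / ND k))" by (simp add: powr_minus_divide)
        qed
        hence "(\<Sum>j\<in>J k. cmod (g k j x) / ND k)\<^sup>2 \<le> (\<Sum>j\<in>J k. (M k j powr (-1))\<^sup>2) * (\<Sum>j\<in>J k. (M k j * (cmod (g k j x) / ND k))\<^sup>2)"
          by (simp only: Cauchy_Schwarz_ineq_sum)
        also have "(\<Sum>j\<in>J k. (M k j powr (-1))\<^sup>2) = (\<Sum>j\<in>J k. M k j powr (-2))"
          unfolding power2_eq_square powr_add[symmetric] by simp
        also have "(\<Sum>j\<in>J k. M k j powr (-2)) * (\<Sum>j\<in>J k. (M k j * (cmod (g k j x) / ND k))\<^sup>2) \<le> C3 * (\<Sum>j\<in>J k. (M k j * (cmod (g k j x) / ND k))\<^sup>2)"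
          by (intro mult_right_mono M2 sum_nonneg) auto
        finally show "(\<Sum>j\<in>J k. cmod (g k j x) / ND k)\<^sup>2 \<le> C3 * (\<Sum>j\<in>J k. ((M k j)\<^sup>2 / (ND k)\<^sup>2) * (cmod (g k j x))\<^sup>2)"
          by (simp add: power_mult_distrib power_divide)
      qed
      also have "\<dots> = C3 * (\<Sum>k\<in>Ks'. \<Sum>x\<in>X. \<Sum>j\<in>J k. ((M k j)\<^sup>2 / (ND k)\<^sup>2) * (cmod (g k j x))\<^sup>2)"
        by (subst sum.swap) (simp add: sum_distrib_left)
      also have "\<dots> = C3 * (\<Sum>k\<in>Ks'. \<Sum>j\<in>J k. ((M k j)\<^sup>2 / (ND k)\<^sup>2) * (\<Sum>x\<in>X. (cmod (g k j x))\<^sup>2))"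
        by (subst sum.swap) (simp add: sum_distrib_left)
      also have "\<dots> \<le> C3 * (\<Sum>k\<in>Ks'. \<Sum>j\<in>J k. ((M k j)\<^sup>2 / (ND k)\<^sup>2) * l2sq (g k j))"
        using C3 by (intro mult_left_mono sum_mono sum_le_l2sq fg X) auto
      also have "\<dots> = C3 * (\<Sum>(k, j)\<in>Sigma Ks' J. ((M k j)\<^sup>2 / (ND k)\<^sup>2) * l2sq (g k j))"
        by (subst sum.Sigma) (use Ks' finJ in auto)
      also have "\<dots> \<le> C3 * ((C1 * C3 * C4 * E\<^sup>2) * l2sq F)" using C3 by (intro mult_left_mono square) auto
      also have "\<dots> = Cs * E\<^sup>2 * l2sq F" by (simp add: Cs_def)
      finally have "L2_set Zs X \<le> sqrt (Cs * E\<^sup>2 * l2sq F)" unfolding L2_set_def by (rule real_sqrt_le_mono)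
      thus ?thesis using E0 by (simp add: real_sqrt_mult)
    qed

    \<comment> \<open>The inserted 0 keeps \<open>Max\<close> meaningful when \<open>Ks'\<close> is
      empty.\<close>
    define mx where "mx x = Max (insert 0 ((\<lambda>k. lattice_avg (int q) (U k) (\<lambda>y. cmod (F y)) x) ` Ks'))" for x
    have mx0: "mx x \<ge> 0" for x unfolding mx_def by (rule Max_ge) (use Ks' in auto)
    have mx_ge: "lattice_avg (int q) (U k) (\<lambda>y. cmod (F y)) x \<le> mx x" if "k \<in> Ks'" for k x
      unfolding mx_def by (rule Max_ge) (use Ks' that in auto)
    have mx_bound: "L2_set mx X \<le> sqrt C2 * sqrt (l2sq F)" if X: "finite X" for X
    proof -
      have "\<exists>r. mx x \<le> lattice_avg (int q) r (\<lambda>y. cmod (F y)) x" for x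
      proof -
        have "mx x \<in> insert 0 ((\<lambda>k. lattice_avg (int q) (U k) (\<lambda>y. cmod (F y)) x) ` Ks')"
          unfolding mx_def by (rule Max_in) (use Ks' in auto)
        then consider "mx x = 0" | k where "mx x = lattice_avg (int q) (U k) (\<lambda>y. cmod (F y)) x" by blast
        thus ?thesis
        proof cases
          case 1
          have "0 \<le> lattice_avg (int q) 0 (\<lambda>y. cmod (F y)) x" by (rule lattice_avg_nonneg) simp
          thus ?thesis using 1 by (intro exI[of _ 0]) simp
        qed auto
      qed
      then obtain r where r: "\<And>x. mx x \<le> lattice_avg (int q) (r x) (\<lambda>y. cmod (F y)) x" by metis
      have "(\<Sum>x\<in>X. (mx x)\<^sup>2) \<le> (\<Sum>x\<in>X. (lattice_avg (int q) (r x) (\<lambda>y. cmod (F y)) x)\<^sup>2)"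
        by (intro sum_mono power_mono r mx0)
      also have "\<dots> \<le> C2 * l2sq F" by (rule maximal) (use q F X in auto)
      finally have "L2_set mx X \<le> sqrt (C2 * l2sq F)" unfolding L2_set_def by (rule real_sqrt_le_mono)
      thus ?thesis by (simp add: real_sqrt_mult)
    qed

    have pointwise: "(\<Sum>j\<in>J k. cmod (cv (smooth_kernel q (U k) (\<tau> k j)) F x)) / ND k \<le> Zs x + Ch * E * mx x" if "k \<in> Ks" for k x
    proof (cases "k \<in> Ks'")
      case False
      hence "J k = {}" using arc_indices_facts(2)[OF L1 d1 R, of _ a q k] that by (auto simp: J_def Ks'_def)
      thus ?thesis using E0 Ch mx0 by (auto simp: Zs_def intro!: add_nonneg_nonneg sum_nonneg)
    next
      case k: True
      define h0 where "h0 = cmod (cv (smooth_kernel q (U k) 0) F x)"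
      have c: "cmod (c k j) \<le> A * (4 powr (2 + s) * ((R / real q) powr (- s) * M k j powr (-2)))" if j: "j \<in> J k" for j
      proof -
        note af = arc_indices_facts[OF L1 d1 R j[unfolded J_def], folded U_def \<tau>_def M_def]
        have "cmod (c k j) \<le> A * (1 + (real (U k))\<^sup>2 * \<bar>\<tau> k j * (real q)\<^sup>2\<bar>) powr (- \<sigma>)"
          unfolding c_def A_def \<sigma>_def by (rule norm_mean_ratio_le) (use \<eta> af in auto)
        also have "\<dots> \<le> A * (1 + (real (U k))\<^sup>2 * \<bar>\<tau> k j * (real q)\<^sup>2\<bar>) powr (- (2 + s))"
          using A \<sigma> af(9) by (intro mult_left_mono powr_mono) auto
        also have "\<dots> \<le> A * (4 powr (2 + s) * ((R / real q) powr (- s) * M k j powr (-2)))"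
          using A s by (intro mult_left_mono af(12)) auto
        finally show ?thesis .
      qed
      \<comment> \<open>The coefficients have an absolute sum over the frequencies bounded uniformly
        in the scale, so one maximal function serves them all.\<close>
      have sumc: "(\<Sum>j\<in>J k. cmod (c k j)) \<le> A * 4 powr (2 + s) * (R / real q) powr (- s) * C3"
      proof -
        have "(\<Sum>j\<in>J k. cmod (c k j)) \<le> (\<Sum>j\<in>J k. A * (4 powr (2 + s) * ((R / real q) powr (- s) * M k j powr (-2))))"
          by (intro sum_mono c)
        also have "\<dots> = A * 4 powr (2 + s) * (R / real q) powr (- s) * (\<Sum>j\<in>J k. M k j powr (-2))"
          by (simp add: sum_distrib_left mult_ac)
        also have "\<dots> \<le> A * 4 powr (2 + s) * (R / real q) powr (- s) * C3" using A by (intro mult_left_mono M2) auto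
        finally show ?thesis .
      qed
      have h0: "h0 / ND k \<le> 3 ^ ?d * (1 / real q) ^ ?d * mx x"
      proof -
        have U1: "U k \<ge> 1" using dyadic_multiple_bounds(1)[OF q Ks'(2)[OF k]] by (simp add: U_def)
        have "real (card (cube (U k) :: (int ^ 'd) set)) = real (2 * U k + 1) ^ ?d" by (simp add: card_cube)
        also have "\<dots> \<le> (3 * real (U k)) ^ ?d" using U1 by (intro power_mono) auto
        also have "\<dots> = 3 ^ ?d * real (U k) ^ ?d" by (rule power_mult_distrib)
        also have "\<dots> \<le> 3 ^ ?d * ((1 / real q) ^ ?d * ND k)" by (intro mult_left_mono UE k) auto
        finally have card: "real (card (cube (U k) :: (int ^ 'd) set)) \<le> 3 ^ ?d * ((1 / real q) ^ ?d * ND k)" .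
        have "h0 \<le> real (card (cube (U k) :: (int ^ 'd) set)) * lattice_avg (int q) (U k) (\<lambda>y. cmod (F y)) x"
          unfolding h0_def by (rule norm_cv_smooth_kernel_le[OF q])
        also have "\<dots> \<le> (3 ^ ?d * ((1 / real q) ^ ?d * ND k)) * mx x"
          using ND0[of k] by (intro mult_mono card mx_ge k) (auto intro: lattice_avg_nonneg)
        finally show ?thesis using ND0[of k] by (simp add: divide_le_eq mult_ac)
      qed
      have "(\<Sum>j\<in>J k. cmod (cv (smooth_kernel q (U k) (\<tau> k j)) F x)) \<le> (\<Sum>j\<in>J k. cmod (g k j x) + cmod (c k j) * h0)"
      proof (rule sum_mono)
        fix j
        have "cv (smooth_kernel q (U k) (\<tau> k j)) F x = g k j x + c k j * cv (smooth_kernel q (U k) 0) F x" by (simp add: g_def)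
        thus "cmod (cv (smooth_kernel q (U k) (\<tau> k j)) F x) \<le> cmod (g k j x) + cmod (c k j) * h0"
          using norm_triangle_ineq[of "g k j x" "c k j * cv (smooth_kernel q (U k) 0) F x"] by (simp add: h0_def norm_mult)
      qed
      also have "\<dots> = (\<Sum>j\<in>J k. cmod (g k j x)) + (\<Sum>j\<in>J k. cmod (c k j)) * h0"
        by (simp add: sum.distrib sum_distrib_right)
      finally have "(\<Sum>j\<in>J k. cmod (cv (smooth_kernel q (U k) (\<tau> k j)) F x)) / ND k \<le> ((\<Sum>j\<in>J k. cmod (g k j x)) + (\<Sum>j\<in>J k. cmod (c k j)) * h0) / ND k"
        using ND0[of k] by (intro divide_right_mono) auto
      also have "\<dots> = (\<Sum>j\<in>J k. cmod (g k j x) / ND k) + (\<Sum>j\<in>J k. cmod (c k j)) * (h0 / ND k)"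
        by (simp add: add_divide_distrib sum_divide_distrib)
      also have "\<dots> \<le> Zs x + (A * 4 powr (2 + s) * (R / real q) powr (- s) * C3) * (3 ^ ?d * (1 / real q) ^ ?d * mx x)"
      proof (intro add_mono mult_mono sumc h0)
        have "(\<Sum>j\<in>J k. cmod (g k j x) / ND k)\<^sup>2 \<le> (\<Sum>k\<in>Ks'. (\<Sum>j\<in>J k. cmod (g k j x) / ND k)\<^sup>2)"
          by (rule member_le_sum) (use k Ks' in auto)
        thus "(\<Sum>j\<in>J k. cmod (g k j x) / ND k) \<le> Zs x" unfolding Zs_def by (rule real_le_rsqrt)
      qed (use A C3 ND0 in \<open>auto simp: h0_def less_imp_le\<close>)
      also have "\<dots> = Zs x + Ch * E * mx x" by (simp add: Ch_def E_def mult_ac)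
      finally show ?thesis .
    qed

    show "\<exists>Z. (\<forall>x. Z x \<ge> 0) \<and>
      (\<forall>k\<in>Ks. \<forall>x. (\<Sum>j\<in>arc_indices ?d R a q (2 ^ k).
         cmod (cv (smooth_kernel q (2 ^ k div q) (arc_err (2 ^ k) (gridfrac ?d (2 ^ k) j))) F x)) / real (2 ^ k) ^ ?d \<le> Z x) \<and>
      (\<forall>X. finite X \<longrightarrow> L2_set Z X \<le> (sqrt Cs + Ch * sqrt C2) * ((1 / real q) ^ ?d * (R / real q) powr (- s)) * sqrt (l2sq F))"
    proof (intro exI[of _ "\<lambda>x. Zs x + Ch * E * mx x"] conjI allI ballI impI)
      fix x show "0 \<le> Zs x + Ch * E * mx x" using E0 Ch mx0 by (auto simp: Zs_def intro!: add_nonneg_nonneg sum_nonneg)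
    next
      fix k x assume "k \<in> Ks"
      from pointwise[OF this, of x] show "(\<Sum>j\<in>arc_indices ?d R a q (2 ^ k).
         cmod (cv (smooth_kernel q (2 ^ k div q) (arc_err (2 ^ k) (gridfrac ?d (2 ^ k) j))) F x)) / real (2 ^ k) ^ ?d \<le> Zs x + Ch * E * mx x"
        by (simp only: J_def U_def \<tau>_def ND_def)
    next
      fix X :: "(int ^ 'd) set" assume X: "finite X"
      have "L2_set (\<lambda>x. Zs x + Ch * E * mx x) X \<le> L2_set Zs X + L2_set (\<lambda>x. Ch * E * mx x) X" by (rule L2_set_triangle_ineq)
      also have "L2_set (\<lambda>x. Ch * E * mx x) X = Ch * E * L2_set mx X" using Ch E0 by (intro L2_set_cmult) auto
      also have "L2_set Zs X + Ch * E * L2_set mx X \<le> sqrt Cs * E * sqrt (l2sq F) + Ch * E * (sqrt C2 * sqrt (l2sq F))"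
        using Ch E0 by (intro add_mono mult_left_mono Zs_bound mx_bound X) auto
      finally show "L2_set (\<lambda>x. Zs x + Ch * E * mx x) X \<le> (sqrt Cs + Ch * sqrt C2) * ((1 / real q) ^ ?d * (R / real q) powr (- s)) * sqrt (l2sq F)"
        by (simp add: E_def algebra_simps)
    qed
  qed
qed

section \<open>High and low parts\<close>

text \<open>One Gauss sum per coordinate. Together with the density factor
  \<open>(1 / q) ^ d\<close> of \<open>arc_family_bound\<close> this leaves about
  \<open>q powr (- d / 2)\<close> per fraction.\<close>

lemma l2_residue_le:
  fixes f :: "int ^ 'd::finite \<Rightarrow> complex"
  assumes \<eta>: "0 < \<eta>" "\<eta> \<le> 1" and q: "1 \<le> q" and cop: "coprime a (int q)" and f: "fsupp f"
  shows "sqrt (l2sq (cv (residue_kernel a q) f)) \<le> sqrt (48 / \<eta>) ^ CARD('d) * real q powr ((1 + \<eta>) * real CARD('d) / 2) * sqrt (l2sq f)"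
proof -
  define B where "B = sqrt (48 / \<eta>) ^ CARD('d) * real q powr ((1 + \<eta>) * real CARD('d) / 2)"
  have B: "B \<ge> 0" using \<eta> by (simp add: B_def)
  have G: "cmod (qsum {0..<int q} (of_int a / real q) x) \<le> sqrt (48 / \<eta>) * real q powr ((1 + \<eta>) / 2)" for x
  proof (rule power2_le_imp_le)
    have "(real q powr ((1 + \<eta>) / 2))\<^sup>2 = real q powr (1 + \<eta>)" by (simp add: power2_eq_square flip: powr_add)
    thus "(cmod (qsum {0..<int q} (of_int a / real q) x))\<^sup>2 \<le> (sqrt (48 / \<eta>) * real q powr ((1 + \<eta>) / 2))\<^sup>2"
      using qsum_complete_bound[OF \<eta> q cop, of x] \<eta> by (simp add: power_mult_distrib)
  qed (use \<eta> in auto)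
  have "l2sq (cv (residue_kernel a q) f) \<le> B\<^sup>2 * l2sq f"
  proof (rule l2sq_le_of_ft_le)
    fix \<xi> :: "real ^ 'd"
    have "cmod (ft (residue_kernel a q) \<xi>) \<le> (sqrt (48 / \<eta>) * real q powr ((1 + \<eta>) / 2)) ^ CARD('d)"
      unfolding ft_residue_kernel by (intro norm_prod_le_power G)
    also have "\<dots> = B" using q by (simp add: B_def power_mult_distrib powr_power mult.commute)
    finally show "cmod (ft (cv (residue_kernel a q) f) \<xi>) \<le> B * cmod (ft f \<xi>)"
      by (simp add: ft_cv fsupp_residue_kernel f norm_mult mult_right_mono)
  qed (auto intro: fsupp_cv fsupp_residue_kernel f)
  hence "sqrt (l2sq (cv (residue_kernel a q) f)) \<le> sqrt (B\<^sup>2 * l2sq f)" by (rule real_sqrt_le_mono)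
  also have "\<dots> = B * sqrt (l2sq f)" using B by (simp add: real_sqrt_mult)
  finally show ?thesis by (simp add: B_def)
qed

lemma sum_powers_of_two_le:
  assumes "\<theta> > (0::real)" "finite Ks"
  shows "(\<Sum>k\<in>Ks. real (2 ^ k) powr (- \<theta>)) \<le> 1 / (1 - 2 powr (- \<theta>))"
proof -
  have "(\<Sum>k\<in>Ks. real (2 ^ k) powr (- \<theta>)) = (\<Sum>l\<in>int ` Ks. (1 * 2 powr (- of_int l)) powr \<theta>)"
    by (subst sum.reindex) (auto simp: powr_powr powr_realpow[symmetric] intro!: sum.cong)
  also have "\<dots> \<le> 1 powr \<theta> / (1 - 2 powr (- \<theta>))"
  proof (rule sum_geometric_levels_le)
    fix l assume "l \<in> int ` Ks"
    hence "- real_of_int l \<le> 0" by auto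
    thus "1 * 2 powr (- real_of_int l) \<le> 1" using powr_mono[of "- real_of_int l" 0 2] by simp
  qed (use assms in auto)
  finally show ?thesis by simp
qed

text \<open>Minor arcs, with size above both \<open>R\<close> and \<open>L powr \<delta>\<close>,
  gain \<open>L powr (- (\<delta> * \<eta>))\<close>, and the factorisation errors gain
  \<open>L powr (- (1 / 2))\<close>; both are summed over the scales by the triangle inequality. The
  main parts have no gain in \<open>L\<close> and are grouped by fraction, where
  \<open>arc_family_bound\<close> treats all scales together; a fraction with denominator
  \<open>q\<close> then contributes at most a multiple of \<open>q powr (- (2 + \<eta>))\<close>,
  which is summable over all fractions.\<close>

lemma high_part_bound:
  fixes \<eta> s :: real
  assumes \<eta>: "0 < \<eta>" "\<eta> < 1" and s: "s = real CARD('d::finite) / 2 - 2 - (real CARD('d) + 1) * \<eta>" "s > 0"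
  shows "\<exists>C\<ge>0. \<forall>R (f :: int ^ 'd \<Rightarrow> complex) Ks. R \<ge> 1 \<longrightarrow> fsupp f \<longrightarrow> finite Ks \<longrightarrow>
    (\<exists>Z. (\<forall>x. Z x \<ge> 0) \<and>
      (\<forall>k\<in>Ks. \<forall>x. (\<Sum>j | j < grid_size CARD('d) (2 ^ k) \<and> R < arc_size (2 ^ k) (gridfrac CARD('d) (2 ^ k) j).
         cmod (cv (ball_kernel (2 ^ k) (gridfrac CARD('d) (2 ^ k) j)) f x)) / real (2 ^ k) ^ CARD('d) \<le> Z x) \<and>
      (\<forall>X. finite X \<longrightarrow> L2_set Z X \<le> C * R powr (- s) * sqrt (l2sq f)))"
proof -
  let ?d = "CARD('d)"
  define \<delta> where "\<delta> = 1 / (2 * real ?d)"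
  have d0: "real ?d > 0" by simp
  have \<delta>: "\<delta> > 0" using d0 by (simp add: \<delta>_def)
  have \<eta>1: "\<eta> \<le> 1" using \<eta> by simp
  have sd: "s \<le> real ?d / 2 - 2" using s \<eta> by simp
  obtain C1 where C1: "C1 \<ge> 0" and minor: "\<And>L (f :: int ^ 'd \<Rightarrow> complex) X Y. L \<ge> 1 \<Longrightarrow> fsupp f \<Longrightarrow> finite X \<Longrightarrow> Y \<ge> 1 \<Longrightarrow>
     L2_set (\<lambda>x. (\<Sum>j | j < grid_size ?d L \<and> Y < arc_size L (gridfrac ?d L j).
        cmod (cv (ball_kernel L (gridfrac ?d L j)) f x)) / real L ^ ?d) X \<le> C1 * Y powr (- (s + \<eta>)) * sqrt (l2sq f)"
    using minor_arcs_bound[OF \<eta>(1) \<eta>1 s] by blast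
  obtain C2 where C2: "C2 \<ge> 0" and err: "\<And>L (f :: int ^ 'd \<Rightarrow> complex) X R. L \<ge> 1 \<Longrightarrow> fsupp f \<Longrightarrow> finite X \<Longrightarrow> R \<ge> 1 \<Longrightarrow>
     L2_set (\<lambda>x. (\<Sum>j | j < grid_size ?d L \<and> R < arc_size L (gridfrac ?d L j) \<and> arc_size L (gridfrac ?d L j) \<le> real L powr \<delta>.
        cmod (cv (ball_kernel L (gridfrac ?d L j)) f x - arc_part L (gridfrac ?d L j) f x)) / real L ^ ?d) X
       \<le> C2 * R powr (- s) * real L powr (- (1 / 2)) * sqrt (l2sq f)"
    using factorisation_error_bound[OF \<eta>(1) \<eta>1 s(2) sd] unfolding \<delta>_def by blast
  obtain C3 where C3: "C3 \<ge> 0" and family: "\<And>a q R (F :: int ^ 'd \<Rightarrow> complex) Ks. R > 0 \<Longrightarrow> q \<ge> 1 \<Longrightarrow> fsupp F \<Longrightarrow> finite Ks \<Longrightarrow>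
    (\<exists>Z. (\<forall>x. Z x \<ge> 0) \<and>
      (\<forall>k\<in>Ks. \<forall>x. (\<Sum>j\<in>arc_indices ?d R a q (2 ^ k).
         cmod (cv (smooth_kernel q (2 ^ k div q) (arc_err (2 ^ k) (gridfrac ?d (2 ^ k) j))) F x)) / real (2 ^ k) ^ ?d \<le> Z x) \<and>
      (\<forall>X. finite X \<longrightarrow> L2_set Z X \<le> C3 * ((1 / real q) ^ ?d * (R / real q) powr (- s)) * sqrt (l2sq F)))"
    using arc_family_bound[OF \<eta> s] by blast
  have summ: "summable (\<lambda>q. real q powr (- (1 + \<eta>)))" using \<eta> by (subst summable_real_powr_iff) auto
  define S where "S = (\<Sum>q. real q powr (- (1 + \<eta>)))"
  have S0: "S \<ge> 0" unfolding S_def by (intro suminf_nonneg summ) auto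
  define A where "A = sqrt (48 / \<eta>) ^ ?d"
  have A: "A \<ge> 0" using \<eta> by (simp add: A_def)
  define G1 where "G1 = 1 / (1 - 2 powr (- (\<delta> * \<eta>)))"
  define G2 where "G2 = 1 / (1 - 2 powr (- (1 / 2 :: real)))"
  have "2 powr (- (\<delta> * \<eta>)) < (1::real)" using \<eta> \<delta> by (intro powr_less_one) auto
  hence G1: "G1 \<ge> 0" by (simp add: G1_def)
  have "2 powr (- (1 / 2)) < (1::real)" by (intro powr_less_one) auto
  hence G2: "G2 \<ge> 0" by (simp add: G2_def)
  show ?thesis
  proof (intro exI[of _ "C1 * G1 + C2 * G2 + C3 * A * 2 * S"] conjI allI impI)
    show "0 \<le> C1 * G1 + C2 * G2 + C3 * A * 2 * S" using C1 C2 C3 G1 G2 A S0 by simp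
    fix R :: real and f :: "int ^ 'd \<Rightarrow> complex" and Ks :: "nat set"
    assume R: "R \<ge> 1" and f: "fsupp f" and Ks: "finite Ks"
    define \<Theta> where "\<Theta> k j = arc_size (2 ^ k) (gridfrac ?d (2 ^ k) j)" for k j
    define h where "h k j x = cmod (cv (ball_kernel (2 ^ k) (gridfrac ?d (2 ^ k) j)) f x)" for k j x
    define e where "e k j x = cmod (cv (ball_kernel (2 ^ k) (gridfrac ?d (2 ^ k) j)) f x - arc_part (2 ^ k) (gridfrac ?d (2 ^ k) j) f x)" for k j x
    define p where "p k j x = cmod (arc_part (2 ^ k) (gridfrac ?d (2 ^ k) j) f x)" for k j x
    define ND where "ND k = real (2 ^ k) ^ ?d" for k :: nat
    \<comment> \<open>There are sizes between \<open>R\<close> and \<open>Y k\<close> only if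
      \<open>Y k\<close> is the power of the scale; those frequencies form the major arcs.\<close>
    define Y where "Y k = max R (real (2 ^ k) powr \<delta>)" for k
    define Jmin where "Jmin k = {j. j < grid_size ?d (2 ^ k) \<and> Y k < \<Theta> k j}" for k
    define Jmaj where "Jmaj k = {j. j < grid_size ?d (2 ^ k) \<and> R < \<Theta> k j \<and> \<Theta> k j \<le> real (2 ^ k) powr \<delta>}" for k
    \<comment> \<open>A bound for all scales in \<open>Ks\<close>, hence for all denominators that
      occur, which makes the set \<open>P\<close> of fractions finite.\<close>
    define N where "N = (\<Sum>k\<in>Ks. 2 ^ k :: nat)"
    define P where "P = {(q, a). (q, a) \<in> (SIGMA q:{1..N}. {0..int q}) \<and> coprime a (int q)}"
    have finP: "finite P" unfolding P_def by (rule finite_subset[of _ "SIGMA q:{1..N}. {0..int q}"]) auto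
    have ND0: "ND k > 0" for k by (simp add: ND_def)
    have finJ: "finite (Jmin k)" "finite (Jmaj k)" for k by (auto simp: Jmin_def Jmaj_def)
    have "\<forall>q a. q \<ge> 1 \<longrightarrow> (\<exists>Z. (\<forall>x. Z x \<ge> 0) \<and>
      (\<forall>k\<in>Ks. \<forall>x. (\<Sum>j\<in>arc_indices ?d R a q (2 ^ k).
         cmod (cv (smooth_kernel q (2 ^ k div q) (arc_err (2 ^ k) (gridfrac ?d (2 ^ k) j))) (cv (residue_kernel a q) f) x)) / real (2 ^ k) ^ ?d \<le> Z x) \<and>
      (\<forall>X. finite X \<longrightarrow> L2_set Z X \<le> C3 * ((1 / real q) ^ ?d * (R / real q) powr (- s)) * sqrt (l2sq (cv (residue_kernel a q) f))))"
      using R by (intro allI impI family fsupp_cv fsupp_residue_kernel f Ks) auto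
    then obtain Zf where Zf: "\<And>q a x. q \<ge> 1 \<Longrightarrow> Zf q a x \<ge> 0"
      "\<And>q a k x. q \<ge> 1 \<Longrightarrow> k \<in> Ks \<Longrightarrow> (\<Sum>j\<in>arc_indices ?d R a q (2 ^ k).
         cmod (cv (smooth_kernel q (2 ^ k div q) (arc_err (2 ^ k) (gridfrac ?d (2 ^ k) j))) (cv (residue_kernel a q) f) x)) / real (2 ^ k) ^ ?d \<le> Zf q a x"
      "\<And>q a X. q \<ge> 1 \<Longrightarrow> finite X \<Longrightarrow> L2_set (Zf q a) X \<le> C3 * ((1 / real q) ^ ?d * (R / real q) powr (- s)) * sqrt (l2sq (cv (residue_kernel a q) f))"
      by metis
    define Z1 where "Z1 k x = (\<Sum>j\<in>Jmin k. h k j x) / ND k" for k x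
    define Z2 where "Z2 k x = (\<Sum>j\<in>Jmaj k. e k j x) / ND k" for k x
    define Z where "Z x = (\<Sum>k\<in>Ks. Z1 k x) + (\<Sum>k\<in>Ks. Z2 k x) + (\<Sum>(q, a)\<in>P. Zf q a x)" for x
    have Z12: "Z1 k x \<ge> 0" "Z2 k x \<ge> 0" for k x
      using ND0[of k] by (auto simp: Z1_def Z2_def h_def e_def intro!: divide_nonneg_pos sum_nonneg)
    have ZfP: "Zf q a x \<ge> 0" if "(q, a) \<in> P" for q a x using that by (intro Zf) (auto simp: P_def)

    have pointwise: "(\<Sum>j | j < grid_size ?d (2 ^ k) \<and> R < \<Theta> k j. h k j x) / ND k \<le> Z x" if k: "k \<in> Ks" for k x
    proof -
      have "(2::nat) ^ k \<le> N" unfolding N_def by (rule member_le_sum[OF k]) (use Ks in auto)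
      have cen: "(\<lambda>(a, q). (q, a)) (arc_center (2 ^ k) (gridfrac ?d (2 ^ k) j)) \<in> P" if j: "j \<in> Jmaj k" for j
      proof -
        obtain a q where aq: "arc_center (2 ^ k) (gridfrac ?d (2 ^ k) j) = (a, q)" by (cases "arc_center (2 ^ k) (gridfrac ?d (2 ^ k) j)")
        have "j \<in> arc_indices ?d R a q (2 ^ k)" using j aq by (auto simp: Jmaj_def arc_indices_def \<Theta>_def \<delta>_def)
        from arc_indices_facts(1-5)[OF _ _ _ this] R have "1 \<le> q" "q \<le> 2 ^ k" "coprime a (int q)" "0 \<le> a" "a \<le> int q"
          by (auto simp: Suc_leI)
        thus ?thesis using \<open>2 ^ k \<le> N\<close> by (simp add: aq P_def)
      qed
      have "(\<Sum>j\<in>Jmaj k. p k j x) = (\<Sum>y\<in>P. \<Sum>j | j \<in> Jmaj k \<and> (\<lambda>(a, q). (q, a)) (arc_center (2 ^ k) (gridfrac ?d (2 ^ k) j)) = y. p k j x)"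
        by (rule sum.group[symmetric]) (use finP finJ cen in auto)
      also have "\<dots> \<le> (\<Sum>(q, a)\<in>P. Zf q a x * ND k)"
      proof (rule sum_mono, clarify)
        fix q a assume qa: "(q, a) \<in> P"
        have J: "{j. j \<in> Jmaj k \<and> (\<lambda>(a, q). (q, a)) (arc_center (2 ^ k) (gridfrac ?d (2 ^ k) j)) = (q, a)} = arc_indices ?d R a q (2 ^ k)"
          by (auto simp: Jmaj_def arc_indices_def \<Theta>_def \<delta>_def case_prod_unfold prod_eq_iff)
        have "(\<Sum>j\<in>arc_indices ?d R a q (2 ^ k). p k j x) = (\<Sum>j\<in>arc_indices ?d R a q (2 ^ k).
         cmod (cv (smooth_kernel q (2 ^ k div q) (arc_err (2 ^ k) (gridfrac ?d (2 ^ k) j))) (cv (residue_kernel a q) f) x))"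
          by (intro sum.cong refl) (auto simp: p_def arc_part_def arc_indices_def)
        also have "\<dots> \<le> Zf q a x * ND k"
          using Zf(2)[of q k a x] qa k ND0[of k] by (simp add: ND_def divide_le_eq P_def)
        finally show "(\<Sum>j | j \<in> Jmaj k \<and> (\<lambda>(a, q). (q, a)) (arc_center (2 ^ k) (gridfrac ?d (2 ^ k) j)) = (q, a). p k j x) \<le> Zf q a x * ND k"
          unfolding J .
      qed
      also have "\<dots> = (\<Sum>(q, a)\<in>P. Zf q a x) * ND k" by (simp add: sum_distrib_right case_prod_unfold)
      finally have maj: "(\<Sum>j\<in>Jmaj k. p k j x) \<le> (\<Sum>(q, a)\<in>P. Zf q a x) * ND k" .
      have "(\<Sum>j | j < grid_size ?d (2 ^ k) \<and> R < \<Theta> k j. h k j x) \<le> (\<Sum>j\<in>Jmin k \<union> Jmaj k. h k j x)"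
        by (rule sum_mono2) (use finJ in \<open>auto simp: Jmin_def Jmaj_def Y_def h_def\<close>)
      also have "\<dots> = (\<Sum>j\<in>Jmin k. h k j x) + (\<Sum>j\<in>Jmaj k. h k j x)"
        by (rule sum.union_disjoint) (use finJ in \<open>auto simp: Jmin_def Jmaj_def Y_def\<close>)
      also have "(\<Sum>j\<in>Jmaj k. h k j x) \<le> (\<Sum>j\<in>Jmaj k. e k j x + p k j x)"
      proof (rule sum_mono)
        fix j show "h k j x \<le> e k j x + p k j x"
          unfolding h_def e_def p_def by (metis diff_add_cancel norm_triangle_ineq)
      qed
      also have "\<dots> = (\<Sum>j\<in>Jmaj k. e k j x) + (\<Sum>j\<in>Jmaj k. p k j x)" by (rule sum.distrib)
      also have "\<dots> \<le> (\<Sum>j\<in>Jmaj k. e k j x) + (\<Sum>(q, a)\<in>P. Zf q a x) * ND k" using maj by simp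
      finally have "(\<Sum>j | j < grid_size ?d (2 ^ k) \<and> R < \<Theta> k j. h k j x) \<le> (Z1 k x + Z2 k x + (\<Sum>(q, a)\<in>P. Zf q a x)) * ND k"
        using ND0[of k] by (simp add: Z1_def Z2_def distrib_right)
      hence "(\<Sum>j | j < grid_size ?d (2 ^ k) \<and> R < \<Theta> k j. h k j x) / ND k \<le> Z1 k x + Z2 k x + (\<Sum>(q, a)\<in>P. Zf q a x)"
        using ND0[of k] by (simp add: divide_le_eq)
      also have "\<dots> \<le> Z x" unfolding Z_def using Z12 Ks k by (intro add_mono member_le_sum) auto
      finally show ?thesis .
    qed

    have l2: "L2_set Z X \<le> (C1 * G1 + C2 * G2 + C3 * A * 2 * S) * R powr (- s) * sqrt (l2sq f)" if X: "finite X" for X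
    proof -
      define n where "n = R powr (- s) * sqrt (l2sq f)"
      have n0: "n \<ge> 0" by (simp add: n_def l2sq_nonneg)
      have "L2_set (\<lambda>x. \<Sum>k\<in>Ks. Z1 k x) X \<le> (\<Sum>k\<in>Ks. L2_set (Z1 k) X)" by (rule L2_set_sum_le[OF Ks])
      also have "\<dots> \<le> (\<Sum>k\<in>Ks. C1 * n * real (2 ^ k) powr (- (\<delta> * \<eta>)))"
      proof (rule sum_mono)
        fix k
        have Y: "Y k \<ge> 1" "Y k \<ge> R" "Y k \<ge> real (2 ^ k) powr \<delta>" using R by (auto simp: Y_def)
        have "L2_set (Z1 k) X \<le> C1 * Y k powr (- (s + \<eta>)) * sqrt (l2sq f)"
          unfolding Z1_def[abs_def] Jmin_def h_def \<Theta>_def ND_def by (rule minor) (use f X Y in auto)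
        also have "Y k powr (- (s + \<eta>)) = Y k powr (- s) * Y k powr (- \<eta>)"
          unfolding powr_add[symmetric] by simp
        also have "C1 * (Y k powr (- s) * Y k powr (- \<eta>)) * sqrt (l2sq f) \<le> C1 * (R powr (- s) * (real (2 ^ k) powr \<delta>) powr (- \<eta>)) * sqrt (l2sq f)"
          using C1 Y R s \<eta> by (intro mult_right_mono mult_left_mono mult_mono powr_mono2') (auto simp: l2sq_nonneg)
        finally show "L2_set (Z1 k) X \<le> C1 * n * real (2 ^ k) powr (- (\<delta> * \<eta>))" by (simp add: n_def powr_powr mult_ac)
      qed
      also have "\<dots> = C1 * n * (\<Sum>k\<in>Ks. real (2 ^ k) powr (- (\<delta> * \<eta>)))" by (simp add: sum_distrib_left)
      also have "\<dots> \<le> C1 * n * G1" unfolding G1_def using C1 n0 \<delta> \<eta> Ks by (intro mult_left_mono sum_powers_of_two_le) auto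
      finally have 1: "L2_set (\<lambda>x. \<Sum>k\<in>Ks. Z1 k x) X \<le> C1 * n * G1" .
      have "L2_set (\<lambda>x. \<Sum>k\<in>Ks. Z2 k x) X \<le> (\<Sum>k\<in>Ks. L2_set (Z2 k) X)" by (rule L2_set_sum_le[OF Ks])
      also have "\<dots> \<le> (\<Sum>k\<in>Ks. C2 * n * real (2 ^ k) powr (- (1 / 2)))"
      proof (rule sum_mono)
        fix k
        have "L2_set (Z2 k) X \<le> C2 * R powr (- s) * real (2 ^ k) powr (- (1 / 2)) * sqrt (l2sq f)"
          unfolding Z2_def[abs_def] Jmaj_def e_def \<Theta>_def ND_def by (rule err) (use f X R in auto)
        thus "L2_set (Z2 k) X \<le> C2 * n * real (2 ^ k) powr (- (1 / 2))" by (simp add: n_def mult_ac)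
      qed
      also have "\<dots> = C2 * n * (\<Sum>k\<in>Ks. real (2 ^ k) powr (- (1 / 2)))" by (simp add: sum_distrib_left)
      also have "\<dots> \<le> C2 * n * G2" unfolding G2_def using C2 n0 Ks by (intro mult_left_mono sum_powers_of_two_le) auto
      finally have 2: "L2_set (\<lambda>x. \<Sum>k\<in>Ks. Z2 k x) X \<le> C2 * n * G2" .
      have "L2_set (\<lambda>x. \<Sum>(q, a)\<in>P. Zf q a x) X \<le> (\<Sum>(q, a)\<in>P. L2_set (Zf q a) X)"
        using L2_set_sum_le[OF finP, of "\<lambda>(q, a). Zf q a" X] by (simp add: case_prod_unfold)
      also have "\<dots> \<le> (\<Sum>(q, a)\<in>P. C3 * A * n * real q powr (- (2 + \<eta>)))"
      proof (rule sum_mono, clarify)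
        fix q a assume "(q, a) \<in> P"
        hence q: "1 \<le> q" "coprime a (int q)" by (auto simp: P_def)
        have q0: "real q > 0" using q by simp
        have "L2_set (Zf q a) X \<le> C3 * ((1 / real q) ^ ?d * (R / real q) powr (- s)) * sqrt (l2sq (cv (residue_kernel a q) f))"
          by (rule Zf(3)[OF q(1) X])
        also have "\<dots> \<le> C3 * ((1 / real q) ^ ?d * (R / real q) powr (- s)) * (A * real q powr ((1 + \<eta>) * real ?d / 2) * sqrt (l2sq f))"
          unfolding A_def using C3 by (intro mult_left_mono l2_residue_le \<eta> \<eta>1 q f) auto
        also have "(1 / real q) ^ ?d = real q powr (- real ?d)"
          using q0 by (simp add: powr_minus powr_realpow power_divide divide_inverse power_inverse)
        also have "(R / real q) powr (- s) = R powr (- s) * real q powr s"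
          using q0 R by (simp add: powr_divide powr_minus field_simps)
        also have "C3 * (real q powr (- real ?d) * (R powr (- s) * real q powr s)) * (A * real q powr ((1 + \<eta>) * real ?d / 2) * sqrt (l2sq f))
            = C3 * A * n * (real q powr (- real ?d) * real q powr s * real q powr ((1 + \<eta>) * real ?d / 2))" by (simp add: n_def mult_ac)
        \<comment> \<open>\<open>- d\<close> comes from the density, \<open>s\<close> from the
          threshold \<open>R / q\<close> and \<open>(1 + \<eta>) * d / 2\<close> from the Gauss
          sums; by the definition of \<open>s\<close> the total is at most
          \<open>- (2 + \<eta>)\<close>.\<close>
        also have "real q powr (- real ?d) * real q powr s * real q powr ((1 + \<eta>) * real ?d / 2) \<le> real q powr (- (2 + \<eta>))"
        proof -
          have "- real ?d + s + (1 + \<eta>) * real ?d / 2 = - 2 - \<eta> - \<eta> * real ?d / 2" unfolding s(1) by (simp add: field_simps)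
          also have "\<dots> \<le> - (2 + \<eta>)" using \<eta> by simp
          finally show ?thesis unfolding powr_add[symmetric] using q by (intro powr_mono) auto
        qed
        finally show "L2_set (Zf q a) X \<le> C3 * A * n * real q powr (- (2 + \<eta>))" using C3 A n0 by (simp add: mult_left_mono)
      qed
      also have "\<dots> \<le> (\<Sum>(q, a)\<in>(SIGMA q:{1..N}. {0..int q}). C3 * A * n * real q powr (- (2 + \<eta>)))"
        by (rule sum_mono2) (use C3 A n0 in \<open>auto simp: P_def\<close>)
      also have "\<dots> = (\<Sum>q\<in>{1..N}. \<Sum>a\<in>{0..int q}. C3 * A * n * real q powr (- (2 + \<eta>)))"
        by (subst sum.Sigma) auto
      also have "\<dots> \<le> (\<Sum>q\<in>{1..N}. C3 * A * n * 2 * real q powr (- (1 + \<eta>)))"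
      proof (rule sum_mono)
        fix q assume q: "q \<in> {1..N}"
        have e: "real q powr (- (1 + \<eta>)) = real q * real q powr (- (2 + \<eta>))"
        proof -
          have "real q powr (- (1 + \<eta>)) = real q powr 1 * real q powr (- (2 + \<eta>))" unfolding powr_add[symmetric] by simp
          thus ?thesis using q by simp
        qed
        have "(\<Sum>a\<in>{0..int q}. C3 * A * n * real q powr (- (2 + \<eta>))) = (real q + 1) * (C3 * A * n * real q powr (- (2 + \<eta>)))"
          by (simp add: nat_add_distrib)
        also have "\<dots> \<le> (2 * real q) * (C3 * A * n * real q powr (- (2 + \<eta>)))"
          using q C3 A n0 by (intro mult_right_mono) auto
        finally show "(\<Sum>a\<in>{0..int q}. C3 * A * n * real q powr (- (2 + \<eta>))) \<le> C3 * A * n * 2 * real q powr (- (1 + \<eta>))"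
          unfolding e by (simp add: mult_ac)
      qed
      also have "\<dots> = C3 * A * n * 2 * (\<Sum>q\<in>{1..N}. real q powr (- (1 + \<eta>)))" by (simp add: sum_distrib_left)
      also have "\<dots> \<le> C3 * A * n * 2 * S"
        unfolding S_def using C3 A n0 by (intro mult_left_mono sum_le_suminf summ) auto
      finally have 3: "L2_set (\<lambda>x. \<Sum>(q, a)\<in>P. Zf q a x) X \<le> C3 * A * n * 2 * S" .
      have "L2_set Z X \<le> L2_set (\<lambda>x. \<Sum>k\<in>Ks. Z1 k x) X + L2_set (\<lambda>x. \<Sum>k\<in>Ks. Z2 k x) X + L2_set (\<lambda>x. \<Sum>(q, a)\<in>P. Zf q a x) X"
        unfolding Z_def[abs_def] by (intro order.trans[OF L2_set_triangle_ineq] add_right_mono L2_set_triangle_ineq)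
      also have "\<dots> \<le> C1 * n * G1 + C2 * n * G2 + C3 * A * n * 2 * S" using 1 2 3 by simp
      finally show ?thesis by (simp add: n_def algebra_simps)
    qed
    show "\<exists>Z. (\<forall>x. Z x \<ge> 0) \<and>
      (\<forall>k\<in>Ks. \<forall>x. (\<Sum>j | j < grid_size ?d (2 ^ k) \<and> R < arc_size (2 ^ k) (gridfrac ?d (2 ^ k) j).
         cmod (cv (ball_kernel (2 ^ k) (gridfrac ?d (2 ^ k) j)) f x)) / real (2 ^ k) ^ ?d \<le> Z x) \<and>
      (\<forall>X. finite X \<longrightarrow> L2_set Z X \<le> (C1 * G1 + C2 * G2 + C3 * A * 2 * S) * R powr (- s) * sqrt (l2sq f))"
    proof (intro exI[of _ Z] conjI allI ballI impI)
      fix x show "Z x \<ge> 0" unfolding Z_def using Z12 ZfP by (auto intro!: add_nonneg_nonneg sum_nonneg)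
    next
      fix k x assume "k \<in> Ks"
      from pointwise[OF this, of x] show "(\<Sum>j | j < grid_size ?d (2 ^ k) \<and> R < arc_size (2 ^ k) (gridfrac ?d (2 ^ k) j).
         cmod (cv (ball_kernel (2 ^ k) (gridfrac ?d (2 ^ k) j)) f x)) / real (2 ^ k) ^ ?d \<le> Z x"
        by (simp only: \<Theta>_def h_def ND_def)
    qed (rule l2)
  qed
qed

text \<open>The count of the frequencies of size at most \<open>R\<close> follows from
  \<open>sum_arc_sizes_le\<close> by Chebyshev's inequality, and each kernel is at most 1 in modulus
  on the cube; no cancellation is used.\<close>

lemma low_part_bound:
  fixes \<eta> :: real
  assumes \<eta>: "0 < \<eta>"
  shows "\<exists>C\<ge>0. \<forall>L R (f :: int ^ 'd::finite \<Rightarrow> complex) x. L \<ge> 1 \<longrightarrow> R \<ge> 1 \<longrightarrow>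
      (\<Sum>j | j < grid_size CARD('d) L \<and> arc_size L (gridfrac CARD('d) L j) \<le> R.
         cmod (cv (ball_kernel L (gridfrac CARD('d) L j)) f x)) / real L ^ CARD('d)
       \<le> C * R powr (2 + \<eta>) * lattice_avg 1 L (\<lambda>y. cmod (f y)) x"
proof -
  let ?d = "CARD('d)"
  obtain C where C: "C \<ge> 0" "\<And>L. L \<ge> 1 \<Longrightarrow> (\<Sum>j\<in>{..<grid_size ?d L}. arc_size L (real j / real (grid_size ?d L)) powr (- (2 + \<eta>))) \<le> C"
    using sum_arc_sizes_le[OF \<eta>, of ?d] by blast
  show ?thesis
  proof (intro exI[of _ "C * 3 ^ ?d"] conjI allI impI)
    show "0 \<le> C * 3 ^ ?d" using C by simp
    fix L :: nat and R :: real and f :: "int ^ 'd \<Rightarrow> complex" and x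
    assume L: "L \<ge> 1" and R: "R \<ge> 1"
    define J where "J = {j. j < grid_size ?d L \<and> arc_size L (gridfrac ?d L j) \<le> R}"
    define v where "v = lattice_avg 1 L (\<lambda>y. cmod (f y)) x"
    have v0: "v \<ge> 0" unfolding v_def by (rule lattice_avg_nonneg) simp
    have finJ: "finite J" by (simp add: J_def)
    have "cmod (cv (ball_kernel L (gridfrac ?d L j)) f x) \<le> 3 ^ ?d * real L ^ ?d * v" for j
    proof -
      have "real (card (cube L :: (int ^ 'd) set)) = real (2 * L + 1) ^ ?d" by (simp add: card_cube)
      also have "\<dots> \<le> (3 * real L) ^ ?d" using L by (intro power_mono) auto
      finally have "real (card (cube L :: (int ^ 'd) set)) \<le> 3 ^ ?d * real L ^ ?d" by (simp add: power_mult_distrib)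
      from mult_right_mono[OF this v0] show ?thesis
        using norm_cv_smooth_kernel_le[of 1 L "gridfrac ?d L j" f x] by (simp add: ball_kernel_eq_smooth v_def)
    qed
    hence "(\<Sum>j\<in>J. cmod (cv (ball_kernel L (gridfrac ?d L j)) f x)) \<le> (\<Sum>j\<in>J. 3 ^ ?d * real L ^ ?d * v)" by (intro sum_mono)
    also have "\<dots> = real (card J) * (3 ^ ?d * real L ^ ?d * v)" by simp
    also have "real (card J) \<le> C * R powr (2 + \<eta>)"
    proof -
      have "real (card J) * R powr (- (2 + \<eta>)) = (\<Sum>j\<in>J. R powr (- (2 + \<eta>)))" by simp
      also have "\<dots> \<le> (\<Sum>j\<in>J. arc_size L (gridfrac ?d L j) powr (- (2 + \<eta>)))"
      proof (rule sum_mono)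
        fix j assume j: "j \<in> J"
        hence t: "0 \<le> gridfrac ?d L j" "gridfrac ?d L j \<le> 1" using gridfrac_range by (auto simp: J_def)
        obtain a q where aq: "arc_center L (gridfrac ?d L j) = (a, q)" by (cases "arc_center L (gridfrac ?d L j)")
        show "R powr (- (2 + \<eta>)) \<le> arc_size L (gridfrac ?d L j) powr (- (2 + \<eta>))"
          using arc_center(11)[OF L t aq] j \<eta> by (intro powr_mono2') (auto simp: J_def)
      qed
      also have "\<dots> \<le> (\<Sum>j\<in>{..<grid_size ?d L}. arc_size L (gridfrac ?d L j) powr (- (2 + \<eta>)))"
        by (rule sum_mono2) (auto simp: J_def)
      also have "\<dots> \<le> C" using C(2)[OF L] by (simp add: gridfrac_def)
      finally have "real (card J) * R powr (- (2 + \<eta>)) * R powr (2 + \<eta>) \<le> C * R powr (2 + \<eta>)" by (intro mult_right_mono) auto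
      thus ?thesis using R by (simp add: mult.assoc flip: powr_add)
    qed
    finally have "(\<Sum>j\<in>J. cmod (cv (ball_kernel L (gridfrac ?d L j)) f x)) \<le> C * R powr (2 + \<eta>) * (3 ^ ?d * real L ^ ?d * v)"
      using v0 by (simp add: mult_right_mono)
    hence "(\<Sum>j\<in>J. cmod (cv (ball_kernel L (gridfrac ?d L j)) f x)) / real L ^ ?d \<le> C * R powr (2 + \<eta>) * (3 ^ ?d * v)"
      using L by (simp add: divide_le_eq mult_ac)
    thus "(\<Sum>j | j < grid_size ?d L \<and> arc_size L (gridfrac ?d L j) \<le> R. cmod (cv (ball_kernel L (gridfrac ?d L j)) f x)) / real L ^ ?d
       \<le> C * 3 ^ ?d * R powr (2 + \<eta>) * lattice_avg 1 L (\<lambda>y. cmod (f y)) x"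
      by (simp add: J_def v_def mult_ac)
  qed
qed

section \<open>The spherical maximal function\<close>

lemma ball_kernel_cube:
  fixes m :: "int ^ 'd::finite"
  assumes "m \<in> cube L"
  shows "ball_kernel L t m = ee (t * of_int (\<Sum>i\<in>UNIV. (m $ i)\<^sup>2))"
proof -
  have "\<forall>i. m $ i \<in> {- int L..int L}" using assms by (simp add: cube_def)
  thus ?thesis by (simp add: ball_kernel_def quad_kernel_def prod_kernel_def sum_distrib_left ee_sum)
qed

lemma ball_kernel_outside:
  fixes m :: "int ^ 'd::finite"
  shows "m \<notin> cube L \<Longrightarrow> ball_kernel L t m = 0"
  by (auto simp: ball_kernel_def quad_kernel_def prod_kernel_def cube_def)

lemma cv_ball_kernel:
  fixes f :: "int ^ 'd::finite \<Rightarrow> complex"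
  shows "cv (ball_kernel L t) f x = (\<Sum>m\<in>cube L. ee (t * of_int (\<Sum>i\<in>UNIV. (m $ i)\<^sup>2)) * f (x - m))"
  by (subst cv_eq[of "cube L"]) (auto simp: ball_kernel_outside ball_kernel_cube)

lemma lattice_sphere_eq:
  assumes "r > 0" "r\<^sup>2 = real n"
  shows "(lattice_sphere r :: (int ^ 'd::finite) set) = {m. (\<Sum>i\<in>UNIV. (m $ i)\<^sup>2) = int n}"
proof -
  have "lattice_norm m = r \<longleftrightarrow> (\<Sum>i\<in>UNIV. (m $ i)\<^sup>2) = int n" for m :: "int ^ 'd"
  proof -
    have "lattice_norm m = sqrt (real_of_int (\<Sum>i\<in>UNIV. (m $ i)\<^sup>2))"
      by (simp add: lattice_norm_def norm_vec_def L2_set_def)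
    moreover have "r = sqrt (real n)" using assms by (metis less_imp_le real_sqrt_abs abs_of_nonneg)
    ultimately have "lattice_norm m = r \<longleftrightarrow> real_of_int (\<Sum>i\<in>UNIV. (m $ i)\<^sup>2) = real_of_int (int n)" by simp
    thus ?thesis by (simp only: of_int_eq_iff)
  qed
  thus ?thesis by (auto simp: lattice_sphere_def)
qed

lemma radii_cases:
  assumes "r \<in> radii"
  obtains n k where "n > 0" "r > 0" "r\<^sup>2 = real n" "n \<le> (2 ^ k)\<^sup>2" "(2 ^ k)\<^sup>2 < 4 * n"
proof -
  have r: "r > 0" "r\<^sup>2 \<in> \<int>" using assms by (auto simp: radii_def)
  then obtain z where z: "r\<^sup>2 = of_int z" by (auto elim: Ints_cases)
  define n where "n = nat z"
  have "real_of_int z > 0" using z r by (metis zero_less_power)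
  hence n: "n > 0" "r\<^sup>2 = real n" using z by (auto simp: n_def)
  have ex: "n \<le> 4 ^ n" using less_exp[of n] power_mono[of 2 4 n] by simp
  \<comment> \<open>The least power of 4 that is at least \<open>n\<close> is below
    \<open>4 * n\<close>, so \<open>2 ^ k\<close> lies between the radius and twice the
    radius.\<close>
  define k where "k = (LEAST k. n \<le> 4 ^ k)"
  have k: "n \<le> 4 ^ k" unfolding k_def by (rule LeastI[of _ n]) (rule ex)
  have "4 ^ k < 4 * n"
  proof (cases k)
    case (Suc k')
    hence "\<not> n \<le> 4 ^ k'" using not_less_Least[of k' "\<lambda>k. n \<le> 4 ^ k"] by (auto simp: k_def)
    thus ?thesis using Suc by simp
  qed (use n in simp)
  moreover have "(4::nat) ^ k = (2 ^ k)\<^sup>2" by (simp add: power_mult[symmetric] power2_eq_square power_mult_distrib[symmetric])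
  ultimately show ?thesis using that[OF n(1) r(1) n(2), of k] k by simp
qed

text \<open>Orthogonality on the grid. On the right \<open>n\<close> occurs only in a unimodular
  factor, which is why the absolute values of the convolutions control every sphere of the scale
  simultaneously.\<close>

lemma sphere_sum_fourier:
  fixes f :: "int ^ 'd::finite \<Rightarrow> complex"
  assumes n: "n \<le> L\<^sup>2"
  shows "of_nat (grid_size CARD('d) L) * (\<Sum>m | (\<Sum>i\<in>UNIV. (m $ i)\<^sup>2) = int n. f (x - m))
    = (\<Sum>j\<in>{..<grid_size CARD('d) L}. ee (- (gridfrac CARD('d) L j * real n)) * cv (ball_kernel L (gridfrac CARD('d) L j)) f x)"
proof -
  let ?Q = "grid_size CARD('d) L" and ?S = "{m :: int ^ 'd. (\<Sum>i\<in>UNIV. (m $ i)\<^sup>2) = int n}"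
  define ns where "ns m = (\<Sum>i\<in>UNIV. (m $ i)\<^sup>2)" for m :: "int ^ 'd"
  have sub: "?S \<subseteq> cube L"
  proof
    fix m :: "int ^ 'd" assume m: "m \<in> ?S"
    have "\<bar>m $ i\<bar> \<le> int L" for i
    proof -
      have "(m $ i)\<^sup>2 \<le> (\<Sum>i\<in>UNIV. (m $ i)\<^sup>2)" by (rule member_le_sum) auto
      also have "\<dots> = int n" using m by simp
      also have "\<dots> \<le> int (L\<^sup>2)" using n by (simp only: of_nat_le_iff)
      finally have "(m $ i)\<^sup>2 \<le> (int L)\<^sup>2" by simp
      thus ?thesis by (metis abs_le_square_iff abs_of_nat)
    qed
    thus "m \<in> cube L" by (simp add: cube_def abs_le_iff minus_le_iff)
  qed
  have orth: "(\<Sum>j\<in>{..<?Q}. ee (gridfrac CARD('d) L j * of_int (ns m - int n))) = (if ns m = int n then of_nat ?Q else 0)"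
    if m: "m \<in> cube L" for m
  proof -
    have "int ?Q dvd ns m - int n \<longleftrightarrow> ns m = int n"
    proof
      assume dvd: "int ?Q dvd ns m - int n"
      have ns: "0 \<le> ns m" "ns m \<le> int (CARD('d) * L\<^sup>2)"
      proof -
        show "0 \<le> ns m" by (simp add: ns_def sum_nonneg)
        have "ns m \<le> (\<Sum>i\<in>(UNIV :: 'd set). (int L)\<^sup>2)" unfolding ns_def
        proof (rule sum_mono)
          fix i
          have "\<bar>m $ i\<bar> \<le> int L" using m by (simp add: cube_def abs_le_iff minus_le_iff)
          thus "(m $ i)\<^sup>2 \<le> (int L)\<^sup>2" by (metis abs_le_square_iff abs_of_nat)
        qed
        thus "ns m \<le> int (CARD('d) * L\<^sup>2)" by simp
      qed
      have "L\<^sup>2 \<le> CARD('d) * L\<^sup>2" by simp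
      hence "int n \<le> int (CARD('d) * L\<^sup>2)" using n by (simp only: of_nat_le_iff)
      hence "\<bar>ns m - int n\<bar> < int ?Q" using ns unfolding grid_size_def by linarith
      thus "ns m = int n" using dvd dvd_imp_le_int[of "ns m - int n" "int ?Q"] by (cases "ns m = int n") auto
    qed auto
    thus ?thesis unfolding gridfrac_def using sum_ee_fraction[of ?Q "ns m - int n"] grid_size_pos[of "CARD('d)" L] by simp
  qed
  have "(\<Sum>j\<in>{..<?Q}. ee (- (gridfrac CARD('d) L j * real n)) * cv (ball_kernel L (gridfrac CARD('d) L j)) f x)
     = (\<Sum>j\<in>{..<?Q}. \<Sum>m\<in>cube L. ee (gridfrac CARD('d) L j * of_int (ns m - int n)) * f (x - m))"
    unfolding cv_ball_kernel sum_distrib_left ns_def[symmetric] mult.assoc[symmetric] ee_add[symmetric]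
    by (intro sum.cong refl) (simp add: algebra_simps)
  also have "\<dots> = (\<Sum>m\<in>cube L. (\<Sum>j\<in>{..<?Q}. ee (gridfrac CARD('d) L j * of_int (ns m - int n))) * f (x - m))"
    by (subst sum.swap) (simp add: sum_distrib_right)
  also have "\<dots> = (\<Sum>m\<in>cube L. (if ns m = int n then of_nat ?Q else 0) * f (x - m))"
    by (intro sum.cong refl) (simp only: orth)
  also have "\<dots> = (\<Sum>m\<in>?S. of_nat ?Q * f (x - m))"
    using sub by (intro sum.mono_neutral_cong_right) (auto simp: ns_def)
  finally show ?thesis by (simp add: sum_distrib_left)
qed

text \<open>The sphere has at least a constant times \<open>L ^ (d - 2)\<close> points and the grid
  at least \<open>L\<^sup>2\<close>, so the two normalisations together amount to
  \<open>L ^ d\<close>. The scale \<open>k\<close> depends on the radius alone.\<close>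

lemma spherical_avg_le:
  assumes d: "CARD('d::finite) \<ge> 5"
  shows "\<exists>C\<ge>0. \<forall>r\<in>radii. \<exists>k. \<forall>(f :: int ^ 'd \<Rightarrow> complex) x. cmod (spherical_avg r f x) \<le>
     C * ((\<Sum>j\<in>{..<grid_size CARD('d) (2 ^ k)}. cmod (cv (ball_kernel (2 ^ k) (gridfrac CARD('d) (2 ^ k) j)) f x)) / real (2 ^ k) ^ CARD('d))"
proof -
  let ?d = "CARD('d)"
  \<comment> \<open>From \<open>L\<^sup>2 / 4 \<le> n\<close>: the square root in
    \<open>card_lattice_level_ge\<close> is at least \<open>L / B\<close>.\<close>
  define B where "B = 8 * sqrt (real ?d)"
  have B: "B > 0" by (simp add: B_def)
  show ?thesis
  proof (intro exI[of _ "4 * B ^ (?d - 4)"] conjI ballI)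
    show "0 \<le> 4 * B ^ (?d - 4)" using B by simp
    fix r assume "r \<in> radii"
    then obtain n k where n: "n > 0" "r > 0" "r\<^sup>2 = real n" "n \<le> (2 ^ k)\<^sup>2" "(2 ^ k)\<^sup>2 < 4 * n" by (rule radii_cases)
    define L :: nat where "L = 2 ^ k"
    have L: "L \<ge> 1" by (simp add: L_def)
    let ?Q = "grid_size ?d L" and ?S = "{m :: int ^ 'd. (\<Sum>i\<in>UNIV. (m $ i)\<^sup>2) = int n}"
    have S: "(lattice_sphere r :: (int ^ 'd) set) = ?S" by (rule lattice_sphere_eq[OF n(2,3)])
    have "real (L\<^sup>2) < real (4 * n)" using n(5) unfolding L_def by (simp only: of_nat_less_iff)
    hence Ln: "(real L)\<^sup>2 / 4 \<le> real n" by simp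
    have "real L / B \<le> sqrt (real n / (16 * real ?d))"
    proof (rule real_le_rsqrt)
      have "(real L / B)\<^sup>2 = (real L)\<^sup>2 / 4 / (16 * real ?d)" by (simp add: B_def power_divide power_mult_distrib)
      also have "\<dots> \<le> real n / (16 * real ?d)" using Ln by (intro divide_right_mono) auto
      finally show "(real L / B)\<^sup>2 \<le> real n / (16 * real ?d)" .
    qed
    hence "(real L)\<^sup>2 / 4 * (real L / B) ^ (?d - 4) \<le> real n * sqrt (real n / (16 * real ?d)) ^ (?d - 4)"
      using Ln B by (intro mult_mono power_mono) auto
    also have "\<dots> \<le> real (card ?S)" by (rule card_lattice_level_ge[OF d n(1)])
    finally have N: "(real L)\<^sup>2 / 4 * (real L / B) ^ (?d - 4) \<le> real (card ?S)" .
    have Q: "(real L)\<^sup>2 \<le> real ?Q"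
    proof -
      have "1 * L\<^sup>2 \<le> ?d * L\<^sup>2" using d by (intro mult_right_mono) auto
      hence "L\<^sup>2 \<le> ?Q" unfolding grid_size_def by linarith
      hence "real (L\<^sup>2) \<le> real ?Q" by (simp only: of_nat_le_iff)
      thus ?thesis by simp
    qed
    have L4: "(real L)\<^sup>2 * (real L)\<^sup>2 * real L ^ (?d - 4) = real L ^ ?d"
      using d by (simp flip: power_add)
    have "real L ^ ?d / (4 * B ^ (?d - 4)) = ((real L)\<^sup>2 / 4 * (real L / B) ^ (?d - 4)) * (real L)\<^sup>2"
      unfolding L4[symmetric] by (simp add: power_divide)
    also have "\<dots> \<le> real (card ?S) * real ?Q" using N Q by (intro mult_mono) auto
    finally have NQ: "real L ^ ?d / (4 * B ^ (?d - 4)) \<le> real (card ?S) * real ?Q" .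
    have Ld: "real L ^ ?d > 0" using L by simp
    have "0 < real L ^ ?d / (4 * B ^ (?d - 4))" using Ld B by simp
    hence cQ: "real (card ?S) * real ?Q > 0" using NQ by linarith
    show "\<exists>k. \<forall>(f :: int ^ 'd \<Rightarrow> complex) x. cmod (spherical_avg r f x) \<le>
       4 * B ^ (?d - 4) * ((\<Sum>j\<in>{..<grid_size ?d (2 ^ k)}. cmod (cv (ball_kernel (2 ^ k) (gridfrac ?d (2 ^ k) j)) f x)) / real (2 ^ k) ^ ?d)"
    proof (intro exI[of _ k] allI)
      fix f :: "int ^ 'd \<Rightarrow> complex" and x
      define T where "T = (\<Sum>j\<in>{..<?Q}. cmod (cv (ball_kernel L (gridfrac ?d L j)) f x))"
      have T0: "T \<ge> 0" by (simp add: T_def sum_nonneg)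
      have "real ?Q * cmod (\<Sum>m\<in>?S. f (x - m)) = cmod (of_nat ?Q * (\<Sum>m\<in>?S. f (x - m)))" by (simp add: norm_mult)
      also have "\<dots> = cmod (\<Sum>j\<in>{..<?Q}. ee (- (gridfrac ?d L j * real n)) * cv (ball_kernel L (gridfrac ?d L j)) f x)"
        by (subst sphere_sum_fourier) (use n(4) in \<open>auto simp: L_def\<close>)
      also have "\<dots> \<le> (\<Sum>j\<in>{..<?Q}. cmod (ee (- (gridfrac ?d L j * real n)) * cv (ball_kernel L (gridfrac ?d L j)) f x))"
        by (rule norm_sum)
      also have "\<dots> = T" by (simp add: norm_mult T_def)
      finally have QT: "real ?Q * cmod (\<Sum>m\<in>?S. f (x - m)) \<le> T" .
      have "cmod (spherical_avg r f x) = cmod (\<Sum>m\<in>?S. f (x - m)) / real (card ?S)"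
        unfolding spherical_avg_def S by (simp add: norm_mult norm_divide)
      also have "\<dots> = real ?Q * cmod (\<Sum>m\<in>?S. f (x - m)) / (real (card ?S) * real ?Q)"
        by simp
      also have "\<dots> \<le> T / (real L ^ ?d / (4 * B ^ (?d - 4)))"
        using QT NQ T0 \<open>0 < real L ^ ?d / (4 * B ^ (?d - 4))\<close> by (intro frac_le) auto
      also have "\<dots> = 4 * B ^ (?d - 4) * (T / real L ^ ?d)" by simp
      finally show "cmod (spherical_avg r f x) \<le>
        4 * B ^ (?d - 4) * ((\<Sum>j\<in>{..<grid_size ?d (2 ^ k)}. cmod (cv (ball_kernel (2 ^ k) (gridfrac ?d (2 ^ k) j)) f x)) / real (2 ^ k) ^ ?d)"
        by (simp only: T_def L_def)
    qed
  qed
qed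

text \<open>
  The threshold \<open>R\<close> separates the low part, bounded by \<open>R\<^sup>2\<^sup>+\<^sup>\<eta>\<close> times the maximal function of
  cube averages, from the high part, of \<open>\<ell>\<^sup>2\<close> norm \<open>R\<^sup>-\<^sup>s\<close>; the choice
  \<open>R = \<alpha>\<^sup>-\<^sup>1\<^sup>/\<^sup>(\<^sup>d\<^sup>-\<^sup>2\<^sup>)\<close> balances the two.
\<close>

lemma spherical_restricted_weak_type:
  fixes \<eta> s p1 :: real
  assumes d: "CARD('d::finite) \<ge> 5" and \<eta>: "0 < \<eta>" "\<eta> < 1"
    and s: "s = real CARD('d) / 2 - 2 - (real CARD('d) + 1) * \<eta>" "s > 0"
    and p1: "p1 = (real CARD('d) + 2 * (real CARD('d) + 1) * \<eta>) / (real CARD('d) - 2)"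
  shows "\<exists>C\<ge>0. \<forall>(F :: (int ^ 'd) set) X r \<alpha>. finite F \<longrightarrow> finite X \<longrightarrow> 0 < \<alpha> \<longrightarrow> \<alpha> \<le> 1 \<longrightarrow> (\<forall>x\<in>X. r x \<in> radii) \<longrightarrow>
     (\<forall>x\<in>X. \<alpha> < cmod (spherical_avg (r x) (\<lambda>y. of_bool (y \<in> F)) x)) \<longrightarrow> real (card X) \<le> C * \<alpha> powr (- p1) * real (card F)"
proof -
  let ?d = "CARD('d)"
  obtain C0 where C0: "C0 \<ge> 0" and avg: "\<And>r. r \<in> radii \<Longrightarrow> \<exists>k. \<forall>(f :: int ^ 'd \<Rightarrow> complex) x. cmod (spherical_avg r f x) \<le>
     C0 * ((\<Sum>j\<in>{..<grid_size ?d (2 ^ k)}. cmod (cv (ball_kernel (2 ^ k) (gridfrac ?d (2 ^ k) j)) f x)) / real (2 ^ k) ^ ?d)"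
    using spherical_avg_le[OF d] by blast
  obtain C1 where C1: "C1 \<ge> 0" and high: "\<And>R (f :: int ^ 'd \<Rightarrow> complex) Ks. R \<ge> 1 \<Longrightarrow> fsupp f \<Longrightarrow> finite Ks \<Longrightarrow>
    (\<exists>Z. (\<forall>x. Z x \<ge> 0) \<and>
      (\<forall>k\<in>Ks. \<forall>x. (\<Sum>j | j < grid_size ?d (2 ^ k) \<and> R < arc_size (2 ^ k) (gridfrac ?d (2 ^ k) j).
         cmod (cv (ball_kernel (2 ^ k) (gridfrac ?d (2 ^ k) j)) f x)) / real (2 ^ k) ^ ?d \<le> Z x) \<and>
      (\<forall>X. finite X \<longrightarrow> L2_set Z X \<le> C1 * R powr (- s) * sqrt (l2sq f)))"
    using high_part_bound[OF \<eta> s] by blast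
  obtain C2 where C2: "C2 \<ge> 0" and low: "\<And>L R (f :: int ^ 'd \<Rightarrow> complex) x. L \<ge> 1 \<Longrightarrow> R \<ge> 1 \<Longrightarrow>
      (\<Sum>j | j < grid_size ?d L \<and> arc_size L (gridfrac ?d L j) \<le> R. cmod (cv (ball_kernel L (gridfrac ?d L j)) f x)) / real L ^ ?d
       \<le> C2 * R powr (2 + \<eta>) * lattice_avg 1 L (\<lambda>y. cmod (f y)) x"
    using low_part_bound[OF \<eta>(1), where 'd = 'd] by blast
  define A1 where "A1 = 2 * C0 * C2 * 2 ^ ?d"
  define A2 where "A2 = (2 * C0 * C1)\<^sup>2"
  have A: "A1 \<ge> 0" "A2 \<ge> 0" using C0 C1 C2 by (auto simp: A1_def A2_def)
  have d2: "real ?d - 2 > 0" using d by simp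
  show ?thesis
  proof (intro exI[of _ "A1 + A2"] conjI allI impI)
    show "0 \<le> A1 + A2" using A by simp
    fix F :: "(int ^ 'd) set" and X :: "(int ^ 'd) set" and r and \<alpha> :: real
    assume F: "finite F" and X: "finite X" and \<alpha>: "0 < \<alpha>" "\<alpha> \<le> 1" and r: "\<forall>x\<in>X. r x \<in> radii"
      and big: "\<forall>x\<in>X. \<alpha> < cmod (spherical_avg (r x) (\<lambda>y. of_bool (y \<in> F)) x)"
    define f :: "int ^ 'd \<Rightarrow> complex" where "f y = of_bool (y \<in> F)" for y
    have f: "fsupp f" by (rule fsuppI[OF F]) (simp add: f_def)
    have l2f: "l2sq f = real (card F)"
    proof -
      have "l2sq f = (\<Sum>n\<in>F. (cmod (f n))\<^sup>2)" by (rule l2sq_eq[OF F]) (simp add: f_def)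
      thus ?thesis by (simp add: f_def)
    qed
    have cf: "(\<lambda>y. cmod (f y)) = (\<lambda>y. of_bool (y \<in> F))" by (auto simp: f_def)
    define R where "R = \<alpha> powr (- 1 / (real ?d - 2))"
    have "1 = 1 powr (- 1 / (real ?d - 2))" by simp
    also have "\<dots> \<le> R" unfolding R_def using \<alpha> d2 by (intro powr_mono2') auto
    finally have R: "R \<ge> 1" .
    have "\<forall>x\<in>X. \<exists>k. \<forall>(f :: int ^ 'd \<Rightarrow> complex) y. cmod (spherical_avg (r x) f y) \<le>
     C0 * ((\<Sum>j\<in>{..<grid_size ?d (2 ^ k)}. cmod (cv (ball_kernel (2 ^ k) (gridfrac ?d (2 ^ k) j)) f y)) / real (2 ^ k) ^ ?d)"
      using avg r by blast
    then obtain k where k: "\<And>x (f :: int ^ 'd \<Rightarrow> complex) y. x \<in> X \<Longrightarrow> cmod (spherical_avg (r x) f y) \<le>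
     C0 * ((\<Sum>j\<in>{..<grid_size ?d (2 ^ k x)}. cmod (cv (ball_kernel (2 ^ k x) (gridfrac ?d (2 ^ k x) j)) f y)) / real (2 ^ k x) ^ ?d)"
      by metis
    obtain Z where Z: "\<And>x. Z x \<ge> 0"
      "\<And>l x. l \<in> k ` X \<Longrightarrow> (\<Sum>j | j < grid_size ?d (2 ^ l) \<and> R < arc_size (2 ^ l) (gridfrac ?d (2 ^ l) j).
         cmod (cv (ball_kernel (2 ^ l) (gridfrac ?d (2 ^ l) j)) f x)) / real (2 ^ l) ^ ?d \<le> Z x"
      "\<And>X. finite X \<Longrightarrow> L2_set Z X \<le> C1 * R powr (- s) * sqrt (l2sq f)"
      using high[OF R f finite_imageI[OF X, of k]] by blast
    define v where "v x = lattice_avg 1 (2 ^ k x) (\<lambda>y. of_bool (y \<in> F)) x" for x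
    have split: "\<alpha> < C0 * (C2 * R powr (2 + \<eta>) * v x) + C0 * Z x" if x: "x \<in> X" for x
    proof -
      define h where "h j = cmod (cv (ball_kernel (2 ^ k x) (gridfrac ?d (2 ^ k x) j)) f x)" for j
      define \<Theta> where "\<Theta> j = arc_size (2 ^ k x) (gridfrac ?d (2 ^ k x) j)" for j
      let ?Q = "grid_size ?d (2 ^ k x)"
      have "\<alpha> < C0 * ((\<Sum>j\<in>{..<?Q}. h j) / real (2 ^ k x) ^ ?d)"
        using big x k[OF x, of f x] unfolding h_def by (force simp: f_def[abs_def])
      also have "(\<Sum>j\<in>{..<?Q}. h j) = (\<Sum>j | j < ?Q \<and> \<Theta> j \<le> R. h j) + (\<Sum>j | j < ?Q \<and> R < \<Theta> j. h j)"
        by (subst sum.union_disjoint[symmetric]) (auto intro!: sum.cong)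
      also have "C0 * (((\<Sum>j | j < ?Q \<and> \<Theta> j \<le> R. h j) + (\<Sum>j | j < ?Q \<and> R < \<Theta> j. h j)) / real (2 ^ k x) ^ ?d)
        = C0 * ((\<Sum>j | j < ?Q \<and> \<Theta> j \<le> R. h j) / real (2 ^ k x) ^ ?d) + C0 * ((\<Sum>j | j < ?Q \<and> R < \<Theta> j. h j) / real (2 ^ k x) ^ ?d)"
        by (simp add: add_divide_distrib distrib_left)
      also have "\<dots> \<le> C0 * (C2 * R powr (2 + \<eta>) * v x) + C0 * Z x"
      proof (intro add_mono mult_left_mono C0)
        show "(\<Sum>j | j < ?Q \<and> \<Theta> j \<le> R. h j) / real (2 ^ k x) ^ ?d \<le> C2 * R powr (2 + \<eta>) * v x"
          using low[of "2 ^ k x" R f x] R by (simp add: h_def \<Theta>_def v_def cf)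
        show "(\<Sum>j | j < ?Q \<and> R < \<Theta> j. h j) / real (2 ^ k x) ^ ?d \<le> Z x"
          using Z(2)[of "k x" x] x by (simp add: h_def \<Theta>_def)
      qed
      finally show ?thesis .
    qed
    \<comment> \<open>Where the average exceeds \<open>\<alpha>\<close>, one of the two parts
      exceeds \<open>\<alpha> / 2\<close>. The weak type of cube averages bounds \<open>X1\<close>,
      and Chebyshev's inequality for squares bounds \<open>X2\<close>.\<close>
    define X1 where "X1 = {x \<in> X. \<alpha> / 2 < C0 * (C2 * R powr (2 + \<eta>) * v x)}"
    define X2 where "X2 = {x \<in> X. \<alpha> / 2 < C0 * Z x}"
    have "X \<subseteq> X1 \<union> X2"
    proof
      fix x assume x: "x \<in> X"
      show "x \<in> X1 \<union> X2" using split[OF x] x by (auto simp: X1_def X2_def)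
    qed
    hence "card X \<le> card (X1 \<union> X2)" using X by (intro card_mono) (auto simp: X1_def X2_def)
    also have "\<dots> \<le> card X1 + card X2" by (rule card_Un_le)
    finally have cX: "real (card X) \<le> real (card X1) + real (card X2)" by linarith

    have e: "R powr e = \<alpha> powr (- e / (real ?d - 2))" for e
      unfolding R_def powr_powr by (rule arg_cong[where f = "(powr) \<alpha>"]) simp
    have W1: "real (card X1) \<le> A1 * \<alpha> powr (- p1) * real (card F)"
    proof (cases "X1 = {} \<or> C0 * C2 = 0")
      case True
      hence "X1 = {}" using \<alpha> by (auto simp: X1_def)
      thus ?thesis using A by simp
    next
      case False
      hence CC: "C0 * C2 > 0" using C0 C2 by (simp add: less_le)
      define D where "D = C0 * C2 * R powr (2 + \<eta>)"
      have D: "D > 0" using CC R by (simp add: D_def)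
      have "real (card X1) \<le> 2 ^ ?d / (\<alpha> / (2 * D)) * real (card F)"
      proof (rule lattice_avg_weak_type[where q = 1 and r = "\<lambda>x. 2 ^ k x"])
        fix x assume "x \<in> X1"
        hence "\<alpha> / 2 < D * v x" by (simp add: X1_def D_def mult.assoc)
        thus "\<alpha> / (2 * D) < lattice_avg 1 (2 ^ k x) (\<lambda>y. of_bool (y \<in> F)) x"
          using D by (simp add: v_def field_simps)
      qed (use X F \<alpha> D in \<open>auto simp: X1_def\<close>)
      also have "\<dots> = A1 * (R powr (2 + \<eta>) * \<alpha> powr (-1)) * real (card F)"
        using \<alpha> by (simp add: D_def A1_def powr_minus field_simps)
      also have "R powr (2 + \<eta>) * \<alpha> powr (-1) = \<alpha> powr (- (2 + \<eta>) / (real ?d - 2)) * \<alpha> powr (-1)" by (simp only: e)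
      also have "\<dots> = \<alpha> powr (- (2 + \<eta>) / (real ?d - 2) + (-1))" by (rule powr_add[symmetric])
      \<comment> \<open>The exponent here is \<open>(d + \<eta>) / (d - 2)\<close>, with room to
        spare; as \<open>\<alpha> \<le> 1\<close> it may be raised to \<open>p1\<close>.\<close>
      also have "\<alpha> powr (- (2 + \<eta>) / (real ?d - 2) + (-1)) \<le> \<alpha> powr (- p1)"
      proof (rule powr_mono')
        have "(2 + \<eta>) / (real ?d - 2) + 1 = (real ?d + \<eta>) / (real ?d - 2)" using d2 by (simp add: field_simps)
        also have "\<dots> \<le> p1" unfolding p1
        proof (rule divide_right_mono)
          have "1 * \<eta> \<le> (2 * (real ?d + 1)) * \<eta>" using \<eta> by (intro mult_right_mono) auto
          thus "real ?d + \<eta> \<le> real ?d + 2 * (real ?d + 1) * \<eta>" by simp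
        qed (use d2 in simp)
        finally show "- p1 \<le> - (2 + \<eta>) / (real ?d - 2) + (-1)" unfolding minus_divide_left[symmetric] by linarith
      qed (use \<alpha> in auto)
      finally show ?thesis using A by (simp add: mult_left_mono mult_right_mono)
    qed
    have W2: "real (card X2) \<le> A2 * \<alpha> powr (- p1) * real (card F)"
    proof -
      have finX2: "finite X2" using X by (simp add: X2_def)
      have "real (card X2) * (\<alpha> / 2)\<^sup>2 = (\<Sum>x\<in>X2. (\<alpha> / 2)\<^sup>2)" by simp
      also have "\<dots> \<le> (\<Sum>x\<in>X2. (C0 * Z x)\<^sup>2)"
        by (intro sum_mono power_mono) (use \<alpha> in \<open>auto simp: X2_def\<close>)
      also have "\<dots> = C0\<^sup>2 * (L2_set Z X2)\<^sup>2" by (simp add: L2_set_def sum_nonneg power_mult_distrib sum_distrib_left)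
      also have "\<dots> \<le> C0\<^sup>2 * (C1 * R powr (- s) * sqrt (l2sq f))\<^sup>2"
        by (intro mult_left_mono power_mono Z(3) finX2) auto
      also have "\<dots> = C0\<^sup>2 * C1\<^sup>2 * (R powr (- s))\<^sup>2 * real (card F)" by (simp add: power_mult_distrib l2f)
      finally have "real (card X2) \<le> C0\<^sup>2 * C1\<^sup>2 * (R powr (- s))\<^sup>2 * real (card F) / (\<alpha> / 2)\<^sup>2"
        using \<alpha> by (simp add: le_divide_eq)
      also have "\<dots> = A2 * ((R powr (- s) * R powr (- s)) * \<alpha> powr (-2)) * real (card F)"
        using \<alpha> by (simp add: A2_def power_mult_distrib power2_eq_square powr_minus powr_numeral field_simps)
      \<comment> \<open>An equality: the high part is what determines \<open>p1\<close>.\<close>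
      also have "R powr (- s) * R powr (- s) * \<alpha> powr (-2) = \<alpha> powr (- p1)"
      proof -
        have "- (- s) / (real ?d - 2) + - (- s) / (real ?d - 2) + (-2) = - p1"
        proof -
          have "- (- s) / D + - (- s) / D + (-2) = (2 * s - 2 * D) / D" if "D > 0" for D :: real
            using that by (simp add: field_simps)
          note this[OF d2]
          also have "2 * s - 2 * (real ?d - 2) = - (real ?d + 2 * (real ?d + 1) * \<eta>)" unfolding s(1) by (simp add: algebra_simps)
          finally show ?thesis unfolding p1 minus_divide_left .
        qed
        thus ?thesis unfolding e powr_add[symmetric] by simp
      qed
      finally show ?thesis .
    qed
    show "real (card X) \<le> (A1 + A2) * \<alpha> powr (- p1) * real (card F)"
      using cX W1 W2 by (simp add: algebra_simps)
  qed
qed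


section \<open>From finite sets of points to the full maximal operator\<close>

definition sphere_mean :: "real \<Rightarrow> (int ^ 'd \<Rightarrow> real) \<Rightarrow> int ^ 'd \<Rightarrow> real" where
  "sphere_mean r g x = (\<Sum>m\<in>lattice_sphere r. g (x - m)) / real (card (lattice_sphere r :: (int ^ 'd) set))"

lemma finite_lattice_sphere: "r \<in> radii \<Longrightarrow> finite (lattice_sphere r :: (int ^ 'd::finite) set)"
  by (elim radii_cases) (simp add: lattice_sphere_eq finite_lattice_level)

lemma spherical_avg_of_bool:
  "cmod (spherical_avg r (\<lambda>y. of_bool (y \<in> F)) x) = sphere_mean r (\<lambda>y. of_bool (y \<in> F)) x"
proof -
  have "(\<Sum>m\<in>lattice_sphere r. of_bool (x - m \<in> F) :: complex) = of_real (\<Sum>m\<in>lattice_sphere r. of_bool (x - m \<in> F))"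
    by (simp add: of_bool_def if_distrib cong: if_cong)
  moreover have "(\<Sum>m\<in>lattice_sphere r. of_bool (x - m \<in> F) :: real) \<ge> 0" by (simp add: sum_nonneg)
  ultimately have "cmod (\<Sum>m\<in>lattice_sphere r. of_bool (x - m \<in> F) :: complex) = (\<Sum>m\<in>lattice_sphere r. of_bool (x - m \<in> F))"
    by (simp only: norm_of_real abs_of_nonneg)
  thus ?thesis by (simp add: spherical_avg_def sphere_mean_def norm_mult norm_divide)
qed

lemma spherical_avg_le_mean: "cmod (spherical_avg r f x) \<le> sphere_mean r (\<lambda>y. cmod (f y)) x"
  by (auto simp: spherical_avg_def sphere_mean_def norm_mult norm_divide intro!: divide_right_mono norm_sum)

lemma spherical_avg_bounded:
  fixes f :: "int ^ 'd::finite \<Rightarrow> complex"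
  assumes "\<And>y. cmod (f y) \<le> K"
  shows "cmod (spherical_avg r f x) \<le> K"
proof -
  have K: "K \<ge> 0" using order.trans[OF norm_ge_zero assms[of undefined]] .
  let ?N = "card (lattice_sphere r :: (int ^ 'd) set)"
  have "(\<Sum>m\<in>lattice_sphere r. cmod (f (x - m))) \<le> (\<Sum>m\<in>(lattice_sphere r :: (int ^ 'd) set). K)" by (intro sum_mono assms)
  hence "sphere_mean r (\<lambda>y. cmod (f y)) x \<le> real ?N * K / real ?N"
    unfolding sphere_mean_def by (intro divide_right_mono) auto
  \<comment> \<open>An inequality, since a sphere of cardinality 0 makes the quotient 0.\<close>
  also have "\<dots> \<le> K" using K by simp
  finally show ?thesis using spherical_avg_le_mean[of r f x] by linarith
qed

text \<open>A radius chosen at each point of a finite set stands for the supremum, and the constant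
  does not depend on the choice. The interpolation is applied to the weights of the spherical means,
  with \<open>\<eta>\<close> so small that \<open>p1 < p\<close>.\<close>

lemma linearised_spherical_maximal:
  fixes p :: real
  assumes d: "CARD('d::finite) \<ge> 5" and p: "real CARD('d) / (real CARD('d) - 2) < p"
  shows "\<exists>C\<ge>0. \<forall>(X :: (int ^ 'd) set) r g Z. finite X \<longrightarrow> finite Z \<longrightarrow> (\<forall>x\<in>X. r x \<in> radii) \<longrightarrow> (\<forall>y. 0 \<le> g y) \<longrightarrow>
     (\<forall>y. y \<notin> Z \<longrightarrow> g y = 0) \<longrightarrow> (\<Sum>x\<in>X. sphere_mean (r x) g x powr p) \<le> C * (\<Sum>y\<in>Z. g y powr p)"
proof -
  let ?d = "real CARD('d)"
  have d5: "?d \<ge> 5" using d by simp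
  \<comment> \<open>\<open>u\<close> is the total loss: \<open>s = d / 2 - 2 - u\<close> stays
    positive as \<open>d \<ge> 5\<close>, and \<open>p1 = (d + 2 * u) / (d - 2)\<close> stays below
    \<open>p\<close>.\<close>
  define u where "u = min (1 / 10) ((p * (?d - 2) - ?d) / 4)"
  define \<eta> where "\<eta> = u / (?d + 1)"
  define s where "s = ?d / 2 - 2 - (?d + 1) * \<eta>"
  define p1 where "p1 = (?d + 2 * (?d + 1) * \<eta>) / (?d - 2)"
  have "p * (?d - 2) > ?d" using p d5 by (simp add: divide_less_eq)
  hence u: "u > 0" "u \<le> 1 / 10" "4 * u \<le> p * (?d - 2) - ?d"
    using min.cobounded2[of "1 / 10" "(p * (?d - 2) - ?d) / 4"] by (auto simp: u_def)
  have \<eta>u: "(?d + 1) * \<eta> = u" using d5 by (simp add: \<eta>_def)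
  have \<eta>: "0 < \<eta>" "\<eta> < 1" using u d5 by (auto simp: \<eta>_def divide_less_eq)
  have s0: "s > 0" unfolding s_def \<eta>u using u d5 by simp
  have p1e: "p1 = (?d + 2 * u) / (?d - 2)" unfolding p1_def mult.assoc \<eta>u ..
  have p10: "0 < p1" "p1 < p" unfolding p1e using u d5 by (auto simp: divide_less_eq)
  obtain A where A: "A \<ge> 0" and weak: "\<And>(F :: (int ^ 'd) set) X r \<alpha>. finite F \<Longrightarrow> finite X \<Longrightarrow> 0 < \<alpha> \<Longrightarrow> \<alpha> \<le> 1 \<Longrightarrow> (\<forall>x\<in>X. r x \<in> radii) \<Longrightarrow>
     (\<forall>x\<in>X. \<alpha> < cmod (spherical_avg (r x) (\<lambda>y. of_bool (y \<in> F)) x)) \<Longrightarrow> real (card X) \<le> A * \<alpha> powr (- p1) * real (card F)"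
    using spherical_restricted_weak_type[OF d \<eta> s_def s0 p1_def] by blast
  obtain C where C: "C \<ge> 0" and main: "\<And>(X :: (int ^ 'd) set) (Y :: int ^ 'd \<Rightarrow> (int ^ 'd) set) w A f Z. finite X \<Longrightarrow> finite Z \<Longrightarrow> A \<ge> 0 \<Longrightarrow>
    (\<forall>x\<in>X. finite (Y x) \<and> (\<forall>y\<in>Y x. 0 \<le> w x y) \<and> (\<Sum>y\<in>Y x. w x y) \<le> 1) \<Longrightarrow>
    (\<forall>F X' \<alpha>. finite F \<longrightarrow> X' \<subseteq> X \<longrightarrow> 0 < \<alpha> \<longrightarrow> \<alpha> \<le> 1 \<longrightarrow> (\<forall>x\<in>X'. \<alpha> < (\<Sum>y\<in>Y x. w x y * of_bool (y \<in> F))) \<longrightarrow>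
       real (card X') \<le> A * \<alpha> powr (- p1) * real (card F)) \<Longrightarrow>
    (\<forall>y. f y \<ge> 0) \<Longrightarrow> (\<forall>y. y \<notin> Z \<longrightarrow> f y = 0) \<Longrightarrow>
    (\<Sum>x\<in>X. (\<Sum>y\<in>Y x. w x y * f y) powr p) \<le> C * A * (\<Sum>y\<in>Z. f y powr p)"
    using restricted_weak_type_interpolation[OF p10, where 'x = "int ^ 'd" and 'y = "int ^ 'd"] by auto
  show ?thesis
  proof (intro exI[of _ "C * A"] conjI allI impI)
    show "0 \<le> C * A" using C A by simp
    fix X Z :: "(int ^ 'd) set" and r and g :: "int ^ 'd \<Rightarrow> real"
    assume X: "finite X" and Z: "finite Z" and r: "\<forall>x\<in>X. r x \<in> radii" and g: "\<forall>y. 0 \<le> g y" "\<forall>y. y \<notin> Z \<longrightarrow> g y = 0"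
    define S where "S x = (lattice_sphere (r x) :: (int ^ 'd) set)" for x
    define Y where "Y x = (\<lambda>m. x - m) ` S x" for x
    define w where "w x (y :: int ^ 'd) = 1 / real (card (S x))" for x y
    have mean: "sphere_mean (r x) h x = (\<Sum>y\<in>Y x. w x y * h y)" for h x
      unfolding sphere_mean_def Y_def w_def S_def by (subst sum.reindex) (auto simp: inj_on_def sum_divide_distrib)
    have card: "card (Y x) = card (S x)" for x unfolding Y_def by (rule card_image) (auto simp: inj_on_def)
    have "(\<Sum>x\<in>X. (\<Sum>y\<in>Y x. w x y * g y) powr p) \<le> C * A * (\<Sum>y\<in>Z. g y powr p)"
    proof (rule main[OF X Z A])
      show "\<forall>x\<in>X. finite (Y x) \<and> (\<forall>y\<in>Y x. 0 \<le> w x y) \<and> (\<Sum>y\<in>Y x. w x y) \<le> 1"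
        using r by (auto simp: Y_def S_def finite_lattice_sphere w_def card[unfolded Y_def S_def])
      show "\<forall>F X' \<alpha>. finite F \<longrightarrow> X' \<subseteq> X \<longrightarrow> 0 < \<alpha> \<longrightarrow> \<alpha> \<le> 1 \<longrightarrow> (\<forall>x\<in>X'. \<alpha> < (\<Sum>y\<in>Y x. w x y * of_bool (y \<in> F))) \<longrightarrow>
         real (card X') \<le> A * \<alpha> powr (- p1) * real (card F)"
      proof (intro allI impI)
        fix F X' and \<alpha> :: real
        assume h: "finite F" "X' \<subseteq> X" "0 < \<alpha>" "\<alpha> \<le> 1" "\<forall>x\<in>X'. \<alpha> < (\<Sum>y\<in>Y x. w x y * of_bool (y \<in> F))"
        show "real (card X') \<le> A * \<alpha> powr (- p1) * real (card F)"
          by (rule weak[of F X' \<alpha> r]) (use h r finite_subset[OF h(2) X] in \<open>auto simp: spherical_avg_of_bool mean\<close>)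
      qed
    qed (use g in auto)
    thus "(\<Sum>x\<in>X. sphere_mean (r x) g x powr p) \<le> C * A * (\<Sum>y\<in>Z. g y powr p)" by (simp only: mean)
  qed
qed

lemma one_mem_radii: "1 \<in> radii"
  by (simp add: radii_def)

lemma spherical_max_bounds:
  assumes "\<And>y. cmod (f y) \<le> K"
  shows "bdd_above ((\<lambda>r. cmod (spherical_avg r f n)) ` radii)" "0 \<le> spherical_max f n" "spherical_max f n \<le> K"
proof -
  show bdd: "bdd_above ((\<lambda>r. cmod (spherical_avg r f n)) ` radii)"
    by (rule bdd_aboveI2[where M = K]) (rule spherical_avg_bounded[OF assms])
  have "0 \<le> cmod (spherical_avg 1 f n)" by simp
  also have "\<dots> \<le> spherical_max f n" unfolding spherical_max_def by (rule cSUP_upper[OF one_mem_radii bdd])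
  finally show "0 \<le> spherical_max f n" .
  show "spherical_max f n \<le> K" unfolding spherical_max_def
    by (rule cSUP_least) (use one_mem_radii spherical_avg_bounded[OF assms] in auto)
qed

lemma spherical_max_infinity:
  fixes f :: "int ^ 'd::finite \<Rightarrow> complex"
  assumes "f \<in> ell \<infinity>"
  shows "(\<forall>n. bdd_above ((\<lambda>r. cmod (spherical_avg r f n)) ` radii)) \<and> spherical_max f \<in> ell \<infinity> \<and>
    ell_norm \<infinity> (spherical_max f) \<le> 1 * ell_norm \<infinity> f"
proof -
  obtain a where "\<And>y. cmod (f y) \<le> a" using assms by (auto simp: ell_def bounded_iff)
  hence bdd: "bdd_above (range (\<lambda>y. cmod (f y)))" by (intro bdd_aboveI2[where M = a])
  define K where "K = (SUP y. cmod (f y))"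
  have K: "cmod (f y) \<le> K" for y unfolding K_def by (rule cSUP_upper[OF UNIV_I bdd])
  note b = spherical_max_bounds[of f K, OF K]
  have "bounded (range (spherical_max f))" unfolding bounded_iff using b by (intro exI[of _ K]) auto
  moreover have "(SUP n. norm (spherical_max f n)) \<le> K" by (rule cSUP_least) (use b in auto)
  ultimately show ?thesis using b by (auto simp: ell_def ell_norm_def K_def)
qed

text \<open>Exhaustion by finite sets of points: one bound for all finite sums gives both the
  summability and the inequality of norms.\<close>

lemma spherical_max_finite_exponent:
  fixes p :: real
  assumes d: "CARD('d::finite) \<ge> 5" and p: "real CARD('d) / (real CARD('d) - 2) < p"
  shows "\<exists>C. \<forall>f :: int ^ 'd \<Rightarrow> complex. f \<in> ell (ereal p) \<longrightarrow>
     (\<forall>n. bdd_above ((\<lambda>r. cmod (spherical_avg r f n)) ` radii)) \<and> spherical_max f \<in> ell (ereal p) \<and>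
     ell_norm (ereal p) (spherical_max f) \<le> C * ell_norm (ereal p) f"
proof -
  have "0 \<le> real CARD('d) / (real CARD('d) - 2)" using d by simp
  hence p0: "p > 0" using p by linarith
  obtain C where C: "C \<ge> 0" and main: "\<And>(X :: (int ^ 'd) set) r g Z. finite X \<Longrightarrow> finite Z \<Longrightarrow> (\<forall>x\<in>X. r x \<in> radii) \<Longrightarrow> (\<forall>y. 0 \<le> g y) \<Longrightarrow>
     (\<forall>y. y \<notin> Z \<longrightarrow> g y = 0) \<Longrightarrow> (\<Sum>x\<in>X. sphere_mean (r x) g x powr p) \<le> C * (\<Sum>y\<in>Z. g y powr p)"
    using linearised_spherical_maximal[OF d p] by blast
  show ?thesis
  proof (intro exI[of _ "(2 powr p * C) powr (1 / p)"] allI impI)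
    fix f :: "int ^ 'd \<Rightarrow> complex" assume "f \<in> ell (ereal p)"
    hence summ: "(\<lambda>n. cmod (f n) powr p) summable_on UNIV" by (simp add: ell_def)
    define I where "I = (\<Sum>\<^sub>\<infinity>n. cmod (f n) powr p)"
    have le_I: "(\<Sum>n\<in>Z. cmod (f n) powr p) \<le> I" if "finite Z" for Z
      unfolding I_def by (rule finite_sum_le_infsum[OF summ that]) auto
    have I0: "I \<ge> 0" using le_I[of "{}"] by simp
    \<comment> \<open>Members of the space are bounded, which makes each real supremum below one of
      a set that is bounded above.\<close>
    have K: "cmod (f y) \<le> I powr (1 / p)" for y
    proof -
      have "(cmod (f y) powr p) powr (1 / p) \<le> I powr (1 / p)"
        using le_I[of "{y}"] p0 by (intro powr_mono2) auto
      thus ?thesis using p0 by (simp add: powr_powr)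
    qed
    note b = spherical_max_bounds[of f "I powr (1 / p)", OF K]
    have fin: "(\<Sum>x\<in>X. spherical_max f x powr p) \<le> 2 powr p * C * I" if X: "finite X" for X
    proof -
      \<comment> \<open>The supremum need not be attained; unless it is 0, when any radius will do,
        some radius reaches half of it.\<close>
      have "\<exists>r\<in>radii. spherical_max f x \<le> 2 * cmod (spherical_avg r f x)" for x
      proof (cases "spherical_max f x = 0")
        case True
        thus ?thesis using one_mem_radii by (intro bexI[of _ 1]) auto
      next
        case False
        hence "spherical_max f x / 2 < (SUP r\<in>radii. cmod (spherical_avg r f x))"
          using b(2)[of x] unfolding spherical_max_def[symmetric] by simp
        then obtain r where "r \<in> radii" "spherical_max f x / 2 < cmod (spherical_avg r f x)"
          using less_cSUP_iff[OF _ b(1)[of x]] one_mem_radii by blast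
        thus ?thesis by (intro bexI[of _ r]) auto
      qed
      then obtain r where r: "\<And>x. r x \<in> radii" "\<And>x. spherical_max f x \<le> 2 * cmod (spherical_avg (r x) f x)" by metis
      \<comment> \<open>The points reached from \<open>X\<close> by the chosen spheres are finitely
        many; truncating \<open>f\<close> to them leaves these means unchanged.\<close>
      define Z where "Z = (\<Union>x\<in>X. (\<lambda>m. x - m) ` lattice_sphere (r x))"
      have Z: "finite Z" unfolding Z_def using X r(1) by (auto intro: finite_lattice_sphere)
      define g where "g y = (if y \<in> Z then cmod (f y) else 0)" for y
      have "(\<Sum>x\<in>X. spherical_max f x powr p) \<le> (\<Sum>x\<in>X. 2 powr p * sphere_mean (r x) g x powr p)"
      proof (rule sum_mono)
        fix x assume x: "x \<in> X"
        have "sphere_mean (r x) (\<lambda>y. cmod (f y)) x = sphere_mean (r x) g x"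
          unfolding sphere_mean_def by (intro arg_cong2[where f = "(/)"] sum.cong refl) (use x in \<open>auto simp: g_def Z_def\<close>)
        hence "spherical_max f x \<le> 2 * sphere_mean (r x) g x"
          using r(2)[of x] spherical_avg_le_mean[of "r x" f x] by simp
        hence "spherical_max f x powr p \<le> (2 * sphere_mean (r x) g x) powr p"
          using b(2) p0 by (intro powr_mono2) auto
        also have "\<dots> = 2 powr p * sphere_mean (r x) g x powr p"
          by (rule powr_mult)
        finally show "spherical_max f x powr p \<le> 2 powr p * sphere_mean (r x) g x powr p" .
      qed
      also have "\<dots> = 2 powr p * (\<Sum>x\<in>X. sphere_mean (r x) g x powr p)" by (simp add: sum_distrib_left)
      also have "\<dots> \<le> 2 powr p * (C * (\<Sum>y\<in>Z. g y powr p))"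
        using r by (intro mult_left_mono main X Z) (auto simp: g_def)
      also have "(\<Sum>y\<in>Z. g y powr p) = (\<Sum>y\<in>Z. cmod (f y) powr p)" by (intro sum.cong) (auto simp: g_def)
      also have "2 powr p * (C * (\<Sum>y\<in>Z. cmod (f y) powr p)) \<le> 2 powr p * (C * I)"
        using C by (intro mult_left_mono le_I Z) auto
      finally show ?thesis by (simp add: mult.assoc)
    qed
    have summ': "(\<lambda>x. spherical_max f x powr p) summable_on UNIV"
      by (rule nonneg_bdd_above_summable_on) (use fin in \<open>auto intro!: bdd_aboveI2[where M = "2 powr p * C * I"]\<close>)
    have "(\<Sum>\<^sub>\<infinity>x. spherical_max f x powr p) \<le> 2 powr p * C * I"
      by (rule infsum_le_finite_sums[OF summ']) (use fin in auto)
    hence "(\<Sum>\<^sub>\<infinity>x. spherical_max f x powr p) powr (1 / p) \<le> (2 powr p * C * I) powr (1 / p)"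
      using p0 by (intro powr_mono2 infsum_nonneg) auto
    also have "\<dots> = (2 powr p * C) powr (1 / p) * I powr (1 / p)" using C I0 by (intro powr_mult)
    finally show "(\<forall>n. bdd_above ((\<lambda>r. cmod (spherical_avg r f n)) ` radii)) \<and> spherical_max f \<in> ell (ereal p) \<and>
       ell_norm (ereal p) (spherical_max f) \<le> (2 powr p * C) powr (1 / p) * ell_norm (ereal p) f"
      using b(1,2) summ' by (simp add: ell_def ell_norm_def I_def)
  qed
qed

theorem mainTheorem1:
  fixes p :: ereal
  assumes "CARD('d::finite) \<ge> 5"
    and "ereal (real CARD('d) / (real CARD('d) - 2)) < p"
  shows "\<exists>C::real. \<forall>f :: int ^ 'd \<Rightarrow> complex. f \<in> ell p \<longrightarrow>
           (\<forall>n. bdd_above ((\<lambda>r. cmod (spherical_avg r f n)) ` radii)) \<and>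
           spherical_max f \<in> ell p \<and>
           ell_norm p (spherical_max f) \<le> C * ell_norm p f"
proof (cases p)
  case (real P)
  thus ?thesis using spherical_max_finite_exponent[OF assms(1), of P] assms(2) by simp
next
  case PInf
  show ?thesis unfolding PInf using spherical_max_infinity by blast
next
  case MInf
  thus ?thesis using assms(2) by simp
qed

end
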